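(* Let $n\ge 1$ be an integer, $0<s<1$. There exists a positive constant $C$, independent of $u$ and $f$, such that the following holds. Let $f:\mathbb{R}^n\times\mathbb{R}\to\mathbb{R}$ with $f\ge 0$, and let $u\ge 0$ be a nonnegative classical entire solution of $$(\partial_t-\Delta)^s u(x,t)=f(x,t)\quad\text{in }\mathbb{R}^n\times\mathbb{R}.$$ Assume that both $f$ and $u$ are bounded in $Q_2(0,0)$. Then $$\|u\|_{C^{2s,s}_{x,t}(Q_1(0,0))}\le C\left(\|f\|_{L^\infty(Q_2(0,0))}+\|u\|_{L^\infty(Q_2(0,0))}\right)\quad\text{if } s\ne \tfrac12,$$ $$\|u\|_{C^{\log L,s}_{x,t}(Q_1(0,0))}\le C\left(\|f\|_{L^\infty(Q_2(0,0))}+\|u\|_{L^\infty(Q_2(0,0))}\right)\quad\text{if } s=\tfrac12.$$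
   Context: Cylinders: $Q_r(x^o,t_o)=\{(x,t)\in\mathbb{R}^n\times\mathbb{R}: |x-x^o|<r,\ |t-t_o|<r^2\}$. Operator: for $0<s<1$, $$(\partial_t-\Delta)^s u(x,t)=C_{n,s}\int_{-\infty}^t\int_{\mathbb{R}^n}\frac{u(x,t)-u(y,\tau)}{(t-\tau)^{\frac n2+1+s}}e^{-\frac{|x-y|^2}{4(t-\tau)}}\,dy\,d\tau,\qquad C_{n,s}=\frac{1}{(4\pi)^{n/2}|\Gamma(-s)|},$$ the $y$-integral being in the Cauchy principal value sense. Classical entire solution: $u\in C^{2s+\epsilon,s+\epsilon}_{x,t,\mathrm{loc}}(\mathbb{R}^n\times\mathbb{R})\cap\mathcal{L}(\mathbb{R}^n\times\mathbb{R})$ for some $\epsilon>0$ (locally Hölder of order $2s+\epsilon$ in $x$ and $s+\epsilon$ in $t$) and the equation holds pointwise. Here $\mathcal{L}(\mathbb{R}^n\times\mathbb{R})$ is the set of $u\in L^1_{\rm loc}(\mathbb{R}^n\times\mathbb{R})$ with $$\int_{-\infty}^t\int_{\mathbb{R}^n}\frac{|u(x,\tau)|e^{-\frac{|x|^2}{4(t-\tau)}}}{1+(t-\tau)^{\frac n2+1+s}}\,dx\,d\tau<\infty\quad\text{for all } t\in\mathbb{R}.$$ Parabolic Hölder spaces on a cylinder $\Omega$: (i) if $0<\beta\le\frac12$, $u\in C^{2\beta,\beta}_{x,t}(\Omega)$ means $u$ is bounded and $|u(x,t)-u(y,\tau)|\le K(|x-y|+|t-\tau|^{1/2})^{2\beta}$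 on $\Omega$ for some $K$; the norm is $\sup|u|$ plus the least $K$. (ii) If $\frac12<\beta\le 1$, $u\in C^{2\beta,\beta}_{x,t}(\Omega)$ means $u$ and $\nabla_x u$ are bounded, $u$ is $\beta$-Hölder in $t$ uniformly in $x$, and $\nabla_x u$ is $(2\beta-1)$-Hölder in $x$ uniformly in $t$ and $(\beta-\frac12)$-Hölder in $t$ uniformly in $x$; the norm is the sum of the corresponding sup norms and Hölder seminorms. Log-Lipschitz space: $\|g\|_{C^{\log L}(D)}=\|g\|_{L^\infty(D)}+\sup_{x\ne y\in D}\dfrac{|g(x)-g(y)|}{|x-y|\,|\log\min\{|x-y|,1/2\}|}$. $C^{\log L,s}_{x,t}(\Omega)$: $u$ is $C^{\log L}$ in $x$ uniformly in $t$ and $C^s$ in $t$ uniformly in $x$, with the corresponding norm. *)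

theory Defs
  imports "HOL-Probability.Essential_Supremum" "HOL-Analysis.Analysis"
begin

text \<open>Functions on space-time are functions of pairs \<^term>\<open>(x, t)\<close> with
  \<^term>\<open>x :: real ^ 'n\<close> and \<^term>\<open>t :: real\<close>; the dimension is \<^term>\<open>CARD('n)\<close>.\<close>

definition cyl :: "real \<Rightarrow> real ^ 'n \<Rightarrow> real \<Rightarrow> ((real ^ 'n) \<times> real) set" where
  "cyl r x0 t0 = {(x, t). norm (x - x0) < r \<and> \<bar>t - t0\<bar> < r\<^sup>2}"

definition frac_heat_const :: "'n::finite itself \<Rightarrow> real \<Rightarrow> real" where
  "frac_heat_const _ s = 1 / ((4 * pi) powr (real CARD('n) / 2) * \<bar>Gamma (- s)\<bar>)"

definition has_pv_integral :: "(real ^ 'n \<Rightarrow> real) \<Rightarrow> real ^ 'n \<Rightarrow> real \<Rightarrow> bool" where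
  "has_pv_integral g x I \<longleftrightarrow>
     (\<forall>e>0. set_integrable lebesgue {y. norm (y - x) > e} g) \<and>
     ((\<lambda>e. LINT y:{y. norm (y - x) > e}|lebesgue. g y) \<longlongrightarrow> I) (at_right 0)"

text \<open>The operator is a relation, so that stating an equation at \<^term>\<open>(x, t)\<close> includes
  the convergence of the iterated integral. As usual for an iterated integral, the inner one,
  \<^term>\<open>P \<tau>\<close>, need only exist for almost every \<^term>\<open>\<tau>\<close>.\<close>

definition has_frac_heat ::
    "real \<Rightarrow> ((real ^ 'n) \<times> real \<Rightarrow> real) \<Rightarrow> real ^ 'n \<Rightarrow> real \<Rightarrow> real \<Rightarrow> bool" where
  "has_frac_heat s u x t v \<longleftrightarrow>
     (\<exists>P. (AE \<tau> in lebesgue. \<tau> < t \<longrightarrow>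
              has_pv_integral
                (\<lambda>y. (u (x, t) - u (y, \<tau>)) / (t - \<tau>) powr (real CARD('n) / 2 + 1 + s)
                       * exp (- (norm (x - y))\<^sup>2 / (4 * (t - \<tau>))))
                x (P \<tau>)) \<and>
          set_integrable lebesgue {..<t} P \<and>
          v = frac_heat_const TYPE('n) s * (LINT \<tau>:{..<t}|lebesgue. P \<tau>))"

definition slowly_increasing :: "real \<Rightarrow> ((real ^ 'n) \<times> real \<Rightarrow> real) set" where
  "slowly_increasing s =
     {u. (\<forall>K. compact K \<longrightarrow> set_integrable lebesgue K u) \<and>
         (\<forall>t. (\<integral>\<^sup>+\<tau>\<in>{..<t}. (\<integral>\<^sup>+x. ennreal
                  (\<bar>u (x, \<tau>)\<bar> * exp (- (norm x)\<^sup>2 / (4 * (t - \<tau>)))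
                     / (1 + (t - \<tau>) powr (real CARD('n) / 2 + 1 + s))) \<partial>lebesgue) \<partial>lebesgue)
              < \<infinity>)}"

text \<open>All norms and seminorms take values in \<^typ>\<open>ennreal\<close>; a function belongs to the
  corresponding space iff the norm is finite.\<close>

definition sup_norm :: "'a set \<Rightarrow> ('a \<Rightarrow> 'b::real_normed_vector) \<Rightarrow> ennreal" where
  "sup_norm S g = (SUP p\<in>S. ennreal (norm (g p)))"

definition Linfty_norm :: "'a::euclidean_space set \<Rightarrow> ('a \<Rightarrow> real) \<Rightarrow> ennreal" where
  "Linfty_norm S g = esssup (restrict_space lebesgue S) (\<lambda>p. ennreal \<bar>g p\<bar>)"

text \<open>The distance is an argument so as to cover both the Euclidean and the parabolic one;
  the infimum of the empty set is \<^term>\<open>\<infinity> :: ennreal\<close>.\<close>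

definition hoelder_seminorm ::
    "('a \<Rightarrow> 'a \<Rightarrow> real) \<Rightarrow> real \<Rightarrow> 'a set \<Rightarrow> ('a \<Rightarrow> 'b::real_normed_vector) \<Rightarrow> ennreal" where
  "hoelder_seminorm d \<alpha> S g =
     (INF K\<in>{K. 0 \<le> K \<and> (\<forall>p\<in>S. \<forall>q\<in>S. norm (g p - g q) \<le> K * d p q powr \<alpha>)}. ennreal K)"

definition parabolic_dist :: "(real ^ 'n) \<times> real \<Rightarrow> (real ^ 'n) \<times> real \<Rightarrow> real" where
  "parabolic_dist p q = norm (fst p - fst q) + \<bar>snd p - snd q\<bar> powr (1 / 2)"

definition hoelder_x ::
    "real \<Rightarrow> ((real ^ 'n) \<times> real) set \<Rightarrow> ((real ^ 'n) \<times> real \<Rightarrow> 'b::real_normed_vector) \<Rightarrow> ennreal" where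
  "hoelder_x \<alpha> \<Omega> u = (SUP t\<in>snd ` \<Omega>. hoelder_seminorm dist \<alpha> {x. (x, t) \<in> \<Omega>} (\<lambda>x. u (x, t)))"

definition hoelder_t ::
    "real \<Rightarrow> ((real ^ 'n) \<times> real) set \<Rightarrow> ((real ^ 'n) \<times> real \<Rightarrow> 'b::real_normed_vector) \<Rightarrow> ennreal" where
  "hoelder_t \<alpha> \<Omega> u = (SUP x\<in>fst ` \<Omega>. hoelder_seminorm dist \<alpha> {t. (x, t) \<in> \<Omega>} (\<lambda>t. u (x, t)))"

definition x_differentiable_on ::
    "((real ^ 'n) \<times> real \<Rightarrow> real) \<Rightarrow> ((real ^ 'n) \<times> real) set \<Rightarrow> bool" where
  "x_differentiable_on u \<Omega> \<longleftrightarrow> (\<forall>(x, t)\<in>\<Omega>. (\<lambda>y. u (y, t)) differentiable (at x))"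

definition grad_x :: "((real ^ 'n) \<times> real \<Rightarrow> real) \<Rightarrow> (real ^ 'n) \<times> real \<Rightarrow> real ^ 'n" where
  "grad_x u = (\<lambda>(x, t). THE D. GDERIV (\<lambda>y. u (y, t)) x :> D)"

text \<open>The norm of \<open>C\<^sup>2\<^sup>\<beta>\<^sup>,\<^sup>\<beta>\<close>, for \<open>0 < \<beta> \<le> 1\<close>.\<close>

definition parabolic_hoelder_norm ::
    "real \<Rightarrow> ((real ^ 'n) \<times> real) set \<Rightarrow> ((real ^ 'n) \<times> real \<Rightarrow> real) \<Rightarrow> ennreal" where
  "parabolic_hoelder_norm \<beta> \<Omega> u =
     (if \<beta> \<le> 1 / 2 then sup_norm \<Omega> u + hoelder_seminorm parabolic_dist (2 * \<beta>) \<Omega> u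
      else if x_differentiable_on u \<Omega> then
        sup_norm \<Omega> u + sup_norm \<Omega> (grad_x u) + hoelder_t \<beta> \<Omega> u
        + hoelder_x (2 * \<beta> - 1) \<Omega> (grad_x u) + hoelder_t (\<beta> - 1 / 2) \<Omega> (grad_x u)
      else \<infinity>)"

definition log_lipschitz_norm :: "(real ^ 'n) set \<Rightarrow> (real ^ 'n \<Rightarrow> real) \<Rightarrow> ennreal" where
  "log_lipschitz_norm D g =
     Linfty_norm D g
     + (SUP (x, y)\<in>{(x, y). x \<in> D \<and> y \<in> D \<and> x \<noteq> y}.
          ennreal (\<bar>g x - g y\<bar> / (norm (x - y) * \<bar>ln (min (norm (x - y)) (1 / 2))\<bar>)))"

definition parabolic_log_lipschitz_norm ::
    "real \<Rightarrow> ((real ^ 'n) \<times> real) set \<Rightarrow> ((real ^ 'n) \<times> real \<Rightarrow> real) \<Rightarrow> ennreal" where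
  "parabolic_log_lipschitz_norm \<alpha> \<Omega> u =
     (SUP t\<in>snd ` \<Omega>. log_lipschitz_norm {x. (x, t) \<in> \<Omega>} (\<lambda>x. u (x, t))) + hoelder_t \<alpha> \<Omega> u"

text \<open>Locally Hoelder of order \<^term>\<open>\<gamma>\<close> in \<open>x\<close> and of order \<^term>\<open>\<alpha>\<close> in \<open>t\<close>,
  for \<open>0 < \<gamma> \<le> 2\<close> and \<open>0 < \<alpha> \<le> 1\<close>.\<close>

definition locally_hoelder :: "real \<Rightarrow> real \<Rightarrow> ((real ^ 'n) \<times> real \<Rightarrow> real) set" where
  "locally_hoelder \<gamma> \<alpha> =
     {u. \<forall>x0 t0. \<forall>r>0.
           sup_norm (cyl r x0 t0) u < \<infinity> \<and> hoelder_t \<alpha> (cyl r x0 t0) u < \<infinity> \<and>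
           (if \<gamma> \<le> 1 then hoelder_x \<gamma> (cyl r x0 t0) u < \<infinity>
            else x_differentiable_on u (cyl r x0 t0) \<and>
                 sup_norm (cyl r x0 t0) (grad_x u) < \<infinity> \<and>
                 hoelder_x (\<gamma> - 1) (cyl r x0 t0) (grad_x u) < \<infinity>)}"

text \<open>The local spaces decrease as \<^term>\<open>\<epsilon>\<close> grows, so the bound \<open>s + \<epsilon> \<le> 1\<close> (hence
  \<open>2 * s + \<epsilon> < 2\<close>) loses no solutions; it avoids Hoelder spaces of higher order.\<close>

definition classical_entire_solution ::
    "real \<Rightarrow> ((real ^ 'n) \<times> real \<Rightarrow> real) \<Rightarrow> ((real ^ 'n) \<times> real \<Rightarrow> real) \<Rightarrow> bool" where
  "classical_entire_solution s u f \<longleftrightarrow>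
     (\<exists>\<epsilon>>0. s + \<epsilon> \<le> 1 \<and> u \<in> locally_hoelder (2 * s + \<epsilon>) (s + \<epsilon>)) \<and>
     u \<in> slowly_increasing s \<and>
     (\<forall>x t. has_frac_heat s u x t (f (x, t)))"

end

theory Submission
  imports Defs "HOL-Probability.Probability" "HOL-Real_Asymp.Real_Asymp"
begin

text \<open>Write \<open>P\<^sub>a\<close> for the heat semigroup acting on space-time, \<open>(P\<^sub>a u)(x, t) = \<integral> heat_kernel a (x - y) u(y, t - a) dy\<close>.
  Up to a constant the equation reads \<open>f = \<integral> \<sigma>\<^bsup>-1-s\<^esup> (u - P\<^sub>\<sigma> u) d\<sigma>\<close>. Applying \<open>\<integral>\<^bsub>0<b<\<kappa>\<^esub> b\<^bsup>s-1\<^esup> P\<^sub>b db\<close> to both sides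
  and using the semigroup law gives the Green--Poisson formula
  \<open>c u = \<integral>\<^bsub>0<a<\<kappa>\<^esub> a\<^bsup>s-1\<^esup> P\<^sub>a f da + \<integral>\<^bsub>a>\<kappa>\<^esub> (1 / (s a)) (\<kappa> / (a - \<kappa>))\<^bsup>s\<^esup> P\<^sub>a u da\<close>.
  Since \<open>u\<close> and \<open>f\<close> are nonnegative, so are both terms, and the formula at the single point \<open>(0, 3)\<close> bounds
  the contribution of everything outside \<open>Q\<^sub>2\<close> to the increments of \<open>u\<close> in \<open>Q\<^sub>1\<close> by \<open>sup u\<close>. Inside \<open>Q\<^sub>2\<close> one uses the
  bound on \<open>f\<close> and the scaling of the kernel \<open>a\<^bsup>s-1\<^esup> heat_kernel a\<close>. This yields second differences of
  order \<open>2 s\<close> in \<open>x\<close> and first differences of order \<open>s\<close> in \<open>t\<close>, and dyadic telescoping of the second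
  differences (the Zygmund class) gives the three regimes of \<open>s\<close>.\<close>


subsection \<open>The heat kernel\<close>

text \<open>Two obstacles shape the derivation of the formula. The integral of \<sigma>^(-1-s) (u -
  P_\<sigma> u) converges only because its terms cancel near \<sigma> = 0. It is truncated at a lag
  \<delta>, where the terms may be separated; the divergent parts then cancel algebraically and the
  remainder concentrates at lag 0. Moreover u is regular only locally, so nothing bounds f or the
  truncated operator at spatial infinity, and the limit \<delta> \<rightarrow> 0 needs a cutoff of
  radius R. Its commutator with P_\<sigma> is of order \<sigma>/R: the factor \<sigma> makes
  \<sigma>^(-1-s) integrable at 0, and 1/R removes the error in the end. In the regularity part
  \<kappa> = t + 2, so the slab starts at time -2 for all base points, with |t| < 1 and |x| \<le>
  5/4. Earlier sources have lag above 1; sources in the slab with |y| \<ge> 2 have distance above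
  1/2 from x; the others lie in Q_2. In the first two cases the kernel has no singularity, and the
  gap between 2 and 4 up to time 3 suffices to dominate its derivatives by the kernel based at (0,
  3), a point of Q_2.\<close>

definition heat_kernel :: "real \<Rightarrow> 'a::euclidean_space \<Rightarrow> real" where
  "heat_kernel a z = (4 * pi * a) powr (- (real DIM('a) / 2)) * exp (- (norm z)\<^sup>2 / (4 * a))"

lemma heat_kernel_nonneg [simp]: "0 \<le> heat_kernel a z"
  by (simp add: heat_kernel_def)

lemma heat_kernel_minus [simp]: "heat_kernel a (- z) = heat_kernel a z"
  by (simp add: heat_kernel_def)

lemma heat_kernel_commute: "heat_kernel a (x - y) = heat_kernel a (y - x)"
  by (metis heat_kernel_minus minus_diff_eq)

lemma measurable_heat_kernel [measurable (raw)]: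
  assumes [measurable]: "f \<in> borel_measurable M" "g \<in> borel_measurable M"
  shows "(\<lambda>w. heat_kernel (f w) (g w)) \<in> borel_measurable M"
  unfolding heat_kernel_def by measurable

lemma nn_integral_lborel_translate:
  fixes f :: "'a::euclidean_space \<Rightarrow> ennreal"
  assumes [measurable]: "f \<in> borel_measurable borel"
  shows "(\<integral>\<^sup>+y. f (x + y) \<partial>lborel) = (\<integral>\<^sup>+y. f y \<partial>lborel)"
  by (subst (2) lborel_distr_plus[symmetric, of x]) (subst nn_integral_distr, auto)

lemma nn_integral_lborel_uminus:
  fixes f :: "'a::euclidean_space \<Rightarrow> ennreal"
  assumes [measurable]: "f \<in> borel_measurable borel"
  shows "(\<integral>\<^sup>+y. f (- y) \<partial>lborel) = (\<integral>\<^sup>+y. f y \<partial>lborel)"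
proof -
  have "(lborel :: 'a measure) = density (distr lborel borel (\<lambda>x. 0 + (- 1) *\<^sub>R x)) (\<lambda>_. ennreal (\<bar>- 1\<bar> ^ DIM('a)))"
    by (rule lborel_affine) simp
  also have "\<dots> = distr lborel borel uminus"
    by (simp add: density_1)
  finally have "(lborel :: 'a measure) = distr lborel borel uminus" .
  then have "(\<integral>\<^sup>+y. f y \<partial>lborel) = (\<integral>\<^sup>+y. f y \<partial>(distr lborel borel uminus))"
    by simp
  also have "\<dots> = (\<integral>\<^sup>+y. f (- y) \<partial>lborel)"
    by (subst nn_integral_distr) auto
  finally show ?thesis by simp
qed

lemma nn_integral_lborel_reflect:
  fixes f :: "'a::euclidean_space \<Rightarrow> ennreal"
  assumes [measurable]: "f \<in> borel_measurable borel"
  shows "(\<integral>\<^sup>+y. f (x - y) \<partial>lborel) = (\<integral>\<^sup>+y. f y \<partial>lborel)"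
proof -
  have "(\<integral>\<^sup>+y. f (x - y) \<partial>lborel) = (\<integral>\<^sup>+y. f (x + y) \<partial>lborel)"
    using nn_integral_lborel_uminus[of "\<lambda>y. f (x - y)"] by simp
  then show ?thesis by (simp add: nn_integral_lborel_translate)
qed

text \<open>In coordinates the kernel is a product of one-dimensional normal densities of variance 2
  a, each of mass one.\<close>

lemma nn_integral_heat_kernel [simp]:
  assumes "0 < a"
  shows "(\<integral>\<^sup>+z. ennreal (heat_kernel a (z::'a::euclidean_space)) \<partial>lborel) = 1"
proof -
  have sq: "sqrt (2 * a) > 0" using assms by simp
  have eq: "ennreal (heat_kernel a z) = (\<Prod>b\<in>Basis. ennreal (normal_density 0 (sqrt (2 * a)) (z \<bullet> b)))" for z :: 'a
  proof -
    have "(\<Prod>b\<in>(Basis::'a set). normal_density 0 (sqrt (2 * a)) (z \<bullet> b))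
        = (\<Prod>b\<in>(Basis::'a set). 1 / sqrt (4 * pi * a)) * (\<Prod>b\<in>(Basis::'a set). exp (- (z \<bullet> b)\<^sup>2 / (4 * a)))"
      using assms by (subst prod.distrib[symmetric], intro prod.cong)
         (auto simp: normal_density_def mult_ac)
    also have "(\<Prod>b\<in>(Basis::'a set). exp (- (z \<bullet> b)\<^sup>2 / (4 * a))) = exp (- (norm z)\<^sup>2 / (4 * a))"
      by (subst exp_sum[symmetric], simp)
        (simp add: norm_eq_sqrt_inner euclidean_inner[of z z] sum_divide_distrib sum_negf power2_eq_square sum_nonneg)
    also have "(\<Prod>b\<in>(Basis::'a set). 1 / sqrt (4 * pi * a)) = (4 * pi * a) powr (- (real DIM('a) / 2))"
    proof -
      have "1 / sqrt (4 * pi * a) = (4 * pi * a) powr (- (1/2))"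
        using assms by (simp add: powr_minus powr_half_sqrt divide_simps)
      then show ?thesis
        using assms by (simp add: powr_powr powr_realpow[symmetric])
    qed
    finally have "heat_kernel a z = (\<Prod>b\<in>Basis. normal_density 0 (sqrt (2 * a)) (z \<bullet> b))"
      by (simp add: heat_kernel_def)
    then show ?thesis by (simp add: prod_ennreal)
  qed
  have "(\<integral>\<^sup>+z. ennreal (heat_kernel a (z::'a)) \<partial>lborel)
      = (\<Prod>b\<in>(Basis::'a set). \<integral>\<^sup>+x. ennreal (normal_density 0 (sqrt (2 * a)) x) \<partial>lborel)"
    unfolding eq by (subst nn_integral_lborel_prod) auto
  also have "(\<integral>\<^sup>+x. ennreal (normal_density 0 (sqrt (2 * a)) x) \<partial>lborel) = 1"
    using integral_normal_density[OF sq, of 0] integrable_normal_density[OF sq, of 0]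
    by (subst nn_integral_eq_integral) auto
  finally show ?thesis by simp
qed

lemma nn_integral_heat_kernel_diff [simp]:
  assumes "0 < a"
  shows "(\<integral>\<^sup>+y. ennreal (heat_kernel a (x - y)) \<partial>lborel) = 1"
  using nn_integral_lborel_reflect[of "\<lambda>z. ennreal (heat_kernel a z)" x] assms by simp

lemma nn_integral_heat_kernel_diff' [simp]:
  assumes "0 < a"
  shows "(\<integral>\<^sup>+y. ennreal (heat_kernel a (y - x)) \<partial>lborel) = 1"
  using nn_integral_heat_kernel_diff[OF assms, of x] by (simp add: heat_kernel_commute)

text \<open>The exponent -|z|^2/(4 a) is split into two halves: one is the exponent belonging to 2
  a, the other remains as a spare Gaussian factor that can absorb polynomials in |z|^2/a and mild
  exponentials.\<close>

lemma heat_kernel_double: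
  fixes z :: "'a::euclidean_space"
  assumes "0 < a"
  shows "heat_kernel a z = 2 powr (real DIM('a) / 2) * exp (- (norm z)\<^sup>2 / (8 * a)) * heat_kernel (2 * a) z"
proof -
  have "(4 * pi * (2 * a)) powr (- (real DIM('a) / 2)) = 2 powr (- (real DIM('a) / 2)) * (4 * pi * a) powr (- (real DIM('a) / 2))"
    using assms by (subst powr_mult[symmetric]) (auto simp: mult_ac)
  moreover have "exp (- (norm z)\<^sup>2 / (4 * a)) = exp (- (norm z)\<^sup>2 / (8 * a)) * exp (- (norm z)\<^sup>2 / (8 * a))"
    by (subst exp_add[symmetric]) (simp add: field_simps)
  moreover have "2 powr (real DIM('a) / 2) * 2 powr (- (real DIM('a) / 2)) = (1::real)"
    by (subst powr_add[symmetric]) simp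
  ultimately show ?thesis
    by (simp add: heat_kernel_def mult_ac)
qed

lemma powr_exp_bounded:
  fixes p c :: real
  assumes "0 \<le> p" "0 < c"
  obtains C where "0 < C" "\<And>x. 0 \<le> x \<Longrightarrow> (1 + x) powr p * exp (- c * x) \<le> C"
proof -
  have "((\<lambda>x. (1 + x) powr p * exp (- c * x)) \<longlongrightarrow> 0) at_top"
    using assms by real_asymp
  then have "eventually (\<lambda>x. (1 + x) powr p * exp (- c * x) < 1) at_top"
    by (rule order_tendstoD) simp
  then obtain N where N: "\<And>x. x \<ge> N \<Longrightarrow> (1 + x) powr p * exp (- c * x) < 1"
    by (auto simp: eventually_at_top_linorder)
  have "(1 + x) powr p * exp (- c * x) \<le> (1 + \<bar>N\<bar>) powr p + 1" if "0 \<le> x" for x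
  proof (cases "x \<ge> N")
    case True
    then show ?thesis using N[OF True] powr_ge_zero[of "1 + \<bar>N\<bar>" p] by linarith
  next
    case False
    have "(1 + x) powr p \<le> (1 + \<bar>N\<bar>) powr p"
      using that assms False by (intro powr_mono2) auto
    moreover have "exp (- c * x) \<le> 1" using that assms by simp
    ultimately have "(1 + x) powr p * exp (- c * x) \<le> (1 + \<bar>N\<bar>) powr p * 1"
      by (intro mult_mono) auto
    then show ?thesis by simp
  qed
  moreover have "(1 + \<bar>N\<bar>) powr p + 1 > 0" by (simp add: add_nonneg_pos)
  ultimately show ?thesis using that by blast
qed

text \<open>The spare factor of \<open>heat_kernel_double\<close> absorbs the power. The bound is
  pointwise, with the variance doubled, so that it serves for moments as well as for derivatives of
  the kernel.\<close>

lemma heat_kernel_moment: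
  fixes p :: real
  assumes "0 \<le> p"
  obtains C where "0 < C"
    "\<And>a (z::'a::euclidean_space). 0 < a \<Longrightarrow> norm z powr p * heat_kernel a z \<le> C * a powr (p / 2) * heat_kernel (2 * a) z"
proof -
  obtain C where C: "0 < C" "\<And>x. 0 \<le> x \<Longrightarrow> (1 + x) powr (p / 2) * exp (- (1 / 8) * x) \<le> C"
    using powr_exp_bounded[of "p / 2" "1 / 8"] assms by auto
  have "norm z powr p * heat_kernel a z \<le> (2 powr (real DIM('a) / 2) * C) * a powr (p / 2) * heat_kernel (2 * a) z"
    if "0 < a" for a and z :: 'a
  proof -
    let ?x = "(norm z)\<^sup>2 / a"
    have x: "?x \<ge> 0" using that by simp
    have "norm z powr p = ((norm z)\<^sup>2) powr (p / 2)"
      by (metis norm_ge_zero powr_powr powr_numeral times_divide_eq_right mult_2_right power2_eq_square real_sqrt_pow2_iff nonzero_mult_div_cancel_left zero_neq_numeral)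
    also have "\<dots> = a powr (p / 2) * ?x powr (p / 2)"
      using that by (subst powr_mult[symmetric]) auto
    also have "?x powr (p / 2) \<le> (1 + ?x) powr (p / 2)"
      using x assms by (intro powr_mono2) auto
    finally have 1: "norm z powr p \<le> a powr (p / 2) * (1 + ?x) powr (p / 2)"
      by (simp add: mult_left_mono)
    have "norm z powr p * exp (- (norm z)\<^sup>2 / (8 * a)) \<le> a powr (p / 2) * (1 + ?x) powr (p / 2) * exp (- (1/8) * ?x)"
      using 1 by (intro mult_mono) auto
    also have "\<dots> \<le> a powr (p / 2) * C"
      using C(2)[OF x] by (simp add: mult.assoc mult_left_mono)
    finally have "norm z powr p * exp (- (norm z)\<^sup>2 / (8 * a)) \<le> a powr (p / 2) * C" .
    then have "(norm z powr p * exp (- (norm z)\<^sup>2 / (8 * a))) * (2 powr (real DIM('a) / 2) * heat_kernel (2 * a) z) \<le> (a powr (p / 2) * C) * (2 powr (real DIM('a) / 2) * heat_kernel (2 * a) z)"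
      by (intro mult_right_mono) auto
    then show ?thesis
      by (subst heat_kernel_double[OF that]) (simp add: mult_ac)
  qed
  then show ?thesis using that[of "2 powr (real DIM('a) / 2) * C"] C by auto
qed

text \<open>Completing the square in \<open>y\<close>. In probabilistic terms, a Brownian path that
  runs from \<open>x\<close> to \<open>y'\<close> in time \<open>b + \<sigma>\<close> is at lag
  \<open>b\<close> Gaussian, with mean on the segment between the end points and variance parameter
  \<open>b * \<sigma> / (b + \<sigma>)\<close>. Integrating over \<open>y\<close> gives the
  semigroup law.\<close>

lemma heat_kernel_mult:
  fixes x y y' :: "'a::euclidean_space"
  assumes "0 < b" "0 < \<sigma>"
  shows "heat_kernel b (x - y) * heat_kernel \<sigma> (y - y')
     = heat_kernel (b + \<sigma>) (x - y') * heat_kernel (b * \<sigma> / (b + \<sigma>)) (y - (y' + (\<sigma> / (b + \<sigma>)) *\<^sub>R (x - y')))"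
proof -
  let ?n = "- (real DIM('a) / 2)"
  have ab: "b + \<sigma> > 0" using assms by simp
  have 1: "(4 * pi * b) powr ?n * (4 * pi * \<sigma>) powr ?n = (4 * pi * (b + \<sigma>)) powr ?n * (4 * pi * (b * \<sigma> / (b + \<sigma>))) powr ?n"
  proof -
    have "(4 * pi * b) * (4 * pi * \<sigma>) = (4 * pi * (b + \<sigma>)) * (4 * pi * (b * \<sigma> / (b + \<sigma>)))"
      using ab by simp
    then have "((4 * pi * b) * (4 * pi * \<sigma>)) powr ?n = ((4 * pi * (b + \<sigma>)) * (4 * pi * (b * \<sigma> / (b + \<sigma>)))) powr ?n"
      by (rule arg_cong)
    then show ?thesis
      using assms by (subst (asm) (1 2) powr_mult) simp_all
  qed
  define X Y where "X = x - y'" and "Y = y - y'"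
  have e: "x - y = X - Y" "y - y' = Y" "x - y' = X" "y - (y' + (\<sigma> / (b + \<sigma>)) *\<^sub>R X) = Y - (\<sigma> / (b + \<sigma>)) *\<^sub>R X"
    by (auto simp: X_def Y_def algebra_simps)
  have n1: "(norm (X - Y))\<^sup>2 = (norm X)\<^sup>2 - 2 * (X \<bullet> Y) + (norm Y)\<^sup>2"
    by (simp add: power2_norm_eq_inner inner_diff_left inner_diff_right inner_commute)
  have n2: "(norm (Y - (\<sigma> / (b + \<sigma>)) *\<^sub>R X))\<^sup>2 = (norm Y)\<^sup>2 - 2 * (\<sigma> / (b + \<sigma>)) * (X \<bullet> Y) + (\<sigma> / (b + \<sigma>))\<^sup>2 * (norm X)\<^sup>2"
    by (simp add: power2_norm_eq_inner inner_diff_left inner_diff_right inner_commute)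
      (simp add: power2_eq_square)
  have "- (norm (X - Y))\<^sup>2 / (4 * b) + - (norm Y)\<^sup>2 / (4 * \<sigma>)
     = - (norm X)\<^sup>2 / (4 * (b + \<sigma>)) + - (norm (Y - (\<sigma> / (b + \<sigma>)) *\<^sub>R X))\<^sup>2 / (4 * (b * \<sigma> / (b + \<sigma>)))"
    unfolding n1 n2 using assms ab
    by (simp add: divide_simps power2_eq_square) (simp add: algebra_simps)?
  then have 2: "exp (- (norm (X - Y))\<^sup>2 / (4 * b)) * exp (- (norm Y)\<^sup>2 / (4 * \<sigma>))
     = exp (- (norm X)\<^sup>2 / (4 * (b + \<sigma>))) * exp (- (norm (Y - (\<sigma> / (b + \<sigma>)) *\<^sub>R X))\<^sup>2 / (4 * (b * \<sigma> / (b + \<sigma>))))"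
    by (simp only: exp_add[symmetric])
  show ?thesis
  proof -
    have rearrange: "(p * q) * (p' * q') = (P * Q) * (P' * Q')"
      if "p * p' = P * P'" "q * q' = Q * Q'" for p q p' q' P Q P' Q' :: real
      using that by (metis (no_types, lifting) mult.assoc mult.left_commute)
    show ?thesis
      unfolding heat_kernel_def e by (rule rearrange[OF 1 2])
  qed
qed

text \<open>At positive time separation, or away from the pole, polynomial factors in \<open>1 / a\<close> and
  \<open>norm z / a\<close> are absorbed by enlarging the variance by a fixed amount.\<close>

lemma gauss_absorb:
  fixes A m :: real
  assumes "0 \<le> m"
  obtains C where "0 < C"
    "\<And>a e (x::'a::euclidean_space) y. 0 < a \<Longrightarrow> norm x \<le> A \<Longrightarrow> 1 \<le> a \<or> 1 / 2 \<le> norm (x - y) \<Longrightarrow> 2 \<le> e \<Longrightarrow>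
       (1 + 1 / a) powr m * (1 + norm (x - y) / a) powr m * exp (norm (x - y) / (64 * a)) * exp (- (norm (x - y))\<^sup>2 / (4 * a))
         \<le> C * exp (- (norm y)\<^sup>2 / (4 * (a + e)))"
proof -
  \<comment> \<open>3/64 = 1/16 - 1/64: the spare part of the Gaussian yields decay exp(-X/16) up to
    a constant, and the exponential factor of the statement consumes exp(X/64), where X = |x -
    y|/a.\<close>
  obtain C where C: "0 < C" "\<And>x. 0 \<le> x \<Longrightarrow> (1 + x) powr (2 * m) * exp (- (3 / 64) * x) \<le> C"
    using powr_exp_bounded[of "2 * m" "3 / 64"] assms by auto
  define C' where "C' = 2 powr (2 * m) * exp 1 * C * exp (A\<^sup>2 / 4)"
  have "(1 + 1 / a) powr m * (1 + norm (x - y) / a) powr m * exp (norm (x - y) / (64 * a)) * exp (- (norm (x - y))\<^sup>2 / (4 * a))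
         \<le> C' * exp (- (norm y)\<^sup>2 / (4 * (a + e)))"
    if a: "0 < a" and x: "norm x \<le> A" and reg: "1 \<le> a \<or> 1 / 2 \<le> norm (x - y)" and e: "2 \<le> e" for a e and x y :: 'a
  proof -
    define r where "r = norm (x - y)"
    define X where "X = r / a"
    have r: "0 \<le> r" "r = X * a" using a by (auto simp: r_def X_def)
    have X: "0 \<le> X" using a by (simp add: X_def r_def)
    \<comment> \<open>1/a = 1/(a (a + 1)) + 1/(a + 1): the first part pays for the polynomial and
      exponential factors, the second is left for the comparison with the enlarged variance.\<close>
    have split: "- r\<^sup>2 / (4 * a) = - r\<^sup>2 / (4 * a * (a + 1)) + - r\<^sup>2 / (4 * (a + 1))"
      using a by (simp add: divide_simps) (simp add: algebra_simps)
    have inva: "1 + 1 / a \<le> 2 * (1 + X)"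
    proof (cases "1 \<le> a")
      case True
      then have "1 + 1 / a \<le> 2" by simp
      also have "2 \<le> 2 * (1 + X)" using X by simp
      finally show ?thesis .
    next
      case False
      then have "1 / 2 \<le> r" using reg r_def by auto
      then have "1 / a \<le> 2 * X" using a by (simp add: X_def divide_simps)
      then have "1 + 1 / a \<le> 2 + 2 * X" by simp
      then show ?thesis by simp
    qed
    have ex: "r / (64 * a) + - r\<^sup>2 / (4 * a * (a + 1)) \<le> 1 + - (3 / 64) * X"
    proof (cases "1 \<le> a")
      case True
      have "r\<^sup>2 / (4 * a * (a + 1)) = X\<^sup>2 * (a / (4 * (a + 1)))"
        using a by (simp add: r(2) divide_simps power2_eq_square)
      also have "\<dots> \<ge> X\<^sup>2 * (1 / 8)" using True a by (intro mult_left_mono) (auto simp: divide_simps)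
      finally have "r\<^sup>2 / (4 * a * (a + 1)) \<ge> X\<^sup>2 / 8" by simp
      moreover have "r / (64 * a) = X / 64" by (simp add: X_def)
      moreover have "X\<^sup>2 / 8 - X / 16 + 1 \<ge> 0"
      proof -
        have "(X - 1/4)\<^sup>2 \<ge> 0" by simp
        then show ?thesis by (simp add: power2_eq_square algebra_simps)
      qed
      moreover have "- r\<^sup>2 / (4 * a * (a + 1)) = - (r\<^sup>2 / (4 * a * (a + 1)))" by simp
      ultimately show ?thesis by linarith
    next
      case False
      then have r2: "1 / 2 \<le> r" using reg r_def by auto
      have "r\<^sup>2 / (4 * a * (a + 1)) \<ge> r\<^sup>2 / (4 * a * 2)"
        using False a by (intro divide_left_mono) auto
      moreover have "r\<^sup>2 / (4 * a * 2) \<ge> ((1 / 2) * r) / (4 * a * 2)"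
        using a r2 by (intro divide_right_mono) (auto simp: power2_eq_square intro: mult_right_mono)
      ultimately have "r\<^sup>2 / (4 * a * (a + 1)) \<ge> X / 16"
        using a by (simp add: X_def)
      moreover have "r / (64 * a) = X / 64" by (simp add: X_def)
      moreover have "- r\<^sup>2 / (4 * a * (a + 1)) = - (r\<^sup>2 / (4 * a * (a + 1)))" by simp
      ultimately show ?thesis using X by linarith
    qed
    \<comment> \<open>One unit of variance pays for moving the centre from x to 0: by Cauchy-Schwarz
      with weights a + 1 and 1, (|x| + r)^2 is at most (r^2/(a + 1) + |x|^2) (a + 2).\<close>
    have shift: "- r\<^sup>2 / (4 * (a + 1)) \<le> - (norm y)\<^sup>2 / (4 * (a + e)) + A\<^sup>2 / 4"
    proof -
      have ny: "norm y \<le> norm x + r" unfolding r_def by norm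
      have "(norm y)\<^sup>2 / (a + 2) \<le> r\<^sup>2 / (a + 1) + (norm x)\<^sup>2"
      proof -
        have "(norm y)\<^sup>2 \<le> (norm x + r)\<^sup>2" using ny by (intro power_mono) auto
        also have "(norm x + r)\<^sup>2 \<le> (r\<^sup>2 / (a + 1) + (norm x)\<^sup>2) * (a + 2)"
        proof -
          have "(r\<^sup>2 / (a + 1) + (norm x)\<^sup>2) * (a + 2) - (norm x + r)\<^sup>2 = (r - (a + 1) * norm x)\<^sup>2 / (a + 1)"
            using a by (simp add: divide_simps power2_eq_square) (simp add: algebra_simps)
          moreover have "\<dots> \<ge> 0" using a by simp
          ultimately show ?thesis by linarith
        qed
        finally show ?thesis using a by (simp add: divide_simps mult_ac)
      qed
      moreover have "(norm y)\<^sup>2 / (a + e) \<le> (norm y)\<^sup>2 / (a + 2)"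
        using a e by (intro divide_left_mono) auto
      moreover have "(norm x)\<^sup>2 \<le> A\<^sup>2" using x by (intro power_mono) auto
      ultimately have "(norm y)\<^sup>2 / (a + e) \<le> r\<^sup>2 / (a + 1) + A\<^sup>2"
        by (meson add_left_mono order_trans)
      then have "(norm y)\<^sup>2 / (a + e) / 4 \<le> (r\<^sup>2 / (a + 1) + A\<^sup>2) / 4"
        by (rule divide_right_mono) simp
      then show ?thesis by (simp add: add_divide_distrib mult_ac)
    qed
    have "exp (r / (64 * a)) * exp (- r\<^sup>2 / (4 * a)) = exp (r / (64 * a) + - r\<^sup>2 / (4 * a * (a + 1))) * exp (- r\<^sup>2 / (4 * (a + 1)))"
      unfolding exp_add[symmetric] by (subst split) (simp only: add.assoc)
    also have "\<dots> \<le> exp (1 + - (3 / 64) * X) * exp (- (norm y)\<^sup>2 / (4 * (a + e)) + A\<^sup>2 / 4)"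
      using ex shift by (intro mult_mono) auto
    finally have E: "exp (r / (64 * a)) * exp (- r\<^sup>2 / (4 * a)) \<le> exp 1 * exp (- (3 / 64) * X) * (exp (- (norm y)\<^sup>2 / (4 * (a + e))) * exp (A\<^sup>2 / 4))"
      by (simp only: exp_add)
    have "(1 + 1 / a) powr m * (1 + X) powr m \<le> (2 * (1 + X)) powr m * (2 * (1 + X)) powr m"
      using inva a X assms by (intro mult_mono powr_mono2) auto
    also have "\<dots> = 2 powr (2 * m) * (1 + X) powr (2 * m)"
      by (simp only: powr_add[symmetric] powr_mult[symmetric] mult_2[symmetric])
    finally have P: "(1 + 1 / a) powr m * (1 + X) powr m \<le> 2 powr (2 * m) * (1 + X) powr (2 * m)" .
    have "((1 + 1 / a) powr m * (1 + X) powr m) * (exp (r / (64 * a)) * exp (- r\<^sup>2 / (4 * a)))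
      \<le> (2 powr (2 * m) * (1 + X) powr (2 * m)) * (exp 1 * exp (- (3 / 64) * X) * (exp (- (norm y)\<^sup>2 / (4 * (a + e))) * exp (A\<^sup>2 / 4)))"
      by (intro mult_mono P E) auto
    also have "\<dots> = (2 powr (2 * m) * exp 1 * exp (A\<^sup>2 / 4)) * ((1 + X) powr (2 * m) * exp (- (3 / 64) * X)) * exp (- (norm y)\<^sup>2 / (4 * (a + e)))"
      by (simp only: mult_ac)
    also have "\<dots> \<le> (2 powr (2 * m) * exp 1 * exp (A\<^sup>2 / 4)) * C * exp (- (norm y)\<^sup>2 / (4 * (a + e)))"
      by (intro mult_right_mono mult_left_mono C X) auto
    also have "\<dots> = C' * exp (- (norm y)\<^sup>2 / (4 * (a + e)))" by (simp add: C'_def mult_ac)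
    finally show ?thesis unfolding X_def r_def by (simp only: mult.assoc)
  qed
  moreover have "0 < C'" using C by (simp add: C'_def)
  ultimately show ?thesis using that by blast
qed

subsection \<open>Nonnegative solutions in terms of the heat semigroup\<close>

lemma nn_integral_powr_0:
  fixes p c :: real
  assumes "-1 < p" "0 \<le> c"
  shows "(\<integral>\<^sup>+x\<in>{0<..<c}. ennreal (x powr p) \<partial>lborel) = ennreal (c powr (p + 1) / (p + 1))"
proof -
  have "((\<lambda>x. x powr p) has_integral (c powr (p + 1) / (p + 1))) {0..c}"
    using has_integral_powr_from_0[OF assms] by simp
  then have "(\<integral>\<^sup>+x. ennreal (indicator {0..c} x * x powr p) \<partial>lborel) = ennreal (c powr (p + 1) / (p + 1))"
    by (intro nn_integral_has_integral_lebesgue) auto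
  moreover have "(\<integral>\<^sup>+x\<in>{0<..<c}. ennreal (x powr p) \<partial>lborel) = (\<integral>\<^sup>+x. ennreal (indicator {0..c} x * x powr p) \<partial>lborel)"
  proof (rule nn_integral_cong_AE)
    have "AE x in lborel. x \<noteq> 0 \<and> x \<noteq> (c::real)"
      by (intro AE_conjI AE_lborel_singleton)
    then show "AE x in lborel. ennreal (x powr p) * indicator {0<..<c} x = ennreal (indicator {0..c} x * x powr p)"
      by eventually_elim (auto simp: indicator_def)
  qed
  ultimately show ?thesis by simp
qed

lemma nn_integral_powr_inf:
  fixes p c :: real
  assumes "p < -1" "0 < c"
  shows "(\<integral>\<^sup>+x\<in>{c..}. ennreal (x powr p) \<partial>lborel) = ennreal (c powr (p + 1) / (- p - 1))"
proof -
  have "((\<lambda>x. x powr p) has_integral (- (c powr (p + 1)) / (p + 1))) {c..}"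
    using has_integral_powr_to_inf[OF assms] by simp
  moreover have "- (c powr (p + 1)) / (p + 1) = c powr (p + 1) / (- p - 1)"
    using assms by (simp add: divide_simps) (simp add: algebra_simps)?
  ultimately have "((\<lambda>x. x powr p) has_integral (c powr (p + 1) / (- p - 1))) {c..}"
    by simp
  then have "(\<integral>\<^sup>+x. ennreal (indicator {c..} x * x powr p) \<partial>lborel) = ennreal (c powr (p + 1) / (- p - 1))"
    by (intro nn_integral_has_integral_lebesgue) auto
  moreover have "(\<integral>\<^sup>+x\<in>{c..}. ennreal (x powr p) \<partial>lborel) = (\<integral>\<^sup>+x. ennreal (indicator {c..} x * x powr p) \<partial>lborel)"
    by (intro nn_integral_cong) (auto simp: indicator_def)
  ultimately show ?thesis by simp
qed

text \<open>The exponents add up to -2, which makes this incomplete Beta integral elementary: (1/(s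
  a)) (b/(a - b))^s is a primitive. The value at \<beta> = \<kappa> is the Poisson kernel of the
  representation formula.\<close>

lemma nn_integral_beta_kernel:
  fixes s a \<beta> :: real
  assumes s: "0 < s" and ab: "0 < \<beta>" "\<beta> < a"
  shows "(\<integral>\<^sup>+b\<in>{0<..<\<beta>}. ennreal (b powr (s - 1) * (a - b) powr (- 1 - s)) \<partial>lborel)
      = ennreal (1 / (s * a) * (\<beta> / (a - \<beta>)) powr s)"
proof -
  define F where "F = (\<lambda>b. 1 / (s * a) * (b / (a - b)) powr s)"
  have "((\<lambda>b. b powr (s - 1) * (a - b) powr (- 1 - s)) has_integral (F \<beta> - F 0)) {0..\<beta>}"
  proof (rule fundamental_theorem_of_calculus_interior)
    show "0 \<le> \<beta>" using ab by simp
    show "continuous_on {0..\<beta>} F"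
      unfolding F_def using ab s by (intro continuous_on_mult continuous_on_const continuous_on_powr' continuous_on_divide continuous_on_diff continuous_on_id) auto
    fix b assume b: "b \<in> {0<..<\<beta>}"
    have d: "((\<lambda>b. b / (a - b)) has_real_derivative (a / (a - b)\<^sup>2)) (at b)"
      using b ab by (auto intro!: derivative_eq_intros simp: power2_eq_square)
    have "(F has_real_derivative (1 / (s * a) * (s * (b / (a - b)) powr (s - 1) * (a / (a - b)\<^sup>2)))) (at b)"
      unfolding F_def using b ab
      by (intro DERIV_cmult) (rule DERIV_fun_powr[OF d, THEN DERIV_cong], auto)
    also have "1 / (s * a) * (s * (b / (a - b)) powr (s - 1) * (a / (a - b)\<^sup>2)) = b powr (s - 1) * (a - b) powr (- 1 - s)"
    proof -
      have "(a - b) powr (s - 1) * (a - b)\<^sup>2 * (a - b) powr (- 1 - s) = 1"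
      proof -
        have "(a - b)\<^sup>2 = (a - b) powr 2" using b ab by (simp add: powr_numeral)
        then have "(a - b) powr (s - 1) * (a - b)\<^sup>2 * (a - b) powr (- 1 - s) = (a - b) powr (s - 1 + 2 + (- 1 - s))"
          by (simp only: powr_add)
        also have "\<dots> = 1" using b ab by simp
        finally show ?thesis .
      qed
      then have "1 / ((a - b) powr (s - 1) * (a - b)\<^sup>2) = (a - b) powr (- 1 - s)"
        using b ab by (simp add: divide_simps mult_ac)
      moreover have "1 / (s * a) * (s * (b / (a - b)) powr (s - 1) * (a / (a - b)\<^sup>2)) = b powr (s - 1) * (1 / ((a - b) powr (s - 1) * (a - b)\<^sup>2))"
        using s b ab by (simp add: powr_divide divide_simps)
      ultimately show ?thesis by simp
    qed
    finally show "(F has_vector_derivative b powr (s - 1) * (a - b) powr (- 1 - s)) (at b)"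
      by (simp add: has_real_derivative_iff_has_vector_derivative)
  qed
  moreover have "F 0 = 0" using s by (simp add: F_def)
  ultimately have "((\<lambda>b. b powr (s - 1) * (a - b) powr (- 1 - s)) has_integral F \<beta>) {0..\<beta>}" by simp
  then have "(\<integral>\<^sup>+b. ennreal (indicator {0..\<beta>} b * (b powr (s - 1) * (a - b) powr (- 1 - s))) \<partial>lborel) = ennreal (F \<beta>)"
    using ab by (intro nn_integral_has_integral_lebesgue) auto
  moreover have "(\<integral>\<^sup>+b\<in>{0<..<\<beta>}. ennreal (b powr (s - 1) * (a - b) powr (- 1 - s)) \<partial>lborel)
      = (\<integral>\<^sup>+b. ennreal (indicator {0..\<beta>} b * (b powr (s - 1) * (a - b) powr (- 1 - s))) \<partial>lborel)"
  proof (rule nn_integral_cong_AE)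
    have "AE x in lborel. x \<noteq> 0 \<and> x \<noteq> (\<beta>::real)"
      by (intro AE_conjI AE_lborel_singleton)
    then show "AE b in lborel. ennreal (b powr (s - 1) * (a - b) powr (- 1 - s)) * indicator {0<..<\<beta>} b
        = ennreal (indicator {0..\<beta>} b * (b powr (s - 1) * (a - b) powr (- 1 - s)))"
      by eventually_elim (auto simp: indicator_def)
  qed
  ultimately show ?thesis by (simp add: F_def)
qed

text \<open>By scaling, the integral is the Beta function of s and 1 - s for every \<open>a\<close>.
  Splitting at a/2 leaves one singular factor on each half, while the other is at most its value at
  a/2.\<close>

lemma nn_integral_beta_bound:
  fixes s a :: real
  assumes s: "0 < s" "s < 1" and a: "0 < a"
  shows "(\<integral>\<^sup>+b\<in>{0<..<a}. ennreal (b powr (s - 1) * (a - b) powr (- s)) \<partial>lborel) \<le> ennreal (2 / s + 2 / (1 - s))"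
proof -
  have pt: "b powr (s - 1) * (a - b) powr (- s) \<le> (a / 2) powr (- s) * b powr (s - 1) + (a / 2) powr (s - 1) * (a - b) powr (- s)"
    if "0 < b" "b < a" for b
  proof (cases "b \<le> a / 2")
    case True
    then have "(a - b) powr (- s) \<le> (a / 2) powr (- s)"
      using s a by (intro powr_mono2') auto
    then have "b powr (s - 1) * (a - b) powr (- s) \<le> (a / 2) powr (- s) * b powr (s - 1)"
      by (subst (2) mult.commute, intro mult_left_mono) auto
    moreover have "0 \<le> (a / 2) powr (s - 1) * (a - b) powr (- s)" by simp
    ultimately show ?thesis by linarith
  next
    case False
    then have "b powr (s - 1) \<le> (a / 2) powr (s - 1)"
      using s a by (intro powr_mono2') auto
    then have "b powr (s - 1) * (a - b) powr (- s) \<le> (a / 2) powr (s - 1) * (a - b) powr (- s)"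
      by (intro mult_right_mono) auto
    moreover have "0 \<le> (a / 2) powr (- s) * b powr (s - 1)" by simp
    ultimately show ?thesis by linarith
  qed
  have r: "(\<integral>\<^sup>+b\<in>{0<..<a}. ennreal ((a - b) powr (- s)) \<partial>lborel) = (\<integral>\<^sup>+b\<in>{0<..<a}. ennreal (b powr (- s)) \<partial>lborel)"
  proof -
    have "(\<integral>\<^sup>+b\<in>{0<..<a}. ennreal ((a - b) powr (- s)) \<partial>lborel)
        = (\<integral>\<^sup>+b. ennreal ((a - b) powr (- s)) * indicator {0<..<a} (a - b) \<partial>lborel)"
      by (intro nn_integral_cong) (auto simp: indicator_def)
    also have "\<dots> = (\<integral>\<^sup>+b\<in>{0<..<a}. ennreal (b powr (- s)) \<partial>lborel)"
      by (rule nn_integral_lborel_reflect[of "\<lambda>b. ennreal (b powr (- s)) * indicator {0<..<a} b" a]) measurable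
    finally show ?thesis .
  qed
  have "(\<integral>\<^sup>+b\<in>{0<..<a}. ennreal (b powr (s - 1) * (a - b) powr (- s)) \<partial>lborel)
    \<le> (\<integral>\<^sup>+b. ennreal ((a / 2) powr (- s)) * (ennreal (b powr (s - 1)) * indicator {0<..<a} b)
         + ennreal ((a / 2) powr (s - 1)) * (ennreal ((a - b) powr (- s)) * indicator {0<..<a} b) \<partial>lborel)"
    by (intro nn_integral_mono)
      (auto simp: indicator_def ennreal_mult[symmetric] ennreal_plus[symmetric] simp del: ennreal_plus intro!: ennreal_leI pt)
  also have "\<dots> = ennreal ((a / 2) powr (- s)) * ennreal (a powr s / s) + ennreal ((a / 2) powr (s - 1)) * ennreal (a powr (1 - s) / (1 - s))"
    using s a by (subst nn_integral_add, simp, simp, subst nn_integral_cmult, simp, subst nn_integral_cmult, simp)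
      (simp add: r nn_integral_powr_0 add.commute)
  also have "\<dots> = ennreal (2 powr s / s + 2 powr (1 - s) / (1 - s))"
  proof -
    have "(a / 2) powr (- s) * (a powr s / s) = 2 powr s / s"
      using s a by (simp add: powr_divide powr_minus divide_simps)
    moreover have "(a / 2) powr (s - 1) * (a powr (1 - s) / (1 - s)) = 2 powr (1 - s) / (1 - s)"
    proof -
      have "a powr (s - 1) * a powr (1 - s) = 1" "2 powr (s - 1) * 2 powr (1 - s) = (1::real)"
        using a by (simp_all add: powr_add[symmetric])
      then show ?thesis using s a by (simp add: powr_divide divide_simps mult_ac)
    qed
    ultimately show ?thesis
      using s by (simp add: ennreal_mult[symmetric] ennreal_plus[symmetric] del: ennreal_plus)
  qed
  also have "\<dots> \<le> ennreal (2 / s + 2 / (1 - s))"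
  proof -
    have "2 powr s \<le> 2 powr (1::real)" "2 powr (1 - s) \<le> 2 powr (1::real)"
      using s by (intro powr_mono; simp)+
    then show ?thesis using s by (intro ennreal_leI add_mono divide_right_mono) auto
  qed
  finally show ?thesis .
qed

lemma nn_integral_heat_kernel_moment:
  fixes p :: real
  assumes "0 \<le> p"
  obtains C where "0 < C"
    "\<And>a. 0 < a \<Longrightarrow> (\<integral>\<^sup>+z. ennreal (heat_kernel a z * norm (z::'a::euclidean_space) powr p) \<partial>lborel) \<le> ennreal (C * a powr (p / 2))"
proof -
  obtain C where C: "0 < C"
    "\<And>a (z::'a). 0 < a \<Longrightarrow> norm z powr p * heat_kernel a z \<le> C * a powr (p / 2) * heat_kernel (2 * a) z"
    using heat_kernel_moment[OF assms] by blast
  have "(\<integral>\<^sup>+z. ennreal (heat_kernel a z * norm (z::'a) powr p) \<partial>lborel) \<le> ennreal (C * a powr (p / 2))" if "0 < a" for a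
  proof -
    have "(\<integral>\<^sup>+z. ennreal (heat_kernel a z * norm (z::'a) powr p) \<partial>lborel)
       \<le> (\<integral>\<^sup>+z. ennreal (C * a powr (p / 2)) * ennreal (heat_kernel (2 * a) (z::'a)) \<partial>lborel)"
      using C that by (intro nn_integral_mono) (auto simp: ennreal_mult[symmetric] mult.commute intro!: ennreal_leI)
    also have "\<dots> = ennreal (C * a powr (p / 2))"
      using that by (subst nn_integral_cmult) auto
    finally show ?thesis .
  qed
  then show ?thesis using C(1) that by blast
qed

text \<open>The equation in semigroup form, with the factor \<open>1 / \<bar>Gamma (- s)\<bar>\<close> of the operator moved into \<open>f\<close>.
  Of the local Hoelder regularity only second differences in \<open>x\<close> and backward differences in \<open>t\<close> matter.\<close>

locale heat_fraction =
  fixes s :: real and u f :: "'a::euclidean_space \<times> real \<Rightarrow> real"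
  assumes s_pos: "0 < s" and s_less: "s < 1"
    and u_cont: "continuous_on UNIV u"
    and u_nonneg: "0 \<le> u p"
    and f_nonneg: "0 \<le> f p"
    and u_slow: "\<And>T. (\<integral>\<^sup>+\<tau>\<in>{..<T}. (\<integral>\<^sup>+y. ennreal (u (y, \<tau>) * exp (- (norm y)\<^sup>2 / (4 * (T - \<tau>)))
                    / (1 + (T - \<tau>) powr (real DIM('a) / 2 + 1 + s))) \<partial>lborel) \<partial>lborel) < \<infinity>"
    and u_reg: "\<exists>\<epsilon>>0. \<forall>A. \<exists>K. \<forall>x t \<xi> h. norm x \<le> A \<longrightarrow> \<bar>t\<bar> \<le> A \<longrightarrow> norm \<xi> \<le> 1 \<longrightarrow> 0 \<le> h \<longrightarrow> h \<le> 1 \<longrightarrow>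
          \<bar>u (x + \<xi>, t) + u (x - \<xi>, t) - 2 * u (x, t)\<bar> \<le> K * norm \<xi> powr (2 * s + \<epsilon>) \<and>
          \<bar>u (x, t - h) - u (x, t)\<bar> \<le> K * h powr (s + \<epsilon>)"
    and f_eq: "f (x, t) = (LINT \<sigma>:{0<..}|lborel. \<sigma> powr (- 1 - s) *
          (u (x, t) - enn2real (\<integral>\<^sup>+y. ennreal (heat_kernel \<sigma> (x - y) * u (y, t - \<sigma>)) \<partial>lborel)))"
begin

text \<open>The value of P_\<sigma> u at (x, t). It lies in \<open>ennreal\<close> because the
  growth condition only bounds a weighted integral over \<sigma>; finiteness holds for almost every
  \<sigma>, see \<open>hN_AE_finite\<close>.\<close>

definition hN :: "real \<Rightarrow> 'a \<Rightarrow> real \<Rightarrow> ennreal" where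
  "hN \<sigma> x t = (\<integral>\<^sup>+y. ennreal (heat_kernel \<sigma> (x - y) * u (y, t - \<sigma>)) \<partial>lborel)"

lemma u_borel [measurable]: "u \<in> borel_measurable borel"
  using u_cont by (rule borel_measurable_continuous_onI)

lemma u_measurable [measurable (raw)]:
  assumes "g \<in> borel_measurable M" "h \<in> borel_measurable M"
  shows "(\<lambda>w. u (g w, h w)) \<in> borel_measurable M"
  using assms by (intro measurable_compose[OF borel_measurable_Pair u_borel])

lemma hN_measurable [measurable (raw)]:
  assumes [measurable]: "a \<in> borel_measurable M" "g \<in> borel_measurable M" "h \<in> borel_measurable M"
  shows "(\<lambda>w. hN (a w) (g w) (h w)) \<in> borel_measurable M"
  unfolding hN_def by measurable

lemma u_bounded: "\<exists>M\<ge>0. \<forall>x t. norm x \<le> A \<longrightarrow> \<bar>t\<bar> \<le> A \<longrightarrow> u (x, t) \<le> M"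
proof -
  have "compact (u ` (cball 0 A \<times> cball 0 A))"
    by (intro compact_continuous_image continuous_on_subset[OF u_cont] compact_Times) auto
  then obtain M where M: "\<forall>v\<in>u ` (cball 0 A \<times> cball 0 A). norm v \<le> M"
    using compact_imp_bounded bounded_iff by metis
  have "u (x, t) \<le> max M 0" if "norm x \<le> A" "\<bar>t\<bar> \<le> A" for x t
  proof -
    have "u (x, t) \<in> u ` (cball 0 A \<times> cball 0 A)" using that by (intro imageI) (auto simp: dist_norm)
    then have "norm (u (x, t)) \<le> M" using M by blast
    then show ?thesis by simp
  qed
  then show ?thesis by (intro exI[of _ "max M 0"]) auto
qed

text \<open>The integral of \<open>u_slow\<close> with the lag \<open>a\<close> to the final time as
  variable.\<close>

definition tailmass :: "real \<Rightarrow> ennreal" where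
  "tailmass T = (\<integral>\<^sup>+a\<in>{0<..}. (\<integral>\<^sup>+y. ennreal (u (y, T - a) * exp (- (norm y)\<^sup>2 / (4 * a))
                    / (1 + a powr (real DIM('a) / 2 + 1 + s))) \<partial>lborel) \<partial>lborel)"

lemma tailmass_finite: "tailmass T < \<infinity>"
proof -
  let ?G = "\<lambda>\<tau>. (\<integral>\<^sup>+y. ennreal (u (y, \<tau>) * exp (- (norm y)\<^sup>2 / (4 * (T - \<tau>)))
                    / (1 + (T - \<tau>) powr (real DIM('a) / 2 + 1 + s))) \<partial>lborel) * indicator {..<T} \<tau>"
  have "tailmass T = (\<integral>\<^sup>+a. ?G (T - a) \<partial>lborel)"
    unfolding tailmass_def by (intro nn_integral_cong) (auto simp: indicator_def)
  also have "\<dots> = (\<integral>\<^sup>+a. ?G a \<partial>lborel)"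
    by (rule nn_integral_lborel_reflect) measurable
  finally show ?thesis using u_slow by simp
qed

text \<open>The weight in \<open>u_slow\<close> is centred at the origin and bounded for small lags,
  whereas the kernel is centred at x and singular. \<open>gauss_absorb\<close> moves the centre and
  turns the power -\<nu> of \<sigma> into the same power of \<sigma> + e, where \<nu> = n/2 + 1 + s.
  Two further powers are kept for the square, which leaves room for the commutator of the
  cutoff.\<close>

lemma kernel_le_weight:
  fixes A :: real
  assumes "0 \<le> A"
  obtains C where "0 < C"
    "\<And>\<sigma> e (x::'a) y. 0 < \<sigma> \<Longrightarrow> norm x \<le> A \<Longrightarrow> 1 \<le> \<sigma> \<or> 1 / 2 \<le> norm (x - y) \<Longrightarrow> 2 \<le> e \<Longrightarrow> e \<le> 2 * A + 2 \<Longrightarrow>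
       \<sigma> powr (- 1 - s) * heat_kernel \<sigma> (x - y) * (1 + norm (x - y) / \<sigma>)\<^sup>2
         \<le> C * (exp (- (norm y)\<^sup>2 / (4 * (\<sigma> + e))) / (1 + (\<sigma> + e) powr (real DIM('a) / 2 + 1 + s)))"
proof -
  define \<nu> where "\<nu> = real DIM('a) / 2 + 1 + s"
  have nu: "\<nu> > 0" using s_pos by (simp add: \<nu>_def)
  obtain C where C: "0 < C"
    "\<And>a e (x::'a) y. 0 < a \<Longrightarrow> norm x \<le> A \<Longrightarrow> 1 \<le> a \<or> 1 / 2 \<le> norm (x - y) \<Longrightarrow> 2 \<le> e \<Longrightarrow>
       (1 + 1 / a) powr (\<nu> + 2) * (1 + norm (x - y) / a) powr (\<nu> + 2) * exp (norm (x - y) / (64 * a)) * exp (- (norm (x - y))\<^sup>2 / (4 * a))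
         \<le> C * exp (- (norm y)\<^sup>2 / (4 * (a + e)))"
    using gauss_absorb[of "\<nu> + 2" A] nu by (metis add_nonneg_nonneg less_eq_real_def zero_le_numeral)
  define D where "D = (4 * pi) powr (- (real DIM('a) / 2)) * (2 * (2 * A + 3) powr \<nu>)"
  have D: "D > 0" using assms by (simp add: D_def)
  have "\<sigma> powr (- 1 - s) * heat_kernel \<sigma> (x - y) * (1 + norm (x - y) / \<sigma>)\<^sup>2
         \<le> (D * C) * (exp (- (norm y)\<^sup>2 / (4 * (\<sigma> + e))) / (1 + (\<sigma> + e) powr \<nu>))"
    if h: "0 < \<sigma>" "norm x \<le> A" "1 \<le> \<sigma> \<or> 1 / 2 \<le> norm (x - y)" "2 \<le> e" "e \<le> 2 * A + 2" for \<sigma> e and x y :: 'a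
  proof -
    define r where "r = norm (x - y)"
    have r: "r \<ge> 0" by (simp add: r_def)
    have 1: "\<sigma> powr (- 1 - s) * heat_kernel \<sigma> (x - y) = (4 * pi) powr (- (real DIM('a) / 2)) * \<sigma> powr (- \<nu>) * exp (- r\<^sup>2 / (4 * \<sigma>))"
    proof -
      have "\<sigma> powr (- \<nu>) = \<sigma> powr (- 1 - s) * \<sigma> powr (- (real DIM('a) / 2))"
        by (subst powr_add[symmetric]) (simp add: \<nu>_def algebra_simps)
      then show ?thesis
        by (simp add: heat_kernel_def r_def powr_mult)
    qed
    have 2: "\<sigma> powr (- \<nu>) * (1 + (\<sigma> + e) powr \<nu>) \<le> 2 * (2 * A + 3) powr \<nu> * (1 + 1 / \<sigma>) powr \<nu>"
    proof -
      have "1 \<le> (\<sigma> + e) powr \<nu>" using h nu by (intro ge_one_powr_ge_zero) auto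
      then have "\<sigma> powr (- \<nu>) * (1 + (\<sigma> + e) powr \<nu>) \<le> \<sigma> powr (- \<nu>) * (2 * (\<sigma> + e) powr \<nu>)"
        by (intro mult_left_mono) auto
      also have "\<dots> = 2 * ((\<sigma> + e) / \<sigma>) powr \<nu>"
        by (simp add: powr_divide powr_minus divide_simps)
      also have "((\<sigma> + e) / \<sigma>) powr \<nu> \<le> ((2 * A + 3) * (1 + 1 / \<sigma>)) powr \<nu>"
      proof (rule powr_mono2)
        show "(\<sigma> + e) / \<sigma> \<le> (2 * A + 3) * (1 + 1 / \<sigma>)"
        proof -
          have "\<sigma> + e \<le> (2 * A + 3) * (\<sigma> + 1)"
          proof -
            have "0 \<le> A * \<sigma>" using h assms by simp
            then have "e \<le> 2 * (A * \<sigma>) + 2 * A + 2 * \<sigma> + 3" using h by linarith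
            then show ?thesis by (simp add: algebra_simps)
          qed
          then show ?thesis using h by (simp add: divide_simps)
        qed
      qed (use h nu in auto)
      finally show ?thesis by (simp add: powr_mult)
    qed
    have q: "(1 + r / \<sigma>)\<^sup>2 \<le> (1 + r / \<sigma>) powr (\<nu> + 2)"
    proof -
      have "(1 + r / \<sigma>) powr 2 \<le> (1 + r / \<sigma>) powr (\<nu> + 2)"
        using h r nu by (intro powr_mono) auto
      moreover have "0 < 1 + r / \<sigma>" using h r by (intro add_pos_nonneg) auto
      ultimately show ?thesis by (simp add: powr_numeral)
    qed
    have q2: "(1 + 1 / \<sigma>) powr \<nu> \<le> (1 + 1 / \<sigma>) powr (\<nu> + 2)"
      using h by (intro powr_mono) auto
    have pos: "0 < 1 + (\<sigma> + e) powr \<nu>" by (simp add: add_pos_nonneg)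
    have ex1: "1 \<le> exp (r / (64 * \<sigma>))" using h r by simp
    have "\<sigma> powr (- 1 - s) * heat_kernel \<sigma> (x - y) * (1 + r / \<sigma>)\<^sup>2 * (1 + (\<sigma> + e) powr \<nu>)
       = (4 * pi) powr (- (real DIM('a) / 2)) * (\<sigma> powr (- \<nu>) * (1 + (\<sigma> + e) powr \<nu>)) * ((1 + r / \<sigma>)\<^sup>2 * exp (- r\<^sup>2 / (4 * \<sigma>)))"
      unfolding 1 by (simp only: mult_ac)
    also have "\<dots> \<le> (4 * pi) powr (- (real DIM('a) / 2)) * (2 * (2 * A + 3) powr \<nu> * (1 + 1 / \<sigma>) powr (\<nu> + 2)) * ((1 + r / \<sigma>) powr (\<nu> + 2) * exp (- r\<^sup>2 / (4 * \<sigma>)))"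
    proof (rule mult_mono)
      show "(4 * pi) powr (- (real DIM('a) / 2)) * (\<sigma> powr (- \<nu>) * (1 + (\<sigma> + e) powr \<nu>))
        \<le> (4 * pi) powr (- (real DIM('a) / 2)) * (2 * (2 * A + 3) powr \<nu> * (1 + 1 / \<sigma>) powr (\<nu> + 2))"
        by (rule mult_left_mono[OF order_trans[OF 2 mult_left_mono[OF q2]]]) auto
      show "(1 + r / \<sigma>)\<^sup>2 * exp (- r\<^sup>2 / (4 * \<sigma>)) \<le> (1 + r / \<sigma>) powr (\<nu> + 2) * exp (- r\<^sup>2 / (4 * \<sigma>))"
        using q by (rule mult_right_mono) simp
    qed auto
    also have "\<dots> = D * ((1 + 1 / \<sigma>) powr (\<nu> + 2) * (1 + r / \<sigma>) powr (\<nu> + 2) * 1 * exp (- r\<^sup>2 / (4 * \<sigma>)))"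
      by (simp add: D_def mult_ac)
    also have "\<dots> \<le> D * ((1 + 1 / \<sigma>) powr (\<nu> + 2) * (1 + r / \<sigma>) powr (\<nu> + 2) * exp (r / (64 * \<sigma>)) * exp (- r\<^sup>2 / (4 * \<sigma>)))"
      using D ex1 by (intro mult_left_mono mult_right_mono) auto
    also have "\<dots> \<le> D * (C * exp (- (norm y)\<^sup>2 / (4 * (\<sigma> + e))))"
      using C(2)[OF h(1-4)] D by (intro mult_left_mono) (auto simp: r_def)
    finally show ?thesis using pos unfolding r_def by (simp add: divide_simps mult_ac)
  qed
  then show ?thesis using that[of "D * C"] C D unfolding \<nu>_def by simp
qed

text \<open>The contribution of all points away from the pole.\<close>

definition farmass :: "'a \<Rightarrow> real \<Rightarrow> ennreal" where
  "farmass x t = (\<integral>\<^sup>+\<sigma>\<in>{0<..}. (\<integral>\<^sup>+y. ennreal (\<sigma> powr (- 1 - s) * heat_kernel \<sigma> (x - y) * (1 + norm (x - y) / \<sigma>)\<^sup>2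
       * u (y, t - \<sigma>)) * indicator {y. 1 \<le> \<sigma> \<or> 1 / 2 \<le> norm (x - y)} y \<partial>lborel) \<partial>lborel)"

text \<open>All base points in the box are compared with the single final time A + 2. It exceeds
  every t by a gap between 2 and 2 A + 2, the range allowed in \<open>kernel_le_weight\<close>, so
  the one finite number \<open>tailmass (A + 2)\<close> controls all of them.\<close>

lemma farmass_bounded:
  assumes "0 \<le> A"
  shows "\<exists>B\<ge>0. \<forall>x t. norm x \<le> A \<longrightarrow> \<bar>t\<bar> \<le> A \<longrightarrow> farmass x t \<le> ennreal B"
proof -
  define \<nu> where "\<nu> = real DIM('a) / 2 + 1 + s"
  obtain C where C: "0 < C"
    "\<And>\<sigma> e (x::'a) y. 0 < \<sigma> \<Longrightarrow> norm x \<le> A \<Longrightarrow> 1 \<le> \<sigma> \<or> 1 / 2 \<le> norm (x - y) \<Longrightarrow> 2 \<le> e \<Longrightarrow> e \<le> 2 * A + 2 \<Longrightarrow>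
       \<sigma> powr (- 1 - s) * heat_kernel \<sigma> (x - y) * (1 + norm (x - y) / \<sigma>)\<^sup>2
         \<le> C * (exp (- (norm y)\<^sup>2 / (4 * (\<sigma> + e))) / (1 + (\<sigma> + e) powr \<nu>))"
    using kernel_le_weight[OF assms] unfolding \<nu>_def by blast
  define T where "T = A + 2"
  have "farmass x t \<le> ennreal C * tailmass T" if x: "norm x \<le> A" and t: "\<bar>t\<bar> \<le> A" for x t
  proof -
    define e where "e = T - t"
    have e: "2 \<le> e" "e \<le> 2 * A + 2" using t by (auto simp: e_def T_def)
    define g where "g = (\<lambda>a. (\<integral>\<^sup>+y. ennreal (u (y, T - a) * exp (- (norm y)\<^sup>2 / (4 * a))
                    / (1 + a powr \<nu>)) \<partial>lborel) * indicator {0<..} a)"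
    have [measurable]: "g \<in> borel_measurable borel" unfolding g_def by measurable
    have "farmass x t \<le> (\<integral>\<^sup>+\<sigma>. ennreal C * g (e + \<sigma>) \<partial>lborel)"
      unfolding farmass_def
    proof (intro nn_integral_mono)
      fix \<sigma> :: real
      show "(\<integral>\<^sup>+y. ennreal (\<sigma> powr (- 1 - s) * heat_kernel \<sigma> (x - y) * (1 + norm (x - y) / \<sigma>)\<^sup>2
         * u (y, t - \<sigma>)) * indicator {y. 1 \<le> \<sigma> \<or> 1 / 2 \<le> norm (x - y)} y \<partial>lborel) * indicator {0<..} \<sigma>
         \<le> ennreal C * g (e + \<sigma>)"
      proof (cases "0 < \<sigma>")
        case True
        have "(\<integral>\<^sup>+y. ennreal (\<sigma> powr (- 1 - s) * heat_kernel \<sigma> (x - y) * (1 + norm (x - y) / \<sigma>)\<^sup>2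
         * u (y, t - \<sigma>)) * indicator {y. 1 \<le> \<sigma> \<or> 1 / 2 \<le> norm (x - y)} y \<partial>lborel)
         \<le> (\<integral>\<^sup>+y. ennreal C * ennreal (u (y, T - (e + \<sigma>)) * exp (- (norm y)\<^sup>2 / (4 * (e + \<sigma>)))
                    / (1 + (e + \<sigma>) powr \<nu>)) \<partial>lborel)"
        proof (intro nn_integral_mono)
          fix y
          show "ennreal (\<sigma> powr (- 1 - s) * heat_kernel \<sigma> (x - y) * (1 + norm (x - y) / \<sigma>)\<^sup>2
             * u (y, t - \<sigma>)) * indicator {y. 1 \<le> \<sigma> \<or> 1 / 2 \<le> norm (x - y)} y
             \<le> ennreal C * ennreal (u (y, T - (e + \<sigma>)) * exp (- (norm y)\<^sup>2 / (4 * (e + \<sigma>)))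
                    / (1 + (e + \<sigma>) powr \<nu>))"
          proof (cases "1 \<le> \<sigma> \<or> 1 / 2 \<le> norm (x - y)")
            case reg: True
            have "T - (e + \<sigma>) = t - \<sigma>" by (simp add: e_def)
            moreover have "(\<sigma> powr (- 1 - s) * heat_kernel \<sigma> (x - y) * (1 + norm (x - y) / \<sigma>)\<^sup>2) * u (y, t - \<sigma>)
              \<le> (C * (exp (- (norm y)\<^sup>2 / (4 * (\<sigma> + e))) / (1 + (\<sigma> + e) powr \<nu>))) * u (y, t - \<sigma>)"
              using C(2)[OF True x reg e] u_nonneg by (intro mult_right_mono) auto
            ultimately have "\<sigma> powr (- 1 - s) * heat_kernel \<sigma> (x - y) * (1 + norm (x - y) / \<sigma>)\<^sup>2 * u (y, t - \<sigma>)
              \<le> C * (u (y, T - (e + \<sigma>)) * exp (- (norm y)\<^sup>2 / (4 * (e + \<sigma>))) / (1 + (e + \<sigma>) powr \<nu>))"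
              by (simp only: add.commute[of e \<sigma>]) (simp only: mult_ac times_divide_eq_left times_divide_eq_right)
            then show ?thesis
              using reg C(1) by (subst ennreal_mult'[symmetric]) (auto intro!: ennreal_leI)
          qed auto
        qed
        also have "\<dots> = ennreal C * (\<integral>\<^sup>+y. ennreal (u (y, T - (e + \<sigma>)) * exp (- (norm y)\<^sup>2 / (4 * (e + \<sigma>)))
                    / (1 + (e + \<sigma>) powr \<nu>)) \<partial>lborel)"
          by (rule nn_integral_cmult) measurable
        finally show ?thesis using True e by (simp add: g_def)
      qed simp
    qed
    also have "\<dots> = ennreal C * (\<integral>\<^sup>+\<sigma>. g (e + \<sigma>) \<partial>lborel)"
      by (rule nn_integral_cmult) measurable
    also have "(\<integral>\<^sup>+\<sigma>. g (e + \<sigma>) \<partial>lborel) = (\<integral>\<^sup>+\<sigma>. g \<sigma> \<partial>lborel)"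
      by (rule nn_integral_lborel_translate) measurable
    also have "\<dots> = tailmass T" by (simp add: g_def tailmass_def \<nu>_def)
    finally show ?thesis .
  qed
  moreover have "ennreal C * tailmass T < \<infinity>"
    using tailmass_finite[of T] by (simp add: ennreal_mult_less_top)
  then have "ennreal C * tailmass T = ennreal (enn2real (ennreal C * tailmass T))"
    by simp
  ultimately show ?thesis by (metis enn2real_nonneg)
qed

end

section \<open>Absolute convergence of the operator, locally uniformly\<close>

context heat_fraction
begin

text \<open>The part of \<open>hN\<close> over the region that \<open>farmass\<close> covers; on the
  rest, \<sigma> < 1 and |x - y| < 1/2, the argument of u stays in a bounded box.\<close>

definition hF :: "real \<Rightarrow> 'a \<Rightarrow> real \<Rightarrow> ennreal" where
  "hF \<sigma> x t = (\<integral>\<^sup>+y. ennreal (heat_kernel \<sigma> (x - y) * u (y, t - \<sigma>)) * indicator {y. 1 \<le> \<sigma> \<or> 1 / 2 \<le> norm (x - y)} y \<partial>lborel)"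

lemma hF_measurable [measurable (raw)]:
  assumes [measurable]: "a \<in> borel_measurable M" "g \<in> borel_measurable M" "h \<in> borel_measurable M"
  shows "(\<lambda>w. hF (a w) (g w) (h w)) \<in> borel_measurable M"
proof -
  have "hF \<sigma> x t = (\<integral>\<^sup>+y. (if 1 \<le> \<sigma> \<or> 1 / 2 \<le> norm (x - y) then ennreal (heat_kernel \<sigma> (x - y) * u (y, t - \<sigma>)) else 0) \<partial>lborel)" for \<sigma> x t
    unfolding hF_def by (intro nn_integral_cong) (auto simp: indicator_def)
  then show ?thesis by (simp only:) measurable
qed

lemma hF_le_farmass: "(\<integral>\<^sup>+\<sigma>\<in>{0<..}. ennreal (\<sigma> powr (- 1 - s)) * hF \<sigma> x t \<partial>lborel) \<le> farmass x t"
  unfolding farmass_def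
proof (rule nn_integral_mono)
  fix \<sigma> :: real
  let ?I = "\<lambda>y. indicator {y. 1 \<le> \<sigma> \<or> 1 / 2 \<le> norm (x - y)} y :: ennreal"
  have "ennreal (\<sigma> powr (- 1 - s)) * hF \<sigma> x t \<le> (\<integral>\<^sup>+y. ennreal (\<sigma> powr (- 1 - s) * heat_kernel \<sigma> (x - y) * (1 + norm (x - y) / \<sigma>)\<^sup>2
       * u (y, t - \<sigma>)) * ?I y \<partial>lborel)" if "0 < \<sigma>"
  proof -
    have "ennreal (\<sigma> powr (- 1 - s)) * hF \<sigma> x t = (\<integral>\<^sup>+y. ennreal (\<sigma> powr (- 1 - s)) * (ennreal (heat_kernel \<sigma> (x - y) * u (y, t - \<sigma>)) * ?I y) \<partial>lborel)"
      unfolding hF_def by (subst nn_integral_cmult) auto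
    also have "\<dots> \<le> (\<integral>\<^sup>+y. ennreal (\<sigma> powr (- 1 - s) * heat_kernel \<sigma> (x - y) * (1 + norm (x - y) / \<sigma>)\<^sup>2
       * u (y, t - \<sigma>)) * ?I y \<partial>lborel)"
    proof (rule nn_integral_mono)
      fix y
      have "1 \<le> (1 + norm (x - y) / \<sigma>)\<^sup>2"
        using that by (intro one_le_power) auto
      then have "(\<sigma> powr (- 1 - s) * heat_kernel \<sigma> (x - y) * u (y, t - \<sigma>)) * 1 \<le> (\<sigma> powr (- 1 - s) * heat_kernel \<sigma> (x - y) * u (y, t - \<sigma>)) * (1 + norm (x - y) / \<sigma>)\<^sup>2"
        using u_nonneg by (intro mult_left_mono) auto
      then have "\<sigma> powr (- 1 - s) * (heat_kernel \<sigma> (x - y) * u (y, t - \<sigma>)) \<le> \<sigma> powr (- 1 - s) * heat_kernel \<sigma> (x - y) * (1 + norm (x - y) / \<sigma>)\<^sup>2 * u (y, t - \<sigma>)"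
        by (simp only: mult_ac mult_1_right mult_1_left)
      then have "ennreal (\<sigma> powr (- 1 - s)) * ennreal (heat_kernel \<sigma> (x - y) * u (y, t - \<sigma>)) \<le> ennreal (\<sigma> powr (- 1 - s) * heat_kernel \<sigma> (x - y) * (1 + norm (x - y) / \<sigma>)\<^sup>2 * u (y, t - \<sigma>))"
        using u_nonneg by (subst ennreal_mult[symmetric]) (auto intro: ennreal_leI)
      then show "ennreal (\<sigma> powr (- 1 - s)) * (ennreal (heat_kernel \<sigma> (x - y) * u (y, t - \<sigma>)) * ?I y)
       \<le> ennreal (\<sigma> powr (- 1 - s) * heat_kernel \<sigma> (x - y) * (1 + norm (x - y) / \<sigma>)\<^sup>2 * u (y, t - \<sigma>)) * ?I y"
        unfolding mult.assoc[symmetric] by (rule mult_right_mono) simp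
    qed
    finally show ?thesis .
  qed
  then show "ennreal (\<sigma> powr (- 1 - s)) * hF \<sigma> x t * indicator {0<..} \<sigma> \<le> (\<integral>\<^sup>+y. ennreal (\<sigma> powr (- 1 - s) * heat_kernel \<sigma> (x - y) * (1 + norm (x - y) / \<sigma>)\<^sup>2
       * u (y, t - \<sigma>)) * ?I y \<partial>lborel) * indicator {0<..} \<sigma>"
    by (cases "0 < \<sigma>") simp_all
qed

lemma hN_le:
  assumes M: "\<And>x t. norm x \<le> A + 1 \<Longrightarrow> \<bar>t\<bar> \<le> A + 1 \<Longrightarrow> u (x, t) \<le> M"
    and x: "norm x \<le> A" "\<bar>t\<bar> \<le> A" and \<sigma>: "0 < \<sigma>" and "0 \<le> M"
  shows "hN \<sigma> x t \<le> ennreal M + hF \<sigma> x t"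
proof -
  have "hN \<sigma> x t \<le> (\<integral>\<^sup>+y. ennreal M * ennreal (heat_kernel \<sigma> (x - y)) + ennreal (heat_kernel \<sigma> (x - y) * u (y, t - \<sigma>)) * indicator {y. 1 \<le> \<sigma> \<or> 1 / 2 \<le> norm (x - y)} y \<partial>lborel)"
    unfolding hN_def
  proof (rule nn_integral_mono)
    fix y
    show "ennreal (heat_kernel \<sigma> (x - y) * u (y, t - \<sigma>)) \<le> ennreal M * ennreal (heat_kernel \<sigma> (x - y))
      + ennreal (heat_kernel \<sigma> (x - y) * u (y, t - \<sigma>)) * indicator {y. 1 \<le> \<sigma> \<or> 1 / 2 \<le> norm (x - y)} y"
    proof (cases "1 \<le> \<sigma> \<or> 1 / 2 \<le> norm (x - y)")
      case False
      have "norm y \<le> norm x + norm (x - y)" by norm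
      then have "u (y, t - \<sigma>) \<le> M" using False x \<sigma> by (intro M) auto
      then have "heat_kernel \<sigma> (x - y) * u (y, t - \<sigma>) \<le> M * heat_kernel \<sigma> (x - y)"
        by (subst mult.commute, intro mult_right_mono) auto
      then show ?thesis using False \<open>0 \<le> M\<close> by (simp add: ennreal_mult[symmetric] ennreal_leI)
    qed simp
  qed
  also have "\<dots> = ennreal M + hF \<sigma> x t"
    unfolding hF_def using \<sigma> by (subst nn_integral_add) (auto simp: nn_integral_cmult)
  finally show ?thesis .
qed

lemma hF_AE_finite: "AE \<sigma> in lborel. 0 < \<sigma> \<longrightarrow> hF \<sigma> x t < \<infinity>"
proof -
  obtain B where B: "\<forall>x' t'. norm x' \<le> max (norm x) \<bar>t\<bar> \<longrightarrow> \<bar>t'\<bar> \<le> max (norm x) \<bar>t\<bar> \<longrightarrow> farmass x' t' \<le> ennreal B"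
    using farmass_bounded[of "max (norm x) \<bar>t\<bar>"] by (auto simp: le_max_iff_disj)
  have "farmass x t \<le> ennreal B"
    by (rule B[rule_format]) auto
  then have "(\<integral>\<^sup>+\<sigma>\<in>{0<..}. ennreal (\<sigma> powr (- 1 - s)) * hF \<sigma> x t \<partial>lborel) \<noteq> \<infinity>"
    using hF_le_farmass[of x t] by (metis ennreal_less_top infinity_ennreal_def order_le_less_trans less_irrefl)
  then have "AE \<sigma> in lborel. ennreal (\<sigma> powr (- 1 - s)) * hF \<sigma> x t * indicator {0<..} \<sigma> \<noteq> \<infinity>"
    by (intro nn_integral_PInf_AE) auto
  then show ?thesis
    by eventually_elim (auto simp: ennreal_mult_eq_top_iff less_top)
qed

lemma hN_AE_finite: "AE \<sigma> in lborel. 0 < \<sigma> \<longrightarrow> hN \<sigma> x t < \<infinity>"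
proof -
  define A where "A = max (norm x) \<bar>t\<bar>"
  obtain M where M: "M \<ge> 0" "\<And>x t. norm x \<le> A + 1 \<Longrightarrow> \<bar>t\<bar> \<le> A + 1 \<Longrightarrow> u (x, t) \<le> M"
    using u_bounded[of "A + 1"] by auto
  have le: "hN \<sigma> x t \<le> ennreal M + hF \<sigma> x t" if "0 < \<sigma>" for \<sigma>
    by (rule hN_le[where A = A]) (use M that in \<open>auto simp: A_def\<close>)
  show ?thesis
    using hF_AE_finite[of x t]
    by eventually_elim (auto intro: order_le_less_trans[OF le])
qed

text \<open>Away from lag 0 the near part of \<open>hN\<close> is at most M times an integrable
  power of \<sigma>, so that \<open>hN\<close> alone, without any cancellation, has a finite
  integral.\<close>

lemma hN_trunc_bounded:
  assumes "0 \<le> A" "0 < \<delta>"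
  shows "\<exists>B\<ge>0. \<forall>x t. norm x \<le> A \<longrightarrow> \<bar>t\<bar> \<le> A \<longrightarrow> (\<integral>\<^sup>+\<sigma>\<in>{\<delta><..}. ennreal (\<sigma> powr (- 1 - s)) * hN \<sigma> x t \<partial>lborel) \<le> ennreal B"
proof -
  obtain M where M: "M \<ge> 0" "\<And>x t. norm x \<le> A + 1 \<Longrightarrow> \<bar>t\<bar> \<le> A + 1 \<Longrightarrow> u (x, t) \<le> M"
    using u_bounded[of "A + 1"] by auto
  obtain F where F: "F \<ge> 0" "\<And>x t. norm x \<le> A \<Longrightarrow> \<bar>t\<bar> \<le> A \<Longrightarrow> farmass x t \<le> ennreal F"
    using farmass_bounded[OF assms(1)] by auto
  have "(\<integral>\<^sup>+\<sigma>\<in>{\<delta><..}. ennreal (\<sigma> powr (- 1 - s)) * hN \<sigma> x t \<partial>lborel) \<le> ennreal (M * (\<delta> powr (- s) / s) + F)"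
    if x: "norm x \<le> A" "\<bar>t\<bar> \<le> A" for x t
  proof -
    have "(\<integral>\<^sup>+\<sigma>\<in>{\<delta><..}. ennreal (\<sigma> powr (- 1 - s)) * hN \<sigma> x t \<partial>lborel)
      \<le> (\<integral>\<^sup>+\<sigma>. ennreal M * (ennreal (\<sigma> powr (- 1 - s)) * indicator {\<delta>..} \<sigma>) + ennreal (\<sigma> powr (- 1 - s)) * hF \<sigma> x t * indicator {0<..} \<sigma> \<partial>lborel)"
    proof (rule nn_integral_mono)
      fix \<sigma>
      show "ennreal (\<sigma> powr (- 1 - s)) * hN \<sigma> x t * indicator {\<delta><..} \<sigma>
        \<le> ennreal M * (ennreal (\<sigma> powr (- 1 - s)) * indicator {\<delta>..} \<sigma>) + ennreal (\<sigma> powr (- 1 - s)) * hF \<sigma> x t * indicator {0<..} \<sigma>"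
      proof (cases "\<delta> < \<sigma>")
        case True
        have "ennreal (\<sigma> powr (- 1 - s)) * hN \<sigma> x t \<le> ennreal (\<sigma> powr (- 1 - s)) * (ennreal M + hF \<sigma> x t)"
          by (intro mult_left_mono hN_le[where A = A]) (use M x True assms in auto)
        then show ?thesis using True assms by (simp add: distrib_left mult_ac)
      qed simp
    qed
    also have "\<dots> \<le> ennreal M * ennreal (\<delta> powr (- s) / s) + ennreal F"
    proof (subst nn_integral_add)
      have "(\<integral>\<^sup>+\<sigma>. ennreal M * (ennreal (\<sigma> powr (- 1 - s)) * indicator {\<delta>..} \<sigma>) \<partial>lborel) = ennreal M * ennreal (\<delta> powr (- s) / s)"
        using s_pos assms by (subst nn_integral_cmult) (auto simp: nn_integral_powr_inf)
      then show "(\<integral>\<^sup>+\<sigma>. ennreal M * (ennreal (\<sigma> powr (- 1 - s)) * indicator {\<delta>..} \<sigma>) \<partial>lborel)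
        + (\<integral>\<^sup>+\<sigma>. ennreal (\<sigma> powr (- 1 - s)) * hF \<sigma> x t * indicator {0<..} \<sigma> \<partial>lborel) \<le> ennreal M * ennreal (\<delta> powr (- s) / s) + ennreal F"
        using order_trans[OF hF_le_farmass F(2)[OF x]] by (auto intro!: add_mono)
    qed auto
    also have "\<dots> = ennreal (M * (\<delta> powr (- s) / s) + F)"
      using M F s_pos by (simp only: ennreal_mult[symmetric] ennreal_plus[symmetric] divide_nonneg_nonneg powr_ge_zero mult_nonneg_nonneg less_imp_le)
    finally show ?thesis .
  qed
  then show ?thesis using M F s_pos by (intro exI[of _ "M * (\<delta> powr (- s) / s) + F"]) auto
qed

lemma hN_translate: "hN \<sigma> x t = (\<integral>\<^sup>+z. ennreal (heat_kernel \<sigma> z * u (x + z, t - \<sigma>)) \<partial>lborel)"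
  using nn_integral_lborel_translate[of "\<lambda>y. ennreal (heat_kernel \<sigma> (x - y) * u (y, t - \<sigma>))" x]
  by (simp add: hN_def)

lemma hN_reflect: "hN \<sigma> x t = (\<integral>\<^sup>+z. ennreal (heat_kernel \<sigma> z * u (x - z, t - \<sigma>)) \<partial>lborel)"
  using nn_integral_lborel_reflect[of "\<lambda>y. ennreal (heat_kernel \<sigma> (x - y) * u (y, t - \<sigma>))" x]
  by (simp add: hN_def)

lemma hF_translate: "hF \<sigma> x t = (\<integral>\<^sup>+z. ennreal (heat_kernel \<sigma> z * u (x + z, t - \<sigma>)) * indicator {z. 1 \<le> \<sigma> \<or> 1 / 2 \<le> norm z} z \<partial>lborel)"
  using nn_integral_lborel_translate[of "\<lambda>y. ennreal (heat_kernel \<sigma> (x - y) * u (y, t - \<sigma>)) * indicator {y. 1 \<le> \<sigma> \<or> 1 / 2 \<le> norm (x - y)} y" x]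
  by (simp add: hF_def indicator_def)

lemma hF_reflect: "hF \<sigma> x t = (\<integral>\<^sup>+z. ennreal (heat_kernel \<sigma> z * u (x - z, t - \<sigma>)) * indicator {z. 1 \<le> \<sigma> \<or> 1 / 2 \<le> norm z} z \<partial>lborel)"
  using nn_integral_lborel_reflect[of "\<lambda>y. ennreal (heat_kernel \<sigma> (x - y) * u (y, t - \<sigma>)) * indicator {y. 1 \<le> \<sigma> \<or> 1 / 2 \<le> norm (x - y)} y" x]
  by (simp add: hF_def indicator_def)

text \<open>The kernel is even and has mass one, so P_\<sigma> u - u is the average of the
  expressions with z and -z. First differences thereby become second differences, which keep the
  order 2 s + \<epsilon> even when it exceeds 1.\<close>

lemma hN_mean_diff:
  assumes fin: "hN \<sigma> x t < \<infinity>" and \<sigma>: "0 < \<sigma>"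
  shows "ennreal \<bar>enn2real (hN \<sigma> x t) - u (x, t - \<sigma>)\<bar>
    \<le> (\<integral>\<^sup>+z. ennreal (heat_kernel \<sigma> z * (\<bar>u (x + z, t - \<sigma>) + u (x - z, t - \<sigma>) - 2 * u (x, t - \<sigma>)\<bar> / 2)) \<partial>lborel)"
proof -
  define g where "g = (\<lambda>z. heat_kernel \<sigma> z * u (x + z, t - \<sigma>))"
  define g' where "g' = (\<lambda>z. heat_kernel \<sigma> z * u (x - z, t - \<sigma>))"
  define g0 where "g0 = (\<lambda>z::'a. heat_kernel \<sigma> z * u (x, t - \<sigma>))"
  have I: "integrable lborel g" "integral\<^sup>L lborel g = enn2real (hN \<sigma> x t)"
    using fin unfolding g_def hN_translate
    by (auto intro!: integrableI_nonneg simp: u_nonneg integral_eq_nn_integral)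
  have I': "integrable lborel g'" "integral\<^sup>L lborel g' = enn2real (hN \<sigma> x t)"
    using fin unfolding g'_def hN_reflect
    by (auto intro!: integrableI_nonneg simp: u_nonneg integral_eq_nn_integral)
  have K: "integrable lborel (\<lambda>z::'a. heat_kernel \<sigma> z)" "integral\<^sup>L lborel (\<lambda>z::'a. heat_kernel \<sigma> z) = 1"
    using \<sigma> by (auto intro!: integrableI_nonneg simp: integral_eq_nn_integral)
  have I0: "integrable lborel g0" "integral\<^sup>L lborel g0 = u (x, t - \<sigma>)"
    using K unfolding g0_def by auto
  have "enn2real (hN \<sigma> x t) - u (x, t - \<sigma>) = (\<integral>z. (g z + g' z - 2 * g0 z) / 2 \<partial>lborel)"
    using I I' I0 by simp
  also have "ennreal \<bar>\<dots>\<bar> \<le> (\<integral>\<^sup>+z. ennreal (norm ((g z + g' z - 2 * g0 z) / 2)) \<partial>lborel)"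
    using I I' I0 by (subst real_norm_def[symmetric], intro integral_norm_bound_ennreal) auto
  also have "\<dots> = (\<integral>\<^sup>+z. ennreal (heat_kernel \<sigma> z * (\<bar>u (x + z, t - \<sigma>) + u (x - z, t - \<sigma>) - 2 * u (x, t - \<sigma>)\<bar> / 2)) \<partial>lborel)"
  proof (intro nn_integral_cong arg_cong[where f = ennreal])
    fix z
    have "(g z + g' z - 2 * g0 z) / 2 = heat_kernel \<sigma> z * ((u (x + z, t - \<sigma>) + u (x - z, t - \<sigma>) - 2 * u (x, t - \<sigma>)) / 2)"
      by (simp add: g_def g'_def g0_def algebra_simps)
    then have "norm ((g z + g' z - 2 * g0 z) / 2) = \<bar>heat_kernel \<sigma> z\<bar> * \<bar>(u (x + z, t - \<sigma>) + u (x - z, t - \<sigma>) - 2 * u (x, t - \<sigma>)) / 2\<bar>"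
      by (simp only: real_norm_def abs_mult)
    then show "norm ((g z + g' z - 2 * g0 z) / 2) = heat_kernel \<sigma> z * (\<bar>u (x + z, t - \<sigma>) + u (x - z, t - \<sigma>) - 2 * u (x, t - \<sigma>)\<bar> / 2)"
      by simp
  qed
  finally show ?thesis .
qed

text \<open>For \<sigma> \<ge> 1 both terms are bounded separately. For \<sigma> < 1 the point (x, t
  - \<sigma>) is inserted: the increment in t is of order \<sigma>^(s + \<epsilon>), and the average
  of second differences is of order \<sigma>^(s + \<epsilon>/2) up to bounded multiples of \<sigma>
  and far contributions. Each of these leaves an integrable power after multiplication by
  \<sigma>^(-1-s), and the far part is controlled by \<open>farmass\<close>.\<close>

lemma increments_bounded:
  assumes "0 \<le> A"
  shows "\<exists>B\<ge>0. \<forall>x t. norm x \<le> A \<longrightarrow> \<bar>t\<bar> \<le> A \<longrightarrow>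
    (\<integral>\<^sup>+\<sigma>\<in>{0<..}. ennreal (\<sigma> powr (- 1 - s) * \<bar>u (x, t) - enn2real (hN \<sigma> x t)\<bar>) \<partial>lborel) \<le> ennreal B"
proof -
  obtain \<epsilon> where \<epsilon>: "\<epsilon> > 0" "\<forall>A. \<exists>K. \<forall>x t \<xi> h. norm x \<le> A \<longrightarrow> \<bar>t\<bar> \<le> A \<longrightarrow> norm \<xi> \<le> 1 \<longrightarrow> 0 \<le> h \<longrightarrow> h \<le> 1 \<longrightarrow>
          \<bar>u (x + \<xi>, t) + u (x - \<xi>, t) - 2 * u (x, t)\<bar> \<le> K * norm \<xi> powr (2 * s + \<epsilon>) \<and>
          \<bar>u (x, t - h) - u (x, t)\<bar> \<le> K * h powr (s + \<epsilon>)"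
    using u_reg by blast
  obtain K0 where K0: "\<And>x t \<xi> h. norm x \<le> A + 1 \<Longrightarrow> \<bar>t\<bar> \<le> A + 1 \<Longrightarrow> norm \<xi> \<le> 1 \<Longrightarrow> 0 \<le> h \<Longrightarrow> h \<le> 1 \<Longrightarrow>
          \<bar>u (x + \<xi>, t) + u (x - \<xi>, t) - 2 * u (x, t)\<bar> \<le> K0 * norm \<xi> powr (2 * s + \<epsilon>) \<and>
          \<bar>u (x, t - h) - u (x, t)\<bar> \<le> K0 * h powr (s + \<epsilon>)"
    using \<epsilon>(2) by metis
  define K where "K = \<bar>K0\<bar>"
  have K: "0 \<le> K" by (simp add: K_def)
  have K1: "\<bar>u (x + \<xi>, t) + u (x - \<xi>, t) - 2 * u (x, t)\<bar> \<le> K * norm \<xi> powr (2 * s + \<epsilon>)"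
    if "norm x \<le> A + 1" "\<bar>t\<bar> \<le> A + 1" "norm \<xi> \<le> 1" for x t \<xi>
  proof -
    have "K0 * norm \<xi> powr (2 * s + \<epsilon>) \<le> K * norm \<xi> powr (2 * s + \<epsilon>)"
      by (intro mult_right_mono) (auto simp: K_def)
    then show ?thesis using K0[OF that, of 0] by auto
  qed
  have K2: "\<bar>u (x, t - h) - u (x, t)\<bar> \<le> K * h powr (s + \<epsilon>)"
    if "norm x \<le> A + 1" "\<bar>t\<bar> \<le> A + 1" "0 \<le> h" "h \<le> 1" for x t h
  proof -
    have "K0 * h powr (s + \<epsilon>) \<le> K * h powr (s + \<epsilon>)"
      by (intro mult_right_mono) (auto simp: K_def)
    then show ?thesis using K0[OF that(1,2) _ that(3,4), of 0] by auto
  qed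
  obtain M where M: "M \<ge> 0" "\<And>x t. norm x \<le> A + 1 \<Longrightarrow> \<bar>t\<bar> \<le> A + 1 \<Longrightarrow> u (x, t) \<le> M"
    using u_bounded[of "A + 1"] by auto
  obtain F where F: "F \<ge> 0" "\<And>x t. norm x \<le> A \<Longrightarrow> \<bar>t\<bar> \<le> A \<Longrightarrow> farmass x t \<le> ennreal F"
    using farmass_bounded[OF assms(1)] by auto
  obtain C1 where C1: "0 < C1" "\<And>a. 0 < a \<Longrightarrow> (\<integral>\<^sup>+z. ennreal (heat_kernel a z * norm (z::'a) powr (2 * s + \<epsilon>)) \<partial>lborel) \<le> ennreal (C1 * a powr ((2 * s + \<epsilon>) / 2))"
    by (rule nn_integral_heat_kernel_moment[of "2 * s + \<epsilon>"]) (use s_pos \<epsilon>(1) in auto)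
  obtain C2 where C2: "0 < C2" "\<And>a. 0 < a \<Longrightarrow> (\<integral>\<^sup>+z. ennreal (heat_kernel a z * norm (z::'a) powr 2) \<partial>lborel) \<le> ennreal (C2 * a powr (2 / 2))"
    by (rule nn_integral_heat_kernel_moment[of 2]) auto
  \<comment> \<open>The four terms bound, in this order: u and the near part of \<open>hN\<close>
    for \<sigma> \<ge> 1; the increment in t; the second differences with |z| \<le> 1; and u(x, t -
    \<sigma>) for |z| > 1, where M \<le> M |z|^2 and the second moment of the kernel gives one power
    of \<sigma>.\<close>
  define g where "g = (\<lambda>\<sigma>. ennreal (2 * M) * (ennreal (\<sigma> powr (- 1 - s)) * indicator {1..} \<sigma>)
      + ennreal K * (ennreal (\<sigma> powr (\<epsilon> - 1)) * indicator {0<..<1} \<sigma>)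
      + ennreal (K * C1) * (ennreal (\<sigma> powr (\<epsilon> / 2 - 1)) * indicator {0<..<1} \<sigma>)
      + ennreal (M * C2) * (ennreal (\<sigma> powr (- s)) * indicator {0<..<1} \<sigma>))"
  have g_int: "(\<integral>\<^sup>+\<sigma>. g \<sigma> \<partial>lborel) = ennreal (2 * M * (1 / s) + K * (1 / \<epsilon>) + K * C1 * (1 / (\<epsilon> / 2)) + M * C2 * (1 / (1 - s)))"
  proof -
    have i: "(\<integral>\<^sup>+\<sigma>\<in>{1..}. ennreal (\<sigma> powr (- 1 - s)) \<partial>lborel) = ennreal (1 / s)"
      using nn_integral_powr_inf[of "- 1 - s" 1] s_pos by simp
    have j: "(\<integral>\<^sup>+\<sigma>\<in>{0<..<1}. ennreal (\<sigma> powr p) \<partial>lborel) = ennreal (1 / (p + 1))" if "-1 < p" for p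
      using nn_integral_powr_0[of p 1] that by simp
    have ag: "\<epsilon> / 2 - 1 > -1" using \<epsilon>(1) by simp
    have c: "(\<integral>\<^sup>+\<sigma>. ennreal c * (ennreal (\<sigma> powr p) * indicator S \<sigma>) \<partial>lborel) = ennreal (c * v)"
      if "(\<integral>\<^sup>+\<sigma>\<in>S. ennreal (\<sigma> powr p) \<partial>lborel) = ennreal v" "0 \<le> c" "S \<in> sets borel" for c p v S
      using that by (subst nn_integral_cmult) (auto simp: ennreal_mult')
    have p: "- 1 < \<epsilon> / 2 - 1" "- 1 < \<epsilon> - 1" "- 1 < - s"
      using \<epsilon>(1) s_less by auto
    have nn: "0 \<le> 2 * M" "0 \<le> K" "0 \<le> K * C1" "0 \<le> M * C2"
      using M(1) K C1(1) C2(1) by auto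
    have "(\<integral>\<^sup>+\<sigma>. g \<sigma> \<partial>lborel) = ennreal (2 * M * (1 / s)) + ennreal (K * (1 / (\<epsilon> - 1 + 1)))
       + ennreal (K * C1 * (1 / (\<epsilon> / 2 - 1 + 1))) + ennreal (M * C2 * (1 / (- s + 1)))"
      unfolding g_def
      by (subst nn_integral_add, measurable, subst nn_integral_add, measurable, subst nn_integral_add, measurable)
        (simp only: c[OF i nn(1)] c[OF j[OF p(2)] nn(2)] c[OF j[OF p(1)] nn(3)] c[OF j[OF p(3)] nn(4)] borel_closed borel_open closed_atLeast open_greaterThanLessThan)
    also have "\<dots> = ennreal (2 * M * (1 / s) + K * (1 / \<epsilon>) + K * C1 * (1 / (\<epsilon> / 2)) + M * C2 * (1 / (1 - s)))"
    proof -
      have "0 \<le> 2 * M * (1 / s)" "0 \<le> K * (1 / (\<epsilon> - 1 + 1))" "0 \<le> K * C1 * (1 / (\<epsilon> / 2 - 1 + 1))" "0 \<le> M * C2 * (1 / (- s + 1))"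
        using nn s_pos s_less \<epsilon>(1) by auto
      then show ?thesis
        by (subst ennreal_plus[symmetric], simp, simp, subst ennreal_plus[symmetric], simp, simp, subst ennreal_plus[symmetric], simp, simp, simp)
    qed
    finally show ?thesis .
  qed
  have pw: "ennreal (\<sigma> powr (- 1 - s) * \<bar>u (x, t) - enn2real (hN \<sigma> x t)\<bar>) \<le> g \<sigma> + ennreal (\<sigma> powr (- 1 - s)) * hF \<sigma> x t"
    if x: "norm x \<le> A" "\<bar>t\<bar> \<le> A" and \<sigma>: "0 < \<sigma>" and fin: "hN \<sigma> x t < \<infinity>" for x t \<sigma>
  proof (cases "1 \<le> \<sigma>")
    case True
    have "\<bar>u (x, t) - enn2real (hN \<sigma> x t)\<bar> \<le> u (x, t) + enn2real (hN \<sigma> x t)"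
      using u_nonneg by (simp add: abs_diff_le_iff abs_le_iff)
    then have "ennreal \<bar>u (x, t) - enn2real (hN \<sigma> x t)\<bar> \<le> ennreal (u (x, t)) + ennreal (enn2real (hN \<sigma> x t))"
      using u_nonneg by (simp add: ennreal_plus[symmetric] ennreal_leI del: ennreal_plus)
    also have "\<dots> \<le> ennreal M + (ennreal M + hF \<sigma> x t)"
      using fin x \<sigma> M by (intro add_mono ennreal_leI) (auto intro!: hN_le[where A = A])
    finally have "ennreal \<bar>u (x, t) - enn2real (hN \<sigma> x t)\<bar> \<le> ennreal (2 * M) + hF \<sigma> x t"
      using M(1) by (metis add.assoc ennreal_plus mult_2)
    then have "ennreal (\<sigma> powr (- 1 - s)) * ennreal \<bar>u (x, t) - enn2real (hN \<sigma> x t)\<bar> \<le> ennreal (\<sigma> powr (- 1 - s)) * (ennreal (2 * M) + hF \<sigma> x t)"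
      by (rule mult_left_mono) simp
    then show ?thesis using True by (simp add: g_def ennreal_mult distrib_left mult_ac)
  next
    case False
    have t': "\<bar>t - \<sigma>\<bar> \<le> A + 1" using x \<sigma> False by auto
    let ?D = "\<lambda>z. \<bar>u (x + z, t - \<sigma>) + u (x - z, t - \<sigma>) - 2 * u (x, t - \<sigma>)\<bar>"
    let ?I = "indicator {z::'a. 1 \<le> \<sigma> \<or> 1 / 2 \<le> norm z} :: 'a \<Rightarrow> ennreal"
    have D: "ennreal (heat_kernel \<sigma> z * (?D z / 2)) \<le> ennreal (K / 2) * ennreal (heat_kernel \<sigma> z * norm z powr (2 * s + \<epsilon>))
       + ennreal M * ennreal (heat_kernel \<sigma> z * norm z powr 2)
       + (ennreal (1 / 2) * (ennreal (heat_kernel \<sigma> z * u (x + z, t - \<sigma>)) * ?I z)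
        + ennreal (1 / 2) * (ennreal (heat_kernel \<sigma> z * u (x - z, t - \<sigma>)) * ?I z))" for z
    proof (cases "norm z \<le> 1")
      case True
      have "?D z / 2 \<le> K / 2 * norm z powr (2 * s + \<epsilon>)"
        using K1[OF _ t' True, of x] x by simp
      then have "heat_kernel \<sigma> z * (?D z / 2) \<le> heat_kernel \<sigma> z * (K / 2 * norm z powr (2 * s + \<epsilon>))"
        by (rule mult_left_mono) simp
      then have "ennreal (heat_kernel \<sigma> z * (?D z / 2)) \<le> ennreal (K / 2) * ennreal (heat_kernel \<sigma> z * norm z powr (2 * s + \<epsilon>))"
        using K by (subst ennreal_mult[symmetric]) (auto intro!: ennreal_leI simp: mult_ac)
      then show ?thesis by (simp add: add_increasing2)
    next
      case False
      then have I: "?I z = 1" by simp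
      have "1 \<le> norm z powr 2" using False by (intro ge_one_powr_ge_zero) auto
      have "u (x, t - \<sigma>) \<le> M * 1" using M(2)[OF _ t', of x] x by simp
      also have "\<dots> \<le> M * norm z powr 2" using \<open>1 \<le> norm z powr 2\<close> M(1) by (rule mult_left_mono)
      finally have "u (x, t - \<sigma>) \<le> M * norm z powr 2" .
      then have "?D z / 2 \<le> M * norm z powr 2 + (1 / 2 * u (x + z, t - \<sigma>) + 1 / 2 * u (x - z, t - \<sigma>))"
      proof -
        have "\<bar>a + b - 2 * c\<bar> / 2 \<le> m + (1 / 2 * a + 1 / 2 * b)" if "c \<le> m" "0 \<le> a" "0 \<le> b" "0 \<le> c" for a b c m :: real
          using that by (auto simp: abs_if field_simps)
        from this[OF \<open>u (x, t - \<sigma>) \<le> M * norm z powr 2\<close>] show ?thesis using u_nonneg by blast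
      qed
      then have "heat_kernel \<sigma> z * (?D z / 2) \<le> heat_kernel \<sigma> z * (M * norm z powr 2 + (1 / 2 * u (x + z, t - \<sigma>) + 1 / 2 * u (x - z, t - \<sigma>)))"
        by (rule mult_left_mono) simp
      also have "\<dots> = M * (heat_kernel \<sigma> z * norm z powr 2) + (1 / 2 * (heat_kernel \<sigma> z * u (x + z, t - \<sigma>)) + 1 / 2 * (heat_kernel \<sigma> z * u (x - z, t - \<sigma>)))"
        by (simp add: algebra_simps)
      finally have "ennreal (heat_kernel \<sigma> z * (?D z / 2)) \<le> ennreal (M * (heat_kernel \<sigma> z * norm z powr 2) + (1 / 2 * (heat_kernel \<sigma> z * u (x + z, t - \<sigma>)) + 1 / 2 * (heat_kernel \<sigma> z * u (x - z, t - \<sigma>))))"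
        by (rule ennreal_leI)
      also have "\<dots> = ennreal M * ennreal (heat_kernel \<sigma> z * norm z powr 2)
         + (ennreal (1 / 2) * ennreal (heat_kernel \<sigma> z * u (x + z, t - \<sigma>)) + ennreal (1 / 2) * ennreal (heat_kernel \<sigma> z * u (x - z, t - \<sigma>)))"
      proof -
        have nn: "0 \<le> heat_kernel \<sigma> z * norm z powr 2" "0 \<le> heat_kernel \<sigma> z * u (x + z, t - \<sigma>)" "0 \<le> heat_kernel \<sigma> z * u (x - z, t - \<sigma>)"
          using u_nonneg by auto
        have "ennreal (a * p + (b * q + b * r)) = ennreal a * ennreal p + (ennreal b * ennreal q + ennreal b * ennreal r)"
          if "0 \<le> a" "0 \<le> b" "0 \<le> p" "0 \<le> q" "0 \<le> r" for a b p q r :: real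
          using that by (simp only: ennreal_mult[symmetric] ennreal_plus[symmetric] mult_nonneg_nonneg add_nonneg_nonneg)
        from this[OF M(1) _ nn, of "1 / 2"] show ?thesis by (simp only: divide_nonneg_nonneg zero_le_one zero_le_numeral simp_thms)
      qed
      finally show ?thesis unfolding I mult_1_right by (simp only: add.assoc) (rule add_increasing, simp_all)
    qed
    have "ennreal \<bar>enn2real (hN \<sigma> x t) - u (x, t - \<sigma>)\<bar> \<le> (\<integral>\<^sup>+z. ennreal (K / 2) * ennreal (heat_kernel \<sigma> z * norm z powr (2 * s + \<epsilon>))
       + ennreal M * ennreal (heat_kernel \<sigma> z * norm z powr 2)
       + (ennreal (1 / 2) * (ennreal (heat_kernel \<sigma> z * u (x + z, t - \<sigma>)) * ?I z)
        + ennreal (1 / 2) * (ennreal (heat_kernel \<sigma> z * u (x - z, t - \<sigma>)) * ?I z)) \<partial>lborel)"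
      by (rule order_trans[OF hN_mean_diff[OF fin \<sigma>] nn_integral_mono[OF D]])
    also have "\<dots> = ennreal (K / 2) * (\<integral>\<^sup>+z. ennreal (heat_kernel \<sigma> z * norm (z::'a) powr (2 * s + \<epsilon>)) \<partial>lborel)
        + ennreal M * (\<integral>\<^sup>+z. ennreal (heat_kernel \<sigma> z * norm (z::'a) powr 2) \<partial>lborel)
        + (ennreal (1 / 2) * hF \<sigma> x t + ennreal (1 / 2) * hF \<sigma> x t)"
      by (subst nn_integral_add, measurable, subst nn_integral_add, measurable, subst nn_integral_add, measurable,
          (subst nn_integral_cmult, measurable)+) (simp only: hF_translate[of \<sigma> x t, symmetric] hF_reflect[of \<sigma> x t, symmetric])
    also have "ennreal (1 / 2) * hF \<sigma> x t + ennreal (1 / 2) * hF \<sigma> x t = hF \<sigma> x t"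
    proof -
      have "ennreal (1 / 2) + ennreal (1 / 2) = 1"
        by (subst ennreal_plus[symmetric]) auto
      then show ?thesis by (metis distrib_right mult_1_left)
    qed
    also have "ennreal (K / 2) * (\<integral>\<^sup>+z. ennreal (heat_kernel \<sigma> z * norm (z::'a) powr (2 * s + \<epsilon>)) \<partial>lborel)
        + ennreal M * (\<integral>\<^sup>+z. ennreal (heat_kernel \<sigma> z * norm (z::'a) powr 2) \<partial>lborel) + hF \<sigma> x t
       \<le> ennreal K * ennreal (C1 * \<sigma> powr ((2 * s + \<epsilon>) / 2)) + ennreal M * ennreal (C2 * \<sigma> powr (2 / 2)) + hF \<sigma> x t"
      using C1(2)[OF \<sigma>] C2(2)[OF \<sigma>] K by (intro add_mono mult_mono ennreal_leI) auto
    also have "\<sigma> powr (2 / 2) = \<sigma>"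
      using \<sigma> by simp
    also have "ennreal K * ennreal (C1 * \<sigma> powr ((2 * s + \<epsilon>) / 2)) = ennreal (K * C1 * \<sigma> powr ((2 * s + \<epsilon>) / 2))"
      using K C1(1) by (subst ennreal_mult[symmetric]) (auto simp: mult.assoc)
    also have "ennreal M * ennreal (C2 * \<sigma>) = ennreal (M * C2 * \<sigma>)"
      using M(1) C2(1) \<sigma> by (subst ennreal_mult[symmetric]) (auto simp: mult.assoc)
    finally have 1: "ennreal \<bar>enn2real (hN \<sigma> x t) - u (x, t - \<sigma>)\<bar> \<le> ennreal (K * C1 * \<sigma> powr ((2 * s + \<epsilon>) / 2)) + ennreal (M * C2 * \<sigma>) + hF \<sigma> x t" .
    have "\<bar>u (x, t) - enn2real (hN \<sigma> x t)\<bar> \<le> \<bar>enn2real (hN \<sigma> x t) - u (x, t - \<sigma>)\<bar> + K * \<sigma> powr (s + \<epsilon>)"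
      using K2[of x t \<sigma>] x \<sigma> False by linarith
    then have "ennreal \<bar>u (x, t) - enn2real (hN \<sigma> x t)\<bar> \<le> ennreal \<bar>enn2real (hN \<sigma> x t) - u (x, t - \<sigma>)\<bar> + ennreal (K * \<sigma> powr (s + \<epsilon>))"
      using K by (simp add: ennreal_plus[symmetric] ennreal_leI del: ennreal_plus)
    also have "\<dots> \<le> (ennreal (K * C1 * \<sigma> powr ((2 * s + \<epsilon>) / 2)) + ennreal (M * C2 * \<sigma>) + hF \<sigma> x t) + ennreal (K * \<sigma> powr (s + \<epsilon>))"
      using 1 by (rule add_right_mono)
    finally have "ennreal (\<sigma> powr (- 1 - s)) * ennreal \<bar>u (x, t) - enn2real (hN \<sigma> x t)\<bar>
       \<le> ennreal (\<sigma> powr (- 1 - s)) * ((ennreal (K * C1 * \<sigma> powr ((2 * s + \<epsilon>) / 2)) + ennreal (M * C2 * \<sigma>) + hF \<sigma> x t) + ennreal (K * \<sigma> powr (s + \<epsilon>)))"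
      by (rule mult_left_mono) simp
    also have "\<dots> = ennreal (K * C1) * ennreal (\<sigma> powr (\<epsilon> / 2 - 1)) + ennreal (M * C2) * ennreal (\<sigma> powr (- s)) + ennreal (\<sigma> powr (- 1 - s)) * hF \<sigma> x t + ennreal K * ennreal (\<sigma> powr (\<epsilon> - 1))"
    proof -
      have "\<sigma> powr (\<epsilon> / 2 - 1) = \<sigma> powr (- 1 - s) * \<sigma> powr ((2 * s + \<epsilon>) / 2)"
        by (subst powr_add[symmetric]) (simp add: field_simps)
      moreover have "\<sigma> powr (\<epsilon> - 1) = \<sigma> powr (- 1 - s) * \<sigma> powr (s + \<epsilon>)"
        by (subst powr_add[symmetric]) (simp add: field_simps)
      moreover have "\<sigma> powr (- s) = \<sigma> powr (- 1 - s) * \<sigma>"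
      proof -
        have "\<sigma> powr (- 1 - s) * \<sigma> powr 1 = \<sigma> powr (- s)"
          by (subst powr_add[symmetric]) simp
        then show ?thesis using \<sigma> by simp
      qed
      moreover have "ennreal p * ((ennreal (a * q1) + ennreal (b * q2) + h) + ennreal (c * q3))
         = ennreal a * ennreal (p * q1) + ennreal b * ennreal (p * q2) + ennreal p * h + ennreal c * ennreal (p * q3)"
        if "0 \<le> a" "0 \<le> b" "0 \<le> c" "0 \<le> p" "0 \<le> q1" "0 \<le> q2" "0 \<le> q3" for a b c p q1 q2 q3 h
        using that by (simp only: distrib_left ennreal_mult mult.left_commute)
      ultimately show ?thesis
        using K C1(1) M(1) C2(1) \<sigma> by simp
    qed
    finally show ?thesis using False \<sigma> by (simp add: g_def ennreal_mult add_ac)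
  qed
  define G where "G = 2 * M * (1 / s) + K * (1 / \<epsilon>) + K * C1 * (1 / (\<epsilon> / 2)) + M * C2 * (1 / (1 - s))"
  have G: "0 \<le> G" using M(1) K C1(1) C2(1) s_pos s_less \<epsilon>(1) by (simp add: G_def)
  have [measurable]: "g \<in> borel_measurable borel" unfolding g_def by measurable
  have "(\<integral>\<^sup>+\<sigma>\<in>{0<..}. ennreal (\<sigma> powr (- 1 - s) * \<bar>u (x, t) - enn2real (hN \<sigma> x t)\<bar>) \<partial>lborel) \<le> ennreal (G + F)"
    if x: "norm x \<le> A" "\<bar>t\<bar> \<le> A" for x t
  proof -
    have "(\<integral>\<^sup>+\<sigma>\<in>{0<..}. ennreal (\<sigma> powr (- 1 - s) * \<bar>u (x, t) - enn2real (hN \<sigma> x t)\<bar>) \<partial>lborel)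
      \<le> (\<integral>\<^sup>+\<sigma>. g \<sigma> + ennreal (\<sigma> powr (- 1 - s)) * hF \<sigma> x t * indicator {0<..} \<sigma> \<partial>lborel)"
      using hN_AE_finite[of x t]
      by (intro nn_integral_mono_AE, elim AE_mp, intro AE_I2) (auto simp: indicator_def intro!: pw x)
    also have "\<dots> = ennreal G + (\<integral>\<^sup>+\<sigma>. ennreal (\<sigma> powr (- 1 - s)) * hF \<sigma> x t * indicator {0<..} \<sigma> \<partial>lborel)"
      by (subst nn_integral_add) (auto simp: g_int G_def)
    also have "\<dots> \<le> ennreal G + ennreal F"
      using order_trans[OF hF_le_farmass F(2)[OF x]] by (intro add_left_mono)
    finally show ?thesis using G F by simp
  qed
  then show ?thesis using G F by (intro exI[of _ "G + F"]) auto
qed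

end

section \<open>A cutoff with bounded second differences\<close>

text \<open>The square makes the truncated paraboloid differentiable with Lipschitz gradient, the
  regularity that bounds second differences. Being radially decreasing, it yields cutoffs that
  increase with the radius.\<close>

definition bump :: "'a::euclidean_space \<Rightarrow> real" where
  "bump v = (max 0 (1 - (norm v)\<^sup>2))\<^sup>2"

lemma bump_bounds: "0 \<le> bump v" "bump v \<le> 1"
  by (auto simp: bump_def max_def power_le_one)

lemma bump_lipschitz: "\<bar>bump v - bump w\<bar> \<le> 4 * norm (v - w)"
proof -
  have p: "max 0 (1 - (norm v)\<^sup>2) = 1 - (min 1 (norm v))\<^sup>2" for v :: 'a
    by (auto simp: max_def min_def power_le_one_iff abs_square_le_1[of "norm v", simplified])
  define a b where "a = min 1 (norm v)" and "b = min 1 (norm w)"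
  have ab: "0 \<le> a" "a \<le> 1" "0 \<le> b" "b \<le> 1" "\<bar>a - b\<bar> \<le> norm (v - w)"
    using norm_triangle_ineq3[of v w] by (auto simp: a_def b_def min_def)
  have "bump v - bump w = ((b - a) * (a + b)) * (2 - a\<^sup>2 - b\<^sup>2)"
    unfolding bump_def p a_def[symmetric] b_def[symmetric]
    by (simp add: power2_eq_square algebra_simps)
  then have "\<bar>bump v - bump w\<bar> = \<bar>a - b\<bar> * (a + b) * (2 - a\<^sup>2 - b\<^sup>2)"
  proof -
    have "a\<^sup>2 \<le> 1" "b\<^sup>2 \<le> 1" using ab by (auto simp: power_le_one)
    then have "\<bar>2 - a\<^sup>2 - b\<^sup>2\<bar> = 2 - a\<^sup>2 - b\<^sup>2" by simp
    then show ?thesis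
      unfolding \<open>bump v - bump w = _\<close> using ab by (simp only: abs_mult) (simp add: abs_minus_commute)
  qed
  also have "\<dots> \<le> norm (v - w) * 2 * 2"
  proof -
    have "a\<^sup>2 \<le> 1" "b\<^sup>2 \<le> 1" using ab by (auto simp: power_le_one)
    then show ?thesis using ab by (intro mult_mono) auto
  qed
  finally show ?thesis by simp
qed

text \<open>The gradient at w is -4 w times the positive part of 1 - |w|^2. If both points are in
  the unit ball, the function is a polynomial. If exactly one of them is, its distance to the sphere
  is at most |v - w|, so 1 minus its squared norm is at most 2 |v - w| and every term is already
  quadratically small; with w inside, this gives 12 = 4 + 8.\<close>

lemma bump_taylor: "\<bar>bump v - bump w + 4 * max 0 (1 - (norm w)\<^sup>2) * (w \<bullet> (v - w))\<bar> \<le> 12 * (norm (v - w))\<^sup>2"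
proof -
  define d where "d = v - w"
  define p q where "p = 1 - (norm v)\<^sup>2" and "q = 1 - (norm w)\<^sup>2"
  have pq: "p - q = - 2 * (w \<bullet> d) - (norm d)\<^sup>2" "p - q = - ((v + w) \<bullet> d)"
    by (auto simp: p_def q_def d_def power2_norm_eq_inner inner_diff_left inner_diff_right inner_add_left inner_add_right inner_commute)
  have small: "x \<le> 2 * norm (a - b)" if x: "x = 1 - (norm a)\<^sup>2" "0 \<le> x" and b: "1 \<le> norm b" for a b :: 'a and x
  proof -
    have "norm a \<le> 1" using x by (simp add: abs_square_le_1[of "norm a", simplified])
    have "x = (1 - norm a) * (1 + norm a)" using x by (simp add: power2_eq_square algebra_simps)
    also have "\<dots> \<le> norm (a - b) * 2"
      using \<open>norm a \<le> 1\<close> b norm_triangle_ineq2[of b a] by (intro mult_mono) (auto simp: norm_minus_commute)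
    finally show ?thesis by simp
  qed
  consider "q \<le> 0" "p \<le> 0" | "q \<le> 0" "0 \<le> p" | "0 \<le> q" "p \<le> 0" | "0 \<le> q" "0 \<le> p" by linarith
  then show ?thesis
  proof cases
    case 1
    then show ?thesis by (simp add: bump_def p_def[symmetric] q_def[symmetric] max_def)
  next
    case 2
    then have "1 \<le> norm w" by (simp add: q_def abs_square_le_1[of "norm w", simplified] abs_le_square_iff[of 1 "norm w", simplified])
    then have "p \<le> 2 * norm d" using small[of p v w] 2 by (simp add: p_def d_def)
    then have "p\<^sup>2 \<le> (2 * norm d)\<^sup>2" using 2 by (intro power_mono) auto
    then have "p\<^sup>2 \<le> 12 * (norm d)\<^sup>2" unfolding power_mult_distrib by (rule order_trans) (simp add: mult_right_mono)
    then show ?thesis using 2 by (simp add: bump_def p_def[symmetric] q_def[symmetric] d_def[symmetric] max_def)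
  next
    case 3
    then have v1: "1 \<le> norm v" by (simp add: p_def abs_le_square_iff[of 1 "norm v", simplified])
    then have q2: "q \<le> 2 * norm d" using small[of q w v] 3 by (simp add: q_def d_def norm_minus_commute)
    have w1: "norm w \<le> 1" using 3 by (simp add: q_def abs_square_le_1[of "norm w", simplified])
    have "\<bar>w \<bullet> d\<bar> \<le> norm w * norm d" by (rule Cauchy_Schwarz_ineq2)
    also have "\<dots> \<le> 1 * norm d" using w1 by (intro mult_right_mono) auto
    finally have wd: "\<bar>w \<bullet> d\<bar> \<le> norm d" by simp
    have "\<bar>- q\<^sup>2 + 4 * q * (w \<bullet> d)\<bar> \<le> \<bar>q\<^sup>2\<bar> + \<bar>4 * q * (w \<bullet> d)\<bar>" by linarith
    also have "\<dots> = q\<^sup>2 + 4 * (q * \<bar>w \<bullet> d\<bar>)" using 3 by (simp add: abs_mult)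
    also have "\<dots> \<le> (2 * norm d)\<^sup>2 + 4 * (2 * norm d * norm d)"
      using 3 q2 wd by (intro add_mono mult_left_mono mult_mono power_mono) auto
    also have "\<dots> = 12 * (norm d)\<^sup>2" by (simp add: power2_eq_square)
    finally show ?thesis using 3 by (simp add: bump_def p_def[symmetric] q_def[symmetric] d_def[symmetric] max_def)
  next
    case 4
    have v1: "norm v \<le> 1" using 4 by (simp add: p_def abs_square_le_1[of "norm v", simplified])
    have w1: "norm w \<le> 1" using 4 by (simp add: q_def abs_square_le_1[of "norm w", simplified])
    have "\<bar>p - q\<bar> \<le> norm (v + w) * norm d" unfolding pq(2) using Cauchy_Schwarz_ineq2[of "v + w" d] by simp
    also have "\<dots> \<le> 2 * norm d" using v1 w1 norm_triangle_ineq[of v w] by (intro mult_right_mono) auto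
    finally have "(p - q)\<^sup>2 \<le> (2 * norm d)\<^sup>2" by (metis abs_le_square_iff abs_mult abs_norm_cancel abs_numeral)
    then have D: "(p - q)\<^sup>2 \<le> 4 * (norm d)\<^sup>2" by (simp add: power_mult_distrib)
    have eq: "p\<^sup>2 - q\<^sup>2 + 4 * q * (w \<bullet> d) = - 2 * (q * (norm d)\<^sup>2) + (p - q)\<^sup>2"
    proof -
      have "p\<^sup>2 - q\<^sup>2 = 2 * q * (p - q) + (p - q)\<^sup>2" by (simp add: power2_eq_square algebra_simps)
      then show ?thesis unfolding pq(1) by (simp add: algebra_simps)
    qed
    have "q \<le> 1" by (simp add: q_def)
    then have Q: "q * (norm d)\<^sup>2 \<le> 1 * (norm d)\<^sup>2" by (rule mult_right_mono) simp
    have Q0: "0 \<le> q * (norm d)\<^sup>2" using 4 by simp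
    have "\<bar>- 2 * Q + D\<bar> \<le> 12 * N" if "0 \<le> Q" "Q \<le> 1 * N" "0 \<le> D" "D \<le> 4 * N" for Q D N :: real
      using that by (simp add: abs_le_iff)
    from this[OF Q0 Q _ D] have "\<bar>p\<^sup>2 - q\<^sup>2 + 4 * q * (w \<bullet> d)\<bar> \<le> 12 * (norm d)\<^sup>2"
      unfolding eq by simp
    then show ?thesis using 4 by (simp add: bump_def p_def[symmetric] q_def[symmetric] d_def[symmetric] max_def)
  qed
qed

definition cutoff :: "real \<Rightarrow> 'a::euclidean_space \<Rightarrow> real" where
  "cutoff R z = bump (z /\<^sub>R R)"

lemma cutoff_bounds: "0 \<le> cutoff R z" "cutoff R z \<le> 1"
  by (simp_all add: cutoff_def bump_bounds)

lemma cutoff_eq: "cutoff R z = (max 0 (1 - (norm z)\<^sup>2 / R\<^sup>2))\<^sup>2"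
  by (simp add: cutoff_def bump_def power_mult_distrib divide_inverse mult.commute power_inverse)

lemma cutoff_outside: "0 < R \<Longrightarrow> R \<le> norm z \<Longrightarrow> cutoff R z = 0"
  by (simp add: cutoff_eq power_mono)

lemma cutoff_mono: "0 < R \<Longrightarrow> R \<le> R' \<Longrightarrow> cutoff R z \<le> cutoff R' z"
  unfolding cutoff_eq
  by (intro power_mono max.mono diff_left_mono divide_left_mono) auto

lemma cutoff_tendsto: "(\<lambda>n. cutoff (real (Suc n)) z) \<longlonglongrightarrow> 1"
proof -
  have "(\<lambda>n. (max 0 (1 - (norm z)\<^sup>2 * (inverse (real (Suc n)))\<^sup>2))\<^sup>2) \<longlonglongrightarrow> (max 0 (1 - (norm z)\<^sup>2 * 0\<^sup>2))\<^sup>2"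
    by (intro tendsto_intros LIMSEQ_inverse_real_of_nat)
  then show ?thesis by (simp add: cutoff_eq divide_inverse power_inverse)
qed

lemma measurable_cutoff [measurable (raw)]:
  assumes [measurable]: "g \<in> borel_measurable M"
  shows "(\<lambda>w. cutoff R (g w)) \<in> borel_measurable M"
  unfolding cutoff_eq by measurable

lemma cutoff_lipschitz:
  assumes "0 < R"
  shows "\<bar>cutoff R z - cutoff R w\<bar> \<le> 4 * norm (z - w) / R"
  using bump_lipschitz[of "z /\<^sub>R R" "w /\<^sub>R R"] assms
  by (simp add: cutoff_def scaleR_diff_right[symmetric] divide_inverse mult_ac)

text \<open>In the sum of two Taylor expansions the gradient terms cancel. Scaling gives R^(-2),
  weakened to 1/R, the rate of the Lipschitz bound with which it is combined.\<close>

lemma cutoff_second_difference: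
  assumes "1 \<le> R"
  shows "\<bar>cutoff R (z + h) + cutoff R (z - h) - 2 * cutoff R z\<bar> \<le> 24 * (norm h)\<^sup>2 / R"
proof -
  define v k where "v = z /\<^sub>R R" and "k = h /\<^sub>R R"
  define c where "c = 4 * max 0 (1 - (norm v)\<^sup>2)"
  have "\<bar>bump (v + k) - bump v + c * (v \<bullet> k)\<bar> \<le> 12 * (norm k)\<^sup>2"
    using bump_taylor[of "v + k" v] by (simp add: c_def)
  moreover have "\<bar>bump (v - k) - bump v - c * (v \<bullet> k)\<bar> \<le> 12 * (norm k)\<^sup>2"
    using bump_taylor[of "v - k" v] by (simp add: c_def)
  ultimately have "\<bar>bump (v + k) + bump (v - k) - 2 * bump v\<bar> \<le> 24 * (norm k)\<^sup>2" by linarith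
  also have "24 * (norm k)\<^sup>2 = 24 * (norm h)\<^sup>2 / R\<^sup>2"
    by (simp add: k_def power_mult_distrib divide_inverse power_inverse)
  also have "\<dots> \<le> 24 * (norm h)\<^sup>2 / R"
    using assms by (intro divide_left_mono) (auto simp: power2_eq_square)
  finally show ?thesis by (simp add: cutoff_def v_def k_def scaleR_add_right scaleR_diff_right)
qed

text \<open>The commutator of the cutoff with the heat semigroup is linear in \<open>\<sigma>\<close>: the product of the two
  kernels is a Gaussian centred at the mean of the Brownian bridge, and its linear part integrates to zero.\<close>

lemma cutoff_average:
  obtains K where "0 < K"
    "\<And>R b \<sigma> (x::'a::euclidean_space) y'. 1 \<le> R \<Longrightarrow> 0 < b \<Longrightarrow> 0 < \<sigma> \<Longrightarrow>
       \<exists>e. 0 \<le> e \<and> e \<le> 1 \<and> \<bar>e - cutoff R (y' - x)\<bar> \<le> K * \<sigma> * (1 + norm (x - y') / (b + \<sigma>)) / R \<and>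
        (\<integral>\<^sup>+y. ennreal (heat_kernel b (x - y) * heat_kernel \<sigma> (y - y') * cutoff R (y - x)) \<partial>lborel)
          = ennreal (heat_kernel (b + \<sigma>) (x - y') * e)"
proof -
  obtain C where C: "0 < C" "\<And>a. 0 < a \<Longrightarrow> (\<integral>\<^sup>+z. ennreal (heat_kernel a z * norm (z::'a) powr 2) \<partial>lborel) \<le> ennreal (C * a powr (2 / 2))"
    by (rule nn_integral_heat_kernel_moment[of 2]) auto
  define K where "K = 12 * C + 4"
  have "\<exists>e. 0 \<le> e \<and> e \<le> 1 \<and> \<bar>e - cutoff R (y' - x)\<bar> \<le> K * \<sigma> * (1 + norm (x - y') / (b + \<sigma>)) / R \<and>
        (\<integral>\<^sup>+y. ennreal (heat_kernel b (x - y) * heat_kernel \<sigma> (y - y') * cutoff R (y - x)) \<partial>lborel)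
          = ennreal (heat_kernel (b + \<sigma>) (x - y') * e)"
    if R: "1 \<le> R" and b: "0 < b" and \<sigma>: "0 < \<sigma>" for R b \<sigma> and x y' :: 'a
  proof -
    \<comment> \<open>The average of the cutoff differs from its value at the mean \<open>m\<close>
      by its second differences times the variance parameter \<open>c\<close>, which is at most
      \<sigma>; and \<open>m\<close> is at distance \<sigma> |x - y'|/(b + \<sigma>) from y', which
      costs the Lipschitz bound. Both errors carry a factor \<sigma>.\<close>
    define c where "c = b * \<sigma> / (b + \<sigma>)"
    define m where "m = y' + (\<sigma> / (b + \<sigma>)) *\<^sub>R (x - y')"
    have c: "0 < c" "c \<le> \<sigma>" using b \<sigma> by (auto simp: c_def field_simps)
    define k where "k = (\<lambda>z. heat_kernel c z * cutoff R (m + z - x))"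
    define k' where "k' = (\<lambda>z. heat_kernel c z * cutoff R (m - z - x))"
    define k0 where "k0 = (\<lambda>z::'a. heat_kernel c z * cutoff R (m - x))"
    define e where "e = (\<integral>z. k z \<partial>lborel)"
    have hk: "integrable lborel (\<lambda>z::'a. heat_kernel c z)" "integral\<^sup>L lborel (\<lambda>z::'a. heat_kernel c z) = 1"
      using c by (auto intro!: integrableI_nonneg simp: integral_eq_nn_integral)
    have le: "heat_kernel c z * cutoff R w \<le> heat_kernel c z" for z w :: 'a
      using cutoff_bounds by (intro mult_right_le_one_le) auto
    have I: "integrable lborel k"
      unfolding k_def by (rule Bochner_Integration.integrable_bound[OF hk(1)]) (auto simp: le cutoff_bounds)
    have I': "integrable lborel k'"
      unfolding k'_def by (rule Bochner_Integration.integrable_bound[OF hk(1)]) (auto simp: le cutoff_bounds)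
    have e0: "0 \<le> e" unfolding e_def by (intro integral_nonneg_AE) (auto simp: k_def cutoff_bounds)
    have nn_e: "(\<integral>\<^sup>+z. ennreal (k z) \<partial>lborel) = ennreal e"
      unfolding e_def using I by (intro nn_integral_eq_integral) (auto simp: k_def cutoff_bounds)
    have nn_e': "(\<integral>\<^sup>+z. ennreal (k' z) \<partial>lborel) = ennreal e"
      using nn_integral_lborel_uminus[of "\<lambda>z. ennreal (k z)"] unfolding nn_e by (simp add: k_def k'_def)
    have "(\<integral>z. k' z \<partial>lborel) = e"
      using nn_e' e0 by (subst integral_eq_nn_integral) (auto simp: k'_def cutoff_bounds)
    moreover have "e \<le> 1"
      unfolding e_def hk(2)[symmetric] using I hk(1) by (intro integral_mono) (auto simp: k_def le)
    ultimately have e': "(\<integral>z. k' z \<partial>lborel) = e" "e \<le> 1" by auto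
    have "e - cutoff R (m - x) = (\<integral>z. (k z + k' z - 2 * k0 z) / 2 \<partial>lborel)"
      using I I' hk e' by (simp add: e_def[symmetric] k0_def)
    also have "ennreal \<bar>\<dots>\<bar> \<le> (\<integral>\<^sup>+z. ennreal (norm ((k z + k' z - 2 * k0 z) / 2)) \<partial>lborel)"
      using I I' hk by (subst real_norm_def[symmetric], intro integral_norm_bound_ennreal) (auto simp: k0_def)
    also have "\<dots> \<le> (\<integral>\<^sup>+z. ennreal (12 / R) * ennreal (heat_kernel c z * norm (z::'a) powr 2) \<partial>lborel)"
    proof (rule nn_integral_mono)
      fix z :: 'a
      have "(k z + k' z - 2 * k0 z) / 2 = heat_kernel c z * ((cutoff R ((m - x) + z) + cutoff R ((m - x) - z) - 2 * cutoff R (m - x)) / 2)"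
        by (simp add: k_def k'_def k0_def algebra_simps)
      then have "norm ((k z + k' z - 2 * k0 z) / 2) = heat_kernel c z * (\<bar>cutoff R ((m - x) + z) + cutoff R ((m - x) - z) - 2 * cutoff R (m - x)\<bar> / 2)"
        by (simp only: real_norm_def abs_mult abs_divide) simp
      also have "\<dots> \<le> heat_kernel c z * ((24 * (norm z)\<^sup>2 / R) / 2)"
        using cutoff_second_difference[OF R] by (intro mult_left_mono divide_right_mono) auto
      also have "\<dots> = 12 / R * (heat_kernel c z * norm z powr 2)" by simp
      finally have "ennreal (norm ((k z + k' z - 2 * k0 z) / 2)) \<le> ennreal (12 / R * (heat_kernel c z * norm z powr 2))"
        by (rule ennreal_leI)
      then show "ennreal (norm ((k z + k' z - 2 * k0 z) / 2)) \<le> ennreal (12 / R) * ennreal (heat_kernel c z * norm z powr 2)"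
        using R by (subst ennreal_mult[symmetric]) auto
    qed
    also have "\<dots> = ennreal (12 / R) * (\<integral>\<^sup>+z. ennreal (heat_kernel c z * norm (z::'a) powr 2) \<partial>lborel)"
      by (rule nn_integral_cmult) measurable
    also have "\<dots> \<le> ennreal (12 / R) * ennreal (C * c powr (2 / 2))"
      using C(2)[OF c(1)] by (rule mult_left_mono) simp
    also have "\<dots> = ennreal (12 / R * (C * c))"
      using R C c by (subst ennreal_mult[symmetric]) auto
    finally have "\<bar>e - cutoff R (m - x)\<bar> \<le> 12 / R * (C * c)"
      using R C c by (subst (asm) ennreal_le_iff) auto
    also have "\<dots> \<le> 12 / R * (C * \<sigma>)"
      using R C c by (intro mult_left_mono) auto
    finally have 1: "\<bar>e - cutoff R (m - x)\<bar> \<le> 12 / R * (C * \<sigma>)" .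
    have "\<bar>cutoff R (m - x) - cutoff R (y' - x)\<bar> \<le> 4 * norm ((m - x) - (y' - x)) / R"
      using R by (intro cutoff_lipschitz) auto
    also have "norm ((m - x) - (y' - x)) = \<sigma> * (norm (x - y') / (b + \<sigma>))"
      using b \<sigma> by (simp add: m_def)
    finally have 2: "\<bar>cutoff R (m - x) - cutoff R (y' - x)\<bar> \<le> 4 * (\<sigma> * (norm (x - y') / (b + \<sigma>))) / R" .
    have "\<bar>e - cutoff R (y' - x)\<bar> \<le> 12 / R * (C * \<sigma>) + 4 * (\<sigma> * (norm (x - y') / (b + \<sigma>))) / R"
      using 1 2 by linarith
    also have "\<dots> = \<sigma> * (12 * C + 4 * (norm (x - y') / (b + \<sigma>))) / R"
      using R by (simp add: divide_simps) (simp add: algebra_simps)?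
    also have "\<dots> \<le> \<sigma> * (K * (1 + norm (x - y') / (b + \<sigma>))) / R"
    proof -
      have "0 \<le> norm (x - y') / (b + \<sigma>)" using b \<sigma> by simp
      then have "0 \<le> C * (norm (x - y') / (b + \<sigma>))" using C(1) by (intro mult_nonneg_nonneg) auto
      then have "12 * C + 4 * (norm (x - y') / (b + \<sigma>)) \<le> K * (1 + norm (x - y') / (b + \<sigma>))"
        unfolding K_def distrib_right distrib_left by linarith
      then show ?thesis using R \<sigma> by (intro divide_right_mono mult_left_mono) auto
    qed
    finally have 3: "\<bar>e - cutoff R (y' - x)\<bar> \<le> K * \<sigma> * (1 + norm (x - y') / (b + \<sigma>)) / R"
      by (simp add: mult_ac)
    have "(\<integral>\<^sup>+y. ennreal (heat_kernel b (x - y) * heat_kernel \<sigma> (y - y') * cutoff R (y - x)) \<partial>lborel)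
       = (\<integral>\<^sup>+y. ennreal (heat_kernel (b + \<sigma>) (x - y')) * ennreal (heat_kernel c (y - m) * cutoff R (y - x)) \<partial>lborel)"
      by (intro nn_integral_cong)
        (simp add: heat_kernel_mult[OF b \<sigma>] c_def[symmetric] m_def[symmetric] ennreal_mult'[symmetric] cutoff_bounds mult.assoc)
    also have "\<dots> = ennreal (heat_kernel (b + \<sigma>) (x - y')) * (\<integral>\<^sup>+y. ennreal (heat_kernel c (y - m) * cutoff R (y - x)) \<partial>lborel)"
      by (rule nn_integral_cmult) measurable
    also have "(\<integral>\<^sup>+y. ennreal (heat_kernel c (y - m) * cutoff R (y - x)) \<partial>lborel) = ennreal e"
      using nn_integral_lborel_translate[of "\<lambda>y. ennreal (heat_kernel c (y - m) * cutoff R (y - x))" m]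
      unfolding nn_e[symmetric] by (simp add: k_def)
    also have "ennreal (heat_kernel (b + \<sigma>) (x - y')) * ennreal e = ennreal (heat_kernel (b + \<sigma>) (x - y') * e)"
      using e0 by (simp add: ennreal_mult)
    finally show ?thesis using e0 e' 3 by blast
  qed
  moreover have "0 < K" using C by (simp add: K_def)
  ultimately show ?thesis using that by blast
qed

subsection \<open>Fractional integration of the equation\<close>

lemma nn_integral_lborel_pair:
  fixes g :: "'b::euclidean_space \<times> 'c::euclidean_space \<Rightarrow> ennreal"
  assumes "g \<in> borel_measurable (lborel \<Otimes>\<^sub>M lborel)"
  shows "(\<integral>\<^sup>+p. g p \<partial>lborel) = (\<integral>\<^sup>+x. \<integral>\<^sup>+y. g (x, y) \<partial>lborel \<partial>lborel)"
  using lborel.nn_integral_fst[OF assms] by (simp add: lborel_prod)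

lemma nn_integral_lborel_swap:
  fixes g :: "'b::euclidean_space \<Rightarrow> 'c::euclidean_space \<Rightarrow> ennreal"
  assumes "(\<lambda>(x, y). g x y) \<in> borel_measurable (lborel \<Otimes>\<^sub>M lborel)"
  shows "(\<integral>\<^sup>+x. \<integral>\<^sup>+y. g x y \<partial>lborel \<partial>lborel) = (\<integral>\<^sup>+y. \<integral>\<^sup>+x. g x y \<partial>lborel \<partial>lborel)"
  using lborel_pair.Fubini'[OF assms] by simp

section \<open>The truncated operator\<close>

context heat_fraction
begin

lemma f_eq': "f (x, t) = (LINT \<sigma>:{0<..}|lborel. \<sigma> powr (- 1 - s) * (u (x, t) - enn2real (hN \<sigma> x t)))"
  using f_eq unfolding hN_def .

lemma f_borel [measurable]: "f \<in> borel_measurable borel"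
proof -
  have "f = (\<lambda>p. LINT \<sigma>:{0<..}|lborel. \<sigma> powr (- 1 - s) * (u (fst p, snd p) - enn2real (hN \<sigma> (fst p) (snd p))))"
    using f_eq' by auto
  also have "\<dots> \<in> borel_measurable (borel \<Otimes>\<^sub>M borel)"
    unfolding set_lebesgue_integral_def by measurable
  also have "(borel :: 'a measure) \<Otimes>\<^sub>M (borel :: real measure) = borel"
    by (rule borel_prod)
  finally show ?thesis .
qed

lemma f_measurable [measurable (raw)]:
  assumes "g \<in> borel_measurable M" "h \<in> borel_measurable M"
  shows "(\<lambda>w. f (g w, h w)) \<in> borel_measurable M"
  using assms by (intro measurable_compose[OF borel_measurable_Pair f_borel])

text \<open>The operator without the lags up to \<delta>. For \<delta> > 0 its two terms converge
  separately (\<open>L_split\<close>); as \<delta> \<rightarrow> 0 in general only their difference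
  has a limit.\<close>

definition L :: "real \<Rightarrow> 'a \<Rightarrow> real \<Rightarrow> real" where
  "L \<delta> x t = (LINT \<sigma>:{\<delta><..}|lborel. \<sigma> powr (- 1 - s) * (u (x, t) - enn2real (hN \<sigma> x t)))"

lemma L_measurable [measurable (raw)]:
  assumes [measurable]: "g \<in> borel_measurable M" "h \<in> borel_measurable M"
  shows "(\<lambda>w. L \<delta> (g w) (h w)) \<in> borel_measurable M"
  unfolding L_def set_lebesgue_integral_def by measurable

definition S :: "real \<Rightarrow> 'a \<Rightarrow> real \<Rightarrow> ennreal" where
  "S \<delta> x t = (\<integral>\<^sup>+\<sigma>\<in>{\<delta><..}. ennreal (\<sigma> powr (- 1 - s)) * hN \<sigma> x t \<partial>lborel)"

lemma S_measurable [measurable (raw)]: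
  assumes [measurable]: "g \<in> borel_measurable M" "h \<in> borel_measurable M"
  shows "(\<lambda>w. S \<delta> (g w) (h w)) \<in> borel_measurable M"
  unfolding S_def by measurable

lemma S_finite:
  assumes "0 < \<delta>"
  shows "S \<delta> x t < \<infinity>"
proof -
  obtain B where B: "\<forall>x' t'. norm x' \<le> max (norm x) \<bar>t\<bar> \<longrightarrow> \<bar>t'\<bar> \<le> max (norm x) \<bar>t\<bar> \<longrightarrow>
    (\<integral>\<^sup>+\<sigma>\<in>{\<delta><..}. ennreal (\<sigma> powr (- 1 - s)) * hN \<sigma> x' t' \<partial>lborel) \<le> ennreal B"
    using hN_trunc_bounded[of "max (norm x) \<bar>t\<bar>" \<delta>] assms by (auto simp: le_max_iff_disj)
  have "S \<delta> x t \<le> ennreal B" unfolding S_def by (rule B[rule_format]) auto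
  then show ?thesis by (rule order_le_less_trans) simp
qed

lemma increments_integrable:
  "set_integrable lborel {0<..} (\<lambda>\<sigma>. \<sigma> powr (- 1 - s) * (u (x, t) - enn2real (hN \<sigma> x t)))"
proof -
  obtain B where B: "\<forall>x' t'. norm x' \<le> max (norm x) \<bar>t\<bar> \<longrightarrow> \<bar>t'\<bar> \<le> max (norm x) \<bar>t\<bar> \<longrightarrow>
    (\<integral>\<^sup>+\<sigma>\<in>{0<..}. ennreal (\<sigma> powr (- 1 - s) * \<bar>u (x', t') - enn2real (hN \<sigma> x' t')\<bar>) \<partial>lborel) \<le> ennreal B"
    using increments_bounded[of "max (norm x) \<bar>t\<bar>"] by (auto simp: le_max_iff_disj)
  have "(\<integral>\<^sup>+\<sigma>. ennreal (norm (indicator {0<..} \<sigma> *\<^sub>R (\<sigma> powr (- 1 - s) * (u (x, t) - enn2real (hN \<sigma> x t))))) \<partial>lborel)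
      = (\<integral>\<^sup>+\<sigma>\<in>{0<..}. ennreal (\<sigma> powr (- 1 - s) * \<bar>u (x, t) - enn2real (hN \<sigma> x t)\<bar>) \<partial>lborel)"
    by (intro nn_integral_cong) (auto simp: indicator_def abs_mult)
  also have "\<dots> \<le> ennreal B" by (rule B[rule_format]) auto
  finally show ?thesis
    unfolding set_integrable_def by (intro integrableI_bounded) (auto simp: order_le_less_trans)
qed

lemma L_bounded:
  assumes "0 \<le> A"
  shows "\<exists>B\<ge>0. \<forall>x t \<delta>. norm x \<le> A \<longrightarrow> \<bar>t\<bar> \<le> A \<longrightarrow> 0 \<le> \<delta> \<longrightarrow> \<bar>L \<delta> x t\<bar> \<le> B"
proof -
  obtain B where B: "B \<ge> 0" "\<And>x t. norm x \<le> A \<Longrightarrow> \<bar>t\<bar> \<le> A \<Longrightarrow>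
    (\<integral>\<^sup>+\<sigma>\<in>{0<..}. ennreal (\<sigma> powr (- 1 - s) * \<bar>u (x, t) - enn2real (hN \<sigma> x t)\<bar>) \<partial>lborel) \<le> ennreal B"
    using increments_bounded[OF assms] by blast
  have "\<bar>L \<delta> x t\<bar> \<le> B" if x: "norm x \<le> A" "\<bar>t\<bar> \<le> A" and "0 \<le> \<delta>" for x t \<delta>
  proof -
    have int: "set_integrable lborel {\<delta><..} (\<lambda>\<sigma>. \<sigma> powr (- 1 - s) * (u (x, t) - enn2real (hN \<sigma> x t)))"
      by (rule set_integrable_subset[OF increments_integrable]) (use that in auto)
    have "ennreal \<bar>L \<delta> x t\<bar> \<le> (\<integral>\<^sup>+\<sigma>. ennreal (norm (indicator {\<delta><..} \<sigma> *\<^sub>R (\<sigma> powr (- 1 - s) * (u (x, t) - enn2real (hN \<sigma> x t))))) \<partial>lborel)"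
      unfolding L_def set_lebesgue_integral_def real_norm_def[symmetric]
      using int unfolding set_integrable_def by (rule integral_norm_bound_ennreal)
    also have "\<dots> \<le> (\<integral>\<^sup>+\<sigma>\<in>{0<..}. ennreal (\<sigma> powr (- 1 - s) * \<bar>u (x, t) - enn2real (hN \<sigma> x t)\<bar>) \<partial>lborel)"
      using \<open>0 \<le> \<delta>\<close> by (intro nn_integral_mono) (auto simp: indicator_def abs_mult)
    also have "\<dots> \<le> ennreal B" by (rule B(2)[OF x])
    finally show ?thesis using B(1) by simp
  qed
  then show ?thesis using B(1) by blast
qed

lemma L_tendsto:
  assumes \<delta>: "\<And>n. 0 < \<delta> n" "\<delta> \<longlonglongrightarrow> 0"
  shows "(\<lambda>n. L (\<delta> n) x t) \<longlonglongrightarrow> f (x, t)"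
  unfolding L_def f_eq' set_lebesgue_integral_def
proof (rule integral_dominated_convergence)
  let ?g = "\<lambda>\<sigma>. \<sigma> powr (- 1 - s) * (u (x, t) - enn2real (hN \<sigma> x t))"
  show "integrable lborel (\<lambda>\<sigma>. norm (indicator {0<..} \<sigma> *\<^sub>R ?g \<sigma>))"
    using increments_integrable unfolding set_integrable_def by (rule integrable_norm)
  show "AE \<sigma> in lborel. (\<lambda>n. indicator {\<delta> n<..} \<sigma> *\<^sub>R ?g \<sigma>) \<longlonglongrightarrow> indicator {0<..} \<sigma> *\<^sub>R ?g \<sigma>"
  proof (rule AE_I2)
    fix \<sigma> :: real
    show "(\<lambda>n. indicator {\<delta> n<..} \<sigma> *\<^sub>R ?g \<sigma>) \<longlonglongrightarrow> indicator {0<..} \<sigma> *\<^sub>R ?g \<sigma>"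
    proof (cases "0 < \<sigma>")
      case True
      then have "eventually (\<lambda>n. \<delta> n < \<sigma>) sequentially"
        using \<delta>(2) by (rule order_tendstoD(2)[rotated])
      then have "eventually (\<lambda>n. indicator {\<delta> n<..} \<sigma> *\<^sub>R ?g \<sigma> = indicator {0<..} \<sigma> *\<^sub>R ?g \<sigma>) sequentially"
        by eventually_elim (use True in auto)
      then show ?thesis by (rule tendsto_eventually)
    next
      case False
      then have "\<And>n. \<not> \<delta> n < \<sigma>" using \<delta>(1) by (metis order_less_trans)
      then show ?thesis using False by simp
    qed
  qed
  show "AE \<sigma> in lborel. norm (indicator {\<delta> n<..} \<sigma> *\<^sub>R ?g \<sigma>) \<le> norm (indicator {0<..} \<sigma> *\<^sub>R ?g \<sigma>)" for n
    using \<delta>(1)[of n] by (intro AE_I2) (auto simp: indicator_def)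
qed measurable

lemma L_split:
  assumes "0 < \<delta>"
  shows "L \<delta> x t = \<delta> powr (- s) / s * u (x, t) - enn2real (S \<delta> x t)"
proof -
  have c: "(\<integral>\<^sup>+\<sigma>. ennreal (indicator {\<delta><..} \<sigma> * (\<sigma> powr (- 1 - s) * u (x, t))) \<partial>lborel) = ennreal (\<delta> powr (- s) / s * u (x, t))"
  proof -
    have "(\<integral>\<^sup>+\<sigma>. ennreal (indicator {\<delta><..} \<sigma> * (\<sigma> powr (- 1 - s) * u (x, t))) \<partial>lborel)
        = (\<integral>\<^sup>+\<sigma>. ennreal (u (x, t)) * (ennreal (\<sigma> powr (- 1 - s)) * indicator {\<delta>..} \<sigma>) \<partial>lborel)"
    proof (rule nn_integral_cong_AE)
      show "AE \<sigma> in lborel. ennreal (indicator {\<delta><..} \<sigma> * (\<sigma> powr (- 1 - s) * u (x, t)))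
          = ennreal (u (x, t)) * (ennreal (\<sigma> powr (- 1 - s)) * indicator {\<delta>..} \<sigma>)"
        using AE_lborel_singleton[of \<delta>]
        by eventually_elim (auto simp: indicator_def ennreal_mult[symmetric] u_nonneg mult.commute)
    qed
    also have "\<dots> = ennreal (u (x, t)) * ennreal (\<delta> powr (- s) / s)"
      using assms s_pos by (subst nn_integral_cmult) (auto simp: nn_integral_powr_inf)
    also have "\<dots> = ennreal (\<delta> powr (- s) / s * u (x, t))"
      using u_nonneg s_pos by (subst ennreal_mult[symmetric]) (auto simp: mult.commute)
    finally show ?thesis .
  qed
  have I1: "integrable lborel (\<lambda>\<sigma>. indicator {\<delta><..} \<sigma> * (\<sigma> powr (- 1 - s) * u (x, t)))"
    using c by (intro integrableI_nonneg) (auto simp: u_nonneg)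
  have J1: "(\<integral>\<sigma>. indicator {\<delta><..} \<sigma> * (\<sigma> powr (- 1 - s) * u (x, t)) \<partial>lborel) = \<delta> powr (- s) / s * u (x, t)"
    using c u_nonneg s_pos by (subst integral_eq_nn_integral) (auto simp: enn2real_ennreal)
  have d: "(\<integral>\<^sup>+\<sigma>. ennreal (indicator {\<delta><..} \<sigma> * (\<sigma> powr (- 1 - s) * enn2real (hN \<sigma> x t))) \<partial>lborel) = S \<delta> x t"
    unfolding S_def
  proof (rule nn_integral_cong_AE)
    show "AE \<sigma> in lborel. ennreal (indicator {\<delta><..} \<sigma> * (\<sigma> powr (- 1 - s) * enn2real (hN \<sigma> x t)))
      = ennreal (\<sigma> powr (- 1 - s)) * hN \<sigma> x t * indicator {\<delta><..} \<sigma>"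
      using hN_AE_finite[of x t]
      by eventually_elim (use assms in \<open>auto simp: indicator_def ennreal_mult\<close>)
  qed
  have I2: "integrable lborel (\<lambda>\<sigma>. indicator {\<delta><..} \<sigma> * (\<sigma> powr (- 1 - s) * enn2real (hN \<sigma> x t)))"
    using d S_finite[OF assms, of x t] by (intro integrableI_nonneg) auto
  have J2: "(\<integral>\<sigma>. indicator {\<delta><..} \<sigma> * (\<sigma> powr (- 1 - s) * enn2real (hN \<sigma> x t)) \<partial>lborel) = enn2real (S \<delta> x t)"
    using d by (subst integral_eq_nn_integral) auto
  have "L \<delta> x t = (\<integral>\<sigma>. indicator {\<delta><..} \<sigma> * (\<sigma> powr (- 1 - s) * u (x, t)) - indicator {\<delta><..} \<sigma> * (\<sigma> powr (- 1 - s) * enn2real (hN \<sigma> x t)) \<partial>lborel)"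
    unfolding L_def set_lebesgue_integral_def by (simp add: algebra_simps)
  then show ?thesis using I1 I2 J1 J2 by simp
qed

end

section \<open>Fractional integration with a spatial cutoff, at a fixed point\<close>

locale heat_fraction_at = heat_fraction s u f
  for s and u f :: "'a::euclidean_space \<times> real \<Rightarrow> real" +
  fixes x :: 'a and t \<kappa> :: real
  assumes kappa: "0 < \<kappa>"
begin

definition W :: "real \<Rightarrow> real \<Rightarrow> 'a \<Rightarrow> real" where
  "W R b y = (if 0 < b \<and> b < \<kappa> then b powr (s - 1) * heat_kernel b (x - y) * cutoff R (y - x) else 0)"

definition Phi :: "real \<Rightarrow> real \<Rightarrow> ennreal" where
  "Phi R a = (\<integral>\<^sup>+y. ennreal (heat_kernel a (x - y) * cutoff R (y - x) * u (y, t - a)) \<partial>lborel)"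

text \<open>P_b applied to the cutoff times P_\<sigma> u. Here the cutoff sits at the intermediate
  point, in \<open>Phi\<close> at the source; if it commuted with the semigroup,
  \<open>V R b \<sigma>\<close> would be \<open>Phi R (b + \<sigma>)\<close>.\<close>

definition V :: "real \<Rightarrow> real \<Rightarrow> real \<Rightarrow> ennreal" where
  "V R b \<sigma> = (\<integral>\<^sup>+y. ennreal (heat_kernel b (x - y) * cutoff R (y - x)) * hN \<sigma> y (t - b) \<partial>lborel)"

text \<open>The product b^(s - 1) \<sigma>^(-1 - s) on 0 < b < \<kappa>, \<sigma> > \<delta>,
  written in the total lag a = b + \<sigma>.\<close>

definition ker :: "real \<Rightarrow> real \<Rightarrow> real \<Rightarrow> real" where
  "ker \<delta> b a = (if 0 < b \<and> b < \<kappa> \<and> b + \<delta> < a then b powr (s - 1) * (a - b) powr (- 1 - s) else 0)"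

text \<open>A bound for the difference of \<open>V R b (a - b)\<close> and \<open>Phi R a\<close>.
  The second entry of the minimum is the estimate of \<open>cutoff_average\<close>; the entry 1 is
  available because both averages of the cutoff lie between 0 and 1, and it keeps the bound
  integrable for large lags.\<close>

definition rho :: "real \<Rightarrow> real \<Rightarrow> real \<Rightarrow> real \<Rightarrow> ennreal" where
  "rho K R b a = (\<integral>\<^sup>+y. ennreal (heat_kernel a (x - y) * u (y, t - a) * min 1 (K * (a - b) * (1 + norm (x - y) / a) / R)) \<partial>lborel)"

lemma W_nonneg: "0 \<le> W R b y" by (simp add: W_def cutoff_bounds)
lemma ker_nonneg: "0 \<le> ker \<delta> b a" by (simp add: ker_def)

lemma W_measurable [measurable (raw)]:
  assumes [measurable]: "g \<in> borel_measurable M" "h \<in> borel_measurable M"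
  shows "(\<lambda>w. W R (g w) (h w)) \<in> borel_measurable M"
  unfolding W_def by measurable

lemma Phi_measurable [measurable (raw)]:
  assumes [measurable]: "g \<in> borel_measurable M"
  shows "(\<lambda>w. Phi R (g w)) \<in> borel_measurable M"
  unfolding Phi_def by measurable

lemma V_measurable [measurable (raw)]:
  assumes [measurable]: "g \<in> borel_measurable M" "h \<in> borel_measurable M"
  shows "(\<lambda>w. V R (g w) (h w)) \<in> borel_measurable M"
  unfolding V_def by measurable

lemma ker_measurable [measurable (raw)]:
  assumes [measurable]: "g \<in> borel_measurable M" "h \<in> borel_measurable M"
  shows "(\<lambda>w. ker \<delta> (g w) (h w)) \<in> borel_measurable M"
  unfolding ker_def by measurable

lemma rho_measurable [measurable (raw)]:
  assumes [measurable]: "g \<in> borel_measurable M" "h \<in> borel_measurable M"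
  shows "(\<lambda>w. rho K R (g w) (h w)) \<in> borel_measurable M"
  unfolding rho_def by measurable

text \<open>\<open>cutoff_average\<close> is integrated against u at time t - a after exchanging the
  two space integrals. Two inequalities replace an absolute value because any of the quantities may
  be infinite.\<close>

lemma V_sandwich:
  "\<exists>K>0. \<forall>R b a. 1 \<le> R \<longrightarrow> 0 < b \<longrightarrow> b < a \<longrightarrow> V R b (a - b) \<le> Phi R a + rho K R b a \<and> Phi R a \<le> V R b (a - b) + rho K R b a"
proof -
  obtain K where K: "0 < K"
    "\<And>R b \<sigma> (x::'a) y'. 1 \<le> R \<Longrightarrow> 0 < b \<Longrightarrow> 0 < \<sigma> \<Longrightarrow>
       \<exists>e. 0 \<le> e \<and> e \<le> 1 \<and> \<bar>e - cutoff R (y' - x)\<bar> \<le> K * \<sigma> * (1 + norm (x - y') / (b + \<sigma>)) / R \<and>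
        (\<integral>\<^sup>+y. ennreal (heat_kernel b (x - y) * heat_kernel \<sigma> (y - y') * cutoff R (y - x)) \<partial>lborel)
          = ennreal (heat_kernel (b + \<sigma>) (x - y') * e)"
    by (rule cutoff_average) blast
  have "V R b (a - b) \<le> Phi R a + rho K R b a \<and> Phi R a \<le> V R b (a - b) + rho K R b a"
    if R: "1 \<le> R" and b: "0 < b" and a: "b < a" for R b a
  proof -
    define \<sigma> where "\<sigma> = a - b"
    have \<sigma>: "0 < \<sigma>" "b + \<sigma> = a" "t - b - \<sigma> = t - a" using a by (auto simp: \<sigma>_def)
    define Q where "Q = (\<lambda>y'. \<integral>\<^sup>+y. ennreal (heat_kernel b (x - y) * heat_kernel \<sigma> (y - y') * cutoff R (y - x)) * ennreal (u (y', t - a)) \<partial>lborel)"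
    have [measurable]: "Q \<in> borel_measurable borel" unfolding Q_def by measurable
    have VQ: "V R b \<sigma> = (\<integral>\<^sup>+y'. Q y' \<partial>lborel)"
    proof -
      have "V R b \<sigma> = (\<integral>\<^sup>+y. \<integral>\<^sup>+y'. ennreal (heat_kernel b (x - y) * heat_kernel \<sigma> (y - y') * cutoff R (y - x)) * ennreal (u (y', t - a)) \<partial>lborel \<partial>lborel)"
        unfolding V_def hN_def \<sigma>(3)
        by (intro nn_integral_cong, subst nn_integral_cmult[symmetric], measurable)
          (intro nn_integral_cong, simp add: ennreal_mult'[symmetric] ennreal_mult''[symmetric] u_nonneg cutoff_bounds mult_ac)
      also have "\<dots> = (\<integral>\<^sup>+y'. Q y' \<partial>lborel)"
        unfolding Q_def by (rule nn_integral_lborel_swap) measurable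
      finally show ?thesis .
    qed
    define r where "r = (\<lambda>y. ennreal (heat_kernel a (x - y) * u (y, t - a) * min 1 (K * (a - b) * (1 + norm (x - y) / a) / R)))"
    define p where "p = (\<lambda>y. ennreal (heat_kernel a (x - y) * cutoff R (y - x) * u (y, t - a)))"
    have [measurable]: "r \<in> borel_measurable borel" "p \<in> borel_measurable borel" unfolding r_def p_def by measurable
    have pw: "Q y' \<le> p y' + r y' \<and> p y' \<le> Q y' + r y'" for y'
    proof -
      obtain e where e: "0 \<le> e" "e \<le> 1" "\<bar>e - cutoff R (y' - x)\<bar> \<le> K * \<sigma> * (1 + norm (x - y') / (b + \<sigma>)) / R"
        "(\<integral>\<^sup>+y. ennreal (heat_kernel b (x - y) * heat_kernel \<sigma> (y - y') * cutoff R (y - x)) \<partial>lborel)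
          = ennreal (heat_kernel (b + \<sigma>) (x - y') * e)"
        using K(2)[OF R b \<sigma>(1)] by blast
      define c where "c = cutoff R (y' - x)"
      define h where "h = heat_kernel a (x - y') * u (y', t - a)"
      define q where "q = min 1 (K * (a - b) * (1 + norm (x - y') / a) / R)"
      have h: "0 \<le> h" by (simp add: h_def u_nonneg)
      have c: "0 \<le> c" "c \<le> 1" by (simp_all add: c_def cutoff_bounds)
      have ecq: "\<bar>e - c\<bar> \<le> q" using e(3) e(1,2) c unfolding q_def \<sigma>(2) c_def[symmetric] \<sigma>_def[symmetric] by auto
      have "Q y' = ennreal (heat_kernel (b + \<sigma>) (x - y') * e) * ennreal (u (y', t - a))"
        unfolding Q_def by (subst nn_integral_multc) (auto simp: e(4))
      then have Q: "Q y' = ennreal (h * e)"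
        using e(1) u_nonneg by (simp add: h_def \<sigma>(2) ennreal_mult[symmetric] mult_ac)
      have p: "p y' = ennreal (h * c)" by (simp add: p_def h_def c_def mult_ac)
      have r: "r y' = ennreal (h * q)" by (simp add: r_def h_def q_def)
      have "h * e \<le> h * (c + q)" "h * c \<le> h * (e + q)"
        using ecq h by (auto intro!: mult_left_mono)
      then show ?thesis
        unfolding Q p r using h e(1) c ecq
        by (simp add: ennreal_plus[symmetric] distrib_left ennreal_leI del: ennreal_plus)
    qed
    have "(\<integral>\<^sup>+y'. Q y' \<partial>lborel) \<le> (\<integral>\<^sup>+y. p y + r y \<partial>lborel)" "(\<integral>\<^sup>+y. p y \<partial>lborel) \<le> (\<integral>\<^sup>+y'. Q y' + r y' \<partial>lborel)"
      using pw by (auto intro!: nn_integral_mono)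
    then show ?thesis
      unfolding VQ[unfolded \<sigma>_def] Phi_def rho_def r_def[symmetric] p_def[symmetric]
      by (simp add: nn_integral_add)
  qed
  then show ?thesis using K(1) by blast
qed

end

lemma nn_integral_lborel_affine:
  fixes g :: "'b::euclidean_space \<Rightarrow> ennreal"
  assumes [measurable]: "g \<in> borel_measurable borel" and c: "c \<noteq> 0"
  shows "(\<integral>\<^sup>+y. g y \<partial>lborel) = ennreal (\<bar>c\<bar> ^ DIM('b)) * (\<integral>\<^sup>+z. g (x + c *\<^sub>R z) \<partial>lborel)"
  by (subst lborel_affine[OF c, of x])
    (simp add: nn_integral_density nn_integral_distr nn_integral_cmult)

section \<open>The commutator error\<close>

context heat_fraction_at
begin

text \<open>The kernel is taken at \<delta> = 0, so that one bound serves all truncations. For a <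
  \<kappa> the integral of \<open>ker 0 b a\<close> over b diverges at b = a; it is the commutator
  factor in \<open>rho\<close> that makes the double integral finite.\<close>

definition Err :: "real \<Rightarrow> real \<Rightarrow> ennreal" where
  "Err K R = (\<integral>\<^sup>+b. \<integral>\<^sup>+a. ennreal (ker 0 b a) * rho K R b a \<partial>lborel \<partial>lborel)"

text \<open>The full integrand in three variables, for which the order of integration can be chosen
  and dominated convergence applied on the product space.\<close>

definition Err_dens :: "real \<Rightarrow> real \<Rightarrow> real \<Rightarrow> real \<Rightarrow> 'a \<Rightarrow> ennreal" where
  "Err_dens K R b a y = ennreal (heat_kernel a (x - y) * u (y, t - a)) * ennreal (ker 0 b a * min 1 (K * (a - b) * (1 + norm (x - y) / a) / R))"

lemma Err_dens_measurable [measurable (raw)]: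
  assumes [measurable]: "g1 \<in> borel_measurable M" "g2 \<in> borel_measurable M" "g3 \<in> borel_measurable M"
  shows "(\<lambda>w. Err_dens K R (g1 w) (g2 w) (g3 w)) \<in> borel_measurable M"
  unfolding Err_dens_def by measurable

lemma ker_rho:
  assumes "0 < K" "0 < R"
  shows "ennreal (ker 0 b a) * rho K R b a = (\<integral>\<^sup>+y. Err_dens K R b a y \<partial>lborel)"
proof -
  have "ennreal (ker 0 b a) * rho K R b a = (\<integral>\<^sup>+y. ennreal (ker 0 b a) * ennreal (heat_kernel a (x - y) * u (y, t - a) * min 1 (K * (a - b) * (1 + norm (x - y) / a) / R)) \<partial>lborel)"
    unfolding rho_def by (rule nn_integral_cmult[symmetric]) measurable
  also have "\<dots> = (\<integral>\<^sup>+y. Err_dens K R b a y \<partial>lborel)"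
  proof (intro nn_integral_cong)
    fix y
    show "ennreal (ker 0 b a) * ennreal (heat_kernel a (x - y) * u (y, t - a) * min 1 (K * (a - b) * (1 + norm (x - y) / a) / R)) = Err_dens K R b a y"
    proof (cases "0 < b \<and> b < a")
      case True
      then have "0 \<le> min 1 (K * (a - b) * (1 + norm (x - y) / a) / R)" using assms by simp
      then show ?thesis
        using ker_nonneg[of 0 b a] u_nonneg
        by (simp only: Err_dens_def ennreal_mult[symmetric] mult_nonneg_nonneg heat_kernel_nonneg) (simp only: mult_ac)
    qed (auto simp: Err_dens_def ker_def)
  qed
  finally show ?thesis .
qed

lemma Err_eq:
  assumes "0 < K" "0 < R"
  shows "Err K R = (\<integral>\<^sup>+p. Err_dens K R (fst p) (fst (snd p)) (snd (snd p)) \<partial>lborel)"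
    and "Err K R = (\<integral>\<^sup>+a. \<integral>\<^sup>+y. \<integral>\<^sup>+b. Err_dens K R b a y \<partial>lborel \<partial>lborel \<partial>lborel)"
proof -
  have 1: "Err K R = (\<integral>\<^sup>+b. \<integral>\<^sup>+a. \<integral>\<^sup>+y. Err_dens K R b a y \<partial>lborel \<partial>lborel \<partial>lborel)"
    unfolding Err_def using ker_rho[OF assms] by simp
  have [measurable]: "(\<lambda>p. Err_dens K R b (fst p) (snd p)) \<in> borel_measurable (lborel \<Otimes>\<^sub>M lborel)" for b
    by measurable
  show "Err K R = (\<integral>\<^sup>+p. Err_dens K R (fst p) (fst (snd p)) (snd (snd p)) \<partial>lborel)"
  proof (subst nn_integral_lborel_pair)
    have "(\<lambda>p. Err_dens K R (fst p) (fst (snd p)) (snd (snd p))) \<in> borel_measurable (borel \<Otimes>\<^sub>M (borel \<Otimes>\<^sub>M borel))"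
      by measurable
    then show "(\<lambda>p. Err_dens K R (fst p) (fst (snd p)) (snd (snd p))) \<in> borel_measurable (lborel \<Otimes>\<^sub>M lborel)"
      by (subst measurable_cong_sets[OF sets_pair_measure_cong[OF sets_lborel sets_lborel] refl]) (simp add: borel_prod)
  next
    show "Err K R = (\<integral>\<^sup>+b. \<integral>\<^sup>+q. Err_dens K R (fst (b, q)) (fst (snd (b, q))) (snd (snd (b, q))) \<partial>lborel \<partial>lborel)"
      unfolding 1 by (intro nn_integral_cong) (simp add: nn_integral_lborel_pair)
  qed
  have "(\<integral>\<^sup>+b. \<integral>\<^sup>+a. \<integral>\<^sup>+y. Err_dens K R b a y \<partial>lborel \<partial>lborel \<partial>lborel) = (\<integral>\<^sup>+a. \<integral>\<^sup>+b. \<integral>\<^sup>+y. Err_dens K R b a y \<partial>lborel \<partial>lborel \<partial>lborel)"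
    by (rule nn_integral_lborel_swap) measurable
  also have "\<dots> = (\<integral>\<^sup>+a. \<integral>\<^sup>+y. \<integral>\<^sup>+b. Err_dens K R b a y \<partial>lborel \<partial>lborel \<partial>lborel)"
    by (intro nn_integral_cong nn_integral_lborel_swap) measurable
  finally show "Err K R = (\<integral>\<^sup>+a. \<integral>\<^sup>+y. \<integral>\<^sup>+b. Err_dens K R b a y \<partial>lborel \<partial>lborel \<partial>lborel)"
    unfolding 1 .
qed

text \<open>The b-integral is estimated in two ways. The factor a - b of the commutator reduces the
  singularity to b^(s - 1) (a - b)^(-s), a Beta integral, bounded uniformly in a up to the factor 1
  + |x - y|/a. For large a the trivial bound 1 leaves the Poisson kernel, which decays like a^(-1 -
  s). In the remaining integral over (a, y), u is bounded near the pole and the first moment of the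
  kernel gives a^(-1/2); elsewhere the integrand is at most a multiple of that of
  \<open>farmass\<close>.\<close>

lemma Err_finite:
  assumes K: "0 < K"
  shows "Err K 1 < \<infinity>"
proof -
  define B where "B = 2 / s + 2 / (1 - s)"
  \<comment> \<open>From this lag on a - \<kappa> \<ge> a/2, so that the Poisson kernel is at most a
    multiple of a^(-1 - s).\<close>
  define A0 where "A0 = 2 * \<kappa> + 1"
  define D where "D = (2 * \<kappa>) powr s / s"
  define m where "m = (\<lambda>b a y. ker 0 b a * min 1 (K * (a - b) * (1 + norm (x - y) / a) / 1))"
  have B: "0 < B" using s_pos s_less by (simp add: B_def add_pos_pos)
  have D: "0 \<le> D" using s_pos by (simp add: D_def)
  have A0: "1 < A0" using kappa by (simp add: A0_def)
  have i: "(\<integral>\<^sup>+b. ennreal (m b a y) \<partial>lborel) \<le> ennreal (K * (1 + norm (x - y) / a) * B)" if a: "0 < a" for a y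
  proof -
    let ?T = "K * (1 + norm (x - y) / a)"
    have T: "0 \<le> ?T" using K a by simp
    have "(\<integral>\<^sup>+b. ennreal (m b a y) \<partial>lborel) \<le> (\<integral>\<^sup>+b. ennreal ?T * (ennreal (b powr (s - 1) * (a - b) powr (- s)) * indicator {0<..<a} b) \<partial>lborel)"
    proof (rule nn_integral_mono)
      fix b :: real
      show "ennreal (m b a y) \<le> ennreal ?T * (ennreal (b powr (s - 1) * (a - b) powr (- s)) * indicator {0<..<a} b)"
      proof (cases "0 < b \<and> b < \<kappa> \<and> b < a")
        case True
        have e: "(a - b) powr (- 1 - s) * (a - b) = (a - b) powr (- s)"
          using powr_add[of "a - b" "- 1 - s" 1] True by simp
        have "m b a y \<le> ker 0 b a * (K * (a - b) * (1 + norm (x - y) / a))"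
          unfolding m_def by (intro mult_left_mono ker_nonneg) simp
        also have "\<dots> = ?T * (b powr (s - 1) * ((a - b) powr (- 1 - s) * (a - b)))"
          using True by (simp add: ker_def mult_ac)
        finally have "m b a y \<le> ?T * (b powr (s - 1) * (a - b) powr (- s))" unfolding e .
        then show ?thesis using True T by (simp add: ennreal_mult[symmetric] ennreal_leI)
      next
        case False
        then have "m b a y = 0" by (auto simp: m_def ker_def)
        then show ?thesis by simp
      qed
    qed
    also have "\<dots> = ennreal ?T * (\<integral>\<^sup>+b\<in>{0<..<a}. ennreal (b powr (s - 1) * (a - b) powr (- s)) \<partial>lborel)"
      by (rule nn_integral_cmult) measurable
    also have "\<dots> \<le> ennreal ?T * ennreal B"
      unfolding B_def by (intro mult_left_mono nn_integral_beta_bound s_pos s_less a) simp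
    also have "\<dots> = ennreal (?T * B)" using T B by (simp add: ennreal_mult)
    finally show ?thesis .
  qed
  have ii: "(\<integral>\<^sup>+b. ennreal (m b a y) \<partial>lborel) \<le> ennreal (D * a powr (- 1 - s))" if a: "A0 \<le> a" for a y
  proof -
    have a1: "0 < a" "\<kappa> < a" "a / 2 \<le> a - \<kappa>" using a kappa by (auto simp: A0_def)
    have "(\<integral>\<^sup>+b. ennreal (m b a y) \<partial>lborel) \<le> (\<integral>\<^sup>+b\<in>{0<..<\<kappa>}. ennreal (b powr (s - 1) * (a - b) powr (- 1 - s)) \<partial>lborel)"
    proof (rule nn_integral_mono)
      fix b
      have "m b a y \<le> ker 0 b a * 1" unfolding m_def by (intro mult_left_mono ker_nonneg) simp
      then show "ennreal (m b a y) \<le> ennreal (b powr (s - 1) * (a - b) powr (- 1 - s)) * indicator {0<..<\<kappa>} b"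
      proof (cases "0 < b \<and> b < \<kappa>")
        case True
        then have "ker 0 b a * 1 \<le> b powr (s - 1) * (a - b) powr (- 1 - s)" by (simp add: ker_def)
        with \<open>m b a y \<le> ker 0 b a * 1\<close> show ?thesis using True by (simp add: ennreal_leI)
      next
        case False
        then have "ker 0 b a = 0" by (auto simp: ker_def)
        with \<open>m b a y \<le> ker 0 b a * 1\<close> show ?thesis by (simp add: ennreal_neg)
      qed
    qed
    also have "\<dots> = ennreal (1 / (s * a) * (\<kappa> / (a - \<kappa>)) powr s)"
      by (rule nn_integral_beta_kernel[OF s_pos kappa a1(2)])
    also have "\<dots> \<le> ennreal (D * a powr (- 1 - s))"
    proof (rule ennreal_leI)
      have "(\<kappa> / (a - \<kappa>)) powr s \<le> (\<kappa> / (a / 2)) powr s"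
        using a1 kappa s_pos by (intro powr_mono2 divide_left_mono) auto
      also have "\<dots> = (2 * \<kappa>) powr s * a powr (- s)"
        using a1 by (simp add: powr_divide powr_minus divide_simps powr_mult)
      finally have "1 / (s * a) * (\<kappa> / (a - \<kappa>)) powr s \<le> 1 / (s * a) * ((2 * \<kappa>) powr s * a powr (- s))"
        using a1 s_pos by (intro mult_left_mono) auto
      also have "\<dots> = D * (a powr (- s) / a)" by (simp add: D_def)
      also have "a powr (- s) / a = a powr (- 1 - s)"
      proof -
        have "a powr (- 1 - s) = a powr (- s - 1)" by (rule arg_cong[where f = "\<lambda>e. a powr e"]) simp
        also have "\<dots> = a powr (- s) / a" using powr_diff[of a "- s" 1] a1 by simp
        finally show ?thesis by simp
      qed
      finally show "1 / (s * a) * (\<kappa> / (a - \<kappa>)) powr s \<le> D * a powr (- 1 - s)" .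
    qed
    finally show ?thesis .
  qed
  \<comment> \<open>Below \<open>A0\<close> the power a^(-1 - s) is at least A0^(-1 - s), so the
    first bound can also be brought into the form of \<open>farmass\<close>; \<open>Q\<close> adds
    the constants of both cases.\<close>
  define Q where "Q = K * B * A0 powr (1 + s) + D"
  have Q: "0 \<le> Q" using K B D by (simp add: Q_def)
  obtain M where M: "M \<ge> 0" "\<forall>x' t'. norm x' \<le> norm x + \<bar>t\<bar> + 1 \<longrightarrow> \<bar>t'\<bar> \<le> norm x + \<bar>t\<bar> + 1 \<longrightarrow> u (x', t') \<le> M"
    using u_bounded by blast
  define near where "near = (\<lambda>a y. (ennreal (M * K * B) * (ennreal (heat_kernel a (x - y)) + ennreal (1 / a) * ennreal (heat_kernel a (x - y) * norm (x - y) powr 1))) * indicator {0<..<1} a)"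
  define far where "far = (\<lambda>a y. (ennreal (a powr (- 1 - s) * heat_kernel a (x - y) * (1 + norm (x - y) / a)\<^sup>2
       * u (y, t - a)) * indicator {y. 1 \<le> a \<or> 1 / 2 \<le> norm (x - y)} y) * indicator {0<..} a)"
  have [measurable]: "(\<lambda>y. near a y) \<in> borel_measurable borel" for a unfolding near_def by measurable
  have [measurable]: "(\<lambda>y. far a y) \<in> borel_measurable borel" for a unfolding far_def by measurable
  have far_meas[measurable]: "(\<lambda>p. far (fst p) (snd p)) \<in> borel_measurable (borel \<Otimes>\<^sub>M borel)"
  proof -
    have "(\<lambda>p. far (fst p) (snd p)) = (\<lambda>p. (if 1 \<le> fst p \<or> 1 / 2 \<le> norm (x - snd p) then ennreal (fst p powr (- 1 - s) * heat_kernel (fst p) (x - snd p) * (1 + norm (x - snd p) / fst p)\<^sup>2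
       * u (snd p, t - fst p)) else 0) * indicator {0<..} (fst p))"
      by (auto simp: far_def indicator_def)
    also have "\<dots> \<in> borel_measurable (borel \<Otimes>\<^sub>M borel)" by measurable
    finally show ?thesis .
  qed
  have pw: "(\<integral>\<^sup>+b. Err_dens K 1 b a y \<partial>lborel) \<le> near a y + ennreal Q * far a y" for a y
  proof (cases "0 < a")
    case False
    then have "Err_dens K 1 b a y = 0" for b by (auto simp: Err_dens_def ker_def)
    then show ?thesis by simp
  next
    case a: True
    let ?h = "heat_kernel a (x - y) * u (y, t - a)"
    have h: "0 \<le> ?h" using u_nonneg by simp
    have eq: "(\<integral>\<^sup>+b. Err_dens K 1 b a y \<partial>lborel) = ennreal ?h * (\<integral>\<^sup>+b. ennreal (m b a y) \<partial>lborel)"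
      unfolding Err_dens_def m_def by (rule nn_integral_cmult) measurable
    show ?thesis
    proof (cases "1 \<le> a \<or> 1 / 2 \<le> norm (x - y)")
      case far: True
      let ?T = "1 + norm (x - y) / a"
      have T1: "1 \<le> ?T" using a by simp
      have T: "1 \<le> ?T" "?T \<le> ?T\<^sup>2" using T1 power_increasing[of 1 2 ?T] by simp_all
      have "(\<integral>\<^sup>+b. ennreal (m b a y) \<partial>lborel) \<le> ennreal (Q * (a powr (- 1 - s) * ?T\<^sup>2))"
      proof (cases "A0 \<le> a")
        case True
        have "D * a powr (- 1 - s) * 1 \<le> Q * (a powr (- 1 - s)) * ?T\<^sup>2"
        proof (intro mult_mono)
          show "D \<le> Q" using K B by (simp add: Q_def)
          show "1 \<le> ?T\<^sup>2" using T by linarith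
        qed (use D Q in auto)
        then show ?thesis using ii[OF True, of y] by (auto simp: mult.assoc intro: order_trans ennreal_leI)
      next
        case False
        have "1 \<le> A0 powr (1 + s) * a powr (- 1 - s)"
        proof -
          have "a powr (1 + s) \<le> A0 powr (1 + s)" using False a s_pos by (intro powr_mono2) auto
          then have "a powr (1 + s) * a powr (- 1 - s) \<le> A0 powr (1 + s) * a powr (- 1 - s)" by (intro mult_right_mono) auto
          moreover have "a powr (1 + s) * a powr (- 1 - s) = 1" using a by (simp add: powr_add[symmetric])
          ultimately show ?thesis by simp
        qed
        then have "(K * B) * 1 * ?T \<le> (K * B) * (A0 powr (1 + s) * a powr (- 1 - s)) * ?T\<^sup>2"
          using K B T by (intro mult_mono) auto
        also have "\<dots> \<le> Q * (a powr (- 1 - s) * ?T\<^sup>2)"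
          using D by (simp add: Q_def distrib_right mult.assoc)
        finally have "K * ?T * B \<le> Q * (a powr (- 1 - s) * ?T\<^sup>2)" by (simp only: mult_ac mult_1_right mult_1_left)
        then show ?thesis using i[OF a, of y] by (auto intro: order_trans ennreal_leI)
      qed
      then have "(\<integral>\<^sup>+b. Err_dens K 1 b a y \<partial>lborel) \<le> ennreal ?h * ennreal (Q * (a powr (- 1 - s) * ?T\<^sup>2))"
        unfolding eq by (rule mult_left_mono) simp
      also have "\<dots> = ennreal Q * ennreal (a powr (- 1 - s) * heat_kernel a (x - y) * ?T\<^sup>2 * u (y, t - a))"
        using h Q by (simp only: ennreal_mult[symmetric] mult_nonneg_nonneg powr_ge_zero zero_le_power2 heat_kernel_nonneg u_nonneg) (simp only: mult_ac)
      also have "\<dots> = ennreal Q * far a y" using far a by (simp add: far_def)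
      finally show ?thesis by (simp add: add_increasing)
    next
      case near: False
      have "norm y \<le> norm x + norm (x - y)" by norm
      moreover have "a < 1" "norm (x - y) < 1 / 2" using near by auto
      ultimately have "norm y \<le> norm x + \<bar>t\<bar> + 1" "\<bar>t - a\<bar> \<le> norm x + \<bar>t\<bar> + 1"
        using a norm_ge_zero[of x] by linarith+
      then have uM: "u (y, t - a) \<le> M" by (rule M(2)[rule_format])
      have "(\<integral>\<^sup>+b. Err_dens K 1 b a y \<partial>lborel) \<le> ennreal ?h * ennreal (K * (1 + norm (x - y) / a) * B)"
        unfolding eq using i[OF a, of y] by (rule mult_left_mono) simp
      also have "\<dots> = ennreal (?h * (K * (1 + norm (x - y) / a) * B))"
        using h K B a by (subst ennreal_mult[symmetric]) auto
      also have "\<dots> \<le> ennreal ((heat_kernel a (x - y) * M) * (K * (1 + norm (x - y) / a) * B))"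
        using uM K B a by (intro ennreal_leI mult_right_mono mult_left_mono) auto
      also have "(heat_kernel a (x - y) * M) * (K * (1 + norm (x - y) / a) * B)
          = (M * K * B) * (heat_kernel a (x - y) + (1 / a) * (heat_kernel a (x - y) * norm (x - y) powr 1))"
        by (simp add: algebra_simps)
      also have "ennreal \<dots> = near a y"
      proof -
        have "ennreal (c * (p + i * q)) = ennreal c * (ennreal p + ennreal i * ennreal q)"
          if "0 \<le> c" "0 \<le> p" "0 \<le> i" "0 \<le> q" for c p i q :: real
          using that by (simp only: ennreal_mult ennreal_plus add_nonneg_nonneg mult_nonneg_nonneg)
        from this[of "M * K * B" "heat_kernel a (x - y)" "1 / a" "heat_kernel a (x - y) * norm (x - y) powr 1"]
        show ?thesis using near a M(1) K B by (simp add: near_def)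
      qed
      finally show ?thesis by (simp add: add_increasing2)
    qed
  qed
  obtain C where C: "0 < C" "\<And>a. 0 < a \<Longrightarrow> (\<integral>\<^sup>+z. ennreal (heat_kernel a z * norm (z::'a) powr 1) \<partial>lborel) \<le> ennreal (C * a powr (1 / 2))"
    by (rule nn_integral_heat_kernel_moment[of 1]) auto
  have near_int: "(\<integral>\<^sup>+y. near a y \<partial>lborel) \<le> ennreal (M * K * B) * (ennreal C * (ennreal (a powr (- 1 / 2)) * indicator {0<..<1} a) + indicator {0<..<1} a)" for a
  proof (cases "0 < a \<and> a < 1")
    case True
    have "(\<integral>\<^sup>+y. near a y \<partial>lborel) = ennreal (M * K * B) * (1 + ennreal (1 / a) * (\<integral>\<^sup>+y. ennreal (heat_kernel a (x - y) * norm (x - y) powr 1) \<partial>lborel))"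
      using True unfolding near_def by (simp add: nn_integral_cmult nn_integral_add)
    also have "(\<integral>\<^sup>+y. ennreal (heat_kernel a (x - y) * norm (x - y) powr 1) \<partial>lborel) = (\<integral>\<^sup>+z. ennreal (heat_kernel a z * norm (z::'a) powr 1) \<partial>lborel)"
      by (rule nn_integral_lborel_reflect) measurable
    also have "ennreal (M * K * B) * (1 + ennreal (1 / a) * \<dots>) \<le> ennreal (M * K * B) * (1 + ennreal (1 / a) * ennreal (C * a powr (1 / 2)))"
      using C(2) True by (intro mult_left_mono add_left_mono) auto
    also have "ennreal (1 / a) * ennreal (C * a powr (1 / 2)) = ennreal C * ennreal (a powr (- 1 / 2))"
    proof -
      have "a powr (1 / 2) / a = a powr (- 1 / 2)"
        using powr_diff[of a "1 / 2" 1] True by simp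
      then show ?thesis using True C(1) by (simp add: ennreal_mult[symmetric] mult_ac)
    qed
    finally show ?thesis using True by (simp add: add.commute)
  qed (simp add: near_def)
  have "Err K 1 = (\<integral>\<^sup>+a. \<integral>\<^sup>+y. \<integral>\<^sup>+b. Err_dens K 1 b a y \<partial>lborel \<partial>lborel \<partial>lborel)"
    by (rule Err_eq(2)[OF K]) simp
  also have "\<dots> \<le> (\<integral>\<^sup>+a. \<integral>\<^sup>+y. near a y + ennreal Q * far a y \<partial>lborel \<partial>lborel)"
    by (intro nn_integral_mono pw)
  also have "\<dots> = (\<integral>\<^sup>+a. (\<integral>\<^sup>+y. near a y \<partial>lborel) + ennreal Q * (\<integral>\<^sup>+y. far a y \<partial>lborel) \<partial>lborel)"
    by (simp add: nn_integral_add nn_integral_cmult)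
  also have "\<dots> \<le> (\<integral>\<^sup>+a. ennreal (M * K * B) * (ennreal C * (ennreal (a powr (- 1 / 2)) * indicator {0<..<1} a) + indicator {0<..<1} a) + ennreal Q * (\<integral>\<^sup>+y. far a y \<partial>lborel) \<partial>lborel)"
    using near_int by (intro nn_integral_mono add_right_mono) auto
  also have "\<dots> = ennreal (M * K * B) * (ennreal C * ennreal 2 + 1) + ennreal Q * farmass x t"
  proof -
    have 1: "(\<integral>\<^sup>+a\<in>{0<..<1}. ennreal (a powr (- 1 / 2)) \<partial>lborel) = ennreal 2"
      using nn_integral_powr_0[of "- 1 / 2" 1] by simp
    have 2: "(\<integral>\<^sup>+a. indicator {0<..<1::real} a \<partial>lborel) = 1"
      by simp
    have 3: "(\<integral>\<^sup>+a. \<integral>\<^sup>+y. far a y \<partial>lborel \<partial>lborel) = farmass x t"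
      unfolding farmass_def far_def
      by (intro nn_integral_cong, subst nn_integral_multc) auto
    have 4: "(\<lambda>a. \<integral>\<^sup>+y. far a y \<partial>lborel) \<in> borel_measurable borel"
      using far_meas by (intro lborel.borel_measurable_nn_integral) (simp add: case_prod_beta' cong: measurable_cong_sets)
    show ?thesis
      using 1 2 3 4 by (simp add: nn_integral_add nn_integral_cmult del: nn_integral_indicator)
  qed
  also have "\<dots> < \<infinity>"
  proof -
    obtain F where F: "\<forall>x' t'. norm x' \<le> max (norm x) \<bar>t\<bar> \<longrightarrow> \<bar>t'\<bar> \<le> max (norm x) \<bar>t\<bar> \<longrightarrow> farmass x' t' \<le> ennreal F"
      using farmass_bounded[of "max (norm x) \<bar>t\<bar>"] by (auto simp: le_max_iff_disj)
    have "farmass x t \<le> ennreal F" by (rule F[rule_format]) auto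
    then have "farmass x t < \<infinity>" by (rule order_le_less_trans) simp
    then show ?thesis by (simp add: ennreal_mult_less_top)
  qed
  finally show ?thesis .
qed

text \<open>The integrand decreases in R through the commutator factor and tends to 0 pointwise; the
  case R = 1, finite by \<open>Err_finite\<close>, dominates.\<close>

lemma Err_tendsto:
  assumes K: "0 < K"
  shows "(\<lambda>n. Err K (real (Suc n))) \<longlonglongrightarrow> 0"
proof -
  let ?h = "\<lambda>n p. Err_dens K (real (Suc n)) (fst p) (fst (snd p)) (snd (snd p))"
  have m: "?h n \<in> borel_measurable lborel" for n
  proof -
    have "?h n \<in> borel_measurable (borel \<Otimes>\<^sub>M (borel \<Otimes>\<^sub>M borel))" by measurable
    then show ?thesis by (simp add: borel_prod)
  qed
  have le: "?h n p \<le> ?h 0 p" for n p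
  proof (cases "0 < fst p \<and> fst p < fst (snd p)")
    case True
    then have "K * (fst (snd p) - fst p) * (1 + norm (x - snd (snd p)) / fst (snd p)) / real (Suc n) \<le> K * (fst (snd p) - fst p) * (1 + norm (x - snd (snd p)) / fst (snd p)) / real (Suc 0)"
      using K by (intro divide_left_mono) auto
    then show ?thesis unfolding Err_dens_def
      by (intro mult_left_mono ennreal_leI ker_nonneg min.mono) auto
  qed (auto simp: Err_dens_def ker_def)
  have "(\<lambda>n. \<integral>\<^sup>+p. ?h n p \<partial>lborel) \<longlonglongrightarrow> (\<integral>\<^sup>+p. 0 \<partial>(lborel :: (real \<times> real \<times> 'a) measure))"
  proof (rule nn_integral_dominated_convergence[where w = "?h 0"])
    show "(\<integral>\<^sup>+p. ?h 0 p \<partial>lborel) < \<infinity>"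
      using Err_finite[OF K] Err_eq(1)[OF K, of 1] by simp
    show "AE p in lborel. (\<lambda>n. ?h n p) \<longlonglongrightarrow> 0"
    proof (rule AE_I2)
      fix p :: "real \<times> real \<times> 'a"
      let ?c = "K * (fst (snd p) - fst p) * (1 + norm (x - snd (snd p)) / fst (snd p))"
      have "(\<lambda>n. min 1 (?c * inverse (real (Suc n)))) \<longlonglongrightarrow> min 1 (?c * 0)"
        by (intro tendsto_intros LIMSEQ_inverse_real_of_nat)
      then have "(\<lambda>n. ennreal (ker 0 (fst p) (fst (snd p)) * min 1 (?c / real (Suc n)))) \<longlonglongrightarrow> ennreal (ker 0 (fst p) (fst (snd p)) * 0)"
        by (intro tendsto_ennrealI tendsto_mult tendsto_const) (simp add: divide_inverse)
      then have "(\<lambda>n. ?h n p) \<longlonglongrightarrow> ennreal (heat_kernel (fst (snd p)) (x - snd (snd p)) * u (snd (snd p), t - fst (snd p))) * ennreal (ker 0 (fst p) (fst (snd p)) * 0)"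
        unfolding Err_dens_def by (intro ennreal_tendsto_cmult) auto
      then show "(\<lambda>n. ?h n p) \<longlonglongrightarrow> 0" by simp
    qed
    show "?h 0 \<in> borel_measurable lborel" by (rule m)
    show "AE p in lborel. ?h n p \<le> ?h 0 p" for n by (intro AE_I2 le)
  qed (use m in auto)
  then show ?thesis using Err_eq(1)[OF K] by simp
qed

end

section \<open>An approximate identity from the truncated kernel\<close>

text \<open>This is the truncated operator, with lags above 1, acting on the power v^(s - 1)
  extended by 0 to v \<le> 0: the term v^(s - 1)/s comes from the identity, and (v - 1)^s/(s v) from
  the shifts, by \<open>nn_integral_beta_kernel\<close> with upper limit v - 1. It is the profile of
  the approximate identity \<open>md\<close>.\<close>

definition green_density :: "real \<Rightarrow> real \<Rightarrow> real" where
  "green_density s v = 1 / (s * v) * (v powr s - (max 0 (v - 1)) powr s)"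

text \<open>The constant c of the Green-Poisson formula. In closed form it is Gamma(s) |Gamma(-s)|,
  the product of the constants of the fractional integral and of the fractional derivative.\<close>

definition green_const :: "real \<Rightarrow> real" where
  "green_const s = enn2real (\<integral>\<^sup>+v\<in>{0<..}. ennreal (green_density s v) \<partial>lborel)"

lemma green_density_measurable [measurable]: "green_density s \<in> borel_measurable borel"
  unfolding green_density_def by measurable

lemma green_density_less: "0 < v \<Longrightarrow> v \<le> 1 \<Longrightarrow> green_density s v = 1 / s * v powr (s - 1)"
  by (simp add: green_density_def max_def powr_diff)

text \<open>Since s < 1, (1 - 1/v)^s \<ge> 1 - 1/v. The two powers nearly cancel, which gains one
  power of v and makes the density integrable at infinity.\<close>

lemma green_density_le:
  assumes "0 < s" "s < 1" "1 \<le> v"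
  shows "green_density s v \<le> 1 / s * v powr (s - 2)"
proof -
  have "(1 - 1 / v) powr 1 \<le> (1 - 1 / v) powr s"
  proof (cases "v = 1")
    case False
    then show ?thesis using assms by (intro powr_mono') auto
  qed simp
  then have "1 - (1 - 1 / v) powr s \<le> 1 / v" using assms by simp
  then have "v powr s * (1 - (1 - 1 / v) powr s) \<le> v powr s * (1 / v)"
    by (rule mult_left_mono) simp
  moreover have "(v - 1) powr s = v powr s * (1 - 1 / v) powr s"
  proof -
    have "v * (1 - 1 / v) = v - 1" using assms by (simp add: field_simps)
    then show ?thesis using powr_mult[of v "1 - 1 / v" s] by simp
  qed
  ultimately have "v powr s - (max 0 (v - 1)) powr s \<le> v powr s / v"
    using assms by (simp add: algebra_simps)
  then have "green_density s v \<le> 1 / (s * v) * (v powr s / v)"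
    unfolding green_density_def using assms by (intro mult_left_mono) auto
  also have "\<dots> = 1 / s * v powr (s - 2)"
    using assms by (simp add: powr_diff power2_eq_square)
  finally show ?thesis .
qed

lemma green_const:
  assumes s: "0 < s" "s < 1"
  shows "(\<integral>\<^sup>+v\<in>{0<..}. ennreal (green_density s v) \<partial>lborel) = ennreal (green_const s)" and "0 < green_const s"
proof -
  let ?I = "\<integral>\<^sup>+v\<in>{0<..}. ennreal (green_density s v) \<partial>lborel"
  have "?I \<le> (\<integral>\<^sup>+v. ennreal (1 / s) * (ennreal (v powr (s - 1)) * indicator {0<..<1} v) + ennreal (1 / s) * (ennreal (v powr (s - 2)) * indicator {1..} v) \<partial>lborel)"
  proof (rule nn_integral_mono)
    fix v :: real
    consider "v \<le> 0" | "0 < v" "v < 1" | "1 \<le> v" by linarith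
    then show "ennreal (green_density s v) * indicator {0<..} v \<le> ennreal (1 / s) * (ennreal (v powr (s - 1)) * indicator {0<..<1} v) + ennreal (1 / s) * (ennreal (v powr (s - 2)) * indicator {1..} v)"
    proof cases
      case 2
      then show ?thesis using s by (simp add: green_density_less ennreal_mult[symmetric])
    next
      case 3
      then have "ennreal (green_density s v) \<le> ennreal (1 / s * v powr (s - 2))"
        by (intro ennreal_leI green_density_le s)
      also have "\<dots> = ennreal (1 / s) * ennreal (v powr (s - 2))"
        using s by (intro ennreal_mult) auto
      finally show ?thesis using 3 by simp
    qed simp
  qed
  also have "\<dots> = ennreal (1 / s) * ennreal (1 / s) + ennreal (1 / s) * ennreal (1 / (1 - s))"
    using s nn_integral_powr_0[of "s - 1" 1] nn_integral_powr_inf[of "s - 2" 1]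
    by (simp add: nn_integral_add nn_integral_cmult)
  also have "\<dots> < \<infinity>" by (simp add: ennreal_mult_less_top)
  finally show 1: "?I = ennreal (green_const s)" by (simp add: green_const_def)
  have "ennreal (1 / s) * ennreal (1 / s) = (\<integral>\<^sup>+v. ennreal (1 / s) * (ennreal (v powr (s - 1)) * indicator {0<..<1} v) \<partial>lborel)"
    using s nn_integral_powr_0[of "s - 1" 1] by (simp add: nn_integral_cmult)
  also have "\<dots> \<le> ?I"
  proof (rule nn_integral_mono)
    fix v
    show "ennreal (1 / s) * (ennreal (v powr (s - 1)) * indicator {0<..<1} v) \<le> ennreal (green_density s v) * indicator {0<..} v"
      using s by (cases "0 < v \<and> v < 1") (auto simp: green_density_less ennreal_mult[symmetric])
  qed
  finally have "ennreal (1 / s * (1 / s)) \<le> ennreal (green_const s)"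
    using s unfolding 1 by (subst ennreal_mult) auto
  then have "1 / s * (1 / s) \<le> green_const s"
    by (subst (asm) ennreal_le_iff) (auto simp: green_const_def)
  moreover have "0 < 1 / s * (1 / s)" using s by simp
  ultimately show "0 < green_const s" by linarith
qed

context heat_fraction_at
begin

text \<open>\<open>ker\<close> with b integrated out, see \<open>ker_integral\<close>; the upper
  limit of b is min \<kappa> (a - \<delta>). For \<delta> = 0 and a > \<kappa> this is the Poisson
  kernel.\<close>

definition kf :: "real \<Rightarrow> real \<Rightarrow> real" where
  "kf \<delta> a = (if \<delta> < a then 1 / (s * a) * (min \<kappa> (a - \<delta>) / (a - min \<kappa> (a - \<delta>))) powr s else 0)"

text \<open>What remains of \<delta>^(-s) a^(s - 1)/s, the density of the identity term, when
  \<open>kf\<close> is subtracted below \<kappa>. It is \<open>green_density\<close> rescaled to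
  length \<delta> (\<open>md_scale\<close>) and thus concentrates at a = 0.\<close>

definition md :: "real \<Rightarrow> real \<Rightarrow> real" where
  "md \<delta> a = 1 / (s * a) * \<delta> powr (- s) * (a powr s - (max 0 (a - \<delta>)) powr s)"

lemma kf_measurable [measurable]: "kf \<delta> \<in> borel_measurable borel"
  unfolding kf_def by measurable

lemma md_measurable [measurable]: "md \<delta> \<in> borel_measurable borel"
  unfolding md_def by measurable

lemma kf_nonneg: "0 \<le> \<delta> \<Longrightarrow> 0 \<le> kf \<delta> a"
  using s_pos by (simp add: kf_def)

lemma md_nonneg: "0 < \<delta> \<Longrightarrow> 0 < a \<Longrightarrow> 0 \<le> md \<delta> a"
  unfolding md_def using s_pos by (intro mult_nonneg_nonneg) (auto intro!: powr_mono2)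

lemma ker_integral:
  assumes "0 \<le> \<delta>" "0 < \<delta> \<or> \<kappa> < a"
  shows "(\<integral>\<^sup>+b. ennreal (ker \<delta> b a) \<partial>lborel) = ennreal (kf \<delta> a)"
proof (cases "\<delta> < a")
  case True
  define \<beta> where "\<beta> = min \<kappa> (a - \<delta>)"
  have \<beta>: "0 < \<beta>" "\<beta> < a" using assms True kappa by (auto simp: \<beta>_def)
  have "(\<integral>\<^sup>+b. ennreal (ker \<delta> b a) \<partial>lborel) = (\<integral>\<^sup>+b\<in>{0<..<\<beta>}. ennreal (b powr (s - 1) * (a - b) powr (- 1 - s)) \<partial>lborel)"
    by (intro nn_integral_cong) (auto simp: ker_def indicator_def \<beta>_def)
  also have "\<dots> = ennreal (kf \<delta> a)"
    unfolding nn_integral_beta_kernel[OF s_pos \<beta>] kf_def \<beta>_def[symmetric] using True by simp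
  finally show ?thesis .
next
  case False
  then have "ker \<delta> b a = 0" for b by (auto simp: ker_def)
  then show ?thesis using False by (simp add: kf_def)
qed

text \<open>For \<delta> < a < \<kappa> the upper limit in \<open>kf\<close> is a - \<delta>, so
  that \<open>kf\<close> is exactly the term subtracted in \<open>md\<close>; for a \<le> \<delta>
  both vanish. This is the algebraic cancellation of the divergent parts.\<close>

lemma md_add_kf:
  assumes "0 < \<delta>" "0 < a" "a < \<kappa>"
  shows "\<delta> powr (- s) / s * a powr (s - 1) = md \<delta> a + kf \<delta> a"
proof (cases "\<delta> < a")
  case True
  have "kf \<delta> a = 1 / (s * a) * (\<delta> powr (- s) * (a - \<delta>) powr s)"
  proof -
    have "kf \<delta> a = 1 / (s * a) * ((a - \<delta>) / \<delta>) powr s"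
      using True assms by (simp add: kf_def)
    also have "((a - \<delta>) / \<delta>) powr s = \<delta> powr (- s) * (a - \<delta>) powr s"
      unfolding powr_divide powr_minus by (simp add: divide_inverse mult.commute)
    finally show ?thesis .
  qed
  then have "md \<delta> a + kf \<delta> a = 1 / (s * a) * \<delta> powr (- s) * a powr s"
    using True by (simp add: md_def algebra_simps)
  also have "\<dots> = \<delta> powr (- s) / s * a powr (s - 1)"
    using assms by (simp add: powr_diff)
  finally show ?thesis by simp
next
  case False
  then show ?thesis using assms s_pos by (simp add: kf_def md_def powr_diff)
qed

lemma md_scale:
  assumes "0 < \<delta>" "0 < v"
  shows "\<delta> * md \<delta> (\<delta> * v) = green_density s v"
proof -
  have "max 0 (\<delta> * v - \<delta>) = \<delta> * max 0 (v - 1)"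
    using assms by (simp add: max_def algebra_simps)
  then have "md \<delta> (\<delta> * v) = 1 / (s * (\<delta> * v)) * (\<delta> powr (- s) * \<delta> powr s) * (v powr s - (max 0 (v - 1)) powr s)"
  proof -
    have "(\<delta> * v) powr s - (\<delta> * max 0 (v - 1)) powr s = \<delta> powr s * (v powr s - (max 0 (v - 1)) powr s)"
      by (simp only: powr_mult right_diff_distrib)
    then show ?thesis unfolding md_def \<open>max 0 (\<delta> * v - \<delta>) = _\<close> by (simp only: mult.assoc)
  qed
  then show ?thesis using assms by (simp add: green_density_def powr_add[symmetric])
qed

lemma cutoff_u_bounded:
  "\<exists>M\<ge>0. \<forall>a y. 0 < a \<longrightarrow> a < \<kappa> \<longrightarrow> norm (y - x) < R \<longrightarrow> u (y, t - a) \<le> M"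
proof -
  obtain M where M: "M \<ge> 0" "\<forall>x' t'. norm x' \<le> norm x + \<bar>R\<bar> + \<bar>t\<bar> + \<kappa> \<longrightarrow> \<bar>t'\<bar> \<le> norm x + \<bar>R\<bar> + \<bar>t\<bar> + \<kappa> \<longrightarrow> u (x', t') \<le> M"
    using u_bounded by blast
  have "u (y, t - a) \<le> M" if "0 < a" "a < \<kappa>" "norm (y - x) < R" for a y
  proof (rule M(2)[rule_format])
    have "norm y \<le> norm x + norm (y - x)" by norm
    then show "norm y \<le> norm x + \<bar>R\<bar> + \<bar>t\<bar> + \<kappa>" using that kappa by linarith
    show "\<bar>t - a\<bar> \<le> norm x + \<bar>R\<bar> + \<bar>t\<bar> + \<kappa>" using that kappa norm_ge_zero[of x] by linarith
  qed
  then show ?thesis using M(1) by blast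
qed

lemma Phi_bounded:
  assumes "1 \<le> R"
  shows "\<exists>M\<ge>0. \<forall>a. 0 < a \<longrightarrow> a < \<kappa> \<longrightarrow> Phi R a \<le> ennreal M"
proof -
  obtain M where M: "M \<ge> 0" "\<And>a y. 0 < a \<Longrightarrow> a < \<kappa> \<Longrightarrow> norm (y - x) < R \<Longrightarrow> u (y, t - a) \<le> M"
    using cutoff_u_bounded by blast
  have "Phi R a \<le> ennreal M" if a: "0 < a" "a < \<kappa>" for a
  proof -
    have "Phi R a \<le> (\<integral>\<^sup>+y. ennreal M * ennreal (heat_kernel a (x - y)) \<partial>lborel)"
      unfolding Phi_def
    proof (rule nn_integral_mono)
      fix y
      have "cutoff R (y - x) * u (y, t - a) \<le> M"
      proof (cases "norm (y - x) < R")
        case True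
        have "cutoff R (y - x) * u (y, t - a) \<le> 1 * u (y, t - a)"
          using cutoff_bounds u_nonneg by (intro mult_right_mono) auto
        then show ?thesis using M(2)[OF a True] by simp
      next
        case False
        then show ?thesis using M(1) assms by (simp add: cutoff_outside)
      qed
      then have "heat_kernel a (x - y) * (cutoff R (y - x) * u (y, t - a)) \<le> heat_kernel a (x - y) * M"
        by (rule mult_left_mono) simp
      then show "ennreal (heat_kernel a (x - y) * cutoff R (y - x) * u (y, t - a)) \<le> ennreal M * ennreal (heat_kernel a (x - y))"
        using M(1) by (subst ennreal_mult[symmetric]) (auto intro!: ennreal_leI simp: mult_ac)
    qed
    also have "\<dots> = ennreal M" using a by (simp add: nn_integral_cmult)
    finally show ?thesis .
  qed
  then show ?thesis using M(1) by blast
qed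

text \<open>Rescaling y - x by sqrt a freezes the Gaussian, so that the limit a \<rightarrow> 0
  becomes a pointwise limit under one fixed weight.\<close>

lemma Phi_scaled:
  assumes "0 < a"
  shows "Phi R a = (\<integral>\<^sup>+z. ennreal (heat_kernel 1 z * (cutoff R (sqrt a *\<^sub>R z) * u (x + sqrt a *\<^sub>R z, t - a))) \<partial>lborel)"
proof -
  have k: "sqrt a ^ DIM('a) * heat_kernel a (sqrt a *\<^sub>R z) = heat_kernel 1 z" for z :: 'a
  proof -
    have "sqrt a ^ DIM('a) = a powr (real DIM('a) / 2)"
      using assms by (simp add: powr_half_sqrt[symmetric] powr_powr powr_realpow[symmetric])
    then have "sqrt a ^ DIM('a) * (4 * pi * a) powr (- (real DIM('a) / 2)) = (4 * pi) powr (- (real DIM('a) / 2)) * (a powr (real DIM('a) / 2) * a powr (- (real DIM('a) / 2)))"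
      by (simp add: powr_mult)
    also have "a powr (real DIM('a) / 2) * a powr (- (real DIM('a) / 2)) = 1"
      using assms by (simp add: powr_add[symmetric])
    finally show ?thesis
      using assms unfolding heat_kernel_def by (simp add: power_mult_distrib mult.assoc[symmetric])
  qed
  have "Phi R a = ennreal (\<bar>sqrt a\<bar> ^ DIM('a)) * (\<integral>\<^sup>+z. ennreal (heat_kernel a (x - (x + sqrt a *\<^sub>R z)) * cutoff R (x + sqrt a *\<^sub>R z - x) * u (x + sqrt a *\<^sub>R z, t - a)) \<partial>lborel)"
    unfolding Phi_def using assms by (intro nn_integral_lborel_affine) auto
  also have "\<dots> = (\<integral>\<^sup>+z. ennreal (\<bar>sqrt a\<bar> ^ DIM('a)) * ennreal (heat_kernel a (x - (x + sqrt a *\<^sub>R z)) * cutoff R (x + sqrt a *\<^sub>R z - x) * u (x + sqrt a *\<^sub>R z, t - a)) \<partial>lborel)"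
    by (rule nn_integral_cmult[symmetric]) measurable
  also have "\<dots> = (\<integral>\<^sup>+z. ennreal (heat_kernel 1 z * (cutoff R (sqrt a *\<^sub>R z) * u (x + sqrt a *\<^sub>R z, t - a))) \<partial>lborel)"
    using assms u_nonneg
    by (intro nn_integral_cong) (simp add: ennreal_mult'[symmetric] cutoff_bounds k[symmetric] mult_ac)
  finally show ?thesis .
qed

lemma Phi_tendsto:
  assumes R: "1 \<le> R" and a: "\<And>n. 0 < a n" "a \<longlonglongrightarrow> 0"
  shows "(\<lambda>n. Phi R (a n)) \<longlonglongrightarrow> ennreal (u (x, t))"
proof -
  obtain M where M: "M \<ge> 0" "\<And>a y. 0 < a \<Longrightarrow> a < \<kappa> \<Longrightarrow> norm (y - x) < R \<Longrightarrow> u (y, t - a) \<le> M"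
    using cutoff_u_bounded by blast
  obtain N where N: "\<And>n. N \<le> n \<Longrightarrow> a n < \<kappa>"
    using order_tendstoD(2)[OF a(2) kappa] by (auto simp: eventually_sequentially)
  define g where "g = (\<lambda>n (z::'a). ennreal (heat_kernel 1 z * (cutoff R (sqrt (a (n + N)) *\<^sub>R z) * u (x + sqrt (a (n + N)) *\<^sub>R z, t - a (n + N)))))"
  have "(\<lambda>n. \<integral>\<^sup>+z. g n z \<partial>lborel) \<longlonglongrightarrow> (\<integral>\<^sup>+z. ennreal (heat_kernel 1 (z::'a) * u (x, t)) \<partial>lborel)"
  proof (rule nn_integral_dominated_convergence[where w = "\<lambda>z. ennreal (M * heat_kernel 1 z)"])
    show "(\<integral>\<^sup>+z. ennreal (M * heat_kernel 1 (z::'a)) \<partial>lborel) < \<infinity>"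
      using M(1) by (simp add: ennreal_mult nn_integral_cmult)
    show "AE z in lborel. g n z \<le> ennreal (M * heat_kernel 1 z)" for n
    proof (rule AE_I2)
      fix z :: 'a
      have an: "0 < a (n + N)" "a (n + N) < \<kappa>" using a(1) N by auto
      have "cutoff R (sqrt (a (n + N)) *\<^sub>R z) * u (x + sqrt (a (n + N)) *\<^sub>R z, t - a (n + N)) \<le> M"
      proof (cases "norm (sqrt (a (n + N)) *\<^sub>R z) < R")
        case True
        have "cutoff R (sqrt (a (n + N)) *\<^sub>R z) * u (x + sqrt (a (n + N)) *\<^sub>R z, t - a (n + N)) \<le> 1 * u (x + sqrt (a (n + N)) *\<^sub>R z, t - a (n + N))"
          using cutoff_bounds u_nonneg by (intro mult_right_mono) auto
        then show ?thesis using M(2)[OF an, of "x + sqrt (a (n + N)) *\<^sub>R z"] True by simp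
      next
        case False
        then show ?thesis using M(1) R cutoff_outside[of R "sqrt (a (n + N)) *\<^sub>R z"] by simp
      qed
      then show "g n z \<le> ennreal (M * heat_kernel 1 z)"
        unfolding g_def by (subst mult.commute[of M]) (intro ennreal_leI mult_left_mono, auto)
    qed
    show "AE z in lborel. (\<lambda>n. g n z) \<longlonglongrightarrow> ennreal (heat_kernel 1 z * u (x, t))"
    proof (rule AE_I2)
      fix z :: 'a
      have lim: "(\<lambda>n. a (n + N)) \<longlonglongrightarrow> 0" using a(2) by (rule LIMSEQ_ignore_initial_segment)
      have sq: "(\<lambda>n. sqrt (a (n + N))) \<longlonglongrightarrow> 0" using tendsto_real_sqrt[OF lim] by simp
      have z: "(\<lambda>n. sqrt (a (n + N)) *\<^sub>R z) \<longlonglongrightarrow> 0" using tendsto_scaleR[OF sq tendsto_const[of z]] by simp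
      have "(\<lambda>n. (x + sqrt (a (n + N)) *\<^sub>R z, t - a (n + N))) \<longlonglongrightarrow> (x + 0, t - 0)"
        by (intro tendsto_intros z lim)
      then have ul: "(\<lambda>n. u (x + sqrt (a (n + N)) *\<^sub>R z, t - a (n + N))) \<longlonglongrightarrow> u (x + 0, t - 0)"
        using u_cont by (intro isCont_tendsto_compose[of _ u]) (auto simp: continuous_on_eq_continuous_at)
      have "(\<lambda>n. (max 0 (1 - (norm (sqrt (a (n + N)) *\<^sub>R z))\<^sup>2 / R\<^sup>2))\<^sup>2) \<longlonglongrightarrow> (max 0 (1 - (norm (0::'a))\<^sup>2 / R\<^sup>2))\<^sup>2"
        using R by (intro tendsto_intros z) auto
      then have cl: "(\<lambda>n. cutoff R (sqrt (a (n + N)) *\<^sub>R z)) \<longlonglongrightarrow> 1" by (simp add: cutoff_eq)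
      have "(\<lambda>n. g n z) \<longlonglongrightarrow> ennreal (heat_kernel 1 z * (1 * u (x + 0, t - 0)))"
        unfolding g_def by (intro tendsto_ennrealI tendsto_mult tendsto_const cl ul)
      then show "(\<lambda>n. g n z) \<longlonglongrightarrow> ennreal (heat_kernel 1 z * u (x, t))" by simp
    qed
  qed (auto simp: g_def)
  moreover have "(\<integral>\<^sup>+z. g n z \<partial>lborel) = Phi R (a (n + N))" for n
    unfolding g_def using a(1) by (simp add: Phi_scaled)
  moreover have "(\<integral>\<^sup>+z. ennreal (heat_kernel 1 (z::'a) * u (x, t)) \<partial>lborel) = ennreal (u (x, t))"
    using u_nonneg by (simp add: ennreal_mult nn_integral_multc)
  ultimately have "(\<lambda>n. Phi R (a (n + N))) \<longlonglongrightarrow> ennreal (u (x, t))" by simp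
  then show ?thesis by (rule LIMSEQ_offset)
qed

text \<open>After the substitution a = \<delta> v the weight is the fixed integrable
  \<open>green_density\<close>, while \<open>Phi R (\<delta> * v)\<close> tends to u(x, t) and is
  bounded as long as \<delta> v < \<kappa>; dominated convergence applies.\<close>

lemma X_tendsto:
  assumes R: "1 \<le> R" and \<delta>: "\<And>n. 0 < \<delta> n" "\<delta> \<longlonglongrightarrow> 0"
  shows "(\<lambda>n. \<integral>\<^sup>+a\<in>{0<..<\<kappa>}. ennreal (md (\<delta> n) a) * Phi R a \<partial>lborel) \<longlonglongrightarrow> ennreal (green_const s * u (x, t))"
proof -
  obtain M where M: "M \<ge> 0" "\<And>a. 0 < a \<Longrightarrow> a < \<kappa> \<Longrightarrow> Phi R a \<le> ennreal M"
    using Phi_bounded[OF R] by blast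
  define g where "g = (\<lambda>n v. ennreal (green_density s v) * Phi R (\<delta> n * v) * indicator {v. 0 < v \<and> \<delta> n * v < \<kappa>} v)"
  have eq: "(\<integral>\<^sup>+a\<in>{0<..<\<kappa>}. ennreal (md (\<delta> n) a) * Phi R a \<partial>lborel) = (\<integral>\<^sup>+v. g n v \<partial>lborel)" for n
  proof -
    have "(\<integral>\<^sup>+a\<in>{0<..<\<kappa>}. ennreal (md (\<delta> n) a) * Phi R a \<partial>lborel)
      = ennreal (\<bar>\<delta> n\<bar> ^ DIM(real)) * (\<integral>\<^sup>+v. ennreal (md (\<delta> n) (0 + \<delta> n *\<^sub>R v)) * Phi R (0 + \<delta> n *\<^sub>R v) * indicator {0<..<\<kappa>} (0 + \<delta> n *\<^sub>R v) \<partial>lborel)"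
      by (rule nn_integral_lborel_affine) (use \<delta>(1)[of n] in auto)
    also have "\<dots> = (\<integral>\<^sup>+v. ennreal (\<delta> n) * (ennreal (md (\<delta> n) (\<delta> n * v)) * Phi R (\<delta> n * v) * indicator {0<..<\<kappa>} (\<delta> n * v)) \<partial>lborel)"
      using \<delta>(1)[of n] by (subst nn_integral_cmult[symmetric]) auto
    also have "\<dots> = (\<integral>\<^sup>+v. g n v \<partial>lborel)"
    proof (rule nn_integral_cong)
      fix v
      show "ennreal (\<delta> n) * (ennreal (md (\<delta> n) (\<delta> n * v)) * Phi R (\<delta> n * v) * indicator {0<..<\<kappa>} (\<delta> n * v)) = g n v"
      proof (cases "0 < v \<and> \<delta> n * v < \<kappa>")
        case True
        then have "ennreal (green_density s v) = ennreal (\<delta> n) * ennreal (md (\<delta> n) (\<delta> n * v))"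
          using \<delta>(1)[of n] md_nonneg[of "\<delta> n" "\<delta> n * v"] by (subst md_scale[symmetric, of "\<delta> n"]) (auto simp: ennreal_mult)
        then show ?thesis using True \<delta>(1)[of n] by (simp add: g_def mult.assoc)
      next
        case False
        then have "\<not> (0 < \<delta> n * v \<and> \<delta> n * v < \<kappa>)" using \<delta>(1)[of n] by (auto simp: zero_less_mult_iff)
        then show ?thesis using False by (auto simp: g_def)
      qed
    qed
    finally show ?thesis .
  qed
  have [measurable]: "g n \<in> borel_measurable borel" for n unfolding g_def by measurable
  have "(\<lambda>n. \<integral>\<^sup>+v. g n v \<partial>lborel) \<longlonglongrightarrow> (\<integral>\<^sup>+v. ennreal (u (x, t)) * (ennreal (green_density s v) * indicator {0<..} v) \<partial>lborel)"
  proof (rule nn_integral_dominated_convergence[where w = "\<lambda>v. ennreal M * (ennreal (green_density s v) * indicator {0<..} v)"])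
    show "(\<integral>\<^sup>+v. ennreal M * (ennreal (green_density s v) * indicator {0<..} v) \<partial>lborel) < \<infinity>"
      by (subst nn_integral_cmult) (auto simp: green_const(1)[OF s_pos s_less] ennreal_mult_less_top)
    show "AE v in lborel. g n v \<le> ennreal M * (ennreal (green_density s v) * indicator {0<..} v)" for n
    proof (rule AE_I2)
      fix v
      show "g n v \<le> ennreal M * (ennreal (green_density s v) * indicator {0<..} v)"
      proof (cases "0 < v \<and> \<delta> n * v < \<kappa>")
        case True
        then have "Phi R (\<delta> n * v) \<le> ennreal M" using \<delta>(1)[of n] by (intro M(2)) auto
        then have "ennreal (green_density s v) * Phi R (\<delta> n * v) \<le> ennreal (green_density s v) * ennreal M"
          by (rule mult_left_mono) simp
        then show ?thesis using True by (simp add: g_def mult.commute)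
      qed (simp add: g_def)
    qed
    show "AE v in lborel. (\<lambda>n. g n v) \<longlonglongrightarrow> ennreal (u (x, t)) * (ennreal (green_density s v) * indicator {0<..} v)"
    proof (rule AE_I2)
      fix v
      show "(\<lambda>n. g n v) \<longlonglongrightarrow> ennreal (u (x, t)) * (ennreal (green_density s v) * indicator {0<..} v)"
      proof (cases "0 < v")
        case True
        have l: "(\<lambda>n. \<delta> n * v) \<longlonglongrightarrow> 0" using tendsto_mult[OF \<delta>(2) tendsto_const[of v]] by simp
        have "(\<lambda>n. ennreal (green_density s v) * Phi R (\<delta> n * v)) \<longlonglongrightarrow> ennreal (green_density s v) * ennreal (u (x, t))"
          by (intro ennreal_tendsto_cmult Phi_tendsto R l) (use True \<delta>(1) in auto)
        moreover have "eventually (\<lambda>n. ennreal (green_density s v) * Phi R (\<delta> n * v) = g n v) sequentially"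
          using order_tendstoD(2)[OF l kappa] by eventually_elim (use True in \<open>simp add: g_def\<close>)
        ultimately have "(\<lambda>n. g n v) \<longlonglongrightarrow> ennreal (green_density s v) * ennreal (u (x, t))"
          by (rule Lim_transform_eventually)
        then show ?thesis using True by (simp add: mult.commute)
      qed (simp add: g_def)
    qed
  qed auto
  also have "(\<integral>\<^sup>+v. ennreal (u (x, t)) * (ennreal (green_density s v) * indicator {0<..} v) \<partial>lborel) = ennreal (u (x, t)) * ennreal (green_const s)"
    by (subst nn_integral_cmult) (auto simp: green_const(1)[OF s_pos s_less])
  also have "\<dots> = ennreal (green_const s * u (x, t))"
    using u_nonneg green_const(2)[OF s_pos s_less] by (subst ennreal_mult[symmetric]) (auto simp: mult.commute)
  finally show ?thesis unfolding eq .
qed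

text \<open>As \<delta> decreases the range of b in \<open>kf\<close> grows, and for each a >
  \<kappa> it is eventually all of b < \<kappa>. Monotone convergence is the right tool since the
  limit is not yet known to be finite.\<close>

lemma Y_tendsto:
  "(\<lambda>n. \<integral>\<^sup>+a\<in>{\<kappa><..}. ennreal (kf (inverse (real (Suc n))) a) * Phi R a \<partial>lborel)
     \<longlonglongrightarrow> (\<integral>\<^sup>+a\<in>{\<kappa><..}. ennreal (kf 0 a) * Phi R a \<partial>lborel)"
proof (rule nn_integral_LIMSEQ)
  let ?d = "\<lambda>n. inverse (real (Suc n))"
  have mono: "kf d a \<le> kf d' a" if "0 < d'" "d' \<le> d" "\<kappa> < a" for d d' a
  proof (cases "d < a")
    case True
    let ?p = "min \<kappa> (a - d)" and ?q = "min \<kappa> (a - d')"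
    have pq: "0 < ?p" "?p \<le> ?q" "?q < a" using True that kappa by auto
    then have "?p / (a - ?p) \<le> ?q / (a - ?q)" by (intro frac_le) auto
    then have "(?p / (a - ?p)) powr s \<le> (?q / (a - ?q)) powr s"
      using pq s_pos by (intro powr_mono2) auto
    then have "1 / (s * a) * (?p / (a - ?p)) powr s \<le> 1 / (s * a) * (?q / (a - ?q)) powr s"
      using s_pos that kappa by (intro mult_left_mono) auto
    then show ?thesis using True that by (simp add: kf_def)
  next
    case False
    then show ?thesis using kf_nonneg[of d' a] that by (simp add: kf_def)
  qed
  show "incseq (\<lambda>n a. ennreal (kf (?d n) a) * Phi R a * indicator {\<kappa><..} a)"
  proof (intro incseq_SucI le_funI)
    fix n a
    show "ennreal (kf (?d n) a) * Phi R a * indicator {\<kappa><..} a \<le> ennreal (kf (?d (Suc n)) a) * Phi R a * indicator {\<kappa><..} a"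
    proof (cases "\<kappa> < a")
      case True
      then have "kf (?d n) a \<le> kf (?d (Suc n)) a" by (intro mono) auto
      then show ?thesis by (intro mult_right_mono ennreal_leI) auto
    qed simp
  qed
  show "(\<lambda>n. ennreal (kf (?d n) a) * Phi R a * indicator {\<kappa><..} a) \<longlonglongrightarrow> ennreal (kf 0 a) * Phi R a * indicator {\<kappa><..} a" for a
  proof (cases "\<kappa> < a")
    case True
    have "eventually (\<lambda>n. ?d n < a - \<kappa>) sequentially"
      using True by (intro order_tendstoD(2)[OF LIMSEQ_inverse_real_of_nat]) simp
    then have "eventually (\<lambda>n. ennreal (kf (?d n) a) * Phi R a * indicator {\<kappa><..} a = ennreal (kf 0 a) * Phi R a * indicator {\<kappa><..} a) sequentially"
    proof eventually_elim
      case (elim n)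
      then have "min \<kappa> (a - ?d n) = \<kappa>" "?d n < a" using kappa by auto
      then have "kf (?d n) a = kf 0 a" using True kappa by (simp add: kf_def)
      then show ?case by simp
    qed
    then show ?thesis by (rule tendsto_eventually)
  qed simp
qed measurable

end

subsection \<open>Representation of the solution\<close>

context heat_fraction_at
begin

definition UW :: "real \<Rightarrow> ennreal" where
  "UW R = (\<integral>\<^sup>+b. \<integral>\<^sup>+y. ennreal (W R b y) * ennreal (u (y, t - b)) \<partial>lborel \<partial>lborel)"

definition BV :: "real \<Rightarrow> real \<Rightarrow> ennreal" where
  "BV \<delta> R = (\<integral>\<^sup>+b. \<integral>\<^sup>+y. ennreal (W R b y) * S \<delta> y (t - b) \<partial>lborel \<partial>lborel)"

text \<open>The fractional integral of the truncated operator, with cutoff. By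
  \<open>L_split\<close> it is the difference of \<open>UW\<close>, multiplied by \<delta>^(-s)/s,
  and \<open>BV\<close>.\<close>

definition G :: "real \<Rightarrow> real \<Rightarrow> real" where
  "G \<delta> R = (\<integral>p. W R (fst p) (snd p) * L \<delta> (snd p) (t - fst p) \<partial>lborel)"

lemma W_support: "W R b y \<noteq> 0 \<Longrightarrow> 1 \<le> R \<Longrightarrow> 0 < b \<and> b < \<kappa> \<and> norm (y - x) < R"
  using cutoff_outside[of R "y - x"] by (auto simp: W_def not_less split: if_splits) (meson not_less)

lemma W_support_bounds:
  assumes "W R b y \<noteq> 0" "1 \<le> R"
  shows "norm y \<le> norm x + R + \<bar>t\<bar> + \<kappa>" "\<bar>t - b\<bar> \<le> norm x + R + \<bar>t\<bar> + \<kappa>"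
proof -
  have w: "0 < b" "b < \<kappa>" "norm (y - x) < R" using W_support[OF assms] by auto
  have "norm y \<le> norm x + norm (y - x)" by norm
  then show "norm y \<le> norm x + R + \<bar>t\<bar> + \<kappa>" using w by linarith
  show "\<bar>t - b\<bar> \<le> norm x + R + \<bar>t\<bar> + \<kappa>" using w assms norm_ge_zero[of x] by linarith
qed

lemma W_total: "(\<integral>\<^sup>+b. \<integral>\<^sup>+y. ennreal (W R b y) \<partial>lborel \<partial>lborel) \<le> ennreal (\<kappa> powr s / s)"
proof -
  have "(\<integral>\<^sup>+b. \<integral>\<^sup>+y. ennreal (W R b y) \<partial>lborel \<partial>lborel) \<le> (\<integral>\<^sup>+b. ennreal (b powr (s - 1)) * indicator {0<..<\<kappa>} b \<partial>lborel)"
  proof (rule nn_integral_mono)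
    fix b :: real
    show "(\<integral>\<^sup>+y. ennreal (W R b y) \<partial>lborel) \<le> ennreal (b powr (s - 1)) * indicator {0<..<\<kappa>} b"
    proof (cases "0 < b \<and> b < \<kappa>")
      case True
      have "(\<integral>\<^sup>+y. ennreal (W R b y) \<partial>lborel) \<le> (\<integral>\<^sup>+y. ennreal (b powr (s - 1)) * ennreal (heat_kernel b (x - y)) \<partial>lborel)"
      proof (rule nn_integral_mono)
        fix y
        have "b powr (s - 1) * heat_kernel b (x - y) * cutoff R (y - x) \<le> b powr (s - 1) * heat_kernel b (x - y) * 1"
          by (intro mult_left_mono cutoff_bounds) simp
        then show "ennreal (W R b y) \<le> ennreal (b powr (s - 1)) * ennreal (heat_kernel b (x - y))"
          using True by (simp add: W_def ennreal_mult[symmetric] ennreal_leI)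
      qed
      also have "\<dots> = ennreal (b powr (s - 1))" using True by (simp add: nn_integral_cmult)
      finally show ?thesis using True by simp
    next
      case False
      then have "W R b y = 0" for y by (auto simp: W_def)
      then show ?thesis by simp
    qed
  qed
  also have "\<dots> = ennreal (\<kappa> powr s / s)"
    using nn_integral_powr_0[of "s - 1" \<kappa>] s_pos kappa by simp
  finally show ?thesis .
qed

lemma lborel_pair_measurable:
  "g \<in> borel_measurable (lborel \<Otimes>\<^sub>M lborel) \<Longrightarrow> g \<in> borel_measurable (lborel :: ('b::euclidean_space \<times> 'c::euclidean_space) measure)"
  by (simp add: lborel_prod)

lemma W_bounded_integral:
  fixes g :: "'a \<Rightarrow> real \<Rightarrow> ennreal"
  assumes R: "1 \<le> R" and B: "0 \<le> B"
    and le: "\<And>y \<tau>. norm y \<le> norm x + R + \<bar>t\<bar> + \<kappa> \<Longrightarrow> \<bar>\<tau>\<bar> \<le> norm x + R + \<bar>t\<bar> + \<kappa> \<Longrightarrow> g y \<tau> \<le> ennreal B"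
  shows "(\<integral>\<^sup>+b. \<integral>\<^sup>+y. ennreal (W R b y) * g y (t - b) \<partial>lborel \<partial>lborel) < \<infinity>"
proof -
  have "(\<integral>\<^sup>+b. \<integral>\<^sup>+y. ennreal (W R b y) * g y (t - b) \<partial>lborel \<partial>lborel) \<le> (\<integral>\<^sup>+b. \<integral>\<^sup>+y. ennreal B * ennreal (W R b y) \<partial>lborel \<partial>lborel)"
  proof (intro nn_integral_mono)
    fix b y
    show "ennreal (W R b y) * g y (t - b) \<le> ennreal B * ennreal (W R b y)"
    proof (cases "W R b y = 0")
      case False
      then have "g y (t - b) \<le> ennreal B" by (intro le W_support_bounds R)
      then show ?thesis by (subst mult.commute) (rule mult_right_mono, auto)
    qed simp
  qed
  also have "\<dots> = ennreal B * (\<integral>\<^sup>+b. \<integral>\<^sup>+y. ennreal (W R b y) \<partial>lborel \<partial>lborel)"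
    by (simp add: nn_integral_cmult)
  also have "\<dots> \<le> ennreal B * ennreal (\<kappa> powr s / s)"
    by (intro mult_left_mono W_total) simp
  also have "\<dots> < \<infinity>" by (simp add: ennreal_mult_less_top)
  finally show ?thesis .
qed

lemma UW_finite:
  assumes "1 \<le> R"
  shows "UW R < \<infinity>"
proof -
  obtain M where "M \<ge> 0" "\<forall>x' t'. norm x' \<le> norm x + R + \<bar>t\<bar> + \<kappa> \<longrightarrow> \<bar>t'\<bar> \<le> norm x + R + \<bar>t\<bar> + \<kappa> \<longrightarrow> u (x', t') \<le> M"
    using u_bounded by blast
  then show ?thesis
    unfolding UW_def by (intro W_bounded_integral[where g = "\<lambda>y \<tau>. ennreal (u (y, \<tau>))", OF assms]) (auto intro: ennreal_leI)
qed

lemma BV_finite: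
  assumes "1 \<le> R" "0 < \<delta>"
  shows "BV \<delta> R < \<infinity>"
proof -
  have "0 \<le> norm x + R + \<bar>t\<bar> + \<kappa>" using assms kappa by simp
  then obtain M where "M \<ge> 0" "\<forall>x' t'. norm x' \<le> norm x + R + \<bar>t\<bar> + \<kappa> \<longrightarrow> \<bar>t'\<bar> \<le> norm x + R + \<bar>t\<bar> + \<kappa> \<longrightarrow> S \<delta> x' t' \<le> ennreal M"
    using hN_trunc_bounded[of _ \<delta>] assms unfolding S_def by meson
  then show ?thesis
    unfolding BV_def by (intro W_bounded_integral[where g = "S \<delta>", OF assms(1)]) auto
qed

lemma G_eq:
  assumes R: "1 \<le> R" and \<delta>: "0 < \<delta>"
  shows "G \<delta> R = \<delta> powr (- s) / s * enn2real (UW R) - enn2real (BV \<delta> R)"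
proof -
  let ?g1 = "\<lambda>p. W R (fst p) (snd p) * u (snd p, t - fst p)"
  let ?g2 = "\<lambda>p. W R (fst p) (snd p) * enn2real (S \<delta> (snd p) (t - fst p))"
  have m1: "?g1 \<in> borel_measurable lborel" by (rule lborel_pair_measurable) measurable
  have m2: "?g2 \<in> borel_measurable lborel" by (rule lborel_pair_measurable) measurable
  have n1: "(\<integral>\<^sup>+p. ennreal (?g1 p) \<partial>lborel) = UW R"
    unfolding UW_def by (subst nn_integral_lborel_pair) (auto simp: ennreal_mult W_nonneg u_nonneg)
  have n2: "(\<integral>\<^sup>+p. ennreal (?g2 p) \<partial>lborel) = BV \<delta> R"
    unfolding BV_def using S_finite[OF \<delta>] by (subst nn_integral_lborel_pair) (auto simp: ennreal_mult W_nonneg)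
  have i1: "integrable lborel ?g1" using n1 UW_finite[OF R] m1 by (intro integrableI_nonneg) (auto simp: W_nonneg u_nonneg)
  have i2: "integrable lborel ?g2" using n2 BV_finite[OF R \<delta>] m2 by (intro integrableI_nonneg) (auto simp: W_nonneg)
  have j1: "(\<integral>p. ?g1 p \<partial>lborel) = enn2real (UW R)"
    using n1 m1 by (subst integral_eq_nn_integral) (auto simp: W_nonneg u_nonneg)
  have j2: "(\<integral>p. ?g2 p \<partial>lborel) = enn2real (BV \<delta> R)"
    using n2 m2 by (subst integral_eq_nn_integral) (auto simp: W_nonneg)
  have "G \<delta> R = (\<integral>p. \<delta> powr (- s) / s * ?g1 p - ?g2 p \<partial>lborel)"
    unfolding G_def by (intro Bochner_Integration.integral_cong) (auto simp: L_split[OF \<delta>] algebra_simps)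
  also have "\<dots> = \<delta> powr (- s) / s * (\<integral>p. ?g1 p \<partial>lborel) - (\<integral>p. ?g2 p \<partial>lborel)"
    using i1 i2 by (subst Bochner_Integration.integral_diff) auto
  finally show ?thesis unfolding j1 j2 .
qed

lemma UW_Phi: "UW R = (\<integral>\<^sup>+b\<in>{0<..<\<kappa>}. ennreal (b powr (s - 1)) * Phi R b \<partial>lborel)"
  unfolding UW_def
proof (rule nn_integral_cong)
  fix b :: real
  show "(\<integral>\<^sup>+y. ennreal (W R b y) * ennreal (u (y, t - b)) \<partial>lborel) = ennreal (b powr (s - 1)) * Phi R b * indicator {0<..<\<kappa>} b"
  proof (cases "0 < b \<and> b < \<kappa>")
    case True
    have "ennreal (b powr (s - 1)) * Phi R b = (\<integral>\<^sup>+y. ennreal (b powr (s - 1)) * ennreal (heat_kernel b (x - y) * cutoff R (y - x) * u (y, t - b)) \<partial>lborel)"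
      unfolding Phi_def by (rule nn_integral_cmult[symmetric]) measurable
    then show ?thesis
      using True by (auto intro!: nn_integral_cong simp: W_def ennreal_mult[symmetric] u_nonneg cutoff_bounds mult_ac)
  next
    case False
    then have "W R b y = 0" for y by (auto simp: W_def)
    then show ?thesis using False by auto
  qed
qed

text \<open>The integrals over y and \<sigma> are exchanged, then \<sigma> is shifted by b: the
  product of the two powers becomes \<open>ker\<close> in the total lag a.\<close>

lemma BV_V:
  assumes "0 < \<delta>"
  shows "BV \<delta> R = (\<integral>\<^sup>+b. \<integral>\<^sup>+a. ennreal (ker \<delta> b a) * V R b (a - b) \<partial>lborel \<partial>lborel)"
  unfolding BV_def
proof (rule nn_integral_cong)
  fix b :: real
  show "(\<integral>\<^sup>+y. ennreal (W R b y) * S \<delta> y (t - b) \<partial>lborel) = (\<integral>\<^sup>+a. ennreal (ker \<delta> b a) * V R b (a - b) \<partial>lborel)"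
  proof (cases "0 < b \<and> b < \<kappa>")
    case True
    have "(\<integral>\<^sup>+y. ennreal (W R b y) * S \<delta> y (t - b) \<partial>lborel)
      = (\<integral>\<^sup>+y. \<integral>\<^sup>+\<sigma>. ennreal (W R b y) * (ennreal (\<sigma> powr (- 1 - s)) * hN \<sigma> y (t - b) * indicator {\<delta><..} \<sigma>) \<partial>lborel \<partial>lborel)"
      unfolding S_def by (intro nn_integral_cong nn_integral_cmult[symmetric]) measurable
    also have "\<dots> = (\<integral>\<^sup>+\<sigma>. \<integral>\<^sup>+y. ennreal (W R b y) * (ennreal (\<sigma> powr (- 1 - s)) * hN \<sigma> y (t - b) * indicator {\<delta><..} \<sigma>) \<partial>lborel \<partial>lborel)"
      by (rule nn_integral_lborel_swap) measurable
    also have "\<dots> = (\<integral>\<^sup>+\<sigma>. ennreal (b powr (s - 1) * \<sigma> powr (- 1 - s)) * indicator {\<delta><..} \<sigma> * V R b \<sigma> \<partial>lborel)"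
    proof (rule nn_integral_cong)
      fix \<sigma> :: real
      have "(\<integral>\<^sup>+y. ennreal (W R b y) * (ennreal (\<sigma> powr (- 1 - s)) * hN \<sigma> y (t - b) * indicator {\<delta><..} \<sigma>) \<partial>lborel)
        = (\<integral>\<^sup>+y. (ennreal (b powr (s - 1) * \<sigma> powr (- 1 - s)) * indicator {\<delta><..} \<sigma>) * (ennreal (heat_kernel b (x - y) * cutoff R (y - x)) * hN \<sigma> y (t - b)) \<partial>lborel)"
      proof (rule nn_integral_cong)
        fix y
        have "ennreal (W R b y) = ennreal (b powr (s - 1)) * ennreal (heat_kernel b (x - y) * cutoff R (y - x))"
          using True by (simp add: W_def ennreal_mult[symmetric] cutoff_bounds mult.assoc)
        moreover have "ennreal (b powr (s - 1) * \<sigma> powr (- 1 - s)) = ennreal (b powr (s - 1)) * ennreal (\<sigma> powr (- 1 - s))"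
          by (rule ennreal_mult) auto
        ultimately show "ennreal (W R b y) * (ennreal (\<sigma> powr (- 1 - s)) * hN \<sigma> y (t - b) * indicator {\<delta><..} \<sigma>)
          = (ennreal (b powr (s - 1) * \<sigma> powr (- 1 - s)) * indicator {\<delta><..} \<sigma>) * (ennreal (heat_kernel b (x - y) * cutoff R (y - x)) * hN \<sigma> y (t - b))"
          by (simp only: mult_ac)
      qed
      also have "\<dots> = ennreal (b powr (s - 1) * \<sigma> powr (- 1 - s)) * indicator {\<delta><..} \<sigma> * V R b \<sigma>"
        unfolding V_def by (rule nn_integral_cmult) measurable
      finally show "(\<integral>\<^sup>+y. ennreal (W R b y) * (ennreal (\<sigma> powr (- 1 - s)) * hN \<sigma> y (t - b) * indicator {\<delta><..} \<sigma>) \<partial>lborel)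
        = ennreal (b powr (s - 1) * \<sigma> powr (- 1 - s)) * indicator {\<delta><..} \<sigma> * V R b \<sigma>" .
    qed
    also have "\<dots> = (\<integral>\<^sup>+a. ennreal (b powr (s - 1) * (- b + a) powr (- 1 - s)) * indicator {\<delta><..} (- b + a) * V R b (- b + a) \<partial>lborel)"
      by (rule nn_integral_lborel_translate[symmetric]) measurable
    also have "\<dots> = (\<integral>\<^sup>+a. ennreal (ker \<delta> b a) * V R b (a - b) \<partial>lborel)"
      using True by (intro nn_integral_cong) (auto simp: ker_def indicator_def)
    finally show ?thesis .
  next
    case False
    then have "W R b y = 0" "ker \<delta> b a = 0" for y a by (auto simp: W_def ker_def)
    then show ?thesis by simp
  qed
qed

text \<open>Let P be the integral of \<open>ker\<close> against \<open>Phi\<close>. Then P = Z + Y,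
  split at a = \<kappa>; the identity term equals X + Z by \<open>md_add_kf\<close>; and
  \<open>BV\<close> equals P up to \<open>Err\<close>. Hence G = (X + Z) - (Z + Y) = X - Y up to
  \<open>Err\<close>: the part Z, which in general diverges as \<delta> \<rightarrow> 0, drops
  out.\<close>

lemma level:
  assumes R: "1 \<le> R" and \<delta>: "0 < \<delta>" "\<delta> < \<kappa>"
    and sand: "\<And>b a. 0 < b \<Longrightarrow> b < a \<Longrightarrow> V R b (a - b) \<le> Phi R a + rho K R b a \<and> Phi R a \<le> V R b (a - b) + rho K R b a"
    and E: "Err K R < \<infinity>"
  defines "X \<equiv> (\<integral>\<^sup>+a\<in>{0<..<\<kappa>}. ennreal (md \<delta> a) * Phi R a \<partial>lborel)"
    and "Y \<equiv> (\<integral>\<^sup>+a\<in>{\<kappa><..}. ennreal (kf \<delta> a) * Phi R a \<partial>lborel)"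
  shows "X < \<infinity>" "Y < \<infinity>" "\<bar>G \<delta> R + enn2real Y - enn2real X\<bar> \<le> enn2real (Err K R)"
proof -
  define Z where "Z = (\<integral>\<^sup>+a\<in>{0<..<\<kappa>}. ennreal (kf \<delta> a) * Phi R a \<partial>lborel)"
  define P where "P = (\<integral>\<^sup>+b. \<integral>\<^sup>+a. ennreal (ker \<delta> b a) * Phi R a \<partial>lborel \<partial>lborel)"
  have "P = (\<integral>\<^sup>+a. \<integral>\<^sup>+b. ennreal (ker \<delta> b a) * Phi R a \<partial>lborel \<partial>lborel)"
    unfolding P_def by (rule nn_integral_lborel_swap) measurable
  also have "\<dots> = (\<integral>\<^sup>+a. ennreal (kf \<delta> a) * Phi R a \<partial>lborel)"
    using ker_integral[of \<delta>] \<delta> by (intro nn_integral_cong) (simp add: nn_integral_multc)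
  also have "\<dots> = (\<integral>\<^sup>+a. ennreal (kf \<delta> a) * Phi R a * indicator {0<..<\<kappa>} a + ennreal (kf \<delta> a) * Phi R a * indicator {\<kappa><..} a \<partial>lborel)"
  proof (rule nn_integral_cong_AE)
    show "AE a in lborel. ennreal (kf \<delta> a) * Phi R a = ennreal (kf \<delta> a) * Phi R a * indicator {0<..<\<kappa>} a + ennreal (kf \<delta> a) * Phi R a * indicator {\<kappa><..} a"
      using AE_lborel_singleton[of \<kappa>]
    proof eventually_elim
      case (elim a)
      consider "a \<le> 0" | "0 < a" "a < \<kappa>" | "\<kappa> < a" using elim by linarith
      then show ?case using \<delta> kappa by cases (auto simp: kf_def)
    qed
  qed
  also have "\<dots> = Z + Y" unfolding Z_def Y_def by (rule nn_integral_add) measurable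
  finally have PZY: "P = Z + Y" .
  have UXZ: "ennreal (\<delta> powr (- s) / s) * UW R = X + Z"
  proof -
    have "ennreal (\<delta> powr (- s) / s) * UW R = (\<integral>\<^sup>+b. ennreal (\<delta> powr (- s) / s) * (ennreal (b powr (s - 1)) * Phi R b * indicator {0<..<\<kappa>} b) \<partial>lborel)"
      unfolding UW_Phi by (rule nn_integral_cmult[symmetric]) measurable
    also have "\<dots> = (\<integral>\<^sup>+a. ennreal (md \<delta> a) * Phi R a * indicator {0<..<\<kappa>} a + ennreal (kf \<delta> a) * Phi R a * indicator {0<..<\<kappa>} a \<partial>lborel)"
    proof (rule nn_integral_cong)
      fix a
      show "ennreal (\<delta> powr (- s) / s) * (ennreal (a powr (s - 1)) * Phi R a * indicator {0<..<\<kappa>} a)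
        = ennreal (md \<delta> a) * Phi R a * indicator {0<..<\<kappa>} a + ennreal (kf \<delta> a) * Phi R a * indicator {0<..<\<kappa>} a"
      proof (cases "0 < a \<and> a < \<kappa>")
        case True
        then have "ennreal (\<delta> powr (- s) / s * a powr (s - 1)) = ennreal (md \<delta> a) + ennreal (kf \<delta> a)"
          using md_add_kf[of \<delta> a] md_nonneg[of \<delta> a] kf_nonneg[of \<delta> a] \<delta> by (simp only: ennreal_plus less_imp_le)
        moreover have "ennreal (\<delta> powr (- s) / s * a powr (s - 1)) = ennreal (\<delta> powr (- s) / s) * ennreal (a powr (s - 1))"
          using s_pos by (intro ennreal_mult) auto
        ultimately show ?thesis using True by (simp add: distrib_right[symmetric] mult.assoc[symmetric])
      qed auto
    qed
    also have "\<dots> = X + Z" unfolding X_def Z_def by (rule nn_integral_add) measurable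
    finally show ?thesis .
  qed
  have add_int: "(\<integral>\<^sup>+b. \<integral>\<^sup>+a. ennreal (ker \<delta> b a) * q b a + ennreal (ker 0 b a) * rho K R b a \<partial>lborel \<partial>lborel)
      = (\<integral>\<^sup>+b. \<integral>\<^sup>+a. ennreal (ker \<delta> b a) * q b a \<partial>lborel \<partial>lborel) + Err K R"
    if [measurable]: "(\<lambda>p. q (fst p) (snd p)) \<in> borel_measurable (borel \<Otimes>\<^sub>M borel)" for q :: "real \<Rightarrow> real \<Rightarrow> ennreal"
  proof -
    have q[measurable]: "q b \<in> borel_measurable borel" for b
      using measurable_compose[OF _ that, of "\<lambda>a. (b, a)" borel] by simp
    have q2: "(\<lambda>b. \<integral>\<^sup>+a. ennreal (ker \<delta> b a) * q b a \<partial>lborel) \<in> borel_measurable borel"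
    proof -
      have "(\<lambda>p. ennreal (ker \<delta> (fst p) (snd p)) * q (fst p) (snd p)) \<in> borel_measurable (borel \<Otimes>\<^sub>M borel)" by measurable
      then show ?thesis by (intro lborel.borel_measurable_nn_integral) (simp add: case_prod_beta' cong: measurable_cong_sets)
    qed
    have q3: "(\<lambda>b. \<integral>\<^sup>+a. ennreal (ker 0 b a) * rho K R b a \<partial>lborel) \<in> borel_measurable borel" by measurable
    show ?thesis
      unfolding Err_def using q2 q3 by (simp add: nn_integral_add)
  qed
  have kle: "ennreal (ker \<delta> b a) \<le> ennreal (ker 0 b a)" for b a
    using \<delta> by (intro ennreal_leI) (auto simp: ker_def)
  have 1: "BV \<delta> R \<le> P + Err K R"
  proof -
    have "BV \<delta> R \<le> (\<integral>\<^sup>+b. \<integral>\<^sup>+a. ennreal (ker \<delta> b a) * Phi R a + ennreal (ker 0 b a) * rho K R b a \<partial>lborel \<partial>lborel)"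
      unfolding BV_V[OF \<delta>(1)]
    proof (intro nn_integral_mono)
      fix b a
      show "ennreal (ker \<delta> b a) * V R b (a - b) \<le> ennreal (ker \<delta> b a) * Phi R a + ennreal (ker 0 b a) * rho K R b a"
      proof (cases "ker \<delta> b a = 0")
        case False
        then have "0 < b" "b < a" using \<delta> by (auto simp: ker_def split: if_splits)
        then have "V R b (a - b) \<le> Phi R a + rho K R b a" using sand by blast
        then have "ennreal (ker \<delta> b a) * V R b (a - b) \<le> ennreal (ker \<delta> b a) * Phi R a + ennreal (ker \<delta> b a) * rho K R b a"
          unfolding distrib_left[symmetric] by (rule mult_left_mono) simp
        also have "\<dots> \<le> ennreal (ker \<delta> b a) * Phi R a + ennreal (ker 0 b a) * rho K R b a"
          by (intro add_left_mono mult_right_mono kle) simp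
        finally show ?thesis .
      qed simp
    qed
    also have "\<dots> = P + Err K R" unfolding P_def by (rule add_int) measurable
    finally show ?thesis .
  qed
  have 2: "P \<le> BV \<delta> R + Err K R"
  proof -
    have "P \<le> (\<integral>\<^sup>+b. \<integral>\<^sup>+a. ennreal (ker \<delta> b a) * V R b (a - b) + ennreal (ker 0 b a) * rho K R b a \<partial>lborel \<partial>lborel)"
      unfolding P_def
    proof (intro nn_integral_mono)
      fix b a
      show "ennreal (ker \<delta> b a) * Phi R a \<le> ennreal (ker \<delta> b a) * V R b (a - b) + ennreal (ker 0 b a) * rho K R b a"
      proof (cases "ker \<delta> b a = 0")
        case False
        then have "0 < b" "b < a" using \<delta> by (auto simp: ker_def split: if_splits)
        then have "Phi R a \<le> V R b (a - b) + rho K R b a" using sand by blast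
        then have "ennreal (ker \<delta> b a) * Phi R a \<le> ennreal (ker \<delta> b a) * V R b (a - b) + ennreal (ker \<delta> b a) * rho K R b a"
          unfolding distrib_left[symmetric] by (rule mult_left_mono) simp
        also have "\<dots> \<le> ennreal (ker \<delta> b a) * V R b (a - b) + ennreal (ker 0 b a) * rho K R b a"
          by (intro add_left_mono mult_right_mono kle) simp
        finally show ?thesis .
      qed simp
    qed
    also have "\<dots> = BV \<delta> R + Err K R" unfolding BV_V[OF \<delta>(1)] by (rule add_int) measurable
    finally show ?thesis .
  qed
  have Bf: "BV \<delta> R < \<infinity>" by (rule BV_finite[OF R \<delta>(1)])
  have Uf: "UW R < \<infinity>" by (rule UW_finite[OF R])
  have Pf: "P < \<infinity>" using 2 Bf E by (simp add: order_le_less_trans)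
  have Zf: "Z < \<infinity>" and Yf: "Y < \<infinity>" using Pf unfolding PZY by simp_all
  have Xf: "X < \<infinity>"
  proof -
    have "X + Z < \<infinity>" unfolding UXZ[symmetric] using Uf by (simp add: ennreal_mult_less_top)
    then show ?thesis by simp
  qed
  show "X < \<infinity>" "Y < \<infinity>" by fact+
  \<comment> \<open>All quantities are finite by now, so that the subtraction can be carried out in
    the reals.\<close>
  obtain p z y' x' b e where r: "P = ennreal p" "Z = ennreal z" "Y = ennreal y'" "X = ennreal x'" "BV \<delta> R = ennreal b" "Err K R = ennreal e"
    "0 \<le> p" "0 \<le> z" "0 \<le> y'" "0 \<le> x'" "0 \<le> b" "0 \<le> e"
    using Pf Zf Yf Xf Bf E by (metis enn2real_nonneg ennreal_enn2real infinity_ennreal_def)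
  have "p = z + y'" using PZY r by (simp add: ennreal_plus[symmetric] del: ennreal_plus)
  moreover have "\<delta> powr (- s) / s * enn2real (UW R) = x' + z"
  proof -
    have "enn2real (ennreal (\<delta> powr (- s) / s) * UW R) = enn2real (X + Z)" using UXZ by simp
    then show ?thesis using r s_pos by (simp add: enn2real_mult ennreal_plus[symmetric] del: ennreal_plus)
  qed
  moreover have "b \<le> p + e" using 1 r by (simp add: ennreal_plus[symmetric] del: ennreal_plus)
  moreover have "p \<le> b + e" using 2 r by (simp add: ennreal_plus[symmetric] del: ennreal_plus)
  moreover have "G \<delta> R = \<delta> powr (- s) / s * enn2real (UW R) - b" using G_eq[OF R \<delta>(1)] r by simp
  ultimately have "\<bar>G \<delta> R + y' - x'\<bar> \<le> e" by linarith
  then show "\<bar>G \<delta> R + enn2real Y - enn2real X\<bar> \<le> enn2real (Err K R)" using r by simp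
qed

definition GF :: "real \<Rightarrow> ennreal" where
  "GF R = (\<integral>\<^sup>+b. \<integral>\<^sup>+y. ennreal (W R b y * f (y, t - b)) \<partial>lborel \<partial>lborel)"

definition PF :: "real \<Rightarrow> ennreal" where
  "PF R = (\<integral>\<^sup>+a\<in>{\<kappa><..}. ennreal (kf 0 a) * Phi R a \<partial>lborel)"

text \<open>This is what the cutoff is for: \<open>L_bounded\<close> bounds the truncated operators
  uniformly in \<delta>, but only on bounded sets of space-time, and \<open>W R\<close> has bounded
  support.\<close>

lemma G_tendsto:
  assumes R: "1 \<le> R" and \<delta>: "\<And>n. 0 < \<delta> n" "\<delta> \<longlonglongrightarrow> 0"
  shows "GF R < \<infinity>" "(\<lambda>n. G (\<delta> n) R) \<longlonglongrightarrow> enn2real (GF R)"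
proof -
  have A: "0 \<le> norm x + R + \<bar>t\<bar> + \<kappa>" using R kappa by simp
  obtain B where B: "B \<ge> 0" "\<And>x' t' \<delta>. norm x' \<le> norm x + R + \<bar>t\<bar> + \<kappa> \<Longrightarrow> \<bar>t'\<bar> \<le> norm x + R + \<bar>t\<bar> + \<kappa> \<Longrightarrow> 0 \<le> \<delta> \<Longrightarrow> \<bar>L \<delta> x' t'\<bar> \<le> B"
    using L_bounded[OF A] by blast
  have fB: "f (x', t') \<le> B" if "norm x' \<le> norm x + R + \<bar>t\<bar> + \<kappa>" "\<bar>t'\<bar> \<le> norm x + R + \<bar>t\<bar> + \<kappa>" for x' t'
    using B(2)[OF that, of 0] f_eq'[of x' t'] f_nonneg[of "(x', t')"] by (simp add: L_def)
  have GF': "GF R = (\<integral>\<^sup>+b. \<integral>\<^sup>+y. ennreal (W R b y) * ennreal (f (y, t - b)) \<partial>lborel \<partial>lborel)"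
    unfolding GF_def by (simp add: ennreal_mult W_nonneg f_nonneg)
  show fin: "GF R < \<infinity>"
    unfolding GF' by (rule W_bounded_integral[where g = "\<lambda>y \<tau>. ennreal (f (y, \<tau>))", OF R B(1)]) (intro ennreal_leI fB)
  have m: "(\<lambda>p. W R (fst p) (snd p) * f (snd p, t - fst p)) \<in> borel_measurable lborel"
    by (rule lborel_pair_measurable) measurable
  have "(\<integral>\<^sup>+p. ennreal (W R (fst p) (snd p) * f (snd p, t - fst p)) \<partial>lborel) = GF R"
    unfolding GF_def by (subst nn_integral_lborel_pair) auto
  then have "(\<integral>p. W R (fst p) (snd p) * f (snd p, t - fst p) \<partial>lborel) = enn2real (GF R)"
    using m by (subst integral_eq_nn_integral) (auto simp: W_nonneg f_nonneg)
  moreover have "(\<lambda>n. G (\<delta> n) R) \<longlonglongrightarrow> (\<integral>p. W R (fst p) (snd p) * f (snd p, t - fst p) \<partial>lborel)"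
    unfolding G_def
  proof (rule integral_dominated_convergence[where w = "\<lambda>p. B * W R (fst p) (snd p)"])
    show "(\<lambda>p. W R (fst p) (snd p) * f (snd p, t - fst p)) \<in> borel_measurable lborel" by (rule m)
    show "(\<lambda>p. W R (fst p) (snd p) * L (\<delta> n) (snd p) (t - fst p)) \<in> borel_measurable lborel" for n
      by (rule lborel_pair_measurable) measurable
    show "integrable lborel (\<lambda>p. B * W R (fst p) (snd p))"
    proof (intro integrable_mult_right integrableI_nonneg)
      show "(\<lambda>p. W R (fst p) (snd p)) \<in> borel_measurable lborel" by (rule lborel_pair_measurable) measurable
      have "(\<integral>\<^sup>+p. ennreal (W R (fst p) (snd p)) \<partial>lborel) = (\<integral>\<^sup>+b. \<integral>\<^sup>+y. ennreal (W R b y) \<partial>lborel \<partial>lborel)"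
        by (subst nn_integral_lborel_pair) auto
      also have "\<dots> < \<infinity>" using W_total by (rule order_le_less_trans) simp
      finally show "(\<integral>\<^sup>+p. ennreal (W R (fst p) (snd p)) \<partial>lborel) < \<infinity>" .
    qed (simp add: W_nonneg)
    show "AE p in lborel. (\<lambda>n. W R (fst p) (snd p) * L (\<delta> n) (snd p) (t - fst p)) \<longlonglongrightarrow> W R (fst p) (snd p) * f (snd p, t - fst p)"
      by (intro AE_I2 tendsto_mult tendsto_const L_tendsto \<delta>)
    show "AE p in lborel. norm (W R (fst p) (snd p) * L (\<delta> n) (snd p) (t - fst p)) \<le> B * W R (fst p) (snd p)" for n
    proof (rule AE_I2)
      fix p :: "real \<times> 'a"
      show "norm (W R (fst p) (snd p) * L (\<delta> n) (snd p) (t - fst p)) \<le> B * W R (fst p) (snd p)"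
      proof (cases "W R (fst p) (snd p) = 0")
        case False
        then have "\<bar>L (\<delta> n) (snd p) (t - fst p)\<bar> \<le> B"
          using \<delta>(1)[of n] by (intro B(2) W_support_bounds R) auto
        then have "\<bar>W R (fst p) (snd p)\<bar> * \<bar>L (\<delta> n) (snd p) (t - fst p)\<bar> \<le> W R (fst p) (snd p) * B"
          using W_nonneg by (intro mult_mono) auto
        then show ?thesis by (simp add: abs_mult mult.commute)
      qed simp
    qed
  qed
  ultimately show "(\<lambda>n. G (\<delta> n) R) \<longlonglongrightarrow> enn2real (GF R)" by simp
qed

text \<open>The limit \<delta> \<rightarrow> 0 in \<open>level\<close>: G tends to
  \<open>GF\<close>, Y to \<open>PF\<close> and X to the multiple of u(x, t), while the error does
  not depend on \<delta>.\<close>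

lemma representation_cutoff:
  assumes R: "1 \<le> R"
    and sand: "\<And>b a. 0 < b \<Longrightarrow> b < a \<Longrightarrow> V R b (a - b) \<le> Phi R a + rho K R b a \<and> Phi R a \<le> V R b (a - b) + rho K R b a"
    and E: "Err K R < \<infinity>"
  shows "GF R + PF R \<le> ennreal (green_const s * u (x, t)) + Err K R"
    "ennreal (green_const s * u (x, t)) \<le> GF R + PF R + Err K R"
proof -
  \<comment> \<open>The shift by N puts every term of the sequence \<delta> below \<kappa>, as
    \<open>level\<close> requires.\<close>
  obtain N where N: "inverse (real (Suc N)) < \<kappa>" using reals_Archimedean[OF kappa] by blast
  define \<delta> where "\<delta> = (\<lambda>n. inverse (real (Suc (n + N))))"
  have \<delta>: "0 < \<delta> n" "\<delta> n < \<kappa>" for n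
  proof -
    show "0 < \<delta> n" by (simp add: \<delta>_def)
    have "\<delta> n \<le> inverse (real (Suc N))" unfolding \<delta>_def by (intro le_imp_inverse_le) auto
    then show "\<delta> n < \<kappa>" using N by simp
  qed
  have lim: "\<delta> \<longlonglongrightarrow> 0" unfolding \<delta>_def by (rule LIMSEQ_ignore_initial_segment[OF LIMSEQ_inverse_real_of_nat])
  define X where "X = (\<lambda>n. \<integral>\<^sup>+a\<in>{0<..<\<kappa>}. ennreal (md (\<delta> n) a) * Phi R a \<partial>lborel)"
  define Y where "Y = (\<lambda>n. \<integral>\<^sup>+a\<in>{\<kappa><..}. ennreal (kf (\<delta> n) a) * Phi R a \<partial>lborel)"
  have lev: "X n < \<infinity>" "Y n < \<infinity>" "\<bar>G (\<delta> n) R + enn2real (Y n) - enn2real (X n)\<bar> \<le> enn2real (Err K R)" for n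
    unfolding X_def Y_def by (rule level[OF R \<delta> sand E]; assumption)+
  define c where "c = green_const s * u (x, t)"
  have c: "0 \<le> c" using green_const(2)[OF s_pos s_less] u_nonneg by (simp add: c_def)
  have Xl: "X \<longlonglongrightarrow> ennreal c" unfolding X_def c_def by (rule X_tendsto[OF R \<delta>(1) lim])
  then have Xr: "(\<lambda>n. enn2real (X n)) \<longlonglongrightarrow> c" using c by (metis enn2real_ennreal ennreal_less_top infinity_ennreal_def tendsto_enn2real)
  have Yl: "Y \<longlonglongrightarrow> PF R"
    unfolding Y_def \<delta>_def PF_def using LIMSEQ_ignore_initial_segment[OF Y_tendsto[of R], of N] by simp
  note Gl = G_tendsto[OF R \<delta>(1) lim]
  let ?e = "enn2real (Err K R)" and ?g = "enn2real (GF R)"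
  \<comment> \<open>The limit is first taken in \<open>ennreal\<close>, where it shows that
    \<open>PF R\<close> is finite; only then do the real values of Y converge.\<close>
  have "PF R \<le> ennreal (c + ?e - ?g)"
  proof (rule LIMSEQ_le[OF Yl])
    show "(\<lambda>n. ennreal (enn2real (X n) + ?e - G (\<delta> n) R)) \<longlonglongrightarrow> ennreal (c + ?e - ?g)"
      by (intro tendsto_ennrealI tendsto_intros Xr Gl)
    have "Y n \<le> ennreal (enn2real (X n) + ?e - G (\<delta> n) R)" for n
    proof -
      have "Y n = ennreal (enn2real (Y n))" using lev(2)[of n] by simp
      also have "\<dots> \<le> ennreal (enn2real (X n) + ?e - G (\<delta> n) R)"
        using lev(3)[of n] by (intro ennreal_leI) linarith
      finally show ?thesis .
    qed
    then show "\<exists>N. \<forall>n\<ge>N. Y n \<le> ennreal (enn2real (X n) + ?e - G (\<delta> n) R)" by blast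
  qed
  then have PFf: "PF R < \<infinity>" by (rule order_le_less_trans) simp
  then have Yr: "(\<lambda>n. enn2real (Y n)) \<longlonglongrightarrow> enn2real (PF R)"
    using Yl by (intro tendsto_enn2real) auto
  have "(\<lambda>n. \<bar>G (\<delta> n) R + enn2real (Y n) - enn2real (X n)\<bar>) \<longlonglongrightarrow> \<bar>?g + enn2real (PF R) - c\<bar>"
    by (intro tendsto_intros Gl Yr Xr)
  then have abs: "\<bar>?g + enn2real (PF R) - c\<bar> \<le> ?e"
    by (rule LIMSEQ_le_const2) (use lev(3) in blast)
  have e: "GF R = ennreal ?g" "PF R = ennreal (enn2real (PF R))" "Err K R = ennreal ?e"
    using Gl(1) PFf E by simp_all
  have "ennreal (?g + enn2real (PF R)) \<le> ennreal (c + ?e)" "ennreal c \<le> ennreal (?g + enn2real (PF R) + ?e)"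
    using abs by (intro ennreal_leI; linarith)+
  then show "GF R + PF R \<le> ennreal (green_const s * u (x, t)) + Err K R"
    "ennreal (green_const s * u (x, t)) \<le> GF R + PF R + Err K R"
    unfolding c_def[symmetric] using c e by (metis enn2real_nonneg ennreal_plus add_nonneg_nonneg)+
qed

text \<open>Green--Poisson representation over the slab \<open>(t - \<kappa>, t)\<close>: all terms are nonnegative, which makes
  tails controllable by the value of \<open>u\<close> at a single later point.\<close>

theorem representation:
  "ennreal (green_const s * u (x, t))
    = (\<integral>\<^sup>+b\<in>{0<..<\<kappa>}. (\<integral>\<^sup>+y. ennreal (b powr (s - 1) * heat_kernel b (x - y) * f (y, t - b)) \<partial>lborel) \<partial>lborel)
    + (\<integral>\<^sup>+a\<in>{\<kappa><..}. (\<integral>\<^sup>+y. ennreal (1 / (s * a) * (\<kappa> / (a - \<kappa>)) powr s * heat_kernel a (x - y) * u (y, t - a)) \<partial>lborel) \<partial>lborel)"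
    (is "?c = ?GF + ?PF")
proof -
  obtain K where K: "0 < K" "\<And>R b a. 1 \<le> R \<Longrightarrow> 0 < b \<Longrightarrow> b < a \<Longrightarrow> V R b (a - b) \<le> Phi R a + rho K R b a \<and> Phi R a \<le> V R b (a - b) + rho K R b a"
    using V_sandwich by blast
  let ?R = "\<lambda>n. real (Suc n)"
  have E: "Err K (?R n) < \<infinity>" for n
  proof -
    have "Err K (?R n) \<le> Err K 1"
      unfolding Err_def rho_def
    proof (intro nn_integral_mono)
      fix b a
      show "ennreal (ker 0 b a) * (\<integral>\<^sup>+y. ennreal (heat_kernel a (x - y) * u (y, t - a) * min 1 (K * (a - b) * (1 + norm (x - y) / a) / ?R n)) \<partial>lborel)
        \<le> ennreal (ker 0 b a) * (\<integral>\<^sup>+y. ennreal (heat_kernel a (x - y) * u (y, t - a) * min 1 (K * (a - b) * (1 + norm (x - y) / a) / 1)) \<partial>lborel)"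
      proof (cases "0 < b \<and> b < a")
        case True
        have "K * (a - b) * (1 + norm (x - y) / a) / ?R n \<le> K * (a - b) * (1 + norm (x - y) / a) / 1" for y
          using True K(1) by (intro divide_left_mono) auto
        then show ?thesis
          using u_nonneg by (intro mult_left_mono nn_integral_mono ennreal_leI min.mono) auto
      qed (auto simp: ker_def)
    qed
    then show ?thesis using Err_finite[OF K(1)] by (rule order_le_less_trans)
  qed
  note rep = representation_cutoff[OF _ K(2) E]
  \<comment> \<open>The cutoffs increase to 1 with R, so the Green term, and below it the Poisson
    term, converge monotonically whether or not the limit is finite; the error vanishes by
    \<open>Err_tendsto\<close>.\<close>
  have GFl: "(\<lambda>n. GF (?R n)) \<longlonglongrightarrow> ?GF"
  proof -
    have W: "incseq (\<lambda>n. ennreal (W (?R n) b y * f (y, t - b)))" for b y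
      by (intro incseq_SucI ennreal_leI mult_right_mono f_nonneg) (auto simp: W_def intro!: mult_left_mono cutoff_mono)
    have Wl: "(\<lambda>n. ennreal (W (?R n) b y * f (y, t - b))) \<longlonglongrightarrow> ennreal (b powr (s - 1) * heat_kernel b (x - y) * 1 * f (y, t - b)) * indicator {0<..<\<kappa>} b" for b y
    proof (cases "0 < b \<and> b < \<kappa>")
      case True
      have "(\<lambda>n. ennreal (b powr (s - 1) * heat_kernel b (x - y) * cutoff (?R n) (y - x) * f (y, t - b))) \<longlonglongrightarrow> ennreal (b powr (s - 1) * heat_kernel b (x - y) * 1 * f (y, t - b))"
        by (intro tendsto_ennrealI tendsto_mult tendsto_const cutoff_tendsto)
      then show ?thesis using True by (simp add: W_def)
    qed (auto simp: W_def)
    have "(\<lambda>n. \<integral>\<^sup>+b. \<integral>\<^sup>+y. ennreal (W (?R n) b y * f (y, t - b)) \<partial>lborel \<partial>lborel)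
      \<longlonglongrightarrow> (\<integral>\<^sup>+b. \<integral>\<^sup>+y. ennreal (b powr (s - 1) * heat_kernel b (x - y) * 1 * f (y, t - b)) * indicator {0<..<\<kappa>} b \<partial>lborel \<partial>lborel)"
    proof (rule nn_integral_LIMSEQ)
      show "incseq (\<lambda>n b. \<integral>\<^sup>+y. ennreal (W (?R n) b y * f (y, t - b)) \<partial>lborel)"
        using W by (auto simp: incseq_def le_fun_def intro!: nn_integral_mono)
      show "(\<lambda>n. \<integral>\<^sup>+y. ennreal (W (?R n) b y * f (y, t - b)) \<partial>lborel) \<longlonglongrightarrow> (\<integral>\<^sup>+y. ennreal (b powr (s - 1) * heat_kernel b (x - y) * 1 * f (y, t - b)) * indicator {0<..<\<kappa>} b \<partial>lborel)" for b
        using W by (intro nn_integral_LIMSEQ Wl) (auto simp: incseq_def le_fun_def)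
    qed measurable
    then show ?thesis unfolding GF_def by (simp add: nn_integral_multc)
  qed
  have PFl: "(\<lambda>n. PF (?R n)) \<longlonglongrightarrow> ?PF"
  proof -
    have P: "incseq (\<lambda>n. ennreal (heat_kernel a (x - y) * cutoff (?R n) (y - x) * u (y, t - a)))" for a y
      by (intro incseq_SucI ennreal_leI mult_right_mono u_nonneg mult_left_mono cutoff_mono) auto
    have Pl: "(\<lambda>n. ennreal (heat_kernel a (x - y) * cutoff (?R n) (y - x) * u (y, t - a))) \<longlonglongrightarrow> ennreal (heat_kernel a (x - y) * 1 * u (y, t - a))" for a y
      by (intro tendsto_ennrealI tendsto_mult tendsto_const cutoff_tendsto)
    have Phil: "(\<lambda>n. Phi (?R n) a) \<longlonglongrightarrow> (\<integral>\<^sup>+y. ennreal (heat_kernel a (x - y) * 1 * u (y, t - a)) \<partial>lborel)" for a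
      unfolding Phi_def using P by (intro nn_integral_LIMSEQ Pl) (auto simp: incseq_def le_fun_def)
    have Phi_inc: "Phi (?R n) a \<le> Phi (?R m) a" if "n \<le> m" for n m a
      unfolding Phi_def using P that by (auto simp: incseq_def intro!: nn_integral_mono)
    have "(\<lambda>n. PF (?R n)) \<longlonglongrightarrow> (\<integral>\<^sup>+a\<in>{\<kappa><..}. ennreal (kf 0 a) * (\<integral>\<^sup>+y. ennreal (heat_kernel a (x - y) * 1 * u (y, t - a)) \<partial>lborel) \<partial>lborel)"
      unfolding PF_def
    proof (rule nn_integral_LIMSEQ)
      show "incseq (\<lambda>n a. ennreal (kf 0 a) * Phi (?R n) a * indicator {\<kappa><..} a)"
        by (auto simp: incseq_def le_fun_def simp del: of_nat_Suc intro!: mult_right_mono mult_left_mono Phi_inc)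
      show "(\<lambda>n. ennreal (kf 0 a) * Phi (?R n) a * indicator {\<kappa><..} a) \<longlonglongrightarrow> ennreal (kf 0 a) * (\<integral>\<^sup>+y. ennreal (heat_kernel a (x - y) * 1 * u (y, t - a)) \<partial>lborel) * indicator {\<kappa><..} a" for a
      proof (cases "\<kappa> < a")
        case True
        have "(\<lambda>n. ennreal (kf 0 a) * Phi (?R n) a) \<longlonglongrightarrow> ennreal (kf 0 a) * (\<integral>\<^sup>+y. ennreal (heat_kernel a (x - y) * 1 * u (y, t - a)) \<partial>lborel)"
          by (intro ennreal_tendsto_cmult Phil) simp
        then show ?thesis using True by simp
      qed simp
    qed measurable
    also have "(\<integral>\<^sup>+a\<in>{\<kappa><..}. ennreal (kf 0 a) * (\<integral>\<^sup>+y. ennreal (heat_kernel a (x - y) * 1 * u (y, t - a)) \<partial>lborel) \<partial>lborel) = ?PF"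
    proof (rule nn_integral_cong)
      fix a
      show "ennreal (kf 0 a) * (\<integral>\<^sup>+y. ennreal (heat_kernel a (x - y) * 1 * u (y, t - a)) \<partial>lborel) * indicator {\<kappa><..} a
        = (\<integral>\<^sup>+y. ennreal (1 / (s * a) * (\<kappa> / (a - \<kappa>)) powr s * heat_kernel a (x - y) * u (y, t - a)) \<partial>lborel) * indicator {\<kappa><..} a"
      proof (cases "\<kappa> < a")
        case True
        then have kf: "kf 0 a = 1 / (s * a) * (\<kappa> / (a - \<kappa>)) powr s" using kappa by (simp add: kf_def)
        have "ennreal (kf 0 a) * (\<integral>\<^sup>+y. ennreal (heat_kernel a (x - y) * 1 * u (y, t - a)) \<partial>lborel)
          = (\<integral>\<^sup>+y. ennreal (kf 0 a) * ennreal (heat_kernel a (x - y) * 1 * u (y, t - a)) \<partial>lborel)"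
          by (rule nn_integral_cmult[symmetric]) measurable
        also have "\<dots> = (\<integral>\<^sup>+y. ennreal (kf 0 a * heat_kernel a (x - y) * u (y, t - a)) \<partial>lborel)"
          using u_nonneg kf_nonneg[of 0 a] by (intro nn_integral_cong) (simp add: ennreal_mult[symmetric] mult.assoc)
        finally show ?thesis unfolding kf by simp
      qed simp
    qed
    finally show ?thesis .
  qed
  have sum: "(\<lambda>n. GF (?R n) + PF (?R n)) \<longlonglongrightarrow> ?GF + ?PF" by (intro tendsto_add GFl PFl)
  show ?thesis
  proof (rule antisym)
    have "(\<lambda>n. GF (?R n) + PF (?R n) + Err K (?R n)) \<longlonglongrightarrow> ?GF + ?PF + 0"
      by (intro tendsto_add sum Err_tendsto K)
    then show "?c \<le> ?GF + ?PF"
      using rep(2) by (intro LIMSEQ_le[OF tendsto_const]) (auto intro!: exI[of _ 0])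
    have "(\<lambda>n. ?c + Err K (?R n)) \<longlonglongrightarrow> ?c + 0"
      by (intro tendsto_add tendsto_const Err_tendsto K)
    then show "?GF + ?PF \<le> ?c"
      using rep(1) by (intro LIMSEQ_le[OF sum]) (auto intro!: exI[of _ 0])
  qed
qed

end

subsection \<open>The kernel and its increments\<close>

text \<open>For \<beta> = s this is the Green kernel. For \<beta> = 0 it is the heat kernel divided
  by a, the only factor of the Poisson kernel that involves x. Extension by 0 to a \<le> 0 lets
  kernels of different final times be subtracted.\<close>

definition pk :: "real \<Rightarrow> real \<Rightarrow> 'a::euclidean_space \<Rightarrow> real" where
  "pk \<beta> a z = (if 0 < a then a powr (\<beta> - 1) * heat_kernel a z else 0)"

lemma pk_nonneg [simp]: "0 \<le> pk \<beta> a z"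
  by (simp add: pk_def)

lemma measurable_pk [measurable (raw)]:
  assumes [measurable]: "f \<in> borel_measurable M" "g \<in> borel_measurable M"
  shows "(\<lambda>w. pk \<beta> (f w) (g w)) \<in> borel_measurable M"
  unfolding pk_def by measurable

section \<open>Increments of the kernel in L1\<close>

lemma abs_sinh_le: "\<bar>sinh v\<bar> \<le> \<bar>v\<bar> * exp \<bar>v\<bar>" for v :: real
proof -
  have "sinh w \<le> w * exp w" if "0 \<le> w" for w :: real
  proof -
    have "1 - exp (- 2 * w) \<le> 2 * w" using exp_ge_add_one_self[of "- 2 * w"] by simp
    then have "exp w * (1 - exp (- 2 * w)) \<le> exp w * (2 * w)" by (rule mult_left_mono) simp
    moreover have "exp w * exp (- 2 * w) = exp (- w)" by (simp add: exp_add[symmetric])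
    ultimately show ?thesis by (simp add: sinh_field_def algebra_simps)
  qed
  from this[of "\<bar>v\<bar>"] show ?thesis by (cases "0 \<le> v") auto
qed

lemma cosh_minus_one_le: "cosh w - 1 \<le> w\<^sup>2 / 2 * exp \<bar>w\<bar>" for w :: real
proof -
  have "cosh w = cosh (w / 2 + w / 2)" by simp
  also have "\<dots> = (cosh (w / 2))\<^sup>2 + (sinh (w / 2))\<^sup>2" unfolding cosh_add by (simp add: power2_eq_square)
  also have "(cosh (w / 2))\<^sup>2 = 1 + (sinh (w / 2))\<^sup>2" by (simp add: cosh_square_eq)
  finally have "cosh w - 1 = 2 * \<bar>sinh (w / 2)\<bar>\<^sup>2" by simp
  also have "\<dots> \<le> 2 * (\<bar>w / 2\<bar> * exp \<bar>w / 2\<bar>)\<^sup>2"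
    by (intro mult_left_mono power_mono abs_sinh_le) auto
  also have "\<dots> = w\<^sup>2 / 2 * exp \<bar>w\<bar>"
    by (simp add: power_mult_distrib power_divide exp_double[symmetric])
  finally show ?thesis .
qed

text \<open>Divided by the kernel at z, the two shifted kernels add up to 2 exp(-|d|^2/(4 a)) cosh
  w, where w is the inner product of z and d divided by 2 a. The terms linear in d have cancelled,
  and cosh w - 1 is of second order.\<close>

lemma heat_kernel_second_difference:
  fixes z d :: "'a::euclidean_space"
  assumes a: "0 < a"
  shows "\<bar>heat_kernel a (z + d) + heat_kernel a (z - d) - 2 * heat_kernel a z\<bar>
    \<le> heat_kernel a z * ((norm d)\<^sup>2 / (2 * a) + (norm z * norm d / (2 * a))\<^sup>2 * exp (norm z * norm d / (2 * a)))"
proof -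
  define \<delta> w q where "\<delta> = (norm d)\<^sup>2 / (4 * a)" and "w = (z \<bullet> d) / (2 * a)" and "q = norm z * norm d / (2 * a)"
  have \<delta>: "0 \<le> \<delta>" using a by (simp add: \<delta>_def)
  have e: "- (norm (z + d))\<^sup>2 / (4 * a) = - (norm z)\<^sup>2 / (4 * a) + (- \<delta> + - w)" "- (norm (z - d))\<^sup>2 / (4 * a) = - (norm z)\<^sup>2 / (4 * a) + (- \<delta> + w)"
    using a by (auto simp: \<delta>_def w_def power2_norm_eq_inner inner_add_left inner_add_right inner_diff_left inner_diff_right inner_commute field_simps)
  have "heat_kernel a (z + d) + heat_kernel a (z - d) - 2 * heat_kernel a z = heat_kernel a z * (2 * (exp (- \<delta>) * (cosh w - 1) + (exp (- \<delta>) - 1)))"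
    unfolding heat_kernel_def e exp_add cosh_field_def by (simp add: algebra_simps)
  then have "\<bar>heat_kernel a (z + d) + heat_kernel a (z - d) - 2 * heat_kernel a z\<bar> = heat_kernel a z * (2 * \<bar>exp (- \<delta>) * (cosh w - 1) + (exp (- \<delta>) - 1)\<bar>)"
    by (simp only: abs_mult abs_of_nonneg[OF heat_kernel_nonneg] abs_numeral)
  also have "\<dots> \<le> heat_kernel a z * (2 * ((cosh w - 1) + \<delta>))"
  proof (intro mult_left_mono)
    have "0 \<le> cosh w - 1" by (simp add: cosh_real_ge_1)
    then have "exp (- \<delta>) * (cosh w - 1) \<le> 1 * (cosh w - 1)" using \<delta> by (intro mult_right_mono) auto
    moreover have "0 \<le> exp (- \<delta>) * (cosh w - 1)" using \<open>0 \<le> cosh w - 1\<close> by simp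
    moreover have "1 - exp (- \<delta>) \<le> \<delta>" using exp_ge_add_one_self[of "- \<delta>"] by simp
    moreover have "exp (- \<delta>) \<le> 1" using \<delta> by simp
    moreover have "\<bar>P + (E - 1)\<bar> \<le> k + \<delta>" if "P \<le> 1 * k" "0 \<le> P" "1 - E \<le> \<delta>" "E \<le> 1" "0 \<le> k" for P E k :: real
      using that \<delta> by linarith
    ultimately show "\<bar>exp (- \<delta>) * (cosh w - 1) + (exp (- \<delta>) - 1)\<bar> \<le> (cosh w - 1) + \<delta>"
      using \<open>0 \<le> cosh w - 1\<close> by blast
  qed auto
  also have "\<dots> \<le> heat_kernel a z * (2 * (q\<^sup>2 / 2 * exp q + \<delta>))"
  proof (intro mult_left_mono add_right_mono)
    have "\<bar>w\<bar> = \<bar>z \<bullet> d\<bar> / (2 * a)" using a by (simp add: w_def)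
    also have "\<dots> \<le> q" unfolding q_def using a Cauchy_Schwarz_ineq2[of z d] by (intro divide_right_mono) auto
    finally have wq: "\<bar>w\<bar> \<le> q" .
    have "w\<^sup>2 / 2 * exp \<bar>w\<bar> \<le> q\<^sup>2 / 2 * exp q"
    proof (intro mult_mono)
      have "\<bar>w\<bar>\<^sup>2 \<le> q\<^sup>2" using wq by (intro power_mono) auto
      then show "w\<^sup>2 / 2 \<le> q\<^sup>2 / 2" by simp
    qed (use wq in auto)
    then show "cosh w - 1 \<le> q\<^sup>2 / 2 * exp q" using cosh_minus_one_le[of w] by linarith
  qed auto
  also have "2 * (q\<^sup>2 / 2 * exp q + \<delta>) = (norm d)\<^sup>2 / (2 * a) + q\<^sup>2 * exp q"
    using a by (simp add: \<delta>_def)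
  finally show ?thesis unfolding q_def .
qed

text \<open>For |d|^2 \<le> a the exponent |z| |d|/(2 a) is at most |z|^2/(16 a) + 1. The spare
  factor split off by \<open>heat_kernel_double\<close> absorbs it together with the quadratic
  factor.\<close>

lemma heat_kernel_second_difference_L1:
  obtains C where "0 < C"
    "\<And>a (d::'a::euclidean_space). 0 < a \<Longrightarrow> (norm d)\<^sup>2 \<le> a \<Longrightarrow>
      (\<integral>\<^sup>+z. ennreal \<bar>heat_kernel a (z + d) + heat_kernel a (z - d) - 2 * heat_kernel a z\<bar> \<partial>lborel) \<le> ennreal (C * (norm d)\<^sup>2 / a)"
proof -
  define c where "c = 2 powr (real DIM('a) / 2)"
  define C where "C = 1 / 2 + 4 * exp 1 * c"
  have "(\<integral>\<^sup>+z. ennreal \<bar>heat_kernel a (z + d) + heat_kernel a (z - d) - 2 * heat_kernel a z\<bar> \<partial>lborel) \<le> ennreal (C * (norm d)\<^sup>2 / a)"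
    if a: "0 < a" and d: "(norm d)\<^sup>2 \<le> a" for a and d :: 'a
  proof -
    let ?k = "(norm d)\<^sup>2 / a"
    have pt: "\<bar>heat_kernel a (z + d) + heat_kernel a (z - d) - 2 * heat_kernel a z\<bar> \<le> ?k / 2 * heat_kernel a z + ?k * (4 * exp 1 * c) * heat_kernel (2 * a) z" for z
    proof -
      define X where "X = (norm z)\<^sup>2 / a"
      have X: "0 \<le> X" using a by (simp add: X_def)
      have q: "norm z * norm d / (2 * a) \<le> X / 16 + 1"
      proof -
        have "0 \<le> (norm z / 4 - norm d)\<^sup>2" by simp
        then have "norm z * norm d / 2 \<le> (norm z)\<^sup>2 / 16 + (norm d)\<^sup>2" by (simp add: power2_eq_square algebra_simps)
        also have "\<dots> \<le> (norm z)\<^sup>2 / 16 + a" using d by simp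
        finally have "norm z * norm d / 2 / a \<le> ((norm z)\<^sup>2 / 16 + a) / a" using a by (intro divide_right_mono) auto
        then show ?thesis using a by (simp add: X_def add_divide_distrib)
      qed
      have "X / 4 * exp (X / 16 + 1) * exp (- X / 8) = exp 1 * (4 * (X / 16 * exp (- (X / 16))))"
        by (simp add: exp_add[symmetric]) (simp add: exp_add exp_minus field_simps)?
      also have "\<dots> \<le> exp 1 * (4 * 1)"
      proof (intro mult_left_mono)
        have "X / 16 \<le> exp (X / 16)" using exp_ge_add_one_self[of "X / 16"] by linarith
        then show "X / 16 * exp (- (X / 16)) \<le> 1" by (simp add: exp_minus divide_simps)
      qed auto
      finally have E: "X / 4 * exp (X / 16 + 1) * exp (- X / 8) \<le> 4 * exp 1" by simp
      have "heat_kernel a z * ((norm z * norm d / (2 * a))\<^sup>2 * exp (norm z * norm d / (2 * a)))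
        \<le> heat_kernel a z * (?k * (X / 4) * exp (X / 16 + 1))"
      proof (intro mult_left_mono mult_mono)
        show "(norm z * norm d / (2 * a))\<^sup>2 \<le> ?k * (X / 4)" by (simp add: X_def power2_eq_square mult_ac)
      qed (use q X a in auto)
      also have "\<dots> = ?k * c * heat_kernel (2 * a) z * (X / 4 * exp (X / 16 + 1) * exp (- X / 8))"
        by (subst heat_kernel_double[OF a]) (simp add: c_def X_def mult_ac)
      also have "\<dots> \<le> ?k * c * heat_kernel (2 * a) z * (4 * exp 1)"
        using E a by (intro mult_left_mono) (auto simp: c_def)
      finally have "heat_kernel a z * ((norm z * norm d / (2 * a))\<^sup>2 * exp (norm z * norm d / (2 * a))) \<le> ?k * (4 * exp 1 * c) * heat_kernel (2 * a) z"
        by (simp add: mult_ac)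
      then show ?thesis
        using heat_kernel_second_difference[OF a, of z d] by (simp add: distrib_left mult_ac)
    qed
    have "(\<integral>\<^sup>+z. ennreal \<bar>heat_kernel a (z + d) + heat_kernel a (z - d) - 2 * heat_kernel a z\<bar> \<partial>lborel)
      \<le> (\<integral>\<^sup>+z. ennreal (?k / 2) * ennreal (heat_kernel a z) + ennreal (?k * (4 * exp 1 * c)) * ennreal (heat_kernel (2 * a) (z::'a)) \<partial>lborel)"
    proof (rule nn_integral_mono)
      fix z :: 'a
      have nn: "0 \<le> ?k / 2" "0 \<le> ?k * (4 * exp 1 * c)" using a by (auto simp: c_def)
      then have "ennreal (?k / 2 * heat_kernel a z + ?k * (4 * exp 1 * c) * heat_kernel (2 * a) z) = ennreal (?k / 2) * ennreal (heat_kernel a z) + ennreal (?k * (4 * exp 1 * c)) * ennreal (heat_kernel (2 * a) z)"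
        by (simp only: ennreal_mult ennreal_plus mult_nonneg_nonneg heat_kernel_nonneg)
      then show "ennreal \<bar>heat_kernel a (z + d) + heat_kernel a (z - d) - 2 * heat_kernel a z\<bar> \<le> ennreal (?k / 2) * ennreal (heat_kernel a z) + ennreal (?k * (4 * exp 1 * c)) * ennreal (heat_kernel (2 * a) z)"
        using ennreal_leI[OF pt[of z]] by simp
    qed
    also have "\<dots> = ennreal (?k / 2) + ennreal (?k * (4 * exp 1 * c))"
      using a by (simp add: nn_integral_add nn_integral_cmult)
    also have "\<dots> = ennreal (?k / 2 + ?k * (4 * exp 1 * c))"
      using a by (intro ennreal_plus[symmetric]) (auto simp: c_def)
    also have "?k / 2 + ?k * (4 * exp 1 * c) = C * (norm d)\<^sup>2 / a"
    proof -
      have "k / 2 + k * B = (1 / 2 + B) * k" for k B :: real by (simp add: algebra_simps)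
      from this[of ?k "4 * exp 1 * c"] show ?thesis by (simp only: C_def times_divide_eq_right)
    qed
    finally show ?thesis .
  qed
  moreover have "0 < C" by (simp add: C_def c_def add_pos_pos)
  ultimately show ?thesis using that by blast
qed

lemma nn_integral_heat_kernel_shift:
  assumes "0 < a"
  shows "(\<integral>\<^sup>+z. ennreal (heat_kernel a (z + d)) \<partial>lborel) = 1" "(\<integral>\<^sup>+z. ennreal (heat_kernel a (z - d)) \<partial>lborel) = 1"
  using nn_integral_heat_kernel_diff'[OF assms, of "- d"] nn_integral_heat_kernel_diff'[OF assms, of d] by simp_all

text \<open>The natural scale is a = |d|^2. Below it the four kernels are bounded by their masses,
  and a^(s - 1) is integrable at 0 because s > 0. Above it the gain |d|^2/a leads to a^(s - 2),
  integrable at infinity because s < 1. Both parts are of size |d|^(2 s).\<close>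

lemma pk_second_difference_L1:
  fixes s :: real
  assumes s: "0 < s" "s < 1"
  obtains C where "0 < C"
    "\<And>d::'a::euclidean_space. (\<integral>\<^sup>+a. \<integral>\<^sup>+z. ennreal \<bar>pk s a (z + d) + pk s a (z - d) - 2 * pk s a z\<bar> \<partial>lborel \<partial>lborel) \<le> ennreal (C * norm d powr (2 * s))"
proof -
  obtain C where C: "0 < C"
    "\<And>a (d::'a). 0 < a \<Longrightarrow> (norm d)\<^sup>2 \<le> a \<Longrightarrow>
      (\<integral>\<^sup>+z. ennreal \<bar>heat_kernel a (z + d) + heat_kernel a (z - d) - 2 * heat_kernel a z\<bar> \<partial>lborel) \<le> ennreal (C * (norm d)\<^sup>2 / a)"
    by (rule heat_kernel_second_difference_L1) blast
  define C' where "C' = 4 / s + C / (1 - s)"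
  have "(\<integral>\<^sup>+a. \<integral>\<^sup>+z. ennreal \<bar>pk s a (z + d) + pk s a (z - d) - 2 * pk s a z\<bar> \<partial>lborel \<partial>lborel) \<le> ennreal (C' * norm d powr (2 * s))" for d :: 'a
  proof (cases "d = 0")
    case True
    then show ?thesis by simp
  next
    case False
    define q where "q = (norm d)\<^sup>2"
    have q: "0 < q" using False by (simp add: q_def)
    have ptw: "(\<integral>\<^sup>+z. ennreal \<bar>pk s a (z + d) + pk s a (z - d) - 2 * pk s a z\<bar> \<partial>lborel)
      \<le> ennreal 4 * (ennreal (a powr (s - 1)) * indicator {0<..<q} a) + ennreal (C * q) * (ennreal (a powr (s - 2)) * indicator {q..} a)" for a
    proof (cases "0 < a")
      case False
      then show ?thesis by (simp add: pk_def)
    next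
      case a: True
      let ?D = "\<lambda>z::'a. heat_kernel a (z + d) + heat_kernel a (z - d) - 2 * heat_kernel a z"
      have "pk s a (z + d) + pk s a (z - d) - 2 * pk s a z = a powr (s - 1) * ?D z" for z
        using a by (simp add: pk_def algebra_simps)
      then have "(\<integral>\<^sup>+z. ennreal \<bar>pk s a (z + d) + pk s a (z - d) - 2 * pk s a z\<bar> \<partial>lborel) = (\<integral>\<^sup>+z. ennreal (a powr (s - 1)) * ennreal \<bar>?D z\<bar> \<partial>lborel)"
        by (simp add: abs_mult ennreal_mult)
      also have "\<dots> = ennreal (a powr (s - 1)) * (\<integral>\<^sup>+z. ennreal \<bar>?D z\<bar> \<partial>lborel)"
        by (rule nn_integral_cmult) measurable
      finally have eq: "(\<integral>\<^sup>+z. ennreal \<bar>pk s a (z + d) + pk s a (z - d) - 2 * pk s a z\<bar> \<partial>lborel) = ennreal (a powr (s - 1)) * (\<integral>\<^sup>+z. ennreal \<bar>?D z\<bar> \<partial>lborel)" .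
      show ?thesis
      proof (cases "q \<le> a")
        case True
        have "ennreal (a powr (s - 1)) * (\<integral>\<^sup>+z. ennreal \<bar>?D z\<bar> \<partial>lborel) \<le> ennreal (a powr (s - 1)) * ennreal (C * q / a)"
          using C(2)[OF a, of d] True by (intro mult_left_mono) (auto simp: q_def)
        also have "\<dots> = ennreal (C * q) * ennreal (a powr (s - 2))"
        proof -
          have "a powr (s - 2) = a powr (s - 1) / a" using a powr_diff[of a "s - 1" 1] by simp
          then show ?thesis using a C(1) q by (simp add: ennreal_mult[symmetric] mult_ac)
        qed
        finally show ?thesis using eq True a by simp
      next
        case False
        have "(\<integral>\<^sup>+z. ennreal \<bar>?D z\<bar> \<partial>lborel) \<le> (\<integral>\<^sup>+z. ennreal (heat_kernel a (z + d)) + (ennreal (heat_kernel a (z - d)) + ennreal 2 * ennreal (heat_kernel a z)) \<partial>lborel)"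
        proof (rule nn_integral_mono)
          fix z :: 'a
          have "\<bar>?D z\<bar> \<le> heat_kernel a (z + d) + (heat_kernel a (z - d) + 2 * heat_kernel a z)"
            using heat_kernel_nonneg[of a "z + d"] heat_kernel_nonneg[of a "z - d"] heat_kernel_nonneg[of a z] by linarith
          then have "ennreal \<bar>?D z\<bar> \<le> ennreal (heat_kernel a (z + d) + (heat_kernel a (z - d) + 2 * heat_kernel a z))" by (rule ennreal_leI)
          then show "ennreal \<bar>?D z\<bar> \<le> ennreal (heat_kernel a (z + d)) + (ennreal (heat_kernel a (z - d)) + ennreal 2 * ennreal (heat_kernel a z))"
            by (simp add: ennreal_mult)
        qed
        also have "\<dots> = 1 + (1 + ennreal 2 * 1)"
          using a by (simp add: nn_integral_add nn_integral_cmult nn_integral_heat_kernel_shift)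
        also have "\<dots> = ennreal 4" by simp
        finally have "ennreal (a powr (s - 1)) * (\<integral>\<^sup>+z. ennreal \<bar>?D z\<bar> \<partial>lborel) \<le> ennreal (a powr (s - 1)) * ennreal 4"
          by (rule mult_left_mono) simp
        then show ?thesis using eq False a by (simp add: mult.commute)
      qed
    qed
    have "(\<integral>\<^sup>+a. \<integral>\<^sup>+z. ennreal \<bar>pk s a (z + d) + pk s a (z - d) - 2 * pk s a z\<bar> \<partial>lborel \<partial>lborel)
      \<le> (\<integral>\<^sup>+a. ennreal 4 * (ennreal (a powr (s - 1)) * indicator {0<..<q} a) + ennreal (C * q) * (ennreal (a powr (s - 2)) * indicator {q..} a) \<partial>lborel)"
      by (rule nn_integral_mono[OF ptw])
    also have "\<dots> = ennreal 4 * ennreal (q powr s / s) + ennreal (C * q) * ennreal (q powr (s - 1) / (1 - s))"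
      using s q nn_integral_powr_0[of "s - 1" q] nn_integral_powr_inf[of "s - 2" q]
      by (simp add: nn_integral_add nn_integral_cmult del: ennreal_numeral)
    also have "\<dots> = ennreal (4 * (q powr s / s) + C * q * (q powr (s - 1) / (1 - s)))"
    proof -
      have "ennreal (a * b + c * d) = ennreal a * ennreal b + ennreal c * ennreal d" if "0 \<le> a" "0 \<le> b" "0 \<le> c" "0 \<le> d" for a b c d :: real
        using that by (simp only: ennreal_mult ennreal_plus mult_nonneg_nonneg)
      from this[of 4 "q powr s / s" "C * q" "q powr (s - 1) / (1 - s)", symmetric] show ?thesis
        using s q C(1) by (simp only: divide_nonneg_nonneg powr_ge_zero less_imp_le zero_le_numeral mult_nonneg_nonneg diff_ge_0_iff_ge)
    qed
    also have "4 * (q powr s / s) + C * q * (q powr (s - 1) / (1 - s)) = C' * q powr s"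
    proof -
      have "q * q powr (s - 1) = q powr s" using q powr_add[of q 1 "s - 1"] by simp
      then have "C * q * (q powr (s - 1) / (1 - s)) = C / (1 - s) * q powr s" by (metis mult.assoc times_divide_eq_left times_divide_eq_right)
      then show ?thesis by (simp add: C'_def distrib_right)
    qed
    also have "q powr s = norm d powr (2 * s)"
    proof -
      have "q = norm d powr 2" by (simp add: q_def)
      then show ?thesis by (simp only: powr_powr)
    qed
    finally show ?thesis .
  qed
  moreover have "0 < C'" using C(1) s by (simp add: C'_def add_pos_pos)
  ultimately show ?thesis using that by blast
qed


lemma pk_has_derivative:
  fixes z :: "'a::euclidean_space"
  assumes a: "0 < a"
  shows "((\<lambda>a. a powr (\<beta> - 1) * heat_kernel a z) has_real_derivative
    (pk \<beta> a z * ((norm z)\<^sup>2 / (4 * a\<^sup>2) - (1 - \<beta> + real DIM('a) / 2) / a))) (at a)"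
proof -
  define \<nu> c where "\<nu> = \<beta> - 1 - real DIM('a) / 2" and "c = (4 * pi) powr (- (real DIM('a) / 2))"
  define F where "F = (\<lambda>a. c * a powr \<nu> * exp (- ((norm z)\<^sup>2 / 4) * inverse a))"
  have eq: "b powr (\<beta> - 1) * heat_kernel b z = F b" if "0 < b" for b
  proof -
    have "b powr \<nu> = b powr (\<beta> - 1) * b powr (- (real DIM('a) / 2))"
      by (subst powr_add[symmetric]) (simp add: \<nu>_def)
    moreover have "(4 * pi * b) powr (- (real DIM('a) / 2)) = c * b powr (- (real DIM('a) / 2))"
      unfolding c_def by (rule powr_mult)
    moreover have "- (norm z)\<^sup>2 / (4 * b) = - ((norm z)\<^sup>2 / 4) * inverse b" using that by (simp add: field_simps)
    ultimately show ?thesis by (simp only: F_def heat_kernel_def mult_ac)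
  qed
  have "(F has_real_derivative (F a * ((norm z)\<^sup>2 / (4 * a\<^sup>2) + \<nu> / a))) (at a)"
  proof -
    have dp: "((\<lambda>a. a powr \<nu>) has_real_derivative (\<nu> * a powr (\<nu> - 1))) (at a)"
      using a by (rule has_real_derivative_powr)
    have de: "((\<lambda>a. exp (- ((norm z)\<^sup>2 / 4) * inverse a)) has_real_derivative
        (exp (- ((norm z)\<^sup>2 / 4) * inverse a) * (- ((norm z)\<^sup>2 / 4) * - (inverse a * inverse a)))) (at a)"
      using a by (auto intro!: derivative_eq_intros simp: power2_eq_square)
    have "(F has_real_derivative (c * (\<nu> * a powr (\<nu> - 1)) * exp (- ((norm z)\<^sup>2 / 4) * inverse a)
       + c * a powr \<nu> * (exp (- ((norm z)\<^sup>2 / 4) * inverse a) * (- ((norm z)\<^sup>2 / 4) * - (inverse a * inverse a))))) (at a)"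
      unfolding F_def by (rule DERIV_cong[OF DERIV_mult[OF DERIV_cmult[OF dp, of c] de]]) (simp only: mult_ac)
    also have "c * (\<nu> * a powr (\<nu> - 1)) * exp (- ((norm z)\<^sup>2 / 4) * inverse a)
       + c * a powr \<nu> * (exp (- ((norm z)\<^sup>2 / 4) * inverse a) * (- ((norm z)\<^sup>2 / 4) * - (inverse a * inverse a)))
       = F a * ((norm z)\<^sup>2 / (4 * a\<^sup>2) + \<nu> / a)"
    proof -
      have 1: "a powr (\<nu> - 1) = a powr \<nu> * inverse a"
      proof -
        have "a powr (\<nu> - 1) = a powr \<nu> / a" using powr_diff[of a \<nu> 1] a by simp
        then show ?thesis by (simp only: divide_inverse)
      qed
      have 2: "(norm z)\<^sup>2 / (4 * a\<^sup>2) = (norm z)\<^sup>2 / 4 * (inverse a * inverse a)" "\<nu> / a = \<nu> * inverse a"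
        using a by (simp_all add: power2_eq_square field_simps)
      have "c * (\<nu> * (P * y)) * E + c * P * (E * (- N * - (y * y))) = c * P * E * (N * (y * y) + \<nu> * y)" for P y E N :: real
        by (simp add: algebra_simps)
      then show ?thesis unfolding F_def 1 2 by blast
    qed
    finally show ?thesis .
  qed
  then have "((\<lambda>a. a powr (\<beta> - 1) * heat_kernel a z) has_real_derivative (F a * ((norm z)\<^sup>2 / (4 * a\<^sup>2) + \<nu> / a))) (at a)"
    by (rule has_field_derivative_transform_within_open[where S = "{0<..}"]) (use a in \<open>auto simp: eq\<close>)
  moreover have "F a * ((norm z)\<^sup>2 / (4 * a\<^sup>2) + \<nu> / a) = pk \<beta> a z * ((norm z)\<^sup>2 / (4 * a\<^sup>2) - (1 - \<beta> + real DIM('a) / 2) / a)"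
  proof -
    have "\<nu> / a = - ((1 - \<beta> + real DIM('a) / 2) / a)" by (simp add: \<nu>_def diff_divide_distrib add_divide_distrib)
    then show ?thesis using a eq[OF a] by (simp add: pk_def)
  qed
  ultimately show ?thesis by simp
qed

lemma pk_increment:
  fixes z :: "'a::euclidean_space"
  assumes a: "0 < a" "a < b" and \<beta>: "\<beta> \<le> 1"
  obtains \<xi> where "a < \<xi>" "\<xi> < b"
    "\<bar>pk \<beta> b z - pk \<beta> a z\<bar> \<le> (b - a) * (pk \<beta> \<xi> z * ((norm z)\<^sup>2 / (4 * \<xi>\<^sup>2) + (1 - \<beta> + real DIM('a) / 2) / \<xi>))"
proof -
  let ?F = "\<lambda>a. a powr (\<beta> - 1) * heat_kernel a z"
  let ?F' = "\<lambda>a. pk \<beta> a z * ((norm z)\<^sup>2 / (4 * a\<^sup>2) - (1 - \<beta> + real DIM('a) / 2) / a)"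
  have "\<exists>\<xi>. a < \<xi> \<and> \<xi> < b \<and> ?F b - ?F a = (b - a) * ?F' \<xi>"
    using a by (intro MVT2 pk_has_derivative) auto
  then obtain \<xi> where \<xi>: "a < \<xi>" "\<xi> < b" "?F b - ?F a = (b - a) * ?F' \<xi>" by blast
  have "\<bar>pk \<beta> b z - pk \<beta> a z\<bar> = (b - a) * (pk \<beta> \<xi> z * \<bar>(norm z)\<^sup>2 / (4 * \<xi>\<^sup>2) - (1 - \<beta> + real DIM('a) / 2) / \<xi>\<bar>)"
    using \<xi> a by (simp add: pk_def[of \<beta> b] pk_def[of \<beta> a] abs_mult)
  also have "\<dots> \<le> (b - a) * (pk \<beta> \<xi> z * ((norm z)\<^sup>2 / (4 * \<xi>\<^sup>2) + (1 - \<beta> + real DIM('a) / 2) / \<xi>))"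
  proof (intro mult_left_mono)
    have "0 \<le> (norm z)\<^sup>2 / (4 * \<xi>\<^sup>2)" "0 \<le> (1 - \<beta> + real DIM('a) / 2) / \<xi>" using \<xi> a \<beta> by auto
    then show "\<bar>(norm z)\<^sup>2 / (4 * \<xi>\<^sup>2) - (1 - \<beta> + real DIM('a) / 2) / \<xi>\<bar> \<le> (norm z)\<^sup>2 / (4 * \<xi>\<^sup>2) + (1 - \<beta> + real DIM('a) / 2) / \<xi>"
      by linarith
  qed (use a in auto)
  finally show ?thesis using that \<xi> by blast
qed

text \<open>All variances between a and 2 a are dominated by one kernel. This removes the
  intermediate point of the mean value theorem, which depends on z and therefore obstructs the
  integration over z.\<close>

lemma heat_kernel_dilate:
  fixes z :: "'a::euclidean_space"
  assumes "0 < a" "a \<le> b" "b \<le> 2 * a"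
  shows "heat_kernel b z \<le> 2 powr (real DIM('a) / 2) * heat_kernel (2 * a) z"
proof -
  have "(4 * pi * b) powr (- (real DIM('a) / 2)) \<le> (4 * pi * a) powr (- (real DIM('a) / 2))"
    using assms by (intro powr_mono2') auto
  moreover have "exp (- (norm z)\<^sup>2 / (4 * b)) \<le> exp (- (norm z)\<^sup>2 / (4 * (2 * a)))"
  proof -
    have "(norm z)\<^sup>2 / (4 * (2 * a)) \<le> (norm z)\<^sup>2 / (4 * b)" using assms by (intro divide_left_mono) auto
    then show ?thesis by simp
  qed
  ultimately have "heat_kernel b z \<le> (4 * pi * a) powr (- (real DIM('a) / 2)) * exp (- (norm z)\<^sup>2 / (4 * (2 * a)))"
    unfolding heat_kernel_def by (intro mult_mono) auto
  also have "(4 * pi * a) powr (- (real DIM('a) / 2)) = 2 powr (real DIM('a) / 2) * (4 * pi * (2 * a)) powr (- (real DIM('a) / 2))"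
  proof -
    have "2 powr (real DIM('a) / 2) * 2 powr (- (real DIM('a) / 2)) = (1::real)" by (simp add: powr_add[symmetric])
    moreover have "(4 * pi * (2 * a)) powr (- (real DIM('a) / 2)) = 2 powr (- (real DIM('a) / 2)) * (4 * pi * a) powr (- (real DIM('a) / 2))"
      unfolding powr_mult[symmetric] by (simp add: mult_ac)
    ultimately show ?thesis by simp
  qed
  finally show ?thesis by (simp add: heat_kernel_def)
qed

lemma nn_integral_heat_kernel_sum:
  assumes "0 < a" "0 < b"
  shows "(\<integral>\<^sup>+z. K * (P * ennreal (heat_kernel a z) + Q * ennreal (heat_kernel b (z::'a::euclidean_space))) \<partial>lborel) = K * (P + Q)"
  using assms by (simp add: nn_integral_cmult nn_integral_add)

text \<open>The natural scale is a = h. For a \<ge> h the derivative in a costs one power of a, once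
  |z|^2/a^2 is absorbed by \<open>heat_kernel_moment\<close>, and gives h a^(s - 2). For a < h the
  two kernels are bounded separately by their masses, and those that do not vanish have lags in (0,
  2 h).\<close>

lemma pk_time_L1:
  fixes s :: real
  assumes s: "0 < s" "s < 1"
  obtains C where "0 < C"
    "\<And>h. 0 < h \<Longrightarrow> (\<integral>\<^sup>+a. \<integral>\<^sup>+z. ennreal \<bar>pk s (a + h) z - pk s a (z::'a::euclidean_space)\<bar> \<partial>lborel \<partial>lborel) \<le> ennreal (C * h powr s)"
proof -
  obtain C0 where C0: "0 < C0"
    "\<And>a (z::'a). 0 < a \<Longrightarrow> norm z powr 2 * heat_kernel a z \<le> C0 * a powr (2 / 2) * heat_kernel (2 * a) z"
    by (rule heat_kernel_moment[of 2]) auto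
  define m c where "m = 1 - s + real DIM('a) / 2" and "c = 2 powr (real DIM('a) / 2)"
  have c: "1 \<le> c" "0 < c" by (auto simp: c_def ge_one_powr_ge_zero)
  have m: "0 < m" using s by (simp add: m_def add_pos_nonneg)
  define D where "D = (C0 / 4 * c + m * c)"
  have D: "0 < D" using C0(1) c m by (simp add: D_def add_pos_pos)
  have pt: "\<bar>pk s (a + h) z - pk s a z\<bar> \<le> h * (a powr (s - 2) * (C0 / 4 * c * heat_kernel (4 * a) z + m * c * heat_kernel (2 * a) z))"
    if a: "0 < a" and h: "0 < h" "h \<le> a" for a h and z :: 'a
  proof -
    obtain \<xi> where \<xi>: "a < \<xi>" "\<xi> < a + h"
      "\<bar>pk s (a + h) z - pk s a z\<bar> \<le> (a + h - a) * (pk s \<xi> z * ((norm z)\<^sup>2 / (4 * \<xi>\<^sup>2) + (1 - s + real DIM('a) / 2) / \<xi>))"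
      using pk_increment[of a "a + h" s z] a h s by auto
    have \<xi>2: "\<xi> \<le> 2 * a" "0 < \<xi>" using \<xi> h a by auto
    have e: "\<xi> powr (s - 1) / \<xi> = \<xi> powr (s - 2)" using powr_diff[of \<xi> "s - 1" 1] \<xi>2 by simp
    have "pk s \<xi> z * ((norm z)\<^sup>2 / (4 * \<xi>\<^sup>2) + m / \<xi>) = (\<xi> powr (s - 1) / \<xi>) * (heat_kernel \<xi> z * (norm z)\<^sup>2 / (4 * \<xi>) + m * heat_kernel \<xi> z)"
      using \<xi>2 by (simp add: pk_def power2_eq_square field_simps)
    also have "\<dots> \<le> a powr (s - 2) * (C0 / 4 * c * heat_kernel (4 * a) z + m * c * heat_kernel (2 * a) z)"
      unfolding e
    proof (rule mult_mono[OF _ add_mono])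
      show "\<xi> powr (s - 2) \<le> a powr (s - 2)" using \<xi> a s by (intro powr_mono2') auto
      have "heat_kernel \<xi> z * (norm z)\<^sup>2 \<le> C0 * \<xi> * heat_kernel (2 * \<xi>) z"
        using C0(2)[OF \<xi>2(2), of z] \<xi>2 by (simp add: mult.commute)
      also have "\<dots> \<le> C0 * \<xi> * (c * heat_kernel (4 * a) z)"
        using heat_kernel_dilate[of "2 * a" "2 * \<xi>" z] C0(1) \<xi> \<xi>2 a by (intro mult_left_mono) (auto simp: c_def)
      finally have "heat_kernel \<xi> z * (norm z)\<^sup>2 / (4 * \<xi>) \<le> C0 * \<xi> * (c * heat_kernel (4 * a) z) / (4 * \<xi>)"
        using \<xi>2 by (intro divide_right_mono) auto
      also have "\<dots> = C0 / 4 * c * heat_kernel (4 * a) z" using \<xi>2 by simp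
      finally show "heat_kernel \<xi> z * (norm z)\<^sup>2 / (4 * \<xi>) \<le> C0 / 4 * c * heat_kernel (4 * a) z" .
      have "heat_kernel \<xi> z \<le> c * heat_kernel (2 * a) z"
        using heat_kernel_dilate[of a \<xi> z] \<xi> \<xi>2 a by (simp add: c_def)
      then show "m * heat_kernel \<xi> z \<le> m * c * heat_kernel (2 * a) z" using m by (simp add: mult.assoc)
    qed (use \<xi>2 m in auto)
    finally have "pk s \<xi> z * ((norm z)\<^sup>2 / (4 * \<xi>\<^sup>2) + m / \<xi>) \<le> a powr (s - 2) * (C0 / 4 * c * heat_kernel (4 * a) z + m * c * heat_kernel (2 * a) z)" .
    then have "h * (pk s \<xi> z * ((norm z)\<^sup>2 / (4 * \<xi>\<^sup>2) + m / \<xi>)) \<le> h * (a powr (s - 2) * (C0 / 4 * c * heat_kernel (4 * a) z + m * c * heat_kernel (2 * a) z))"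
      using h by (intro mult_left_mono) auto
    then show ?thesis using \<xi>(3) by (simp add: m_def)
  qed
  define C' where "C' = 2 * (2 powr s / s) + D / (1 - s)"
  have "(\<integral>\<^sup>+a. \<integral>\<^sup>+z. ennreal \<bar>pk s (a + h) z - pk s a (z::'a)\<bar> \<partial>lborel \<partial>lborel) \<le> ennreal (C' * h powr s)" if h: "0 < h" for h
  proof -
    have pkint: "(\<integral>\<^sup>+z. ennreal (pk s a (z::'a)) \<partial>lborel) = ennreal (a powr (s - 1)) * indicator {0<..} a" for a
    proof (cases "0 < a")
      case True
      then show ?thesis by (simp add: pk_def ennreal_mult nn_integral_cmult)
    qed (simp add: pk_def)
    have ptw: "(\<integral>\<^sup>+z. ennreal \<bar>pk s (a + h) z - pk s a (z::'a)\<bar> \<partial>lborel)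
      \<le> (ennreal ((a + h) powr (s - 1)) * indicator {0<..<2 * h} (a + h) + ennreal (a powr (s - 1)) * indicator {0<..<2 * h} a)
        + ennreal (D * h) * (ennreal (a powr (s - 2)) * indicator {h..} a)" for a
    proof (cases "h \<le> a")
      case True
      then have a: "0 < a" using h by simp
      have "(\<integral>\<^sup>+z. ennreal \<bar>pk s (a + h) z - pk s a (z::'a)\<bar> \<partial>lborel)
        \<le> (\<integral>\<^sup>+z. ennreal (h * a powr (s - 2)) * (ennreal (C0 / 4 * c) * ennreal (heat_kernel (4 * a) (z::'a)) + ennreal (m * c) * ennreal (heat_kernel (2 * a) z)) \<partial>lborel)"
      proof (rule nn_integral_mono)
        fix z :: 'a
        have "ennreal \<bar>pk s (a + h) z - pk s a z\<bar> \<le> ennreal ((h * a powr (s - 2)) * ((C0 / 4 * c) * heat_kernel (4 * a) z + (m * c) * heat_kernel (2 * a) z))"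
          using pt[OF a h True, of z] by (intro ennreal_leI) (simp add: mult.assoc)
        also have "\<dots> = ennreal (h * a powr (s - 2)) * (ennreal (C0 / 4 * c) * ennreal (heat_kernel (4 * a) z) + ennreal (m * c) * ennreal (heat_kernel (2 * a) z))"
        proof -
          have "ennreal (k * (p * q + p' * q')) = ennreal k * (ennreal p * ennreal q + ennreal p' * ennreal q')"
            if "0 \<le> k" "0 \<le> p" "0 \<le> q" "0 \<le> p'" "0 \<le> q'" for k p q p' q' :: real
            using that by (simp only: ennreal_mult ennreal_plus mult_nonneg_nonneg add_nonneg_nonneg)
          from this[of "h * a powr (s - 2)" "C0 / 4 * c" "heat_kernel (4 * a) z" "m * c" "heat_kernel (2 * a) z"]
          show ?thesis using h C0(1) c m
            by (simp only: divide_nonneg_nonneg powr_ge_zero less_imp_le zero_le_numeral mult_nonneg_nonneg heat_kernel_nonneg)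
        qed
        finally show "ennreal \<bar>pk s (a + h) z - pk s a z\<bar> \<le> ennreal (h * a powr (s - 2)) * (ennreal (C0 / 4 * c) * ennreal (heat_kernel (4 * a) z) + ennreal (m * c) * ennreal (heat_kernel (2 * a) z))" .
      qed
      also have "\<dots> = ennreal (h * a powr (s - 2)) * (ennreal (C0 / 4 * c) * 1 + ennreal (m * c) * 1)"
        unfolding mult_1_right using a by (intro nn_integral_heat_kernel_sum) auto
      also have "\<dots> = ennreal (D * h) * ennreal (a powr (s - 2))"
      proof -
        have "ennreal (C0 / 4 * c) * 1 + ennreal (m * c) * 1 = ennreal D"
          using C0(1) c m by (simp add: D_def ennreal_plus)
        moreover have "ennreal (h * a powr (s - 2)) * ennreal D = ennreal (D * h) * ennreal (a powr (s - 2))"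
        proof -
          have "ennreal (h * a powr (s - 2)) = ennreal h * ennreal (a powr (s - 2))" using h by (intro ennreal_mult) auto
          moreover have "ennreal (D * h) = ennreal D * ennreal h" using h D by (intro ennreal_mult) auto
          ultimately show ?thesis by (simp only: mult_ac)
        qed
        ultimately show ?thesis by simp
      qed
      finally show ?thesis using True by (simp add: add_increasing)
    next
      case False
      have "(\<integral>\<^sup>+z. ennreal \<bar>pk s (a + h) z - pk s a (z::'a)\<bar> \<partial>lborel) \<le> (\<integral>\<^sup>+z. ennreal (pk s (a + h) z) + ennreal (pk s a (z::'a)) \<partial>lborel)"
      proof (rule nn_integral_mono)
        fix z :: 'a
        have "\<bar>pk s (a + h) z - pk s a z\<bar> \<le> pk s (a + h) z + pk s a z"
          using pk_nonneg[of s "a + h" z] pk_nonneg[of s a z] by linarith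
        then show "ennreal \<bar>pk s (a + h) z - pk s a z\<bar> \<le> ennreal (pk s (a + h) z) + ennreal (pk s a z)"
          by (simp add: ennreal_plus[symmetric] ennreal_leI del: ennreal_plus)
      qed
      also have "\<dots> = ennreal ((a + h) powr (s - 1)) * indicator {0<..} (a + h) + ennreal (a powr (s - 1)) * indicator {0<..} a"
        by (simp add: nn_integral_add pkint)
      finally show ?thesis using False h by (auto simp: indicator_def split: if_splits)
    qed
    have sh: "(\<integral>\<^sup>+a. ennreal ((a + h) powr (s - 1)) * indicator {0<..<2 * h} (a + h) \<partial>lborel) = (\<integral>\<^sup>+a. ennreal (a powr (s - 1)) * indicator {0<..<2 * h} a \<partial>lborel)"
      using nn_integral_lborel_translate[of "\<lambda>a. ennreal (a powr (s - 1)) * indicator {0<..<2 * h} a" h] by (simp add: add.commute)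
    have "(\<integral>\<^sup>+a. \<integral>\<^sup>+z. ennreal \<bar>pk s (a + h) z - pk s a (z::'a)\<bar> \<partial>lborel \<partial>lborel)
      \<le> (\<integral>\<^sup>+a. (ennreal ((a + h) powr (s - 1)) * indicator {0<..<2 * h} (a + h) + ennreal (a powr (s - 1)) * indicator {0<..<2 * h} a)
        + ennreal (D * h) * (ennreal (a powr (s - 2)) * indicator {h..} a) \<partial>lborel)"
      by (rule nn_integral_mono[OF ptw])
    also have "\<dots> = (ennreal ((2 * h) powr s / s) + ennreal ((2 * h) powr s / s)) + ennreal (D * h) * ennreal (h powr (s - 1) / (1 - s))"
      using s h nn_integral_powr_0[of "s - 1" "2 * h"] nn_integral_powr_inf[of "s - 2" h]
      by (simp add: nn_integral_add nn_integral_cmult sh)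
    also have "\<dots> = ennreal (((2 * h) powr s / s + (2 * h) powr s / s) + (D * h) * (h powr (s - 1) / (1 - s)))"
    proof -
      have "ennreal ((p + p) + q * r) = (ennreal p + ennreal p) + ennreal q * ennreal r" if "0 \<le> p" "0 \<le> q" "0 \<le> r" for p q r :: real
        using that by (simp only: ennreal_mult ennreal_plus mult_nonneg_nonneg add_nonneg_nonneg)
      from this[of "(2 * h) powr s / s" "D * h" "h powr (s - 1) / (1 - s)"] show ?thesis
        using s h D by (simp only: divide_nonneg_nonneg powr_ge_zero less_imp_le mult_nonneg_nonneg diff_ge_0_iff_ge)
    qed
    also have "((2 * h) powr s / s + (2 * h) powr s / s) + (D * h) * (h powr (s - 1) / (1 - s)) = C' * h powr s"
    proof -
      have "h * h powr (s - 1) = h powr s" using powr_add[of h 1 "s - 1"] h by simp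
      then have "(D * h) * (h powr (s - 1) / (1 - s)) = D / (1 - s) * h powr s" by (metis mult.assoc times_divide_eq_left times_divide_eq_right)
      moreover have "(2 * h) powr s / s + (2 * h) powr s / s = 2 * (2 powr s / s) * h powr s"
        unfolding powr_mult by simp
      ultimately show ?thesis by (simp only: C'_def distrib_right)
    qed
    finally show ?thesis .
  qed
  moreover have "0 < C'" using s D by (simp add: C'_def add_pos_pos)
  ultimately show ?thesis using that by blast
qed

text \<open>Tail estimates: away from the pole every derivative of the kernel at \<open>(x, t)\<close> is dominated by
  the kernel at a later point over the origin.\<close>

lemma pk_absorb:
  fixes \<beta> :: real
  assumes \<beta>: "\<beta> \<le> 1"
  obtains C where "0 < C"
    "\<And>a e (x::'a::euclidean_space) y. 0 < a \<Longrightarrow> norm x \<le> 5 / 4 \<Longrightarrow> 1 \<le> a \<or> 1 / 2 \<le> norm (x - y) \<Longrightarrow> 2 \<le> e \<Longrightarrow> e \<le> 4 \<Longrightarrow>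
       pk \<beta> a (x - y) * ((1 + 1 / a)\<^sup>2 * (1 + norm (x - y) / a)\<^sup>2 * exp (norm (x - y) / (64 * a)))
         \<le> C * pk \<beta> (a + e) y"
proof -
  define \<nu> where "\<nu> = 1 - \<beta> + real DIM('a) / 2"
  have nu: "0 \<le> \<nu>" using \<beta> by (simp add: \<nu>_def)
  obtain C where C: "0 < C"
    "\<And>a e (x::'a) y. 0 < a \<Longrightarrow> norm x \<le> 5 / 4 \<Longrightarrow> 1 \<le> a \<or> 1 / 2 \<le> norm (x - y) \<Longrightarrow> 2 \<le> e \<Longrightarrow>
       (1 + 1 / a) powr (\<nu> + 2) * (1 + norm (x - y) / a) powr (\<nu> + 2) * exp (norm (x - y) / (64 * a)) * exp (- (norm (x - y))\<^sup>2 / (4 * a))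
         \<le> C * exp (- (norm y)\<^sup>2 / (4 * (a + e)))"
    by (rule gauss_absorb[of "\<nu> + 2" "5 / 4"]) (use nu in auto)
  define c where "c = (4 * pi) powr (- (real DIM('a) / 2))"
  have pkc: "pk \<beta> a z = c * a powr (- \<nu>) * exp (- (norm z)\<^sup>2 / (4 * a))" if "0 < a" for a and z :: 'a
  proof -
    have "a powr (- \<nu>) = a powr (\<beta> - 1) * a powr (- (real DIM('a) / 2))"
      by (subst powr_add[symmetric]) (simp add: \<nu>_def)
    then show ?thesis using that by (simp add: pk_def heat_kernel_def c_def powr_mult mult_ac)
  qed
  have "pk \<beta> a (x - y) * ((1 + 1 / a)\<^sup>2 * (1 + norm (x - y) / a)\<^sup>2 * exp (norm (x - y) / (64 * a)))
         \<le> (5 powr \<nu> * C) * pk \<beta> (a + e) y"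
    if h: "0 < a" "norm x \<le> 5 / 4" "1 \<le> a \<or> 1 / 2 \<le> norm (x - y)" "2 \<le> e" "e \<le> 4" for a e and x y :: 'a
  proof -
    define r where "r = norm (x - y)"
    have r: "0 \<le> r" by (simp add: r_def)
    have p1: "1 \<le> 1 + 1 / a" "1 \<le> 1 + r / a" using h r by auto
    have sq: "w\<^sup>2 = w powr 2" if "1 \<le> w" for w :: real using that by simp
    have A: "a powr (- \<nu>) \<le> 5 powr \<nu> * (a + e) powr (- \<nu>) * (1 + 1 / a) powr \<nu>"
    proof -
      have "a + e \<le> 5 * (1 + 1 / a) * a" using h by (simp add: algebra_simps)
      then have "(a + e) powr \<nu> \<le> (5 * (1 + 1 / a) * a) powr \<nu>" using h nu by (intro powr_mono2) auto
      also have "\<dots> = 5 powr \<nu> * (1 + 1 / a) powr \<nu> * a powr \<nu>" by (simp only: powr_mult)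
      finally have "(a + e) powr \<nu> \<le> 5 powr \<nu> * (1 + 1 / a) powr \<nu> * a powr \<nu>" .
      then have "(a + e) powr \<nu> * (a powr (- \<nu>) * (a + e) powr (- \<nu>)) \<le> 5 powr \<nu> * (1 + 1 / a) powr \<nu> * a powr \<nu> * (a powr (- \<nu>) * (a + e) powr (- \<nu>))"
        by (rule mult_right_mono) simp
      moreover have "(a + e) powr \<nu> * (a + e) powr (- \<nu>) = 1" "a powr \<nu> * a powr (- \<nu>) = 1"
        using h by (simp_all add: powr_add[symmetric])
      moreover have "(a + e) powr \<nu> * (a powr (- \<nu>) * (a + e) powr (- \<nu>)) = a powr (- \<nu>) * ((a + e) powr \<nu> * (a + e) powr (- \<nu>))"
        "5 powr \<nu> * (1 + 1 / a) powr \<nu> * a powr \<nu> * (a powr (- \<nu>) * (a + e) powr (- \<nu>)) = 5 powr \<nu> * (a + e) powr (- \<nu>) * (1 + 1 / a) powr \<nu> * (a powr \<nu> * a powr (- \<nu>))"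
        by (simp_all only: mult_ac)
      ultimately show ?thesis by simp
    qed
    have B: "(1 + r / a)\<^sup>2 \<le> (1 + r / a) powr (\<nu> + 2)"
      unfolding sq[OF p1(2)] using p1 nu by (intro powr_mono) auto
    have B1: "(1 + 1 / a) powr \<nu> * (1 + 1 / a)\<^sup>2 = (1 + 1 / a) powr (\<nu> + 2)"
      unfolding sq[OF p1(1)] powr_add ..
    define E where "E = exp (r / (64 * a)) * exp (- r\<^sup>2 / (4 * a))"
    have E: "0 \<le> E" by (simp add: E_def)
    have c: "0 \<le> c" by (simp add: c_def)
    have "pk \<beta> a (x - y) * ((1 + 1 / a)\<^sup>2 * (1 + r / a)\<^sup>2 * exp (r / (64 * a)))
       = (c * (1 + 1 / a)\<^sup>2 * E) * (a powr (- \<nu>) * (1 + r / a)\<^sup>2)"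
      unfolding pkc[OF h(1)] r_def[symmetric] E_def by (simp only: mult_ac)
    also have "\<dots> \<le> (c * (1 + 1 / a)\<^sup>2 * E) * ((5 powr \<nu> * (a + e) powr (- \<nu>) * (1 + 1 / a) powr \<nu>) * (1 + r / a) powr (\<nu> + 2))"
      using A B c E by (intro mult_left_mono mult_mono) auto
    also have "\<dots> = c * 5 powr \<nu> * (a + e) powr (- \<nu>) * (((1 + 1 / a) powr \<nu> * (1 + 1 / a)\<^sup>2) * (1 + r / a) powr (\<nu> + 2) * exp (r / (64 * a)) * exp (- r\<^sup>2 / (4 * a)))"
      unfolding E_def by (simp only: mult_ac)
    also have "\<dots> \<le> c * 5 powr \<nu> * (a + e) powr (- \<nu>) * (C * exp (- (norm y)\<^sup>2 / (4 * (a + e))))"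
      unfolding B1 r_def using C(2)[OF h(1-4)] c by (intro mult_left_mono) auto
    also have "\<dots> = (5 powr \<nu> * C) * pk \<beta> (a + e) y"
      using h by (subst pkc) (auto simp: mult_ac)
    finally show ?thesis unfolding r_def .
  qed
  moreover have "0 < 5 powr \<nu> * C" using C(1) by simp
  ultimately show ?thesis using that by blast
qed

text \<open>Each of the three quantities is at most the kernel times a factor that
  \<open>pk_absorb\<close> covers. The bound |d| \<le> 1/32 turns the exponential of
  \<open>heat_kernel_second_difference\<close> into exp(|x - y|/(64 a)). In the time increment
  \<open>a\<close> may be nonpositive: then the kernel at \<open>a\<close> vanishes, and the factor
  b - a \<ge> b is gained from one inverse power of b.\<close>

lemma pk_tail:
  fixes \<beta> :: real
  assumes \<beta>: "\<beta> \<le> 1"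
  obtains C where "0 < C"
    "\<And>a e (x::'a::euclidean_space) y. 0 < a \<Longrightarrow> norm x \<le> 5 / 4 \<Longrightarrow> 1 \<le> a \<or> 1 / 2 \<le> norm (x - y) \<Longrightarrow> 2 \<le> e \<Longrightarrow> e \<le> 4 \<Longrightarrow>
       pk \<beta> a (x - y) \<le> C * pk \<beta> (a + e) y"
    "\<And>a e d (x::'a::euclidean_space) y. 0 < a \<Longrightarrow> norm x \<le> 5 / 4 \<Longrightarrow> 1 \<le> a \<or> 1 / 2 \<le> norm (x - y) \<Longrightarrow> 2 \<le> e \<Longrightarrow> e \<le> 4 \<Longrightarrow> norm d \<le> 1 / 32 \<Longrightarrow>
       \<bar>pk \<beta> a (x - y + d) + pk \<beta> a (x - y - d) - 2 * pk \<beta> a (x - y)\<bar> \<le> C * (norm d)\<^sup>2 * pk \<beta> (a + e) y"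
    "\<And>a b T (x::'a::euclidean_space) y. a < b \<Longrightarrow> norm x \<le> 5 / 4 \<Longrightarrow> 1 \<le> a \<or> 1 / 2 \<le> norm (x - y) \<Longrightarrow> 2 \<le> T - b \<Longrightarrow> T - a \<le> 4 \<Longrightarrow>
       \<bar>pk \<beta> b (x - y) - pk \<beta> a (x - y)\<bar> \<le> C * (b - a) * pk \<beta> T y"
proof -
  obtain C where C: "0 < C"
    "\<And>a e (x::'a) y. 0 < a \<Longrightarrow> norm x \<le> 5 / 4 \<Longrightarrow> 1 \<le> a \<or> 1 / 2 \<le> norm (x - y) \<Longrightarrow> 2 \<le> e \<Longrightarrow> e \<le> 4 \<Longrightarrow>
       pk \<beta> a (x - y) * ((1 + 1 / a)\<^sup>2 * (1 + norm (x - y) / a)\<^sup>2 * exp (norm (x - y) / (64 * a)))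
         \<le> C * pk \<beta> (a + e) y"
    by (rule pk_absorb[OF \<beta>]) blast
  define m where "m = 1 - \<beta> + real DIM('a) / 2"
  have m: "0 \<le> m" using \<beta> by (simp add: m_def)
  define C' where "C' = C * (1 + m)"
  have CC: "0 < C'" using C(1) m by (simp add: C'_def add_pos_nonneg)
  have factor: "1 \<le> (1 + 1 / a)\<^sup>2 * (1 + r / a)\<^sup>2 * exp (r / (64 * a))"
    "1 / a \<le> (1 + 1 / a)\<^sup>2 * (1 + r / a)\<^sup>2 * exp (r / (64 * a))"
    "(r / a)\<^sup>2 / 4 + m / a \<le> (1 + m) * ((1 + 1 / a)\<^sup>2 * (1 + r / a)\<^sup>2 * exp (r / (64 * a)))"
    "1 / (2 * a) + (r / (2 * a))\<^sup>2 * exp (r / (64 * a)) \<le> (1 + 1 / a)\<^sup>2 * (1 + r / a)\<^sup>2 * exp (r / (64 * a))"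
    if a: "0 < a" and r: "0 \<le> r" for a r :: real
  proof -
    define i X E where "i = 1 / a" and "X = r / a" and "E = exp (r / (64 * a))"
    have p: "0 \<le> i" "0 \<le> X" "1 \<le> E" using a r by (auto simp: i_def X_def E_def)
    have "1 + i \<le> (1 + i)\<^sup>2" "1 + X\<^sup>2 \<le> (1 + X)\<^sup>2" using p by (auto simp: power2_eq_square algebra_simps)
    then have "(1 + i) * (1 + X\<^sup>2) \<le> (1 + i)\<^sup>2 * (1 + X)\<^sup>2" using p by (intro mult_mono) auto
    moreover have "0 \<le> i * X\<^sup>2" using p by simp
    ultimately have 0: "1 + i + X\<^sup>2 \<le> (1 + i)\<^sup>2 * (1 + X)\<^sup>2" by (simp add: distrib_left distrib_right)
    have "(1 + i + X\<^sup>2) * E \<le> (1 + i)\<^sup>2 * (1 + X)\<^sup>2 * E" using 0 p by (intro mult_right_mono) auto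
    then have *: "E + i * E + X\<^sup>2 * E \<le> (1 + i)\<^sup>2 * (1 + X)\<^sup>2 * E" by (simp add: distrib_right)
    have iE: "i * 1 \<le> i * E" "X\<^sup>2 * 1 \<le> X\<^sup>2 * E" using mult_left_mono[of 1 E i] mult_left_mono[of 1 E "X\<^sup>2"] p by simp_all
    have nn: "0 \<le> i * E" "0 \<le> X\<^sup>2 * E" "0 \<le> X\<^sup>2" using p by auto
    have 1: "1 \<le> (1 + i)\<^sup>2 * (1 + X)\<^sup>2 * E" using * p nn by linarith
    have 2: "i \<le> (1 + i)\<^sup>2 * (1 + X)\<^sup>2 * E" using * p nn iE by linarith
    have 3: "X\<^sup>2 \<le> (1 + i)\<^sup>2 * (1 + X)\<^sup>2 * E" using * p nn iE by linarith
    show "1 \<le> (1 + 1 / a)\<^sup>2 * (1 + r / a)\<^sup>2 * exp (r / (64 * a))" using 1 by (simp add: i_def X_def E_def)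
    show "1 / a \<le> (1 + 1 / a)\<^sup>2 * (1 + r / a)\<^sup>2 * exp (r / (64 * a))" using 2 by (simp add: i_def X_def E_def)
    have "X\<^sup>2 / 4 + m * i \<le> 1 * ((1 + i)\<^sup>2 * (1 + X)\<^sup>2 * E) + m * ((1 + i)\<^sup>2 * (1 + X)\<^sup>2 * E)"
    proof (rule add_mono)
      show "m * i \<le> m * ((1 + i)\<^sup>2 * (1 + X)\<^sup>2 * E)" by (rule mult_left_mono[OF 2 m])
      show "X\<^sup>2 / 4 \<le> 1 * ((1 + i)\<^sup>2 * (1 + X)\<^sup>2 * E)" using 3 nn(3) by linarith
    qed
    then show "(r / a)\<^sup>2 / 4 + m / a \<le> (1 + m) * ((1 + 1 / a)\<^sup>2 * (1 + r / a)\<^sup>2 * exp (r / (64 * a)))"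
      by (simp add: i_def X_def E_def distrib_right)
    have "i / 2 + X\<^sup>2 / 4 * E \<le> (1 + i)\<^sup>2 * (1 + X)\<^sup>2 * E"
    proof -
      have "i / 2 + Y / 4 \<le> T" if "E + j + Y \<le> T" "i * 1 \<le> j" "0 \<le> i" "0 \<le> Y" "1 \<le> E" for j Y T :: real
        using that by linarith
      from this[OF * iE(1) p(1) nn(2) p(3)] show ?thesis by simp
    qed
    then show "1 / (2 * a) + (r / (2 * a))\<^sup>2 * exp (r / (64 * a)) \<le> (1 + 1 / a)\<^sup>2 * (1 + r / a)\<^sup>2 * exp (r / (64 * a))"
      by (simp add: i_def X_def E_def power_divide)
  qed
  have base: "pk \<beta> a (x - y) * w \<le> C' * pk \<beta> (a + e) y"
    if h: "0 < a" "norm x \<le> 5 / 4" "1 \<le> a \<or> 1 / 2 \<le> norm (x - y)" "2 \<le> e" "e \<le> 4"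
      and w: "w \<le> (1 + m) * ((1 + 1 / a)\<^sup>2 * (1 + norm (x - y) / a)\<^sup>2 * exp (norm (x - y) / (64 * a)))" for a e w and x y :: 'a
  proof -
    have "pk \<beta> a (x - y) * w \<le> pk \<beta> a (x - y) * ((1 + m) * ((1 + 1 / a)\<^sup>2 * (1 + norm (x - y) / a)\<^sup>2 * exp (norm (x - y) / (64 * a))))"
      using w by (rule mult_left_mono) simp
    also have "\<dots> = (1 + m) * (pk \<beta> a (x - y) * ((1 + 1 / a)\<^sup>2 * (1 + norm (x - y) / a)\<^sup>2 * exp (norm (x - y) / (64 * a))))"
      by (simp only: mult_ac)
    also have "\<dots> \<le> (1 + m) * (C * pk \<beta> (a + e) y)" using C(2)[OF h] m by (intro mult_left_mono) auto
    finally show ?thesis by (simp add: C'_def mult_ac)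
  qed
  have scale: "w \<le> (1 + m) * v" if "w \<le> v" "0 \<le> v" for w v :: real
    using that(1) mult_nonneg_nonneg[OF m that(2)] by (simp add: distrib_right)
  have 1: "pk \<beta> a (x - y) \<le> C' * pk \<beta> (a + e) y"
    if h: "0 < a" "norm x \<le> 5 / 4" "1 \<le> a \<or> 1 / 2 \<le> norm (x - y)" "2 \<le> e" "e \<le> 4" for a e and x y :: 'a
    using base[OF h, of 1] scale[OF factor(1)[OF h(1), of "norm (x - y)"]] by simp
  have 2: "\<bar>pk \<beta> a (x - y + d) + pk \<beta> a (x - y - d) - 2 * pk \<beta> a (x - y)\<bar> \<le> C' * (norm d)\<^sup>2 * pk \<beta> (a + e) y"
    if h: "0 < a" "norm x \<le> 5 / 4" "1 \<le> a \<or> 1 / 2 \<le> norm (x - y)" "2 \<le> e" "e \<le> 4" and d: "norm d \<le> 1 / 32" for a e d and x y :: 'a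
  proof -
    define r where "r = norm (x - y)"
    have "r * norm d \<le> r * (1 / 32)" using d by (intro mult_left_mono) (auto simp: r_def)
    then have q: "r * norm d / (2 * a) \<le> r / (64 * a)" using h(1) by (simp add: divide_simps)
    have "\<bar>pk \<beta> a (x - y + d) + pk \<beta> a (x - y - d) - 2 * pk \<beta> a (x - y)\<bar>
      = a powr (\<beta> - 1) * \<bar>heat_kernel a (x - y + d) + heat_kernel a (x - y - d) - 2 * heat_kernel a (x - y)\<bar>"
    proof -
      have "pk \<beta> a (x - y + d) + pk \<beta> a (x - y - d) - 2 * pk \<beta> a (x - y)
        = a powr (\<beta> - 1) * (heat_kernel a (x - y + d) + heat_kernel a (x - y - d) - 2 * heat_kernel a (x - y))"
        using h(1) by (simp add: pk_def algebra_simps)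
      then show ?thesis by (simp add: abs_mult)
    qed
    also have "\<dots> \<le> a powr (\<beta> - 1) * (heat_kernel a (x - y) * ((norm d)\<^sup>2 / (2 * a) + (r * norm d / (2 * a))\<^sup>2 * exp (r * norm d / (2 * a))))"
      unfolding r_def by (intro mult_left_mono heat_kernel_second_difference h) simp
    also have "\<dots> = pk \<beta> a (x - y) * ((norm d)\<^sup>2 * (1 / (2 * a) + (r / (2 * a))\<^sup>2 * exp (r * norm d / (2 * a))))"
      using h(1) by (simp add: pk_def power_mult_distrib power_divide distrib_left mult_ac)
    also have "\<dots> \<le> pk \<beta> a (x - y) * ((norm d)\<^sup>2 * (1 / (2 * a) + (r / (2 * a))\<^sup>2 * exp (r / (64 * a))))"
      using q by (intro mult_left_mono add_left_mono) auto
    also have "\<dots> = (norm d)\<^sup>2 * (pk \<beta> a (x - y) * (1 / (2 * a) + (r / (2 * a))\<^sup>2 * exp (r / (64 * a))))"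
      by (simp only: mult_ac)
    also have "\<dots> \<le> (norm d)\<^sup>2 * (C' * pk \<beta> (a + e) y)"
    proof (rule mult_left_mono)
      show "pk \<beta> a (x - y) * (1 / (2 * a) + (r / (2 * a))\<^sup>2 * exp (r / (64 * a))) \<le> C' * pk \<beta> (a + e) y"
        by (rule base[OF h], rule scale) (use factor(4)[OF h(1), of r] in \<open>auto simp: r_def\<close>)
    qed simp
    finally show ?thesis by (simp only: mult_ac)
  qed
  have 3: "\<bar>pk \<beta> b (x - y) - pk \<beta> a (x - y)\<bar> \<le> C' * (b - a) * pk \<beta> T y"
    if ab: "a < b" and x: "norm x \<le> 5 / 4" and reg: "1 \<le> a \<or> 1 / 2 \<le> norm (x - y)" and T: "2 \<le> T - b" "T - a \<le> 4" for a b T and x y :: 'a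
  proof -
    consider "0 < a" | "a \<le> 0" "0 < b" | "b \<le> 0" using ab by linarith
    then show ?thesis
    proof cases
      case 1
      obtain \<xi> where \<xi>: "a < \<xi>" "\<xi> < b"
        "\<bar>pk \<beta> b (x - y) - pk \<beta> a (x - y)\<bar> \<le> (b - a) * (pk \<beta> \<xi> (x - y) * ((norm (x - y))\<^sup>2 / (4 * \<xi>\<^sup>2) + (1 - \<beta> + real DIM('a) / 2) / \<xi>))"
        by (rule pk_increment[OF 1 ab \<beta>])
      have h: "0 < \<xi>" "1 \<le> \<xi> \<or> 1 / 2 \<le> norm (x - y)" "2 \<le> T - \<xi>" "T - \<xi> \<le> 4" using \<xi> 1 reg T by auto
      have "pk \<beta> \<xi> (x - y) * ((norm (x - y))\<^sup>2 / (4 * \<xi>\<^sup>2) + m / \<xi>) \<le> C' * pk \<beta> (\<xi> + (T - \<xi>)) y"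
      proof (rule base[OF h(1) x h(2-4)])
        show "(norm (x - y))\<^sup>2 / (4 * \<xi>\<^sup>2) + m / \<xi> \<le> (1 + m) * ((1 + 1 / \<xi>)\<^sup>2 * (1 + norm (x - y) / \<xi>)\<^sup>2 * exp (norm (x - y) / (64 * \<xi>)))"
          using factor(3)[OF h(1), of "norm (x - y)"] by (simp add: power_divide mult.commute)
      qed
      then have "(b - a) * (pk \<beta> \<xi> (x - y) * ((norm (x - y))\<^sup>2 / (4 * \<xi>\<^sup>2) + m / \<xi>)) \<le> (b - a) * (C' * pk \<beta> T y)"
        using ab by (intro mult_left_mono) auto
      then show ?thesis using \<xi>(3) by (simp add: m_def mult_ac)
    next
      case 2
      then have reg': "1 / 2 \<le> norm (x - y)" using reg by auto
      have h: "1 \<le> b \<or> 1 / 2 \<le> norm (x - y)" "T - b \<le> 4" using reg' ab T by auto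
      have "pk \<beta> b (x - y) * (1 / b) \<le> C' * pk \<beta> (b + (T - b)) y"
        by (rule base[OF 2(2) x h(1) T(1) h(2)], rule scale) (use factor(2)[OF 2(2), of "norm (x - y)"] in auto)
      then have "b * (pk \<beta> b (x - y) * (1 / b)) \<le> b * (C' * pk \<beta> T y)" using 2 by (intro mult_left_mono) auto
      also have "\<dots> \<le> (b - a) * (C' * pk \<beta> T y)" using 2 CC by (intro mult_right_mono) auto
      finally show ?thesis using 2 by (simp add: pk_def[of \<beta> a] mult_ac)
    next
      case 3
      then show ?thesis using ab CC by (simp add: pk_def[of \<beta> a] pk_def[of \<beta> b])
    qed
  qed
  show ?thesis using that[OF CC 1 2 3] by blast
qed

subsection \<open>Increment bounds for the solution\<close>

lemma nn_integral_pair_reflect: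
  fixes g :: "'a::euclidean_space \<times> real \<Rightarrow> ennreal"
  assumes g: "g \<in> borel_measurable (borel \<Otimes>\<^sub>M borel)"
  shows "(\<integral>\<^sup>+p. g p \<partial>lborel) = (\<integral>\<^sup>+a. \<integral>\<^sup>+z. g (x - z, t - a) \<partial>lborel \<partial>lborel)"
proof -
  have gm[measurable (raw)]: "(\<lambda>w. g (k w, l w)) \<in> borel_measurable N" if "k \<in> borel_measurable N" "l \<in> borel_measurable N" for k l and N :: "'c measure"
    using that by (intro measurable_compose[OF _ g]) measurable
  have gm2[measurable (raw)]: "(\<lambda>w. g (k w, l w)) \<in> borel_measurable N" if "k \<in> borel_measurable N" "l \<in> borel_measurable N" for k l and N :: "(real \<times> 'a) measure"
    using that by (intro measurable_compose[OF _ g]) measurable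
  have gm3[measurable (raw)]: "(\<lambda>w. g (k w, l w)) \<in> borel_measurable N" if "k \<in> borel_measurable N" "l \<in> borel_measurable N" for k l and N :: "('a \<times> real) measure"
    using that by (intro measurable_compose[OF _ g]) measurable
  have gm4[measurable (raw)]: "(\<lambda>w. g (k w, l w)) \<in> borel_measurable N" if "k \<in> borel_measurable N" "l \<in> borel_measurable N" for k l and N :: "'a measure"
    using that by (intro measurable_compose[OF _ g]) measurable
  have g': "g \<in> borel_measurable (lborel \<Otimes>\<^sub>M lborel)"
    using g by (subst measurable_cong_sets[OF sets_pair_measure_cong[OF sets_lborel sets_lborel] refl])
  have "(\<integral>\<^sup>+p. g p \<partial>lborel) = (\<integral>\<^sup>+y. \<integral>\<^sup>+\<tau>. g (y, \<tau>) \<partial>lborel \<partial>lborel)"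
    by (rule nn_integral_lborel_pair[OF g'])
  also have "\<dots> = (\<integral>\<^sup>+\<tau>. \<integral>\<^sup>+y. g (y, \<tau>) \<partial>lborel \<partial>lborel)"
    by (rule nn_integral_lborel_swap) (simp add: case_prod_eta g')
  also have "\<dots> = (\<integral>\<^sup>+\<tau>. \<integral>\<^sup>+z. g (x - z, \<tau>) \<partial>lborel \<partial>lborel)"
    by (intro nn_integral_cong nn_integral_lborel_reflect[symmetric]) measurable
  also have "\<dots> = (\<integral>\<^sup>+a. \<integral>\<^sup>+z. g (x - z, t - a) \<partial>lborel \<partial>lborel)"
  proof (rule nn_integral_lborel_reflect[symmetric])
    have "(\<lambda>p. g (x - snd p, fst p)) \<in> borel_measurable (borel \<Otimes>\<^sub>M borel)" by measurable
    then show "(\<lambda>\<tau>. \<integral>\<^sup>+z. g (x - z, \<tau>) \<partial>lborel) \<in> borel_measurable borel"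
      by (intro lborel.borel_measurable_nn_integral) (simp add: case_prod_beta' cong: measurable_cong_sets)
  qed
  finally show ?thesis .
qed

lemma pk_minus [simp]: "pk \<beta> a (- z) = pk \<beta> a z"
  by (simp add: pk_def)

text \<open>The power s < 1 has slope at most 1 on the half line from 1 on. It is applied to t + 2,
  the height of the slab below the base point.\<close>

lemma powr_increment_le:
  fixes p q s :: real
  assumes "1 \<le> p" "p \<le> q" "0 < s" "s < 1"
  shows "0 \<le> q powr s - p powr s" "q powr s - p powr s \<le> q - p"
proof -
  show "0 \<le> q powr s - p powr s" using assms by (simp add: powr_mono2)
  have "(q / p) powr s \<le> (q / p) powr 1" using assms by (intro powr_mono) auto
  then have "p powr s * (q / p) powr s \<le> p powr s * (q / p)" using assms by (intro mult_left_mono) auto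
  moreover have "p powr s * (q / p) powr s = q powr s" using assms by (simp add: powr_mult[symmetric])
  ultimately have "q powr s - p powr s \<le> p powr s * (q / p - 1)" by (simp add: algebra_simps)
  also have "\<dots> = (p powr s / p) * (q - p)" using assms by (simp add: field_simps)
  also have "p powr s / p \<le> 1"
  proof -
    have "p powr s \<le> p powr 1" using assms by (intro powr_mono) auto
    then show ?thesis using assms by simp
  qed
  then have "(p powr s / p) * (q - p) \<le> 1 * (q - p)" using assms by (intro mult_right_mono) auto
  finally show "q powr s - p powr s \<le> q - p" by simp
qed

context heat_fraction
begin

text \<open>The integrand of \<open>representation\<close> with \<kappa> = t + 2, as a function of
  the source point. With this choice the two regimes meet at time -2 for every t, so that integrands
  of different base points can be compared source by source. The hyperplane at time -2 is negligible
  and gets the value 0; for t > -2, sources later than t drop out because \<open>pk\<close> vanishes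
  there.\<close>

definition T :: "'a \<Rightarrow> real \<Rightarrow> 'a \<times> real \<Rightarrow> real" where
  "T x t p = (if - 2 < snd p then pk s (t - snd p) (x - fst p) * f (fst p, snd p)
     else if snd p < - 2 then (t + 2) powr s / s * (- 2 - snd p) powr (- s) * pk 0 (t - snd p) (x - fst p) * u (fst p, snd p)
     else 0)"

lemma T_nonneg: "0 \<le> T x t p"
  using s_pos by (simp add: T_def u_nonneg f_nonneg)

lemma T_measurable: "T x t \<in> borel_measurable (borel \<Otimes>\<^sub>M borel)"
proof -
  have "(\<lambda>p. T x t p) \<in> borel_measurable (borel \<Otimes>\<^sub>M borel)" unfolding T_def by measurable
  then show ?thesis .
qed

lemma T_measurable' [measurable]: "T x t \<in> borel_measurable borel"
  using T_measurable by (simp add: borel_prod)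

lemma T_integral:
  assumes t: "- 2 < t"
  shows "(\<integral>\<^sup>+p. ennreal (T x t p) \<partial>lborel) = ennreal (green_const s * u (x, t))"
proof -
  interpret heat_fraction_at s u f x t "t + 2"
    by unfold_locales (use t in simp)
  have "(\<integral>\<^sup>+p. ennreal (T x t p) \<partial>lborel) = (\<integral>\<^sup>+a. \<integral>\<^sup>+z. ennreal (T x t (x - z, t - a)) \<partial>lborel \<partial>lborel)"
    by (rule nn_integral_pair_reflect) (use T_measurable in measurable)
  also have "\<dots> = (\<integral>\<^sup>+a. (\<integral>\<^sup>+y. ennreal (a powr (s - 1) * heat_kernel a (x - y) * f (y, t - a)) \<partial>lborel) * indicator {0<..<t + 2} a
     + (\<integral>\<^sup>+y. ennreal (1 / (s * a) * ((t + 2) / (a - (t + 2))) powr s * heat_kernel a (x - y) * u (y, t - a)) \<partial>lborel) * indicator {t + 2<..} a \<partial>lborel)"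
  proof (rule nn_integral_cong)
    fix a :: real
    have "(\<integral>\<^sup>+z. ennreal (T x t (x - z, t - a)) \<partial>lborel) = (\<integral>\<^sup>+y. ennreal (T x t (y, t - a)) \<partial>lborel)"
      using nn_integral_lborel_reflect[of "\<lambda>y. ennreal (T x t (y, t - a))" x] unfolding T_def by simp
    moreover consider "a \<le> 0" | "0 < a" "a < t + 2" | "a = t + 2" | "t + 2 < a" by linarith
    then have "(\<integral>\<^sup>+y. ennreal (T x t (y, t - a)) \<partial>lborel) = (\<integral>\<^sup>+y. ennreal (a powr (s - 1) * heat_kernel a (x - y) * f (y, t - a)) \<partial>lborel) * indicator {0<..<t + 2} a
     + (\<integral>\<^sup>+y. ennreal (1 / (s * a) * ((t + 2) / (a - (t + 2))) powr s * heat_kernel a (x - y) * u (y, t - a)) \<partial>lborel) * indicator {t + 2<..} a"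
    proof cases
      case 1
      then have "T x t (y, t - a) = 0" for y using t by (simp add: T_def pk_def)
      then show ?thesis using 1 t by simp
    next
      case 2
      then have "T x t (y, t - a) = a powr (s - 1) * heat_kernel a (x - y) * f (y, t - a)" for y by (simp add: T_def pk_def)
      then show ?thesis using 2 by simp
    next
      case 3
      then have "T x t (y, t - a) = 0" for y by (simp add: T_def)
      then show ?thesis using 3 by simp
    next
      case 4
      have "T x t (y, t - a) = 1 / (s * a) * ((t + 2) / (a - (t + 2))) powr s * heat_kernel a (x - y) * u (y, t - a)" for y
      proof -
        have a: "0 < a" using 4 t by simp
        have e: "- 2 - (t - a) = a - (t + 2)" by simp
        have "T x t (y, t - a) = (t + 2) powr s / s * (- 2 - (t - a)) powr (- s) * (a powr (0 - 1) * heat_kernel a (x - y)) * u (y, t - a)"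
          using 4 a by (simp add: T_def pk_def)
        also note e
        also have "a powr (0 - 1) = 1 / a" using a by (simp add: powr_minus_divide)
        also have "(t + 2) powr s / s * (a - (t + 2)) powr (- s) * (1 / a * heat_kernel a (x - y)) * u (y, t - a)
          = 1 / (s * a) * ((t + 2) powr s * (a - (t + 2)) powr (- s)) * heat_kernel a (x - y) * u (y, t - a)" by simp
        also have "(t + 2) powr s * (a - (t + 2)) powr (- s) = ((t + 2) / (a - (t + 2))) powr s"
          unfolding powr_divide powr_minus by (simp only: divide_inverse)
        finally show ?thesis .
      qed
      then show ?thesis using 4 by simp
    qed
    ultimately show "(\<integral>\<^sup>+z. ennreal (T x t (x - z, t - a)) \<partial>lborel) = (\<integral>\<^sup>+y. ennreal (a powr (s - 1) * heat_kernel a (x - y) * f (y, t - a)) \<partial>lborel) * indicator {0<..<t + 2} a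
     + (\<integral>\<^sup>+y. ennreal (1 / (s * a) * ((t + 2) / (a - (t + 2))) powr s * heat_kernel a (x - y) * u (y, t - a)) \<partial>lborel) * indicator {t + 2<..} a"
      by simp
  qed
  also have "\<dots> = ennreal (green_const s * u (x, t))"
    unfolding representation by (rule nn_integral_add) measurable
  finally show ?thesis .
qed

lemma T_integrable:
  assumes t: "- 2 < t"
  shows "integrable lborel (T x t)" "(\<integral>p. T x t p \<partial>lborel) = green_const s * u (x, t)"
proof -
  have c: "0 \<le> green_const s * u (x, t)" using green_const(2)[OF s_pos s_less] u_nonneg by simp
  show "integrable lborel (T x t)"
    using T_integral[OF t, of x] by (intro integrableI_nonneg) (auto simp: T_nonneg)
  show "(\<integral>p. T x t p \<partial>lborel) = green_const s * u (x, t)"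
    using T_integral[OF t, of x] c by (subst integral_eq_nn_integral) (auto simp: T_nonneg)
qed

lemma abs_integral_le:
  assumes "integrable lborel g" "(\<integral>p. g p \<partial>lborel) = c * v" "0 \<le> c"
  shows "ennreal (c * \<bar>v\<bar>) \<le> (\<integral>\<^sup>+p. ennreal \<bar>g p\<bar> \<partial>lborel)"
proof -
  have "ennreal (norm (\<integral>p. g p \<partial>lborel)) \<le> (\<integral>\<^sup>+p. ennreal (norm (g p)) \<partial>lborel)"
    by (rule integral_norm_bound_ennreal[OF assms(1)])
  then show ?thesis unfolding assms(2) using assms(3) by (simp add: abs_mult)
qed

lemma second_difference_le:
  assumes "- 2 < t"
  shows "ennreal (green_const s * \<bar>u (x + d, t) + u (x - d, t) - 2 * u (x, t)\<bar>)
    \<le> (\<integral>\<^sup>+p. ennreal \<bar>T (x + d) t p + T (x - d) t p - 2 * T x t p\<bar> \<partial>lborel)"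
proof (rule abs_integral_le)
  note I = T_integrable[OF assms]
  show "integrable lborel (\<lambda>p. T (x + d) t p + T (x - d) t p - 2 * T x t p)"
    by (intro Bochner_Integration.integrable_diff Bochner_Integration.integrable_add integrable_mult_right I)
  show "(\<integral>p. T (x + d) t p + T (x - d) t p - 2 * T x t p \<partial>lborel) = green_const s * (u (x + d, t) + u (x - d, t) - 2 * u (x, t))"
    by (simp add: I algebra_simps)
qed (use green_const(2)[OF s_pos s_less] in simp)

lemma time_difference_le:
  assumes "- 2 < t" "- 2 < t'"
  shows "ennreal (green_const s * \<bar>u (x, t') - u (x, t)\<bar>) \<le> (\<integral>\<^sup>+p. ennreal \<bar>T x t' p - T x t p\<bar> \<partial>lborel)"
proof (rule abs_integral_le)
  note I = T_integrable[OF assms(1)] T_integrable[OF assms(2)]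
  show "integrable lborel (\<lambda>p. T x t' p - T x t p)"
    by (intro Bochner_Integration.integrable_diff I)
  show "(\<integral>p. T x t' p - T x t p \<partial>lborel) = green_const s * (u (x, t') - u (x, t))"
    by (simp add: I algebra_simps)
qed (use green_const(2)[OF s_pos s_less] in simp)

text \<open>\<open>k\<close> stands for an increment of the Green kernel, weighted with the bound F
  on f; everything else is a multiple of the integrand at the base point (0, 3), whose total is
  \<open>green_const s\<close> times u(0, 3).\<close>

lemma bound_from_majorant:
  assumes F: "0 \<le> F" and M: "u (0, 3) \<le> M" and Q: "0 \<le> Q" and P: "0 \<le> P"
    and k: "k \<in> borel_measurable borel" "(\<integral>\<^sup>+p. ennreal (k p) \<partial>lborel) \<le> ennreal P"
    and le: "AE p in lborel. g p \<le> ennreal F * ennreal (k p) + ennreal Q * ennreal (T 0 3 p)"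
  shows "(\<integral>\<^sup>+p. g p \<partial>lborel) \<le> ennreal (F * P + Q * (green_const s * M))"
proof -
  have c: "0 \<le> green_const s" using green_const(2)[OF s_pos s_less] by simp
  have M0: "0 \<le> M" using M u_nonneg[of "(0, 3)"] by linarith
  have "(\<integral>\<^sup>+p. g p \<partial>lborel) \<le> (\<integral>\<^sup>+p. ennreal F * ennreal (k p) + ennreal Q * ennreal (T 0 3 p) \<partial>lborel)"
    by (rule nn_integral_mono_AE[OF le])
  also have "\<dots> = ennreal F * (\<integral>\<^sup>+p. ennreal (k p) \<partial>lborel) + ennreal Q * (\<integral>\<^sup>+p. ennreal (T 0 3 p) \<partial>lborel)"
    using k(1) by (simp add: nn_integral_add nn_integral_cmult)
  also have "\<dots> \<le> ennreal F * ennreal P + ennreal Q * ennreal (green_const s * M)"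
    using T_integral[of 3 0] M c k(2) by (intro add_mono mult_left_mono) (auto intro!: ennreal_leI mult_left_mono)
  also have "\<dots> = ennreal (F * P + Q * (green_const s * M))"
    using F P Q M0 c by (simp only: ennreal_mult ennreal_plus mult_nonneg_nonneg)
  finally show ?thesis .
qed

text \<open>There are three kinds of contributing sources. In the slab with |y| < 2 the source lies
  in Q_2 and f \<le> F. In the slab with |y| \<ge> 2 the distance to x is at least 3/4. Before time
  -2 the lag exceeds 1. In the last two cases the tail bound with time gap e = 3 - t compares with
  the kernel based at (0, 3), and the Poisson coefficients compare because t + 2 \<le> 5.\<close>

lemma second_difference_majorant:
  assumes x: "norm x \<le> 5 / 4" and t: "\<bar>t\<bar> < 1" and d: "norm d \<le> 1 / 32" and C: "0 < C"
    and tail: "\<And>\<beta> a e d (x::'a) y. \<beta> = 0 \<or> \<beta> = s \<Longrightarrow> 0 < a \<Longrightarrow> norm x \<le> 5 / 4 \<Longrightarrow> 1 \<le> a \<or> 1 / 2 \<le> norm (x - y) \<Longrightarrow> 2 \<le> e \<Longrightarrow> e \<le> 4 \<Longrightarrow> norm d \<le> 1 / 32 \<Longrightarrow>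
       \<bar>pk \<beta> a (x - y + d) + pk \<beta> a (x - y - d) - 2 * pk \<beta> a (x - y)\<bar> \<le> C * (norm d)\<^sup>2 * pk \<beta> (a + e) y"
    and f: "norm (fst p) < 2 \<and> \<bar>snd p\<bar> < 4 \<longrightarrow> f p \<le> F" and F: "0 \<le> F"
  shows "\<bar>T (x + d) t p + T (x - d) t p - 2 * T x t p\<bar>
    \<le> F * \<bar>pk s (t - snd p) (x - fst p + d) + pk s (t - snd p) (x - fst p - d) - 2 * pk s (t - snd p) (x - fst p)\<bar> + C * (norm d)\<^sup>2 * T 0 3 p"
proof -
  obtain y \<tau> where p: "p = (y, \<tau>)" by (cases p)
  define D where "D = (\<lambda>\<beta>. pk \<beta> (t - \<tau>) (x - y + d) + pk \<beta> (t - \<tau>) (x - y - d) - 2 * pk \<beta> (t - \<tau>) (x - y))"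
  have xy: "x + d - y = x - y + d" "x - d - y = x - y - d" by (auto simp: algebra_simps)
  have T0: "0 \<le> C * (norm d)\<^sup>2 * T 0 3 p" using C T_nonneg by simp
  consider "- 2 < \<tau>" | "\<tau> = - 2" | "\<tau> < - 2" by linarith
  then show ?thesis
  proof cases
    case 1
    have eq: "\<bar>T (x + d) t p + T (x - d) t p - 2 * T x t p\<bar> = \<bar>D s\<bar> * f p"
    proof -
      have "T (x + d) t p + T (x - d) t p - 2 * T x t p = D s * f p"
        using 1 by (simp add: T_def p D_def xy algebra_simps)
      then show ?thesis using f_nonneg[of p] by (simp add: abs_mult)
    qed
    show ?thesis
    proof (cases "t - \<tau> \<le> 0")
      case True
      then have "D s = 0" by (simp add: D_def pk_def)
      then show ?thesis using eq T0 F by simp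
    next
      case a: False
      show ?thesis
      proof (cases "norm y < 2")
        case True
        have "f p \<le> F" using f True 1 a t by (auto simp: p)
        then have "\<bar>D s\<bar> * f p \<le> F * \<bar>D s\<bar>" by (subst (2) mult.commute, intro mult_left_mono) auto
        from add_mono[OF this T0] show ?thesis using eq by (simp add: D_def p)
      next
        case False
        have "norm y \<le> norm x + norm (x - y)" by norm
        then have reg: "1 / 2 \<le> norm (x - y)" using False x by linarith
        have "\<bar>D s\<bar> \<le> C * (norm d)\<^sup>2 * pk s (t - \<tau> + (3 - t)) y"
          unfolding D_def using a t reg d x by (intro tail) auto
        then have "\<bar>D s\<bar> * f p \<le> C * (norm d)\<^sup>2 * pk s (3 - \<tau>) y * f p"
          using f_nonneg by (intro mult_right_mono) auto
        also have "\<dots> = C * (norm d)\<^sup>2 * T 0 3 p" using 1 by (simp add: T_def p)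
        finally show ?thesis using eq F by (simp add: add_increasing)
      qed
    qed
  next
    case 2
    then show ?thesis using T0 F by (simp add: T_def p)
  next
    case 3
    define c where "c = (t + 2) powr s / s * (- 2 - \<tau>) powr (- s)"
    have c: "0 \<le> c" using s_pos by (simp add: c_def)
    have "T x' t p = c * pk 0 (t - \<tau>) (x' - y) * u p" for x' using 3 by (simp add: T_def p c_def)
    then have "T (x + d) t p + T (x - d) t p - 2 * T x t p = c * D 0 * u p"
      unfolding D_def by (simp only: xy) (simp add: algebra_simps)
    then have "\<bar>T (x + d) t p + T (x - d) t p - 2 * T x t p\<bar> = c * \<bar>D 0\<bar> * u p"
      using c u_nonneg[of p] by (simp add: abs_mult)
    also have "\<dots> \<le> c * (C * (norm d)\<^sup>2 * pk 0 (t - \<tau> + (3 - t)) y) * u p"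
      unfolding D_def using 3 t d x c u_nonneg by (intro mult_right_mono mult_left_mono tail) auto
    also have "\<dots> \<le> (5 powr s / s * (- 2 - \<tau>) powr (- s)) * (C * (norm d)\<^sup>2 * pk 0 (t - \<tau> + (3 - t)) y) * u p"
      unfolding c_def using t s_pos C u_nonneg
      by (intro mult_right_mono divide_right_mono powr_mono2 mult_nonneg_nonneg) auto
    also have "\<dots> = C * (norm d)\<^sup>2 * T 0 3 p" using 3 by (simp add: T_def p)
    finally show ?thesis using F by (simp add: add_increasing)
  qed
qed

text \<open>The sources are divided as for second differences, but the Poisson coefficient (t + 2)^s
  now varies too. The product rule gives two terms, the increment of the coefficient and that of the
  kernel, whence the factor 2. Sources between t and t' have negative lag to the earlier time, which
  the tail bound allows.\<close>

lemma time_difference_majorant: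
  assumes x: "norm x \<le> 5 / 4" and t: "- 1 < t" "t < t'" "t' < 1" and C: "0 < C"
    and tail: "\<And>a e (x::'a) y. 0 < a \<Longrightarrow> norm x \<le> 5 / 4 \<Longrightarrow> 1 \<le> a \<or> 1 / 2 \<le> norm (x - y) \<Longrightarrow> 2 \<le> e \<Longrightarrow> e \<le> 4 \<Longrightarrow>
       pk 0 a (x - y) \<le> C * pk 0 (a + e) y"
    and tail': "\<And>\<beta> a b T (x::'a) y. \<beta> = 0 \<or> \<beta> = s \<Longrightarrow> a < b \<Longrightarrow> norm x \<le> 5 / 4 \<Longrightarrow> 1 \<le> a \<or> 1 / 2 \<le> norm (x - y) \<Longrightarrow> 2 \<le> T - b \<Longrightarrow> T - a \<le> 4 \<Longrightarrow>
       \<bar>pk \<beta> b (x - y) - pk \<beta> a (x - y)\<bar> \<le> C * (b - a) * pk \<beta> T y"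
    and f: "norm (fst p) < 2 \<and> \<bar>snd p\<bar> < 4 \<longrightarrow> f p \<le> F" and F: "0 \<le> F"
  shows "\<bar>T x t' p - T x t p\<bar>
    \<le> F * \<bar>pk s (t' - snd p) (x - fst p) - pk s (t - snd p) (x - fst p)\<bar> + 2 * C * (t' - t) * T 0 3 p"
proof -
  obtain y \<tau> where p: "p = (y, \<tau>)" by (cases p)
  define D where "D = (\<lambda>\<beta>. pk \<beta> (t' - \<tau>) (x - y) - pk \<beta> (t - \<tau>) (x - y))"
  have T0: "0 \<le> 2 * C * (t' - t) * T 0 3 p" using C T_nonneg t by simp
  consider "- 2 < \<tau>" | "\<tau> = - 2" | "\<tau> < - 2" by linarith
  then show ?thesis
  proof cases
    case 1
    have eq: "\<bar>T x t' p - T x t p\<bar> = \<bar>D s\<bar> * f p"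
    proof -
      have "T x t' p - T x t p = D s * f p"
        using 1 by (simp add: T_def p D_def algebra_simps)
      then show ?thesis using f_nonneg[of p] by (simp add: abs_mult)
    qed
    show ?thesis
    proof (cases "t' - \<tau> \<le> 0")
      case True
      then have "D s = 0" using t by (simp add: D_def pk_def)
      then show ?thesis using eq T0 F by simp
    next
      case a: False
      show ?thesis
      proof (cases "norm y < 2")
        case True
        have "f p \<le> F" using f True 1 a t by (auto simp: p)
        then have "\<bar>D s\<bar> * f p \<le> F * \<bar>D s\<bar>" by (subst (2) mult.commute, intro mult_left_mono) auto
        from add_mono[OF this T0] show ?thesis using eq by (simp add: D_def p)
      next
        case False
        have "norm y \<le> norm x + norm (x - y)" by norm
        then have reg: "1 / 2 \<le> norm (x - y)" using False x by linarith
        have "\<bar>D s\<bar> \<le> C * (t' - \<tau> - (t - \<tau>)) * pk s (3 - \<tau>) y"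
          unfolding D_def using t reg x by (intro tail') auto
        then have "\<bar>D s\<bar> * f p \<le> C * (t' - \<tau> - (t - \<tau>)) * pk s (3 - \<tau>) y * f p"
          using f_nonneg by (intro mult_right_mono) auto
        also have "\<dots> = C * (t' - t) * T 0 3 p" using 1 by (simp add: T_def p)
        finally have "\<bar>D s\<bar> * f p \<le> 2 * C * (t' - t) * T 0 3 p" using T0 by linarith
        then show ?thesis using eq F by (simp add: add_increasing)
      qed
    qed
  next
    case 2
    then show ?thesis using T0 F by (simp add: T_def p)
  next
    case 3
    define c where "c = (- 2 - \<tau>) powr (- s) / s * u p"
    have c: "0 \<le> c" using s_pos u_nonneg by (simp add: c_def)
    define P where "P = pk 0 (3 - \<tau>) y"
    have P: "0 \<le> P" by (simp add: P_def)
    have five: "1 \<le> 5 powr s" using s_pos by (intro ge_one_powr_ge_zero) auto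
    have A: "pk 0 (t' - \<tau>) (x - y) \<le> C * P"
      using tail[of "t' - \<tau>" x y "3 - t'"] 3 t x by (simp add: P_def)
    have B: "\<bar>D 0\<bar> \<le> C * (t' - t) * P"
      using tail'[of 0 "t - \<tau>" "t' - \<tau>" x y "3 - \<tau>"] 3 t x by (simp add: P_def D_def)
    have "T x t' p - T x t p = c * ((t' + 2) powr s * pk 0 (t' - \<tau>) (x - y) - (t + 2) powr s * pk 0 (t - \<tau>) (x - y))"
      using 3 s_pos by (simp add: T_def p c_def) (simp add: field_simps)
    also have "(t' + 2) powr s * pk 0 (t' - \<tau>) (x - y) - (t + 2) powr s * pk 0 (t - \<tau>) (x - y)
      = ((t' + 2) powr s - (t + 2) powr s) * pk 0 (t' - \<tau>) (x - y) + (t + 2) powr s * D 0"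
      by (simp add: D_def algebra_simps)
    finally have "\<bar>T x t' p - T x t p\<bar> = c * \<bar>((t' + 2) powr s - (t + 2) powr s) * pk 0 (t' - \<tau>) (x - y) + (t + 2) powr s * D 0\<bar>"
      using c by (simp add: abs_mult)
    also have "\<dots> \<le> c * (5 powr s * (t' - t) * (C * P) + 5 powr s * (C * (t' - t) * P))"
    proof (intro mult_left_mono order_trans[OF abs_triangle_ineq] add_mono)
      have i: "0 \<le> (t' + 2) powr s - (t + 2) powr s" "(t' + 2) powr s - (t + 2) powr s \<le> (t' + 2) - (t + 2)"
        using t s_pos s_less by (intro powr_increment_le; simp)+
      have "(t' + 2) powr s - (t + 2) powr s \<le> 1 * (t' - t)" using i(2) by simp
      also have "\<dots> \<le> 5 powr s * (t' - t)" using five t by (intro mult_right_mono) auto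
      finally have "((t' + 2) powr s - (t + 2) powr s) * pk 0 (t' - \<tau>) (x - y) \<le> (5 powr s * (t' - t)) * (C * P)"
        using A t by (intro mult_mono) auto
      then show "\<bar>((t' + 2) powr s - (t + 2) powr s) * pk 0 (t' - \<tau>) (x - y)\<bar> \<le> 5 powr s * (t' - t) * (C * P)"
        using i(1) by (simp add: abs_mult)
      have "(t + 2) powr s \<le> 5 powr s" using t s_pos by (intro powr_mono2) auto
      then have "(t + 2) powr s * \<bar>D 0\<bar> \<le> 5 powr s * (C * (t' - t) * P)" using B by (intro mult_mono) auto
      then show "\<bar>(t + 2) powr s * D 0\<bar> \<le> 5 powr s * (C * (t' - t) * P)" by (simp add: abs_mult)
    qed (use c in auto)
    also have "\<dots> = 2 * C * (t' - t) * T 0 3 p"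
      using 3 s_pos by (simp add: T_def p c_def P_def) (simp add: field_simps)?
    finally show ?thesis using F by (simp add: add_increasing)
  qed
qed

end

text \<open>The Green part contributes F times the L1 norm of the increment of the kernel, which has
  the critical order |d|^(2 s) or (t' - t)^s. The tails contribute |d|^2 M or (t' - t) M, which is
  of higher order. Dividing by \<open>green_const s\<close> gives the bounds for u.\<close>

theorem regularity_bounds:
  fixes s :: real
  assumes s: "0 < s" "s < 1"
  shows "\<exists>C>0. \<forall>u f F M. heat_fraction s u (f :: 'a::euclidean_space \<times> real \<Rightarrow> real) \<longrightarrow> 0 \<le> F \<longrightarrow> u (0, 3) \<le> M \<longrightarrow>
     (AE p in lborel. norm (fst p) < 2 \<and> \<bar>snd p\<bar> < 4 \<longrightarrow> f p \<le> F) \<longrightarrow>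
     (\<forall>x t d. norm x \<le> 5 / 4 \<longrightarrow> \<bar>t\<bar> < 1 \<longrightarrow> norm d \<le> 1 / 32 \<longrightarrow> \<bar>u (x + d, t) + u (x - d, t) - 2 * u (x, t)\<bar> \<le> C * (F + M) * norm d powr (2 * s)) \<and>
     (\<forall>x t t'. norm x \<le> 5 / 4 \<longrightarrow> - 1 < t \<longrightarrow> t < t' \<longrightarrow> t' < 1 \<longrightarrow> \<bar>u (x, t') - u (x, t)\<bar> \<le> C * (F + M) * (t' - t) powr s)"
proof -
  obtain C1 where C1: "0 < C1" "\<And>d::'a. (\<integral>\<^sup>+a. \<integral>\<^sup>+z. ennreal \<bar>pk s a (z + d) + pk s a (z - d) - 2 * pk s a z\<bar> \<partial>lborel \<partial>lborel) \<le> ennreal (C1 * norm d powr (2 * s))"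
    by (rule pk_second_difference_L1[OF s]) blast
  obtain C2 where C2: "0 < C2" "\<And>h. 0 < h \<Longrightarrow> (\<integral>\<^sup>+a. \<integral>\<^sup>+z. ennreal \<bar>pk s (a + h) z - pk s a (z::'a)\<bar> \<partial>lborel \<partial>lborel) \<le> ennreal (C2 * h powr s)"
    by (rule pk_time_L1[OF s]) blast
  obtain K0 where K0: "0 < K0" "\<And>a e (x::'a) y. 0 < a \<Longrightarrow> norm x \<le> 5 / 4 \<Longrightarrow> 1 \<le> a \<or> 1 / 2 \<le> norm (x - y) \<Longrightarrow> 2 \<le> e \<Longrightarrow> e \<le> 4 \<Longrightarrow>
       pk 0 a (x - y) \<le> K0 * pk 0 (a + e) y"
    "\<And>a e d (x::'a) y. 0 < a \<Longrightarrow> norm x \<le> 5 / 4 \<Longrightarrow> 1 \<le> a \<or> 1 / 2 \<le> norm (x - y) \<Longrightarrow> 2 \<le> e \<Longrightarrow> e \<le> 4 \<Longrightarrow> norm d \<le> 1 / 32 \<Longrightarrow>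
       \<bar>pk 0 a (x - y + d) + pk 0 a (x - y - d) - 2 * pk 0 a (x - y)\<bar> \<le> K0 * (norm d)\<^sup>2 * pk 0 (a + e) y"
    "\<And>a b T (x::'a) y. a < b \<Longrightarrow> norm x \<le> 5 / 4 \<Longrightarrow> 1 \<le> a \<or> 1 / 2 \<le> norm (x - y) \<Longrightarrow> 2 \<le> T - b \<Longrightarrow> T - a \<le> 4 \<Longrightarrow>
       \<bar>pk 0 b (x - y) - pk 0 a (x - y)\<bar> \<le> K0 * (b - a) * pk 0 T y"
  proof (rule pk_tail[of 0, where 'a = 'a], goal_cases)
    case (2 C)
    show ?case by (rule that[OF 2(2) 2(3) 2(4) 2(5)])
  qed simp
  obtain K1 where K1: "0 < K1"
    "\<And>a e d (x::'a) y. 0 < a \<Longrightarrow> norm x \<le> 5 / 4 \<Longrightarrow> 1 \<le> a \<or> 1 / 2 \<le> norm (x - y) \<Longrightarrow> 2 \<le> e \<Longrightarrow> e \<le> 4 \<Longrightarrow> norm d \<le> 1 / 32 \<Longrightarrow>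
       \<bar>pk s a (x - y + d) + pk s a (x - y - d) - 2 * pk s a (x - y)\<bar> \<le> K1 * (norm d)\<^sup>2 * pk s (a + e) y"
    "\<And>a b T (x::'a) y. a < b \<Longrightarrow> norm x \<le> 5 / 4 \<Longrightarrow> 1 \<le> a \<or> 1 / 2 \<le> norm (x - y) \<Longrightarrow> 2 \<le> T - b \<Longrightarrow> T - a \<le> 4 \<Longrightarrow>
       \<bar>pk s b (x - y) - pk s a (x - y)\<bar> \<le> K1 * (b - a) * pk s T y"
  proof (rule pk_tail[of s, where 'a = 'a], goal_cases)
    case (2 C)
    show ?case by (rule that[OF 2(2) 2(4) 2(5)])
  qed (use s in simp)
  define K where "K = max K0 K1"
  have K: "0 < K" "K0 \<le> K" "K1 \<le> K" using K0(1) by (auto simp: K_def)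
  have KA: "pk 0 a (x - y) \<le> K * pk 0 (a + e) y" if "0 < a" "norm x \<le> 5 / 4" "1 \<le> a \<or> 1 / 2 \<le> norm (x - y)" "2 \<le> e" "e \<le> 4" for a e and x y :: 'a
    by (rule order_trans[OF K0(2)[OF that]]) (intro mult_right_mono K pk_nonneg)
  have KB: "\<bar>pk \<beta> a (x - y + d) + pk \<beta> a (x - y - d) - 2 * pk \<beta> a (x - y)\<bar> \<le> K * (norm d)\<^sup>2 * pk \<beta> (a + e) y"
    if "\<beta> = 0 \<or> \<beta> = s" and h: "0 < a" "norm x \<le> 5 / 4" "1 \<le> a \<or> 1 / 2 \<le> norm (x - y)" "2 \<le> e" "e \<le> 4" "norm d \<le> 1 / 32" for \<beta> a e d and x y :: 'a
    using that(1)
  proof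
    assume b: "\<beta> = 0"
    show ?thesis unfolding b by (rule order_trans[OF K0(3)[OF h]]) (intro mult_right_mono K pk_nonneg zero_le_power2)
  next
    assume b: "\<beta> = s"
    show ?thesis unfolding b by (rule order_trans[OF K1(2)[OF h]]) (intro mult_right_mono K pk_nonneg zero_le_power2)
  qed
  have KC: "\<bar>pk \<beta> b (x - y) - pk \<beta> a (x - y)\<bar> \<le> K * (b - a) * pk \<beta> T y"
    if "\<beta> = 0 \<or> \<beta> = s" and h: "a < b" "norm x \<le> 5 / 4" "1 \<le> a \<or> 1 / 2 \<le> norm (x - y)" "2 \<le> T - b" "T - a \<le> 4" for \<beta> a b T and x y :: 'a
    using that(1)
  proof
    have ba: "0 \<le> b - a" using h by simp
    { assume b: "\<beta> = 0"
      show ?thesis unfolding b by (rule order_trans[OF K0(4)[OF h]]) (intro mult_right_mono K pk_nonneg ba) }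
    { assume b: "\<beta> = s"
      show ?thesis unfolding b by (rule order_trans[OF K1(3)[OF h]]) (intro mult_right_mono K pk_nonneg ba) }
  qed
  define g where "g = green_const s"
  have g: "0 < g" using green_const(2)[OF s] by (simp add: g_def)
  \<comment> \<open>C1/g and C2/g come from the Green part; K bounds the spatial tail since |d|^2
    \<le> |d|^(2 s) for |d| \<le> 1, and 4 K the temporal one since h \<le> 2 h^s for 0 < h <
    2.\<close>
  define C where "C = C1 / g + C2 / g + 4 * K"
  have C: "0 < C" "C1 / g \<le> C" "K \<le> C" "C2 / g \<le> C" "4 * K \<le> C"
    using C1(1) C2(1) K(1) g by (auto simp: C_def add_pos_pos)
  have final: "v \<le> C * (F + M) * r" if "g * v \<le> F * (c * r) + k * r' * (g * M)" "0 \<le> F" "0 \<le> M" "0 \<le> r" "c / g \<le> C" "k * r' \<le> C * r" for v F M c r k r' :: real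
  proof -
    have "g * v / g \<le> (F * (c * r) + k * r' * (g * M)) / g" using that(1) g by (intro divide_right_mono) auto
    also have "\<dots> = c / g * (F * r) + (k * r') * M" using g by (simp add: add_divide_distrib mult_ac)
    also have "\<dots> \<le> C * (F * r) + (C * r) * M" using that by (intro add_mono mult_right_mono) auto
    finally show ?thesis using g by (simp add: algebra_simps)
  qed
  show ?thesis
  proof (intro exI[of _ C] conjI allI impI C(1))
    fix u f F M
    assume hf: "heat_fraction s u (f :: 'a \<times> real \<Rightarrow> real)" and F: "0 \<le> F" and M: "u (0, 3) \<le> M"
      and AE: "AE p in lborel. norm (fst p) < 2 \<and> \<bar>snd p\<bar> < 4 \<longrightarrow> f p \<le> F"
    interpret heat_fraction s u f by (rule hf)
    have M0: "0 \<le> M" using M u_nonneg[of "(0, 3)"] by linarith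
    {
      fix x d :: 'a and t :: real
      assume x: "norm x \<le> 5 / 4" and t: "\<bar>t\<bar> < 1" and d: "norm d \<le> 1 / 32"
      define k where "k = (\<lambda>p::'a \<times> real. \<bar>pk s (t - snd p) (x - fst p + d) + pk s (t - snd p) (x - fst p - d) - 2 * pk s (t - snd p) (x - fst p)\<bar>)"
      have km: "k \<in> borel_measurable (borel \<Otimes>\<^sub>M borel)" unfolding k_def by measurable
      have kint: "(\<integral>\<^sup>+p. ennreal (k p) \<partial>lborel) \<le> ennreal (C1 * norm d powr (2 * s))"
      proof -
        have "(\<integral>\<^sup>+p. ennreal (k p) \<partial>lborel) = (\<integral>\<^sup>+a. \<integral>\<^sup>+z. ennreal (k (x - z, t - a)) \<partial>lborel \<partial>lborel)"
          by (rule nn_integral_pair_reflect) (use km in measurable)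
        also have "\<dots> \<le> ennreal (C1 * norm d powr (2 * s))" using C1(2)[of d] by (simp add: k_def)
        finally show ?thesis .
      qed
      have "(\<integral>\<^sup>+p. ennreal \<bar>T (x + d) t p + T (x - d) t p - 2 * T x t p\<bar> \<partial>lborel)
        \<le> ennreal (F * (C1 * norm d powr (2 * s)) + K * (norm d)\<^sup>2 * (green_const s * M))"
      proof (rule bound_from_majorant[OF F M _ _ _ kint])
        show "k \<in> borel_measurable borel" using km by (simp add: borel_prod)
        show "AE p in lborel. ennreal \<bar>T (x + d) t p + T (x - d) t p - 2 * T x t p\<bar> \<le> ennreal F * ennreal (k p) + ennreal (K * (norm d)\<^sup>2) * ennreal (T 0 3 p)"
          using AE
        proof eventually_elim
          case (elim p)
          have "\<bar>T (x + d) t p + T (x - d) t p - 2 * T x t p\<bar> \<le> F * k p + K * (norm d)\<^sup>2 * T 0 3 p"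
            unfolding k_def by (rule second_difference_majorant[OF x t d K(1) KB elim F])
          then have "ennreal \<bar>T (x + d) t p + T (x - d) t p - 2 * T x t p\<bar> \<le> ennreal (F * k p + K * (norm d)\<^sup>2 * T 0 3 p)"
            by (rule ennreal_leI)
          also have "\<dots> = ennreal F * ennreal (k p) + ennreal (K * (norm d)\<^sup>2) * ennreal (T 0 3 p)"
            using F K(1) T_nonneg by (simp add: k_def ennreal_mult ennreal_plus)
          finally show ?case .
        qed
      qed (use K C1 in auto)
      moreover have "- 2 < t" using t by linarith
      ultimately have "ennreal (g * \<bar>u (x + d, t) + u (x - d, t) - 2 * u (x, t)\<bar>)
         \<le> ennreal (F * (C1 * norm d powr (2 * s)) + K * (norm d)\<^sup>2 * (g * M))"
        unfolding g_def using second_difference_le[of t x d] by (meson order_trans)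
      then have le: "g * \<bar>u (x + d, t) + u (x - d, t) - 2 * u (x, t)\<bar> \<le> F * (C1 * norm d powr (2 * s)) + K * (norm d)\<^sup>2 * (g * M)"
        using F C1(1) K(1) g M0 by (subst (asm) ennreal_le_iff) auto
      show "\<bar>u (x + d, t) + u (x - d, t) - 2 * u (x, t)\<bar> \<le> C * (F + M) * norm d powr (2 * s)"
      proof (rule final[OF le F M0 _ C(2)])
        have "norm d powr 2 \<le> norm d powr (2 * s)"
        proof (cases "d = 0")
          case False
          then show ?thesis using d s by (intro powr_mono') auto
        qed simp
        then have "(norm d)\<^sup>2 \<le> norm d powr (2 * s)" by simp
        then show "K * (norm d)\<^sup>2 \<le> C * norm d powr (2 * s)" using C K by (intro mult_mono) auto
      qed simp
    }
    {
      fix x :: 'a and t t' :: real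
      assume x: "norm x \<le> 5 / 4" and t: "- 1 < t" "t < t'" "t' < 1"
      define h where "h = t' - t"
      have h: "0 < h" "h < 2" using t by (auto simp: h_def)
      define k where "k = (\<lambda>p::'a \<times> real. \<bar>pk s (t' - snd p) (x - fst p) - pk s (t - snd p) (x - fst p)\<bar>)"
      have km: "k \<in> borel_measurable (borel \<Otimes>\<^sub>M borel)" unfolding k_def by measurable
      have kint: "(\<integral>\<^sup>+p. ennreal (k p) \<partial>lborel) \<le> ennreal (C2 * h powr s)"
      proof -
        have "(\<integral>\<^sup>+p. ennreal (k p) \<partial>lborel) = (\<integral>\<^sup>+a. \<integral>\<^sup>+z. ennreal (k (x - z, t - a)) \<partial>lborel \<partial>lborel)"
          by (rule nn_integral_pair_reflect) (use km in measurable)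
        also have "\<dots> = (\<integral>\<^sup>+a. \<integral>\<^sup>+z. ennreal \<bar>pk s (a + h) z - pk s a (z::'a)\<bar> \<partial>lborel \<partial>lborel)"
          by (simp add: k_def h_def algebra_simps)
        also have "\<dots> \<le> ennreal (C2 * h powr s)" by (rule C2(2)[OF h(1)])
        finally show ?thesis .
      qed
      have "(\<integral>\<^sup>+p. ennreal \<bar>T x t' p - T x t p\<bar> \<partial>lborel)
        \<le> ennreal (F * (C2 * h powr s) + 2 * K * h * (green_const s * M))"
      proof (rule bound_from_majorant[OF F M _ _ _ kint])
        show "k \<in> borel_measurable borel" using km by (simp add: borel_prod)
        show "AE p in lborel. ennreal \<bar>T x t' p - T x t p\<bar> \<le> ennreal F * ennreal (k p) + ennreal (2 * K * h) * ennreal (T 0 3 p)"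
          using AE
        proof eventually_elim
          case (elim p)
          have "\<bar>T x t' p - T x t p\<bar> \<le> F * k p + 2 * K * h * T 0 3 p"
            unfolding k_def h_def by (rule time_difference_majorant[OF x t K(1) KA KC elim F])
          then have "ennreal \<bar>T x t' p - T x t p\<bar> \<le> ennreal (F * k p + 2 * K * h * T 0 3 p)"
            by (rule ennreal_leI)
          also have "\<dots> = ennreal F * ennreal (k p) + ennreal (2 * K * h) * ennreal (T 0 3 p)"
          proof -
            have "ennreal (a * b + c * d) = ennreal a * ennreal b + ennreal c * ennreal d" if "0 \<le> a" "0 \<le> b" "0 \<le> c" "0 \<le> d" for a b c d :: real
              using that by (simp only: ennreal_mult ennreal_plus mult_nonneg_nonneg)
            moreover have "0 \<le> k p" "0 \<le> 2 * K * h" using K(1) h by (auto simp: k_def)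
            ultimately show ?thesis using F T_nonneg by blast
          qed
          finally show ?case .
        qed
      qed (use K C2 h in auto)
      moreover have "- 2 < t" "- 2 < t'" using t by auto
      ultimately have "ennreal (g * \<bar>u (x, t') - u (x, t)\<bar>) \<le> ennreal (F * (C2 * h powr s) + 2 * K * h * (g * M))"
        unfolding g_def using time_difference_le[of t t' x] by (meson order_trans)
      then have le: "g * \<bar>u (x, t') - u (x, t)\<bar> \<le> F * (C2 * h powr s) + 2 * K * h * (g * M)"
        using F C2(1) K(1) g M0 h by (subst (asm) ennreal_le_iff) auto
      have "\<bar>u (x, t') - u (x, t)\<bar> \<le> C * (F + M) * h powr s"
      proof (rule final[OF le F M0 _ C(4)])
        have "h = h powr (1 - s) * h powr s" using h by (simp add: powr_add[symmetric])
        also have "\<dots> \<le> 2 powr 1 * h powr s"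
        proof (intro mult_right_mono)
          have "h powr (1 - s) \<le> 2 powr (1 - s)" using h s by (intro powr_mono2) auto
          also have "\<dots> \<le> 2 powr 1" using s by (intro powr_mono) auto
          finally show "h powr (1 - s) \<le> 2 powr 1" .
        qed simp
        finally have "h \<le> 2 * h powr s" by simp
        then have "2 * K * h \<le> 2 * K * (2 * h powr s)" using K by (intro mult_left_mono) auto
        also have "\<dots> = 4 * K * h powr s" by simp
        also have "\<dots> \<le> C * h powr s" using C by (intro mult_right_mono) auto
        finally show "2 * K * h \<le> C * h powr s" .
      qed simp
      then show "\<bar>u (x, t') - u (x, t)\<bar> \<le> C * (F + M) * (t' - t) powr s" by (simp add: h_def)
    }
  qed
qed

subsection \<open>Classical entire solutions\<close>

lemma hoelder_seminormD:
  assumes "hoelder_seminorm d \<alpha> S g < ennreal K" "p \<in> S" "q \<in> S"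
  shows "norm (g p - g q) \<le> K * d p q powr \<alpha>"
proof -
  obtain K' where K': "0 \<le> K'" "\<forall>p\<in>S. \<forall>q\<in>S. norm (g p - g q) \<le> K' * d p q powr \<alpha>" "ennreal K' < ennreal K"
    using assms(1) unfolding hoelder_seminorm_def INF_less_iff by blast
  have "K' \<le> K" using K'(1,3) by (metis ennreal_le_iff ennreal_less_iff less_imp_le linorder_not_le)
  then have "K' * d p q powr \<alpha> \<le> K * d p q powr \<alpha>" by (rule mult_right_mono) simp
  then show ?thesis using K'(2) assms by (meson order_trans)
qed

lemma ennreal_finite_bound:
  assumes "e < (\<infinity>::ennreal)"
  shows "\<exists>K>0. e < ennreal K"
proof -
  have "e = ennreal (enn2real e)" using assms by simp
  also have "\<dots> < ennreal (enn2real e + 1)" by (rule ennreal_lessI) (auto simp: add_nonneg_pos)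
  finally show ?thesis by (meson add_nonneg_pos enn2real_nonneg zero_less_one)
qed

lemma hoelder_tD:
  assumes "hoelder_t \<alpha> \<Omega> u < \<infinity>"
  obtains K where "0 < K" "\<And>x t t'. (x, t) \<in> \<Omega> \<Longrightarrow> (x, t') \<in> \<Omega> \<Longrightarrow> norm (u (x, t) - u (x, t')) \<le> K * \<bar>t - t'\<bar> powr \<alpha>"
proof -
  obtain K where K: "0 < K" "hoelder_t \<alpha> \<Omega> u < ennreal K" using ennreal_finite_bound[OF assms] by blast
  have "norm (u (x, t) - u (x, t')) \<le> K * \<bar>t - t'\<bar> powr \<alpha>" if "(x, t) \<in> \<Omega>" "(x, t') \<in> \<Omega>" for x t t'
  proof -
    have "hoelder_seminorm dist \<alpha> {t. (x, t) \<in> \<Omega>} (\<lambda>t. u (x, t)) \<le> hoelder_t \<alpha> \<Omega> u"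
      unfolding hoelder_t_def by (rule SUP_upper) (use that in force)
    then have "hoelder_seminorm dist \<alpha> {t. (x, t) \<in> \<Omega>} (\<lambda>t. u (x, t)) < ennreal K" using K(2) by (rule order_le_less_trans)
    from hoelder_seminormD[OF this, of t t'] that show ?thesis by (simp add: dist_real_def)
  qed
  then show ?thesis using that K(1) by blast
qed

lemma hoelder_xD:
  assumes "hoelder_x \<alpha> \<Omega> u < \<infinity>"
  obtains K where "0 < K" "\<And>x x' t. (x, t) \<in> \<Omega> \<Longrightarrow> (x', t) \<in> \<Omega> \<Longrightarrow> norm (u (x, t) - u (x', t)) \<le> K * norm (x - x') powr \<alpha>"
proof -
  obtain K where K: "0 < K" "hoelder_x \<alpha> \<Omega> u < ennreal K" using ennreal_finite_bound[OF assms] by blast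
  have "norm (u (x, t) - u (x', t)) \<le> K * norm (x - x') powr \<alpha>" if "(x, t) \<in> \<Omega>" "(x', t) \<in> \<Omega>" for x x' t
  proof -
    have "hoelder_seminorm dist \<alpha> {x. (x, t) \<in> \<Omega>} (\<lambda>x. u (x, t)) \<le> hoelder_x \<alpha> \<Omega> u"
      unfolding hoelder_x_def by (rule SUP_upper) (use that in force)
    then have "hoelder_seminorm dist \<alpha> {x. (x, t) \<in> \<Omega>} (\<lambda>x. u (x, t)) < ennreal K" using K(2) by (rule order_le_less_trans)
    from hoelder_seminormD[OF this, of x x'] that show ?thesis by (simp add: dist_norm)
  qed
  then show ?thesis using that K(1) by blast
qed

lemma sup_normD:
  assumes "sup_norm S g < \<infinity>"
  obtains K where "0 < K" "\<And>p. p \<in> S \<Longrightarrow> norm (g p) \<le> K"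
proof -
  obtain K where K: "0 < K" "sup_norm S g < ennreal K" using ennreal_finite_bound[OF assms] by blast
  have "norm (g p) \<le> K" if "p \<in> S" for p
  proof -
    have "ennreal (norm (g p)) \<le> sup_norm S g" unfolding sup_norm_def by (rule SUP_upper[OF that])
    then have "ennreal (norm (g p)) < ennreal K" using K(2) by (rule order_le_less_trans)
    then show ?thesis using K(1) by (simp add: ennreal_less_iff)
  qed
  then show ?thesis using that K(1) by blast
qed

text \<open>\<open>grad_x\<close> is a definite description, so existence and uniqueness of the
  gradient have to be supplied; existence comes from representing the derivative as an inner
  product.\<close>

lemma grad_x_GDERIV:
  assumes "(\<lambda>y. u (y, t)) differentiable (at x)"
  shows "GDERIV (\<lambda>y. u (y, t)) x :> grad_x u (x, t)"
proof -
  obtain f' where f': "((\<lambda>y. u (y, t)) has_derivative f') (at x)" using assms unfolding differentiable_def by blast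
  interpret bounded_linear f' by (rule has_derivative_bounded_linear[OF f'])
  define D where "D = (\<Sum>b\<in>Basis. f' b *\<^sub>R b)"
  have "f' h = h \<bullet> D" for h
  proof -
    have "f' h = f' (\<Sum>b\<in>Basis. (h \<bullet> b) *\<^sub>R b)" by (simp add: euclidean_representation)
    also have "\<dots> = (\<Sum>b\<in>Basis. (h \<bullet> b) * f' b)" by (simp add: sum scale)
    also have "\<dots> = h \<bullet> D" by (simp add: D_def inner_sum_right mult.commute)
    finally show ?thesis .
  qed
  then have "f' = (\<lambda>h. h \<bullet> D)" by auto
  then have D: "GDERIV (\<lambda>y. u (y, t)) x :> D" using f' by (simp add: gderiv_def)
  have uniq: "D' = D" if "GDERIV (\<lambda>y. u (y, t)) x :> D'" for D'
  proof -
    have "(\<lambda>h. h \<bullet> D') = (\<lambda>h. h \<bullet> D)" using that D unfolding gderiv_def by (rule has_derivative_unique)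
    then have "(D' - D) \<bullet> D' = (D' - D) \<bullet> D" by (rule fun_cong)
    then have "(D' - D) \<bullet> (D' - D) = 0" by (simp add: inner_diff_right)
    then show ?thesis by simp
  qed
  have "grad_x u (x, t) = (THE D. GDERIV (\<lambda>y. u (y, t)) x :> D)" by (simp add: grad_x_def)
  also have "\<dots> = D" using D by (rule the_equality) (rule uniq)
  finally show ?thesis using D by simp
qed

lemma cyl_iff: "(x, t) \<in> cyl r x0 t0 \<longleftrightarrow> norm (x - x0) < r \<and> \<bar>t - t0\<bar> < r\<^sup>2"
  by (simp add: cyl_def)

text \<open>The exponent \<gamma> may be below or above 1. In the second case first differences are
  only Lipschitz, whence the minimum with 1. Second differences keep the order \<gamma>: the mean
  value theorem for \<theta> \<mapsto> u(x + \<theta> \<xi>, t) + u(x - \<theta> \<xi>, t) produces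
  a difference of gradients at points at most 2 |\<xi>| apart.\<close>

lemma locally_hoelder_local_bounds:
  fixes u :: "(real ^ 'n) \<times> real \<Rightarrow> real"
  assumes u: "u \<in> locally_hoelder \<gamma> \<alpha>" and \<gamma>: "0 < \<gamma>" "\<gamma> \<le> 2" and r: "0 < r"
  obtains K where "0 < K"
    "\<And>x t t'. (x, t) \<in> cyl r x0 t0 \<Longrightarrow> (x, t') \<in> cyl r x0 t0 \<Longrightarrow> \<bar>u (x, t) - u (x, t')\<bar> \<le> K * \<bar>t - t'\<bar> powr \<alpha>"
    "\<And>x x' t. (x, t) \<in> cyl r x0 t0 \<Longrightarrow> (x', t) \<in> cyl r x0 t0 \<Longrightarrow> \<bar>u (x, t) - u (x', t)\<bar> \<le> K * norm (x - x') powr min \<gamma> 1"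
    "\<And>x \<xi> t. (x + \<xi>, t) \<in> cyl r x0 t0 \<Longrightarrow> (x - \<xi>, t) \<in> cyl r x0 t0 \<Longrightarrow> (x, t) \<in> cyl r x0 t0 \<Longrightarrow> \<bar>u (x + \<xi>, t) + u (x - \<xi>, t) - 2 * u (x, t)\<bar> \<le> K * norm \<xi> powr \<gamma>"
proof -
  let ?C = "cyl r x0 t0"
  have h: "hoelder_t \<alpha> ?C u < \<infinity>" "\<gamma> \<le> 1 \<Longrightarrow> hoelder_x \<gamma> ?C u < \<infinity>"
    "\<not> \<gamma> \<le> 1 \<Longrightarrow> x_differentiable_on u ?C" "\<not> \<gamma> \<le> 1 \<Longrightarrow> sup_norm ?C (grad_x u) < \<infinity>" "\<not> \<gamma> \<le> 1 \<Longrightarrow> hoelder_x (\<gamma> - 1) ?C (grad_x u) < \<infinity>"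
    using u r unfolding locally_hoelder_def by (auto split: if_splits)
  obtain Kt where Kt: "0 < Kt" "\<And>x t t'. (x, t) \<in> ?C \<Longrightarrow> (x, t') \<in> ?C \<Longrightarrow> norm (u (x, t) - u (x, t')) \<le> Kt * \<bar>t - t'\<bar> powr \<alpha>"
    using hoelder_tD[OF h(1)] by metis
  show ?thesis
  proof (cases "\<gamma> \<le> 1")
    case True
    obtain Kx where Kx: "0 < Kx" "\<And>x x' t. (x, t) \<in> ?C \<Longrightarrow> (x', t) \<in> ?C \<Longrightarrow> norm (u (x, t) - u (x', t)) \<le> Kx * norm (x - x') powr \<gamma>"
      using hoelder_xD[OF h(2)[OF True]] by metis
    define K where "K = Kt + 2 * Kx"
    have K: "0 < K" "Kt \<le> K" "Kx \<le> K" "2 * Kx = K - Kt" using Kt(1) Kx(1) by (auto simp: K_def)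
    show ?thesis
    proof (rule that[of K])
      show "\<bar>u (x, t) - u (x, t')\<bar> \<le> K * \<bar>t - t'\<bar> powr \<alpha>" if "(x, t) \<in> ?C" "(x, t') \<in> ?C" for x t t'
        using Kt(2)[OF that] mult_right_mono[OF K(2), of "\<bar>t - t'\<bar> powr \<alpha>"] by simp
      show "\<bar>u (x, t) - u (x', t)\<bar> \<le> K * norm (x - x') powr min \<gamma> 1" if "(x, t) \<in> ?C" "(x', t) \<in> ?C" for x x' t
        using Kx(2)[OF that] mult_right_mono[OF K(3), of "norm (x - x') powr \<gamma>"] True by (simp add: min_def)
      show "\<bar>u (x + \<xi>, t) + u (x - \<xi>, t) - 2 * u (x, t)\<bar> \<le> K * norm \<xi> powr \<gamma>" if "(x + \<xi>, t) \<in> ?C" "(x - \<xi>, t) \<in> ?C" "(x, t) \<in> ?C" for x \<xi> t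
      proof -
        have "\<bar>u (x + \<xi>, t) - u (x, t)\<bar> \<le> Kx * norm \<xi> powr \<gamma>" "\<bar>u (x - \<xi>, t) - u (x, t)\<bar> \<le> Kx * norm \<xi> powr \<gamma>"
          using Kx(2)[OF that(1,3)] Kx(2)[OF that(2,3)] by simp_all
        then have "\<bar>u (x + \<xi>, t) + u (x - \<xi>, t) - 2 * u (x, t)\<bar> \<le> 2 * Kx * norm \<xi> powr \<gamma>" by linarith
        also have "\<dots> \<le> K * norm \<xi> powr \<gamma>" using K Kt(1) by (intro mult_right_mono) auto
        finally show ?thesis .
      qed
    qed (rule K)
  next
    case False
    obtain Kx where Kx: "0 < Kx" "\<And>x x' t. (x, t) \<in> ?C \<Longrightarrow> (x', t) \<in> ?C \<Longrightarrow> norm (grad_x u (x, t) - grad_x u (x', t)) \<le> Kx * norm (x - x') powr (\<gamma> - 1)"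
      using hoelder_xD[OF h(5)[OF False]] by metis
    obtain Kg where Kg: "0 < Kg" "\<And>p. p \<in> ?C \<Longrightarrow> norm (grad_x u p) \<le> Kg"
      using sup_normD[OF h(4)[OF False]] by metis
    have der: "((\<lambda>y. u (y, t)) has_derivative (\<lambda>h. h \<bullet> grad_x u (x, t))) (at x)" if "(x, t) \<in> ?C" for x t
    proof -
      have "(\<lambda>y. u (y, t)) differentiable (at x)" using h(3)[OF False] that unfolding x_differentiable_on_def by blast
      from grad_x_GDERIV[OF this] show ?thesis by (simp add: gderiv_def)
    qed
    define K where "K = Kt + Kg + 2 * Kx"
    have K: "0 < K" "Kt \<le> K" "Kg \<le> K" "2 * Kx \<le> K" using Kt(1) Kx(1) Kg(1) by (auto simp: K_def)
    have seg: "(x + \<theta> *\<^sub>R d, t) \<in> ?C" if "(x, t) \<in> ?C" "(x + d, t) \<in> ?C" "0 \<le> \<theta>" "\<theta> \<le> 1" for x d \<theta> t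
    proof -
      have "norm (x + \<theta> *\<^sub>R d - x0) = norm ((1 - \<theta>) *\<^sub>R (x - x0) + \<theta> *\<^sub>R (x + d - x0))" by (simp add: algebra_simps)
      also have "\<dots> \<le> (1 - \<theta>) * norm (x - x0) + \<theta> * norm (x + d - x0)"
        using that(3,4) norm_triangle_ineq[of "(1 - \<theta>) *\<^sub>R (x - x0)" "\<theta> *\<^sub>R (x + d - x0)"] by simp
      also have "\<dots> < r"
        using that by (intro convex_bound_lt) (auto simp: cyl_iff)
      finally show ?thesis using that(1) by (simp add: cyl_iff)
    qed
    have dline: "((\<lambda>\<theta>. u (x + \<theta> *\<^sub>R d, t)) has_real_derivative (d \<bullet> grad_x u (x + \<theta> *\<^sub>R d, t))) (at \<theta>)" if "(x + \<theta> *\<^sub>R d, t) \<in> ?C" for x d \<theta> t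
    proof -
      have "((\<lambda>\<theta>. x + \<theta> *\<^sub>R d) has_derivative (\<lambda>r. r *\<^sub>R d)) (at \<theta>)"
        by (auto intro!: derivative_eq_intros)
      from this der[OF that] have "((\<lambda>\<theta>. u (x + \<theta> *\<^sub>R d, t)) has_derivative (\<lambda>r. (r *\<^sub>R d) \<bullet> grad_x u (x + \<theta> *\<^sub>R d, t))) (at \<theta>)"
        by (rule has_derivative_compose)
      then show ?thesis by (simp add: has_field_derivative_def mult_commute_abs)
    qed
    show ?thesis
    proof (rule that[of K])
      show "\<bar>u (x, t) - u (x, t')\<bar> \<le> K * \<bar>t - t'\<bar> powr \<alpha>" if "(x, t) \<in> ?C" "(x, t') \<in> ?C" for x t t'
        using Kt(2)[OF that] mult_right_mono[OF K(2), of "\<bar>t - t'\<bar> powr \<alpha>"] by simp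
      show "\<bar>u (x, t) - u (x', t)\<bar> \<le> K * norm (x - x') powr min \<gamma> 1" if xx: "(x, t) \<in> ?C" "(x', t) \<in> ?C" for x x' t
      proof -
        let ?d = "x - x'"
        have in_C: "(x' + \<theta> *\<^sub>R ?d, t) \<in> ?C" if "0 \<le> \<theta>" "\<theta> \<le> 1" for \<theta> using seg[of x' t ?d \<theta>] xx that by simp
        have "\<exists>z>0. z < 1 \<and> u (x' + 1 *\<^sub>R ?d, t) - u (x' + 0 *\<^sub>R ?d, t) = (1 - 0) * (?d \<bullet> grad_x u (x' + z *\<^sub>R ?d, t))"
          by (rule MVT2) (use in_C dline in auto)
        then obtain z where z: "0 < z" "z < 1" "u (x, t) - u (x', t) = ?d \<bullet> grad_x u (x' + z *\<^sub>R ?d, t)" by auto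
        have "\<bar>u (x, t) - u (x', t)\<bar> \<le> norm ?d * norm (grad_x u (x' + z *\<^sub>R ?d, t))"
          unfolding z(3) by (rule Cauchy_Schwarz_ineq2)
        also have "\<dots> \<le> norm ?d * K" using Kg(2)[OF in_C[of z]] z K by (intro mult_left_mono) auto
        finally show ?thesis using False by (simp add: min_def mult.commute)
      qed
      show "\<bar>u (x + \<xi>, t) + u (x - \<xi>, t) - 2 * u (x, t)\<bar> \<le> K * norm \<xi> powr \<gamma>" if xx: "(x + \<xi>, t) \<in> ?C" "(x - \<xi>, t) \<in> ?C" "(x, t) \<in> ?C" for x \<xi> t
      proof (cases "\<xi> = 0")
        case True
        then show ?thesis by simp
      next
        case False
        have in1: "(x + \<theta> *\<^sub>R \<xi>, t) \<in> ?C" if "0 \<le> \<theta>" "\<theta> \<le> 1" for \<theta> by (rule seg) (use xx that in auto)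
        have in2: "(x + \<theta> *\<^sub>R (- \<xi>), t) \<in> ?C" if "0 \<le> \<theta>" "\<theta> \<le> 1" for \<theta> by (rule seg) (use xx that in auto)
        let ?F = "\<lambda>\<theta>. u (x + \<theta> *\<^sub>R \<xi>, t) + u (x + \<theta> *\<^sub>R (- \<xi>), t)"
        have "\<exists>z>0. z < 1 \<and> ?F 1 - ?F 0 = (1 - 0) * (\<xi> \<bullet> grad_x u (x + z *\<^sub>R \<xi>, t) + (- \<xi>) \<bullet> grad_x u (x + z *\<^sub>R (- \<xi>), t))"
        proof (rule MVT2)
          fix \<theta> :: real assume "0 \<le> \<theta>" "\<theta> \<le> 1"
          then show "(?F has_real_derivative (\<xi> \<bullet> grad_x u (x + \<theta> *\<^sub>R \<xi>, t) + (- \<xi>) \<bullet> grad_x u (x + \<theta> *\<^sub>R (- \<xi>), t))) (at \<theta>)"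
            by (intro DERIV_add dline in1 in2)
        qed simp
        then obtain z where z: "0 < z" "z < 1" "?F 1 - ?F 0 = (1 - 0) * (\<xi> \<bullet> grad_x u (x + z *\<^sub>R \<xi>, t) + (- \<xi>) \<bullet> grad_x u (x + z *\<^sub>R (- \<xi>), t))"
          by blast
        have "u (x + \<xi>, t) + u (x - \<xi>, t) - 2 * u (x, t) = \<xi> \<bullet> (grad_x u (x + z *\<^sub>R \<xi>, t) - grad_x u (x + z *\<^sub>R (- \<xi>), t))"
          using z(3) by (simp add: inner_diff_right)
        then have "\<bar>u (x + \<xi>, t) + u (x - \<xi>, t) - 2 * u (x, t)\<bar> \<le> norm \<xi> * norm (grad_x u (x + z *\<^sub>R \<xi>, t) - grad_x u (x + z *\<^sub>R (- \<xi>), t))"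
          by (simp only:) (rule Cauchy_Schwarz_ineq2)
        also have "\<dots> \<le> norm \<xi> * (Kx * norm ((x + z *\<^sub>R \<xi>) - (x + z *\<^sub>R (- \<xi>))) powr (\<gamma> - 1))"
          using z by (intro mult_left_mono Kx in1 in2) auto
        also have "\<dots> \<le> norm \<xi> * (Kx * (2 * norm \<xi> powr (\<gamma> - 1)))"
        proof -
          have "(x + a) - (x + - a) = a + a" for a :: "real ^ 'n" by simp
          from this[of "z *\<^sub>R \<xi>"] have "(x + z *\<^sub>R \<xi>) - (x + z *\<^sub>R (- \<xi>)) = z *\<^sub>R \<xi> + z *\<^sub>R \<xi>" by (simp only: scaleR_minus_right)
          then have "norm ((x + z *\<^sub>R \<xi>) - (x + z *\<^sub>R (- \<xi>))) \<le> norm (z *\<^sub>R \<xi>) + norm (z *\<^sub>R \<xi>)" by (simp only: norm_triangle_ineq)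
          moreover have "norm (z *\<^sub>R \<xi>) \<le> norm \<xi>" using z by (simp add: mult_left_le_one_le)
          ultimately have "norm ((x + z *\<^sub>R \<xi>) - (x + z *\<^sub>R (- \<xi>))) \<le> 2 * norm \<xi>" by linarith
          then have "norm ((x + z *\<^sub>R \<xi>) - (x + z *\<^sub>R (- \<xi>))) powr (\<gamma> - 1) \<le> (2 * norm \<xi>) powr (\<gamma> - 1)"
            using \<open>\<not> \<gamma> \<le> 1\<close> by (intro powr_mono2) auto
          also have "\<dots> \<le> 2 * norm \<xi> powr (\<gamma> - 1)"
          proof -
            have "2 powr (\<gamma> - 1) \<le> (2::real) powr 1" using \<gamma> by (intro powr_mono) auto
            then show ?thesis unfolding powr_mult by (intro mult_right_mono) auto
          qed
          finally show ?thesis using Kx(1) by (intro mult_left_mono) auto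
        qed
        finally have "\<bar>u (x + \<xi>, t) + u (x - \<xi>, t) - 2 * u (x, t)\<bar> \<le> norm \<xi> * (Kx * (2 * norm \<xi> powr (\<gamma> - 1)))" .
        also have "\<dots> = 2 * Kx * (norm \<xi> * norm \<xi> powr (\<gamma> - 1))" by simp
        also have "norm \<xi> * norm \<xi> powr (\<gamma> - 1) = norm \<xi> powr \<gamma>"
          using powr_add[of "norm \<xi>" 1 "\<gamma> - 1"] False by simp
        also have "2 * Kx * norm \<xi> powr \<gamma> \<le> K * norm \<xi> powr \<gamma>" using K by (intro mult_right_mono) auto
        finally show ?thesis .
      qed
    qed (rule K)
  qed
qed

lemma locally_hoelder_continuous:
  fixes u :: "(real ^ 'n) \<times> real \<Rightarrow> real"
  assumes u: "u \<in> locally_hoelder \<gamma> \<alpha>" and \<gamma>: "0 < \<gamma>" "\<gamma> \<le> 2" and \<alpha>: "0 < \<alpha>"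
  shows "continuous_on UNIV u"
  unfolding continuous_on_eq_continuous_at[OF open_UNIV]
proof
  fix p :: "(real ^ 'n) \<times> real"
  obtain x0 t0 where p: "p = (x0, t0)" by (cases p)
  obtain K where K: "0 < K"
    "\<And>x t t'. (x, t) \<in> cyl 1 x0 t0 \<Longrightarrow> (x, t') \<in> cyl 1 x0 t0 \<Longrightarrow> \<bar>u (x, t) - u (x, t')\<bar> \<le> K * \<bar>t - t'\<bar> powr \<alpha>"
    "\<And>x x' t. (x, t) \<in> cyl 1 x0 t0 \<Longrightarrow> (x', t) \<in> cyl 1 x0 t0 \<Longrightarrow> \<bar>u (x, t) - u (x', t)\<bar> \<le> K * norm (x - x') powr min \<gamma> 1"
    by (rule locally_hoelder_local_bounds[OF u \<gamma>, of 1 x0 t0]) simp_all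
  have "((\<lambda>q. u q - u p) \<longlongrightarrow> 0) (at p)"
  proof (rule Lim_null_comparison)
    have op: "open (ball x0 1 \<times> ball t0 (1::real))" by (intro open_Times) auto
    have "eventually (\<lambda>q. q \<in> ball x0 1 \<times> ball t0 1) (at p)"
      using op by (rule eventually_at_in_open') (simp add: p)
    then show "eventually (\<lambda>q. norm (u q - u p) \<le> K * \<bar>snd q - t0\<bar> powr \<alpha> + K * norm (fst q - x0) powr min \<gamma> 1) (at p)"
    proof eventually_elim
      case (elim q)
      obtain x t where q: "q = (x, t)" by (cases q)
      have c: "(x, t) \<in> cyl 1 x0 t0" "(x, t0) \<in> cyl 1 x0 t0" "(x0, t0) \<in> cyl 1 x0 t0"
        using elim by (auto simp: q cyl_iff dist_norm norm_minus_commute dist_real_def abs_minus_commute)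
      have "\<bar>u (x, t) - u (x, t0)\<bar> \<le> K * \<bar>t - t0\<bar> powr \<alpha>" "\<bar>u (x, t0) - u (x0, t0)\<bar> \<le> K * norm (x - x0) powr min \<gamma> 1"
        using K(2)[OF c(1,2)] K(3)[OF c(2,3)] by auto
      then show ?case unfolding p q by simp
    qed
    have "((\<lambda>q. K * \<bar>snd q - t0\<bar> powr \<alpha> + K * norm (fst q - x0) powr min \<gamma> 1) \<longlongrightarrow> K * \<bar>snd p - t0\<bar> powr \<alpha> + K * norm (fst p - x0) powr min \<gamma> 1) (at p)"
      using \<alpha> \<gamma> by (intro tendsto_add tendsto_mult tendsto_const tendsto_powr' tendsto_intros) auto
    then show "((\<lambda>q. K * \<bar>snd q - t0\<bar> powr \<alpha> + K * norm (fst q - x0) powr min \<gamma> 1) \<longlongrightarrow> 0) (at p)"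
      using \<alpha> \<gamma> by (simp add: p)
  qed
  then show "isCont u p" unfolding isCont_def by (rule LIM_zero_cancel)
qed

text \<open>A continuous integrand is integrable on the unit ball around x, and outside by the
  definition of the principal value, which is thus an ordinary integral. This applies to the
  operator because at a fixed \<tau> < t the Gaussian has no singularity at y = x.\<close>

lemma has_pv_integral_eq:
  fixes g :: "real ^ 'n \<Rightarrow> real"
  assumes pv: "has_pv_integral g x I" and g: "continuous_on UNIV g"
  shows "integrable lborel g" "integral\<^sup>L lborel g = I"
proof -
  have gm[measurable]: "g \<in> borel_measurable borel" using g by (rule borel_measurable_continuous_onI)
  have far: "set_integrable lborel {y. norm (y - x) > 1} g"
  proof -
    have "set_integrable lebesgue {y. norm (y - x) > 1} g" using pv unfolding has_pv_integral_def by auto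
    then show ?thesis unfolding set_integrable_def by (subst (asm) integrable_completion) auto
  qed
  have near: "set_integrable lborel (cball x 1) g"
    unfolding set_integrable_def using borel_integrable_compact[OF compact_cball continuous_on_subset[OF g]] by auto
  have "set_integrable lborel ({y. norm (y - x) > 1} \<union> cball x 1) g"
    by (rule set_integrable_Un[OF far near]) auto
  moreover have "{y. norm (y - x) > 1} \<union> cball x 1 = UNIV" by (auto simp: dist_norm norm_minus_commute)
  ultimately show int: "integrable lborel g" by (simp add: set_integrable_def)
  let ?J = "\<lambda>e. LINT y:{y. norm (y - x) > e}|lebesgue. g y"
  have J: "?J e = (\<integral>y. indicator {y. norm (y - x) > e} y * g y \<partial>lborel)" for e
    unfolding set_lebesgue_integral_def by (subst integral_completion) auto
  have fl: "filterlim (\<lambda>n. inverse (real (Suc n))) (at_right 0) sequentially"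
    using LIMSEQ_inverse_real_of_nat by (auto simp: filterlim_at intro!: always_eventually)
  have "(?J \<longlongrightarrow> I) (at_right 0)" using pv unfolding has_pv_integral_def by auto
  then have l1: "(\<lambda>n. ?J (inverse (real (Suc n)))) \<longlonglongrightarrow> I" using fl by (rule filterlim_compose)
  have "(\<lambda>n. ?J (inverse (real (Suc n)))) \<longlonglongrightarrow> integral\<^sup>L lborel g"
    unfolding J
  proof (rule integral_dominated_convergence[where w = "\<lambda>y. norm (g y)"])
    show "integrable lborel (\<lambda>y. norm (g y))" using int by (rule integrable_norm)
    show "AE y in lborel. (\<lambda>n. indicator {y. norm (y - x) > inverse (real (Suc n))} y * g y) \<longlonglongrightarrow> g y"
      using AE_lborel_singleton[of x]
    proof eventually_elim
      case (elim y)
      then have "0 < norm (y - x)" by simp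
      then have "eventually (\<lambda>n. inverse (real (Suc n)) < norm (y - x)) sequentially"
        by (rule order_tendstoD(2)[OF LIMSEQ_inverse_real_of_nat])
      then have "eventually (\<lambda>n. indicator {y. norm (y - x) > inverse (real (Suc n))} y * g y = g y) sequentially"
        by eventually_elim simp
      then show ?case by (rule tendsto_eventually)
    qed
    show "AE y in lborel. norm (indicator {y. norm (y - x) > inverse (real (Suc n))} y * g y) \<le> norm (g y)" for n
      by (intro AE_I2) (auto simp: indicator_def)
  qed auto
  then show "integral\<^sup>L lborel g = I" using l1 by (rule LIMSEQ_unique)
qed

text \<open>In the lag \<sigma> = t - \<tau> the kernel is (4 \<pi>)^(n/2) \<sigma>^(-1-s) times the
  heat kernel, whose mass one turns the inner integral into u(x, t) - P_\<sigma> u. The constant of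
  the operator then leaves 1/|Gamma(-s)|, which is moved to the left-hand side.\<close>

lemma has_frac_heat_subordination:
  fixes u :: "(real ^ 'n) \<times> real \<Rightarrow> real"
  assumes s: "0 < s" "s < 1" and u0: "\<And>p. 0 \<le> u p" and cont: "continuous_on UNIV u" and eq: "has_frac_heat s u x t v"
  shows "\<bar>Gamma (- s)\<bar> * v = (LINT \<sigma>:{0<..}|lborel. \<sigma> powr (- 1 - s) *
          (u (x, t) - enn2real (\<integral>\<^sup>+y. ennreal (heat_kernel \<sigma> (x - y) * u (y, t - \<sigma>)) \<partial>lborel)))"
proof -
    have um: "u \<in> borel_measurable borel" using cont by (rule borel_measurable_continuous_onI)
    have um'[measurable (raw)]: "(\<lambda>w. u (g w, h w)) \<in> borel_measurable M" if "g \<in> borel_measurable M" "h \<in> borel_measurable M" for g h and M :: "'b measure"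
      using that by (intro measurable_compose[OF borel_measurable_Pair um])
    have n: "real DIM(real ^ 'n) = real CARD('n)" by simp
    obtain P where P: "AE \<tau> in lebesgue. \<tau> < t \<longrightarrow>
              has_pv_integral
                (\<lambda>y. (u (x, t) - u (y, \<tau>)) / (t - \<tau>) powr (real CARD('n) / 2 + 1 + s)
                       * exp (- (norm (x - y))\<^sup>2 / (4 * (t - \<tau>))))
                x (P \<tau>)" "set_integrable lebesgue {..<t} P"
      "v = frac_heat_const TYPE('n) s * (LINT \<tau>:{..<t}|lebesgue. P \<tau>)"
      using eq unfolding has_frac_heat_def by (elim exE conjE) (rule that)
    define c where "c = (4 * pi) powr (real CARD('n) / 2)"
    have c: "0 < c" by (simp add: c_def)
    define H where "H = (\<lambda>\<sigma>. enn2real (\<integral>\<^sup>+y. ennreal (heat_kernel \<sigma> (x - y) * u (y, t - \<sigma>)) \<partial>lborel))"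
    have [measurable]: "H \<in> borel_measurable borel" unfolding H_def by measurable
    define Q where "Q = (\<lambda>\<sigma>. \<sigma> powr (- 1 - s) * (u (x, t) - H \<sigma>))"
    have [measurable]: "Q \<in> borel_measurable borel" unfolding Q_def by measurable
    have PQ: "P \<tau> = c * Q (t - \<tau>)" if \<tau>: "\<tau> < t" and pv: "has_pv_integral
                (\<lambda>y. (u (x, t) - u (y, \<tau>)) / (t - \<tau>) powr (real CARD('n) / 2 + 1 + s)
                       * exp (- (norm (x - y))\<^sup>2 / (4 * (t - \<tau>)))) x (P \<tau>)" for \<tau>
    proof -
      define \<sigma> where "\<sigma> = t - \<tau>"
      have \<sigma>: "0 < \<sigma>" "t - \<sigma> = \<tau>" using \<tau> by (auto simp: \<sigma>_def)
      define k where "k = c * \<sigma> powr (- 1 - s)"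
      have k: "0 < k" using c \<sigma> by (simp add: k_def)
      have g: "(u (x, t) - u (y, \<tau>)) / \<sigma> powr (real CARD('n) / 2 + 1 + s) * exp (- (norm (x - y))\<^sup>2 / (4 * \<sigma>))
        = k * (heat_kernel \<sigma> (x - y) * (u (x, t) - u (y, \<tau>)))" for y
      proof -
        have "1 / \<sigma> powr (real CARD('n) / 2 + 1 + s) = \<sigma> powr (- 1 - s) * \<sigma> powr (- (real CARD('n) / 2))"
          by (simp add: powr_minus_divide[symmetric] powr_add[symmetric] algebra_simps)
        moreover have "c * (4 * pi * \<sigma>) powr (- (real CARD('n) / 2)) = \<sigma> powr (- (real CARD('n) / 2))"
        proof -
          have "(4 * pi) powr (real CARD('n) / 2) * (4 * pi) powr (- (real CARD('n) / 2)) = 1"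
            by (simp add: powr_add[symmetric])
          then have "c * ((4 * pi) powr (- (real CARD('n) / 2)) * \<sigma> powr (- (real CARD('n) / 2))) = \<sigma> powr (- (real CARD('n) / 2))"
            unfolding c_def by (metis mult.assoc mult_1_left)
          then show ?thesis by (simp only: powr_mult)
        qed
        ultimately have "1 / \<sigma> powr (real CARD('n) / 2 + 1 + s) = k * (4 * pi * \<sigma>) powr (- (real CARD('n) / 2))"
          unfolding k_def by (metis mult.assoc mult.commute)
        then have "(u (x, t) - u (y, \<tau>)) * (1 / \<sigma> powr (real CARD('n) / 2 + 1 + s)) * exp (- (norm (x - y))\<^sup>2 / (4 * \<sigma>))
           = (u (x, t) - u (y, \<tau>)) * (k * (4 * pi * \<sigma>) powr (- (real CARD('n) / 2))) * exp (- (norm (x - y))\<^sup>2 / (4 * \<sigma>))"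
          by simp
        then show ?thesis unfolding heat_kernel_def n by (simp add: mult_ac)
      qed
      have pv': "has_pv_integral (\<lambda>y. k * (heat_kernel \<sigma> (x - y) * (u (x, t) - u (y, \<tau>)))) x (P \<tau>)"
        using pv unfolding \<sigma>_def[symmetric] g .
      have "continuous_on UNIV (\<lambda>y. k * (heat_kernel \<sigma> (x - y) * (u (x, t) - u (y, \<tau>))))"
        unfolding heat_kernel_def using \<sigma>
        by (intro continuous_intros continuous_on_compose2[OF cont]) auto
      note I = has_pv_integral_eq[OF pv' this]
      have hk: "integrable lborel (\<lambda>y. heat_kernel \<sigma> (x - y))" "(\<integral>y. heat_kernel \<sigma> (x - y) \<partial>lborel) = 1"
        using \<sigma> by (auto intro!: integrableI_nonneg simp: integral_eq_nn_integral)
      have i1: "integrable lborel (\<lambda>y. heat_kernel \<sigma> (x - y) * (u (x, t) - u (y, \<tau>)))"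
        using I(1) k by simp
      \<comment> \<open>The equation only provides integrability of the kernel against the
        difference; since the kernel times the constant u(x, t) is integrable, so is the kernel
        times u.\<close>
      have hu: "heat_kernel \<sigma> (x - y) * u (y, \<tau>) = heat_kernel \<sigma> (x - y) * u (x, t) - heat_kernel \<sigma> (x - y) * (u (x, t) - u (y, \<tau>))" for y
        by (simp add: algebra_simps)
      have "H \<sigma> = (\<integral>y. heat_kernel \<sigma> (x - y) * u (y, \<tau>) \<partial>lborel)"
        unfolding H_def \<sigma>(2) using u0 by (subst integral_eq_nn_integral) auto
      also have "\<dots> = u (x, t) - (\<integral>y. heat_kernel \<sigma> (x - y) * (u (x, t) - u (y, \<tau>)) \<partial>lborel)"
        unfolding hu using hk i1 by simp
      finally have "(\<integral>y. heat_kernel \<sigma> (x - y) * (u (x, t) - u (y, \<tau>)) \<partial>lborel) = u (x, t) - H \<sigma>" by simp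
      then have "P \<tau> = k * (u (x, t) - H \<sigma>)" using I(2) by simp
      then show ?thesis by (simp add: Q_def k_def \<sigma>_def)
    qed
    have "(LINT \<tau>:{..<t}|lebesgue. P \<tau>) = (\<integral>\<tau>. indicator {..<t} \<tau> * (c * Q (t - \<tau>)) \<partial>lebesgue)"
      unfolding set_lebesgue_integral_def
    proof (rule integral_cong_AE)
      show "(\<lambda>\<tau>. indicator {..<t} \<tau> *\<^sub>R P \<tau>) \<in> borel_measurable lebesgue"
        using P(2) unfolding set_integrable_def by (rule borel_measurable_integrable)
      show "(\<lambda>\<tau>. indicator {..<t} \<tau> * (c * Q (t - \<tau>))) \<in> borel_measurable lebesgue"
        by (rule measurable_completion) measurable
      show "AE \<tau> in lebesgue. indicator {..<t} \<tau> *\<^sub>R P \<tau> = indicator {..<t} \<tau> * (c * Q (t - \<tau>))"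
        using P(1)
      proof eventually_elim
        case (elim \<tau>)
        show ?case
        proof (cases "\<tau> < t")
          case True
          then have "P \<tau> = c * Q (t - \<tau>)" using PQ elim by blast
          then show ?thesis by simp
        qed simp
      qed
    qed
    also have "\<dots> = (\<integral>\<tau>. indicator {..<t} \<tau> * (c * Q (t - \<tau>)) \<partial>lborel)"
      by (rule integral_completion) measurable
    also have "\<dots> = (\<integral>\<sigma>. indicator {..<t} (t + (- 1) * \<sigma>) * (c * Q (t - (t + (- 1) * \<sigma>))) \<partial>lborel)"
      by (subst lborel_integral_real_affine[of "- 1" _ t]) auto
    also have "\<dots> = c * (LINT \<sigma>:{0<..}|lborel. Q \<sigma>)"
    proof -
      have "indicator {..<t} (t + (- 1) * \<sigma>) * (c * Q (t - (t + (- 1) * \<sigma>))) = c * (indicator {0<..} \<sigma> *\<^sub>R Q \<sigma>)" for \<sigma>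
        by (simp add: indicator_def)
      then show ?thesis unfolding set_lebesgue_integral_def by (simp only: integral_mult_right_zero)
    qed
    finally have a: "v = frac_heat_const TYPE('n) s * (c * (LINT \<sigma>:{0<..}|lborel. Q \<sigma>))"
      using P(3) by simp
    have b: "\<bar>Gamma (- s)\<bar> * (frac_heat_const TYPE('n) s * c) = 1"
    proof -
      \<comment> \<open>\<open>Gamma\<close> has the default value 0 at its poles; -s lies strictly
        between -1 and 0 and so is none of them.\<close>
      have "- s \<notin> \<int>\<^sub>\<le>\<^sub>0"
      proof
        assume "- s \<in> \<int>\<^sub>\<le>\<^sub>0"
        then obtain m :: nat where "- s = - of_nat m" by (auto elim!: nonpos_Ints_cases')
        then have "s = real m" by simp
        then show False using s by (cases m) auto
      qed
      then have "Gamma (- s) \<noteq> 0" by (simp add: Gamma_eq_zero_iff)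
      then show ?thesis using c by (simp add: frac_heat_const_def c_def)
    qed
    have "\<bar>Gamma (- s)\<bar> * v = (\<bar>Gamma (- s)\<bar> * (frac_heat_const TYPE('n) s * c)) * (LINT \<sigma>:{0<..}|lborel. Q \<sigma>)"
      unfolding a by (simp only: mult.assoc)
    also have "\<dots> = (LINT \<sigma>:{0<..}|lborel. Q \<sigma>)" unfolding b by simp
    finally show ?thesis unfolding Q_def H_def .
qed

lemma heat_fraction_if_classical:
  fixes u f :: "(real ^ 'n) \<times> real \<Rightarrow> real"
  assumes s: "0 < s" "s < 1" and f0: "\<And>p. 0 \<le> f p" and u0: "\<And>p. 0 \<le> u p" and sol: "classical_entire_solution s u f"
  shows "heat_fraction s u (\<lambda>p. \<bar>Gamma (- s)\<bar> * f p)"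
proof -
  obtain \<epsilon> where \<epsilon>: "0 < \<epsilon>" "s + \<epsilon> \<le> 1" "u \<in> locally_hoelder (2 * s + \<epsilon>) (s + \<epsilon>)" and slow: "u \<in> slowly_increasing s"
    and eq: "\<And>x t. has_frac_heat s u x t (f (x, t))"
    using sol unfolding classical_entire_solution_def by blast
  have \<gamma>: "0 < 2 * s + \<epsilon>" "2 * s + \<epsilon> \<le> 2" using s \<epsilon> by auto
  have cont: "continuous_on UNIV u" by (rule locally_hoelder_continuous[OF \<epsilon>(3) \<gamma>]) (use s \<epsilon> in auto)
  have n: "real DIM(real ^ 'n) = real CARD('n)" by simp
  show ?thesis
  proof (unfold_locales)
    show "0 < s" "s < 1" "continuous_on UNIV u" by fact+
    show "0 \<le> u p" "0 \<le> \<bar>Gamma (- s)\<bar> * f p" for p using u0 f0 by auto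
    show "(\<integral>\<^sup>+\<tau>\<in>{..<T}. (\<integral>\<^sup>+y. ennreal (u (y, \<tau>) * exp (- (norm y)\<^sup>2 / (4 * (T - \<tau>)))
                    / (1 + (T - \<tau>) powr (real DIM(real ^ 'n) / 2 + 1 + s))) \<partial>lborel) \<partial>lborel) < \<infinity>" for T
      using slow u0 unfolding slowly_increasing_def n by (simp add: nn_integral_completion)
    show "\<exists>\<epsilon>>0. \<forall>A. \<exists>K. \<forall>x t \<xi> h. norm x \<le> A \<longrightarrow> \<bar>t\<bar> \<le> A \<longrightarrow> norm \<xi> \<le> 1 \<longrightarrow> 0 \<le> h \<longrightarrow> h \<le> 1 \<longrightarrow>
          \<bar>u (x + \<xi>, t) + u (x - \<xi>, t) - 2 * u (x, t)\<bar> \<le> K * norm \<xi> powr (2 * s + \<epsilon>) \<and>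
          \<bar>u (x, t - h) - u (x, t)\<bar> \<le> K * h powr (s + \<epsilon>)"
    proof (rule exI[of _ \<epsilon>], intro conjI allI \<epsilon>(1))
      fix A :: real
      \<comment> \<open>The cylinder must contain x, x + \<xi> and x - \<xi> at time t, and x at
        time t - h; its extent in time is r^2, which is at least r.\<close>
      define r where "r = \<bar>A\<bar> + 2"
      have "1 \<le> r" by (simp add: r_def)
      then have r: "0 < r" "r \<le> r\<^sup>2" using mult_left_mono[of 1 r r] by (auto simp: power2_eq_square)
      obtain K where K: "0 < K"
        "\<And>x t t'. (x, t) \<in> cyl r 0 0 \<Longrightarrow> (x, t') \<in> cyl r 0 0 \<Longrightarrow> \<bar>u (x, t) - u (x, t')\<bar> \<le> K * \<bar>t - t'\<bar> powr (s + \<epsilon>)"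
        "\<And>x \<xi> t. (x + \<xi>, t) \<in> cyl r 0 0 \<Longrightarrow> (x - \<xi>, t) \<in> cyl r 0 0 \<Longrightarrow> (x, t) \<in> cyl r 0 0 \<Longrightarrow> \<bar>u (x + \<xi>, t) + u (x - \<xi>, t) - 2 * u (x, t)\<bar> \<le> K * norm \<xi> powr (2 * s + \<epsilon>)"
        by (rule locally_hoelder_local_bounds[OF \<epsilon>(3) \<gamma> r(1), of 0 0]) simp_all
      have "\<bar>u (x + \<xi>, t) + u (x - \<xi>, t) - 2 * u (x, t)\<bar> \<le> K * norm \<xi> powr (2 * s + \<epsilon>) \<and> \<bar>u (x, t - h) - u (x, t)\<bar> \<le> K * h powr (s + \<epsilon>)"
        if "norm x \<le> A" "\<bar>t\<bar> \<le> A" "norm \<xi> \<le> 1" "0 \<le> h" "h \<le> 1" for x t \<xi> h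
      proof -
        have "norm (x + \<xi>) \<le> A + 1" "norm (x - \<xi>) \<le> A + 1"
          using norm_triangle_ineq[of x \<xi>] norm_triangle_ineq4[of x \<xi>] that by auto
        then have c: "(x + \<xi>, t) \<in> cyl r 0 0" "(x - \<xi>, t) \<in> cyl r 0 0" "(x, t) \<in> cyl r 0 0" "(x, t - h) \<in> cyl r 0 0"
          using that r by (auto simp: cyl_iff r_def intro: less_le_trans[OF _ r(2)[unfolded r_def]])
        show ?thesis using K(3)[OF c(1-3)] K(2)[OF c(4,3)] that by simp
      qed
      then show "\<exists>K. \<forall>x t \<xi> h. norm x \<le> A \<longrightarrow> \<bar>t\<bar> \<le> A \<longrightarrow> norm \<xi> \<le> 1 \<longrightarrow> 0 \<le> h \<longrightarrow> h \<le> 1 \<longrightarrow>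
          \<bar>u (x + \<xi>, t) + u (x - \<xi>, t) - 2 * u (x, t)\<bar> \<le> K * norm \<xi> powr (2 * s + \<epsilon>) \<and>
          \<bar>u (x, t - h) - u (x, t)\<bar> \<le> K * h powr (s + \<epsilon>)" by blast
    qed
    show "\<bar>Gamma (- s)\<bar> * f (x, t) = (LINT \<sigma>:{0<..}|lborel. \<sigma> powr (- 1 - s) *
          (u (x, t) - enn2real (\<integral>\<^sup>+y. ennreal (heat_kernel \<sigma> (x - y) * u (y, t - \<sigma>)) \<partial>lborel)))" for x t
      by (rule has_frac_heat_subordination[OF s u0 cont eq])
  qed
qed

subsection \<open>Zygmund estimates\<close>

text \<open>With e(d) = v(x + d) - v(x), the second difference at x + d with increment d is e(2 d) -
  2 e(d), so e(d) is half of e(2 d) up to the Zygmund bound. Doubling is repeated until 1/32 < |d|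
  \<le> 1/16, where the sup bound takes over; \<open>B\<close> is any modulus compatible with this
  recursion. All centres of second differences stay within radius 5/4.\<close>

lemma zygmund_upward:
  fixes v :: "'a::euclidean_space \<Rightarrow> real" and B :: "real \<Rightarrow> real"
  assumes sd: "\<And>x d. norm x \<le> 5 / 4 \<Longrightarrow> norm d \<le> 1 / 32 \<Longrightarrow> \<bar>v (x + d) + v (x - d) - 2 * v x\<bar> \<le> K * norm d powr (2 * s)"
    and M: "\<And>x. norm x \<le> 5 / 4 \<Longrightarrow> \<bar>v x\<bar> \<le> M"
    and B1: "\<And>r. 1 / 32 < r \<Longrightarrow> r \<le> 1 / 16 \<Longrightarrow> 2 * M \<le> B r"
    and B2: "\<And>r. 0 < r \<Longrightarrow> r \<le> 1 / 32 \<Longrightarrow> (B (2 * r) + K * r powr (2 * s)) / 2 \<le> B r"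
    and x: "norm x \<le> 1" and d: "d \<noteq> 0" "norm d \<le> 1 / 16"
  shows "\<bar>v (x + d) - v x\<bar> \<le> B (norm d)"
proof -
  \<comment> \<open>\<open>k\<close> bounds the number of doublings still to be made.\<close>
  have P: "\<bar>v (x + d) - v x\<bar> \<le> B (norm d)" if "1 / 32 < 2 ^ k * norm d" "norm d \<le> 1 / 16" for k d
    using that
  proof (induction k arbitrary: d)
    case 0
    have "norm (x + d) \<le> norm x + norm d" by (rule norm_triangle_ineq)
    then have "\<bar>v (x + d)\<bar> \<le> M" "\<bar>v x\<bar> \<le> M" using x 0 by (auto intro!: M)
    then show ?case using B1[of "norm d"] 0 by auto
  next
    case (Suc k)
    show ?case
    proof (cases "1 / 32 < norm d")
      case True
      have "norm (x + d) \<le> norm x + norm d" by (rule norm_triangle_ineq)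
      then have "\<bar>v (x + d)\<bar> \<le> M" "\<bar>v x\<bar> \<le> M" using x Suc.prems by (auto intro!: M)
      then show ?thesis using B1[of "norm d"] True Suc.prems by auto
    next
      case False
      then have d: "norm d \<le> 1 / 32" by simp
      have pos: "0 < norm d" using Suc.prems(1) by (cases "d = 0") auto
      have IH: "\<bar>v (x + 2 *\<^sub>R d) - v x\<bar> \<le> B (norm (2 *\<^sub>R d))"
        by (rule Suc.IH) (use Suc.prems d in auto)
      have "norm (x + d) \<le> norm x + norm d" by (rule norm_triangle_ineq)
      then have "\<bar>v (x + d + d) + v (x + d - d) - 2 * v (x + d)\<bar> \<le> K * norm d powr (2 * s)"
        using x d by (intro sd) auto
      have "x + d + d = x + 2 *\<^sub>R d" by (simp add: scaleR_2)
      have "\<bar>v (x + d) - v x\<bar> \<le> (B (2 * norm d) + K * norm d powr (2 * s)) / 2"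
      proof -
        have "\<bar>p - c\<bar> \<le> (b + k) / 2" if "\<bar>p' + c - 2 * p\<bar> \<le> k" "\<bar>p' - c\<bar> \<le> b" for p p' c b k :: real
        proof -
          have "2 * (p - c) = (p' - c) - (p' + c - 2 * p)" by simp
          then have "2 * \<bar>p - c\<bar> = \<bar>(p' - c) - (p' + c - 2 * p)\<bar>" by (metis abs_mult abs_numeral)
          also have "\<dots> \<le> \<bar>p' - c\<bar> + \<bar>p' + c - 2 * p\<bar>" by (rule abs_triangle_ineq4)
          also have "\<dots> \<le> b + k" using that by (intro add_mono)
          finally show ?thesis by simp
        qed
        from this[OF _ IH, of "v (x + d)"] show ?thesis
          using \<open>\<bar>v (x + d + d) + v (x + d - d) - 2 * v (x + d)\<bar> \<le> _\<close> \<open>x + d + d = _\<close> by simp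
      qed
      also have "\<dots> \<le> B (norm d)" using pos d by (rule B2)
      finally show ?thesis .
    qed
  qed
  obtain k where "1 / norm d < 2 ^ k" using real_arch_pow[of 2 "1 / norm d"] by auto
  then have "1 / 32 < 2 ^ k * norm d" using d by (simp add: divide_simps)
  then show ?thesis using P d by blast
qed

text \<open>For 2 s < 1 the power A r^(2 s) satisfies the recursion of \<open>zygmund_upward\<close>
  as soon as K \<le> A (2 - 2^(2 s)). The summand 64 M = 32 (2 M) covers increments longer than
  1/32.\<close>

lemma zygmund_hoelder:
  fixes v :: "'a::euclidean_space \<Rightarrow> real"
  assumes s: "0 < s" "s < 1 / 2" and K: "0 \<le> K" and M0: "0 \<le> M"
    and sd: "\<And>x d. norm x \<le> 5 / 4 \<Longrightarrow> norm d \<le> 1 / 32 \<Longrightarrow> \<bar>v (x + d) + v (x - d) - 2 * v x\<bar> \<le> K * norm d powr (2 * s)"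
    and M: "\<And>x. norm x \<le> 5 / 4 \<Longrightarrow> \<bar>v x\<bar> \<le> M"
    and x: "norm x \<le> 1" and y: "norm y \<le> 1"
  shows "\<bar>v y - v x\<bar> \<le> (64 * M + K / (2 - 2 powr (2 * s))) * norm (y - x) powr (2 * s)"
proof -
  define A where "A = 64 * M + K / (2 - 2 powr (2 * s))"
  define q where "q = 2 powr (2 * s)"
  have "q < 2 powr 1" unfolding q_def using s by (intro powr_less_mono) auto
  then have q: "q < 2" by simp
  have A: "64 * M \<le> A" "K / (2 - q) \<le> A" "0 \<le> A" using K M0 q by (auto simp: A_def q_def)
  have low: "1 / 32 \<le> r powr (2 * s)" if "1 / 32 < r" for r
  proof -
    have "(1 / 32) powr 1 \<le> (1 / 32) powr (2 * s)" using s by (intro powr_mono') auto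
    also have "\<dots> \<le> r powr (2 * s)" using that s by (intro powr_mono2) auto
    finally show ?thesis by simp
  qed
  have big: "2 * M \<le> A * r powr (2 * s)" if "1 / 32 < r" for r
  proof -
    have "A * (1 / 32) \<le> A * r powr (2 * s)" using low[OF that] A by (intro mult_left_mono) auto
    then show ?thesis using A by linarith
  qed
  show ?thesis
  proof (cases "y = x \<or> 1 / 16 < norm (y - x)")
    case True
    then show ?thesis
    proof
      assume "1 / 16 < norm (y - x)"
      then have "2 * M \<le> A * norm (y - x) powr (2 * s)" by (intro big) simp
      moreover have "\<bar>v x\<bar> \<le> M" "\<bar>v y\<bar> \<le> M" using x y by (auto intro!: M)
      ultimately show ?thesis unfolding A_def by linarith
    qed simp
  next
    case False
    have "\<bar>v (x + (y - x)) - v x\<bar> \<le> (\<lambda>r. A * r powr (2 * s)) (norm (y - x))"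
    proof (rule zygmund_upward[OF sd M])
      show "2 * M \<le> A * r powr (2 * s)" if "1 / 32 < r" for r by (rule big[OF that])
      show "(A * (2 * r) powr (2 * s) + K * r powr (2 * s)) / 2 \<le> A * r powr (2 * s)" if "0 < r" for r
      proof -
        have "K \<le> A * (2 - q)" using A(2) q by (simp add: divide_simps split: if_splits)
        then have "(A * q + K) * r powr (2 * s) \<le> (2 * A) * r powr (2 * s)" by (intro mult_right_mono) (simp_all add: algebra_simps)
        then show ?thesis by (simp add: q_def powr_mult algebra_simps)
      qed
    qed (use x False in auto)
    then show ?thesis by (simp add: A_def)
  qed
qed

text \<open>At the critical exponent the recursion is resonant: each doubling contributes the same
  amount K r/2, and about log2(1/r) of them are made. The modulus B(r) = r (64 M + (K/2) log2(1/r))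
  solves the recursion with equality.\<close>

lemma zygmund_log_lipschitz:
  fixes v :: "'a::euclidean_space \<Rightarrow> real"
  assumes K: "0 \<le> K" and M0: "0 \<le> M"
    and sd: "\<And>x d. norm x \<le> 5 / 4 \<Longrightarrow> norm d \<le> 1 / 32 \<Longrightarrow> \<bar>v (x + d) + v (x - d) - 2 * v x\<bar> \<le> K * norm d powr (2 * (1 / 2))"
    and M: "\<And>x. norm x \<le> 5 / 4 \<Longrightarrow> \<bar>v x\<bar> \<le> M"
    and x: "norm x \<le> 1" and y: "norm y \<le> 1" and xy: "x \<noteq> y"
  shows "\<bar>v y - v x\<bar> \<le> (64 * M + K) / ln 2 * (norm (y - x) * \<bar>ln (min (norm (y - x)) (1 / 2))\<bar>)"
proof -
  define r where "r = norm (y - x)"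
  have r: "0 < r" using xy by (simp add: r_def)
  have ln2: "0 < ln (2::real)" by simp
  have lmin: "ln 2 \<le> \<bar>ln (min r (1 / 2))\<bar>"
  proof -
    have "ln (min r (1 / 2)) \<le> ln (1 / 2)" using r by (subst ln_le_cancel_iff) auto
    also have "\<dots> = - ln 2" by (simp add: ln_div)
    finally show ?thesis by linarith
  qed
  show ?thesis
  proof (cases "r \<le> 1 / 16")
    case False
    have "\<bar>v x\<bar> \<le> M" "\<bar>v y\<bar> \<le> M" using x y by (auto intro!: M)
    then have "\<bar>v y - v x\<bar> \<le> 2 * M" by linarith
    also have "\<dots> \<le> (64 * M) * (1 / 16)" using M0 by simp
    also have "\<dots> \<le> (64 * M + K) * r" using False K M0 by (intro mult_mono) auto
    also have "\<dots> \<le> (64 * M + K) * (r * (\<bar>ln (min r (1 / 2))\<bar> / ln 2))"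
    proof (intro mult_left_mono)
      have "1 \<le> \<bar>ln (min r (1 / 2))\<bar> / ln 2" using lmin ln2 by simp
      then have "r * 1 \<le> r * (\<bar>ln (min r (1 / 2))\<bar> / ln 2)" using r by (intro mult_left_mono) auto
      then show "r \<le> r * (\<bar>ln (min r (1 / 2))\<bar> / ln 2)" by simp
    qed (use K M0 in auto)
    finally show ?thesis by (simp add: r_def)
  next
    case True
    define B where "B = (\<lambda>r. r * (64 * M + K / 2 * (- ln r / ln 2)))"
    have "\<bar>v (x + (y - x)) - v x\<bar> \<le> B (norm (y - x))"
    proof (rule zygmund_upward[OF sd M])
      show "2 * M \<le> B r" if "1 / 32 < r" "r \<le> 1 / 16" for r
      proof -
        have "ln r \<le> 0" using that by simp
        then have "0 \<le> K / 2 * (- ln r / ln 2)" using K by (intro mult_nonneg_nonneg divide_nonneg_nonneg) auto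
        then have "1 / 32 * (64 * M) \<le> B r" unfolding B_def using that M0 by (intro mult_mono) auto
        then show ?thesis by simp
      qed
      show "(B (2 * r) + K * r powr (2 * (1 / 2))) / 2 \<le> B r" if "0 < r" for r
      proof -
        have l: "- ln (2 * r) / ln 2 = - ln r / ln 2 - 1" using that by (simp add: ln_mult diff_divide_distrib)
        have "(B (2 * r) + K * r powr (2 * (1 / 2))) / 2 = B r"
        proof -
          have "(2 * r * (64 * M + K / 2 * (l - 1)) + K * r) / 2 = r * (64 * M + K / 2 * l)" for l :: real
            by (simp add: field_simps)
          moreover have "r powr (2 * (1 / 2)) = r" using that by simp
          ultimately show ?thesis unfolding B_def l by metis
        qed
        then show ?thesis by simp
      qed
    qed (use x xy True in \<open>auto simp: r_def\<close>)
    then have "\<bar>v y - v x\<bar> \<le> B r" by (simp add: r_def)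
    also have "\<dots> \<le> (64 * M + K) / ln 2 * (r * \<bar>ln (min r (1 / 2))\<bar>)"
    proof -
      have m: "min r (1 / 2) = r" using True by simp
      have lr: "ln r \<le> 0" using True r by simp
      have l2: "1 \<le> - ln r / ln 2" using lmin lr ln2 unfolding m by (simp add: field_simps)
      have "64 * M * 1 \<le> 64 * M * (- ln r / ln 2)" using l2 M0 by (intro mult_left_mono) auto
      moreover have "K / 2 * (- ln r / ln 2) \<le> K * (- ln r / ln 2)" using l2 K by (intro mult_right_mono) auto
      ultimately have "64 * M + K / 2 * (- ln r / ln 2) \<le> (64 * M + K) * (- ln r / ln 2)"
        unfolding distrib_right by linarith
      then have "B r \<le> r * ((64 * M + K) * (- ln r / ln 2))" unfolding B_def using r by (intro mult_left_mono) auto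
      then show ?thesis unfolding m using lr by (simp add: mult_ac)
    qed
    finally show ?thesis by (simp add: r_def)
  qed
qed

text \<open>For 2 s > 1 the telescoping goes down instead of up: 2^k e(d/2^k), with e(d) = v(x + d)
  - v(x), tends to the directional derivative. The errors form a geometric series of ratio q = 2^(1
  - 2 s) < 1, and A = K/(1 - q) is the fixed point of K + q A = A.\<close>

lemma zygmund_taylor:
  fixes v :: "'a::euclidean_space \<Rightarrow> real"
  assumes s: "1 / 2 < s" "s < 1" and K: "0 \<le> K"
    and sd: "\<And>x d. norm x \<le> 5 / 4 \<Longrightarrow> norm d \<le> 1 / 32 \<Longrightarrow> \<bar>v (x + d) + v (x - d) - 2 * v x\<bar> \<le> K * norm d powr (2 * s)"
    and D: "GDERIV v x :> D"
    and x: "norm x \<le> 1" and d: "norm d \<le> 1 / 16"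
  shows "\<bar>v (x + d) - v x - d \<bullet> D\<bar> \<le> K / (1 - 2 powr (1 - 2 * s)) * norm d powr (2 * s)"
proof -
  define A where "A = K / (1 - 2 powr (1 - 2 * s))"
  define q where "q = 2 powr (1 - 2 * s)"
  have "q < 2 powr 0" unfolding q_def using s by (intro powr_less_mono) auto
  then have q: "q < 1" "0 < q" by (auto simp: q_def)
  have A0: "0 \<le> A" using K q by (simp add: A_def q_def)
  have A: "K + q * A = A"
  proof -
    have "A * (1 - q) = K" using q(1) by (simp add: A_def q_def[symmetric])
    then show ?thesis by (simp add: algebra_simps)
  qed
  define e where "e = (\<lambda>d. v (x + d) - v x)"
  have half: "\<bar>e d - 2 * e ((1 / 2) *\<^sub>R d)\<bar> \<le> K * norm d powr (2 * s)" if d: "norm d \<le> 1 / 16" for d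
  proof -
    let ?h = "(1 / 2) *\<^sub>R d"
    have "norm (x + ?h) \<le> norm x + norm ?h" by (rule norm_triangle_ineq)
    then have "\<bar>v (x + ?h + ?h) + v (x + ?h - ?h) - 2 * v (x + ?h)\<bar> \<le> K * norm ?h powr (2 * s)"
      using x d by (intro sd) auto
    also have "\<dots> \<le> K * norm d powr (2 * s)" using K s by (intro mult_left_mono powr_mono2) auto
    finally have "\<bar>v (x + ?h + ?h) + v (x + ?h - ?h) - 2 * v (x + ?h)\<bar> \<le> K * norm d powr (2 * s)" .
    moreover have "x + ?h + ?h = x + d" "x + ?h - ?h = x" by (simp_all add: scaleR_left_distrib[symmetric] add.assoc)
    ultimately show ?thesis by (simp add: e_def algebra_simps)
  qed
  have iter: "\<bar>e d - 2 ^ k * e ((1 / 2 ^ k) *\<^sub>R d)\<bar> \<le> A * norm d powr (2 * s)" if "norm d \<le> 1 / 16" for k d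
    using that
  proof (induction k arbitrary: d)
    case 0
    then show ?case using A0 by simp
  next
    case (Suc k)
    let ?h = "(1 / 2) *\<^sub>R d"
    have IH: "\<bar>e ?h - 2 ^ k * e ((1 / 2 ^ k) *\<^sub>R ?h)\<bar> \<le> A * norm ?h powr (2 * s)"
      by (rule Suc.IH) (use Suc.prems in auto)
    have n: "2 * norm ?h powr (2 * s) = q * norm d powr (2 * s)"
    proof -
      have "norm ?h powr (2 * s) = (1 / 2) powr (2 * s) * norm d powr (2 * s)" by (simp add: powr_mult[symmetric])
      moreover have "2 * (1 / 2) powr (2 * s) = q"
        unfolding q_def by (simp add: powr_diff powr_divide)
      ultimately show ?thesis by (metis mult.assoc)
    qed
    have "\<bar>2 * e ?h - 2 ^ Suc k * e ((1 / 2 ^ Suc k) *\<^sub>R d)\<bar> = 2 * \<bar>e ?h - 2 ^ k * e ((1 / 2 ^ k) *\<^sub>R ?h)\<bar>"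
    proof -
      have "2 * e ?h - 2 ^ Suc k * e ((1 / 2 ^ Suc k) *\<^sub>R d) = 2 * (e ?h - 2 ^ k * e ((1 / 2 ^ k) *\<^sub>R ?h))"
        by (simp add: algebra_simps)
      then show ?thesis by (simp only: abs_mult abs_numeral)
    qed
    also have "\<dots> \<le> 2 * (A * norm ?h powr (2 * s))" using IH by simp
    also have "\<dots> = A * (2 * norm ?h powr (2 * s))" by simp
    also have "\<dots> = A * (q * norm d powr (2 * s))" unfolding n ..
    finally have "\<bar>2 * e ?h - 2 ^ Suc k * e ((1 / 2 ^ Suc k) *\<^sub>R d)\<bar> \<le> A * (q * norm d powr (2 * s))" .
    then have "\<bar>e d - 2 ^ Suc k * e ((1 / 2 ^ Suc k) *\<^sub>R d)\<bar> \<le> K * norm d powr (2 * s) + A * (q * norm d powr (2 * s))"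
      using half[OF Suc.prems] by linarith
    also have "\<dots> = (K + q * A) * norm d powr (2 * s)" by (simp add: algebra_simps)
    finally show ?case unfolding A .
  qed
  have lim: "(\<lambda>k. 2 ^ k * e ((1 / 2 ^ k) *\<^sub>R d)) \<longlonglongrightarrow> d \<bullet> D"
  proof -
    have "((\<lambda>r. v (x + r *\<^sub>R d)) has_real_derivative (d \<bullet> D)) (at 0)"
    proof -
      have "(v has_derivative (\<lambda>h. h \<bullet> D)) (at (x + 0 *\<^sub>R d))" using D by (simp add: gderiv_def)
      moreover have "((\<lambda>r. x + r *\<^sub>R d) has_derivative (\<lambda>r. r *\<^sub>R d)) (at 0)"
        by (auto intro!: derivative_eq_intros)
      ultimately have "((\<lambda>r. v (x + r *\<^sub>R d)) has_derivative (\<lambda>r. (r *\<^sub>R d) \<bullet> D)) (at 0)"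
        by (rule has_derivative_compose[rotated])
      then show ?thesis by (simp add: has_field_derivative_def mult_commute_abs)
    qed
    then have "((\<lambda>r. (v (x + (0 + r) *\<^sub>R d) - v (x + 0 *\<^sub>R d)) / r) \<longlongrightarrow> d \<bullet> D) (at 0)"
      unfolding DERIV_def .
    moreover have "filterlim (\<lambda>k. 1 / 2 ^ k :: real) (at 0) sequentially"
    proof (rule filterlim_atI)
      have "(\<lambda>k. (1 / 2 :: real) ^ k) \<longlonglongrightarrow> 0" by (rule LIMSEQ_power_zero) simp
      then show "(\<lambda>k. 1 / 2 ^ k :: real) \<longlonglongrightarrow> 0" by (simp add: power_one_over)
    qed simp
    ultimately have "(\<lambda>k. (v (x + (0 + 1 / 2 ^ k) *\<^sub>R d) - v (x + 0 *\<^sub>R d)) / (1 / 2 ^ k)) \<longlonglongrightarrow> d \<bullet> D"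
      by (rule filterlim_compose)
    then show ?thesis by (simp add: e_def mult.commute)
  qed
  have "(\<lambda>k. \<bar>e d - 2 ^ k * e ((1 / 2 ^ k) *\<^sub>R d)\<bar>) \<longlonglongrightarrow> \<bar>e d - d \<bullet> D\<bar>"
    by (intro tendsto_intros lim)
  then have "\<bar>e d - d \<bullet> D\<bar> \<le> A * norm d powr (2 * s)"
    by (rule LIMSEQ_le_const2) (use iter[OF d] in blast)
  then show ?thesis by (simp add: e_def A_def)
qed

text \<open>The direction of \<open>w\<close> itself is tested. Taylor expansions see a gradient
  only through its inner products with increments of a given length.\<close>

lemma norm_le_if_inner_le:
  fixes w :: "'a::euclidean_space"
  assumes r: "0 < r" and le: "\<And>d. norm d = r \<Longrightarrow> d \<bullet> w \<le> c"
  shows "r * norm w \<le> max c 0"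
proof (cases "w = 0")
  case False
  have "norm ((r / norm w) *\<^sub>R w) = r" using r False by simp
  then have "((r / norm w) *\<^sub>R w) \<bullet> w \<le> c" by (rule le)
  moreover have "((r / norm w) *\<^sub>R w) \<bullet> w = r * norm w"
    using False by (simp add: dot_square_norm power2_eq_square)
  ultimately show ?thesis by simp
qed simp

text \<open>Taylor expansions of order \<open>2 s\<close> at all base points already control the gradient: compare three of them.\<close>

lemma gradient_hoelder:
  fixes u :: "'a::euclidean_space \<times> real \<Rightarrow> real" and D :: "'a \<times> real \<Rightarrow> 'a"
  assumes s: "1 / 2 < s" "s < 1" and A: "0 \<le> A" and M0: "0 \<le> M" and K: "0 \<le> K"
    and taylor: "\<And>x t d. norm x < 1 \<Longrightarrow> \<bar>t\<bar> < 1 \<Longrightarrow> norm d \<le> 1 / 16 \<Longrightarrow> \<bar>u (x + d, t) - u (x, t) - d \<bullet> D (x, t)\<bar> \<le> A * norm d powr (2 * s)"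
    and M: "\<And>x t. norm x \<le> 5 / 4 \<Longrightarrow> \<bar>t\<bar> < 1 \<Longrightarrow> \<bar>u (x, t)\<bar> \<le> M"
    and time: "\<And>x t t'. norm x \<le> 5 / 4 \<Longrightarrow> \<bar>t\<bar> < 1 \<Longrightarrow> \<bar>t'\<bar> < 1 \<Longrightarrow> \<bar>u (x, t') - u (x, t)\<bar> \<le> K * \<bar>t' - t\<bar> powr s"
  shows "norm x < 1 \<Longrightarrow> \<bar>t\<bar> < 1 \<Longrightarrow> norm (D (x, t)) \<le> 32 * M + 16 * A"
    and "norm x < 1 \<Longrightarrow> norm y < 1 \<Longrightarrow> \<bar>t\<bar> < 1 \<Longrightarrow> norm (D (x, t) - D (y, t)) \<le> (2048 * M + 1033 * A) * norm (x - y) powr (2 * s - 1)"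
    and "norm x < 1 \<Longrightarrow> \<bar>t\<bar> < 1 \<Longrightarrow> \<bar>t'\<bar> < 1 \<Longrightarrow> norm (D (x, t) - D (x, t')) \<le> (2 * K + 1024 * M + 514 * A) * \<bar>t - t'\<bar> powr (s - 1 / 2)"
proof -
  have bound: "norm (D (x, t)) \<le> 32 * M + 16 * A" if x: "norm x < 1" and t: "\<bar>t\<bar> < 1" for x t
  proof -
    have "1 / 16 * norm (D (x, t)) \<le> max (2 * M + A) 0"
    proof (rule norm_le_if_inner_le)
      fix d :: 'a assume d: "norm d = 1 / 16"
      have "norm (x + d) \<le> norm x + norm d" by (rule norm_triangle_ineq)
      then have "\<bar>u (x + d, t)\<bar> \<le> M" "\<bar>u (x, t)\<bar> \<le> M" using x d t by (auto intro!: M)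
      moreover have "A * norm d powr (2 * s) \<le> A * 1"
        using A s unfolding d by (intro mult_left_mono powr_le1) auto
      ultimately show "d \<bullet> D (x, t) \<le> 2 * M + A" using taylor[OF x t, of d] d by linarith
    qed simp
    then show ?thesis using A M0 by simp
  qed
  then show "norm x < 1 \<Longrightarrow> \<bar>t\<bar> < 1 \<Longrightarrow> norm (D (x, t)) \<le> 32 * M + 16 * A" by blast
  have scale_le: "v \<le> c * r powr (p - 1)" if "r * v \<le> c * r powr p" "0 < r" for v c r p :: real
  proof -
    have "r powr p = r * r powr (p - 1)" using that(2) powr_add[of r 1 "p - 1"] by simp
    then have "r * v \<le> r * (c * r powr (p - 1))" using that(1) by (simp add: mult_ac)
    then show ?thesis using that(2) by simp
  qed
  \<comment> \<open>Beyond length 1/32 the bound on the gradient itself is enough, since 32 r^p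
    \<ge> 1 there.\<close>
  have crude: "norm (w - w') \<le> (2 * 32) * (32 * M + 16 * A) * r powr p"
    if "norm w \<le> 32 * M + 16 * A" "norm w' \<le> 32 * M + 16 * A" "1 / 32 < r" "0 < p" "p \<le> 1" for w w' :: 'a and r p
  proof -
    have "(1 / 32) powr 1 \<le> (1 / 32) powr p" using that by (intro powr_mono') auto
    also have "\<dots> \<le> r powr p" using that by (intro powr_mono2) auto
    finally have "1 \<le> 32 * r powr p" by simp
    then have le: "2 * (32 * M + 16 * A) * 1 \<le> 2 * (32 * M + 16 * A) * (32 * r powr p)"
      using A M0 by (intro mult_left_mono) auto
    have "norm (w - w') \<le> norm w + norm w'" by (rule norm_triangle_ineq4)
    also have "\<dots> \<le> 2 * (32 * M + 16 * A) * 1" using add_mono[OF that(1,2)] by simp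
    also note le
    also have "2 * (32 * M + 16 * A) * (32 * r powr p) = (2 * 32) * (32 * M + 16 * A) * r powr p"
      by (simp only: mult_ac)
    finally show ?thesis .
  qed
  show "norm (D (x, t) - D (y, t)) \<le> (2048 * M + 1033 * A) * norm (x - y) powr (2 * s - 1)"
    if x: "norm x < 1" and y: "norm y < 1" and t: "\<bar>t\<bar> < 1"
  proof (cases "x = y \<or> 1 / 32 < norm (x - y)")
    case True
    then show ?thesis
    proof
      assume "1 / 32 < norm (x - y)"
      then have "norm (D (x, t) - D (y, t)) \<le> (2 * 32) * (32 * M + 16 * A) * norm (x - y) powr (2 * s - 1)"
        using s by (intro crude bound x y t) auto
      also have "\<dots> \<le> (2048 * M + 1033 * A) * norm (x - y) powr (2 * s - 1)"
        using A by (intro mult_right_mono) auto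
      finally show ?thesis .
    qed simp
  next
    case False
    define r where "r = norm (x - y)"
    have r: "0 < r" "r \<le> 1 / 32" using False by (auto simp: r_def)
    have four: "(2 * r) powr (2 * s) \<le> 4 * r powr (2 * s)"
    proof -
      have "2 powr (2 * s) \<le> (2::real) powr 2" using s by (intro powr_mono) auto
      then show ?thesis by (simp add: powr_mult mult_right_mono)
    qed
    \<comment> \<open>The value at y + d is expanded at y and at x, and the value at y is expanded
      at x; the combination isolates the inner product of d with the difference of the
      gradients.\<close>
    have "r * norm (D (y, t) - D (x, t)) \<le> max (9 * A * r powr (2 * s)) 0"
    proof (rule norm_le_if_inner_le)
      fix d :: 'a assume d: "norm d = r"
      have e1: "\<bar>u (y + d, t) - u (y, t) - d \<bullet> D (y, t)\<bar> \<le> A * r powr (2 * s)"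
        using taylor[OF y t, of d] d r by simp
      have e2: "\<bar>u (y, t) - u (x, t) - (y - x) \<bullet> D (x, t)\<bar> \<le> A * r powr (2 * s)"
        using taylor[OF x t, of "y - x"] r by (simp add: r_def norm_minus_commute)
      have nd: "norm (y - x + d) \<le> 2 * r" using norm_triangle_ineq[of "y - x" d] d by (simp add: r_def norm_minus_commute)
      have e3: "\<bar>u (y + d, t) - u (x, t) - (y - x + d) \<bullet> D (x, t)\<bar> \<le> A * norm (y - x + d) powr (2 * s)"
        using taylor[OF x t, of "y - x + d"] nd r by (simp add: add.commute add.left_commute)
      also have "\<dots> \<le> A * (2 * r) powr (2 * s)" using nd A s by (intro mult_left_mono powr_mono2) auto
      also have "\<dots> \<le> A * (4 * r powr (2 * s))" using four A by (rule mult_left_mono)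
      finally have e3: "\<bar>u (y + d, t) - u (x, t) - (y - x + d) \<bullet> D (x, t)\<bar> \<le> 4 * (A * r powr (2 * s))" by simp
      have "(y - x + d) \<bullet> D (x, t) = (y - x) \<bullet> D (x, t) + d \<bullet> D (x, t)" by (rule inner_add_left)
      then have "d \<bullet> D (y, t) - d \<bullet> D (x, t) \<le> 9 * (A * r powr (2 * s))"
        using e1 e2 e3 A mult_nonneg_nonneg[OF A powr_ge_zero[of r "2 * s"]] by linarith
      then show "d \<bullet> (D (y, t) - D (x, t)) \<le> 9 * A * r powr (2 * s)" by (simp add: inner_diff_right)
    qed (rule r)
    then have "r * norm (D (y, t) - D (x, t)) \<le> (9 * A) * r powr (2 * s)" using A by simp
    then have "norm (D (y, t) - D (x, t)) \<le> (9 * A) * r powr (2 * s - 1)" using r(1) by (rule scale_le)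
    also have "\<dots> \<le> (2048 * M + 1033 * A) * r powr (2 * s - 1)" using A M0 by (intro mult_right_mono) auto
    finally show ?thesis by (simp add: r_def norm_minus_commute)
  qed
  show "norm (D (x, t) - D (x, t')) \<le> (2 * K + 1024 * M + 514 * A) * \<bar>t - t'\<bar> powr (s - 1 / 2)"
    if x: "norm x < 1" and t: "\<bar>t\<bar> < 1" and t': "\<bar>t'\<bar> < 1"
  proof (cases "t = t'")
    case False
    \<comment> \<open>The parabolic length r = sqrt h balances the errors: the increments in t cost
      K h^s and the Taylor remainders A r^(2 s), which are of the same order.\<close>
    define h r where "h = \<bar>t - t'\<bar>" and "r = h powr (1 / 2)"
    have h: "0 < h" using False by (simp add: h_def)
    have r: "0 < r" using h by (simp add: r_def)
    have rp: "r powr (2 * s - 1) = h powr (s - 1 / 2)" "r powr (2 * s) = h powr s"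
      unfolding r_def powr_powr by (simp_all add: field_simps)
    show ?thesis
    proof (cases "r \<le> 1 / 16")
      case True
      have "r * norm (D (x, t) - D (x, t')) \<le> max ((2 * K + 2 * A) * r powr (2 * s)) 0"
      proof (rule norm_le_if_inner_le)
        fix d :: 'a assume d: "norm d = r"
        have xd: "norm (x + d) \<le> 5 / 4" using norm_triangle_ineq[of x d] x d True by simp
        have e1: "\<bar>u (x + d, t) - u (x, t) - d \<bullet> D (x, t)\<bar> \<le> A * r powr (2 * s)"
          using taylor[OF x t, of d] d True by simp
        have e2: "\<bar>u (x + d, t') - u (x, t') - d \<bullet> D (x, t')\<bar> \<le> A * r powr (2 * s)"
          using taylor[OF x t', of d] d True by simp
        have e3: "\<bar>u (x + d, t) - u (x + d, t')\<bar> \<le> K * r powr (2 * s)" "\<bar>u (x, t) - u (x, t')\<bar> \<le> K * r powr (2 * s)"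
          using time[OF xd t' t] time[OF _ t' t, of x] x unfolding rp h_def by simp_all
        have "d \<bullet> D (x, t) - d \<bullet> D (x, t') \<le> 2 * (K * r powr (2 * s)) + 2 * (A * r powr (2 * s))"
          using e1 e2 e3 by linarith
        then show "d \<bullet> (D (x, t) - D (x, t')) \<le> (2 * K + 2 * A) * r powr (2 * s)"
          by (simp add: inner_diff_right distrib_right)
      qed (rule r)
      then have "r * norm (D (x, t) - D (x, t')) \<le> (2 * K + 2 * A) * r powr (2 * s)" using A K by simp
      then have "norm (D (x, t) - D (x, t')) \<le> (2 * K + 2 * A) * r powr (2 * s - 1)" using r by (rule scale_le)
      also have "\<dots> \<le> (2 * K + 1024 * M + 514 * A) * r powr (2 * s - 1)" using A M0 K by (intro mult_right_mono) auto
      finally show ?thesis unfolding rp h_def .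
    next
      case False
      have "norm (D (x, t) - D (x, t')) \<le> 2 * (32 * M + 16 * A)"
        using order_trans[OF norm_triangle_ineq4[of "D (x, t)" "D (x, t')"] add_mono[OF bound[OF x t] bound[OF x t']]] by simp
      also have "\<dots> \<le> 2 * (32 * M + 16 * A) * (16 * r powr (2 * s - 1))"
      proof -
        have "(1 / 16) powr 1 \<le> (1 / 16) powr (2 * s - 1)" using s by (intro powr_mono') auto
        also have "\<dots> \<le> r powr (2 * s - 1)" using False s by (intro powr_mono2) auto
        finally have "1 \<le> 16 * r powr (2 * s - 1)" by simp
        then have "2 * (32 * M + 16 * A) * 1 \<le> 2 * (32 * M + 16 * A) * (16 * r powr (2 * s - 1))"
          using A M0 by (intro mult_left_mono) auto
        then show ?thesis by simp
      qed
      also have "\<dots> = (1024 * M + 512 * A) * r powr (2 * s - 1)" by (simp add: algebra_simps)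
      also have "\<dots> \<le> (2 * K + 1024 * M + 514 * A) * r powr (2 * s - 1)" using A K by (intro mult_right_mono) auto
      finally show ?thesis unfolding rp h_def .
    qed
  qed simp
qed

subsection \<open>The Hoelder norms\<close>

lemma AE_le_Linfty_norm:
  fixes g :: "'a::euclidean_space \<Rightarrow> real"
  assumes "Linfty_norm S g = ennreal B" "0 \<le> B" "open S"
  shows "AE p in lborel. p \<in> S \<longrightarrow> \<bar>g p\<bar> \<le> B"
proof -
  have S: "S \<inter> space lebesgue \<in> sets lebesgue" using assms(3) by simp
  have "AE p in restrict_space lebesgue S. ennreal \<bar>g p\<bar> \<le> ennreal B"
    using esssup_AE[of "\<lambda>p. ennreal \<bar>g p\<bar>" "restrict_space lebesgue S"] assms(1) unfolding Linfty_norm_def by simp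
  then have "AE p in lebesgue. p \<in> S \<longrightarrow> ennreal \<bar>g p\<bar> \<le> ennreal B"
    by (subst (asm) AE_restrict_space_iff[OF S])
  then have "AE p in lborel. p \<in> S \<longrightarrow> ennreal \<bar>g p\<bar> \<le> ennreal B"
    by (subst (asm) AE_completion_iff)
  then show ?thesis using assms(2) by (simp add: ennreal_le_iff)
qed

text \<open>The set of points of \<open>S\<close> where the bound fails is open, and a nonempty open
  set is not negligible. This makes the essential bound on u available at single points such as (0,
  3).\<close>

lemma le_if_AE_le_continuous:
  fixes g :: "'a::euclidean_space \<Rightarrow> real"
  assumes g: "continuous_on UNIV g" and S: "open S" and ae: "AE p in lborel. p \<in> S \<longrightarrow> g p \<le> B" and p: "p \<in> S"
  shows "g p \<le> B"
proof (rule ccontr)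
  assume "\<not> g p \<le> B"
  let ?N = "S \<inter> {p. B < g p}"
  have o: "open ?N" using g by (intro open_Int S open_Collect_less continuous_on_const)
  then have m: "?N \<in> sets lebesgue" by simp
  have "AE p in lebesgue. p \<in> S \<longrightarrow> g p \<le> B" using ae by (subst AE_completion_iff)
  then have "AE p in lebesgue. p \<notin> ?N" by eventually_elim auto
  then have "?N \<in> null_sets lebesgue" using AE_iff_null_sets[OF m] by blast
  then have "negligible ?N" by (simp add: negligible_iff_null_sets)
  moreover have "?N \<noteq> {}" using p \<open>\<not> g p \<le> B\<close> by auto
  ultimately show False using open_not_negligible[OF o] by blast
qed

lemma hoelder_seminorm_le:
  assumes "0 \<le> K" "\<And>p q. p \<in> S \<Longrightarrow> q \<in> S \<Longrightarrow> norm (g p - g q) \<le> K * d p q powr \<alpha>"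
  shows "hoelder_seminorm d \<alpha> S g \<le> ennreal K"
  unfolding hoelder_seminorm_def by (rule INF_lower) (use assms in blast)

lemma hoelder_t_le:
  assumes "0 \<le> K" "\<And>x t t'. (x, t) \<in> \<Omega> \<Longrightarrow> (x, t') \<in> \<Omega> \<Longrightarrow> norm (u (x, t) - u (x, t')) \<le> K * \<bar>t - t'\<bar> powr \<alpha>"
  shows "hoelder_t \<alpha> \<Omega> u \<le> ennreal K"
  unfolding hoelder_t_def
  by (intro SUP_least hoelder_seminorm_le) (use assms in \<open>auto simp: dist_real_def\<close>)

lemma hoelder_x_le:
  assumes "0 \<le> K" "\<And>x x' t. (x, t) \<in> \<Omega> \<Longrightarrow> (x', t) \<in> \<Omega> \<Longrightarrow> norm (u (x, t) - u (x', t)) \<le> K * norm (x - x') powr \<alpha>"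
  shows "hoelder_x \<alpha> \<Omega> u \<le> ennreal K"
  unfolding hoelder_x_def
  by (intro SUP_least hoelder_seminorm_le) (use assms in \<open>auto simp: dist_norm\<close>)

lemma sup_norm_le:
  assumes "\<And>p. p \<in> S \<Longrightarrow> norm (g p) \<le> B"
  shows "sup_norm S g \<le> ennreal B"
  unfolding sup_norm_def by (intro SUP_least ennreal_leI assms)

text \<open>The increment from (x, t) to (y, r) is split at (y, t); both parts are at most a
  multiple of the parabolic distance to the power 2 s.\<close>

lemma parabolic_hoelder_norm_le_low:
  fixes u :: "(real ^ 'n) \<times> real \<Rightarrow> real"
  assumes s: "0 < s" "s < 1 / 2" and M0: "0 \<le> M" and K0: "0 \<le> K"
    and M: "\<And>x t. norm x \<le> 5 / 4 \<Longrightarrow> \<bar>t\<bar> < 1 \<Longrightarrow> \<bar>u (x, t)\<bar> \<le> M"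
    and sd: "\<And>x t d. norm x \<le> 5 / 4 \<Longrightarrow> \<bar>t\<bar> < 1 \<Longrightarrow> norm d \<le> 1 / 32 \<Longrightarrow> \<bar>u (x + d, t) + u (x - d, t) - 2 * u (x, t)\<bar> \<le> K * norm d powr (2 * s)"
    and time: "\<And>x t t'. norm x \<le> 5 / 4 \<Longrightarrow> \<bar>t\<bar> < 1 \<Longrightarrow> \<bar>t'\<bar> < 1 \<Longrightarrow> \<bar>u (x, t') - u (x, t)\<bar> \<le> K * \<bar>t' - t\<bar> powr s"
  shows "parabolic_hoelder_norm s (cyl 1 0 0) u \<le> ennreal (65 * M + (1 / (2 - 2 powr (2 * s)) + 1) * K)"
proof -
  define A where "A = 64 * M + K / (2 - 2 powr (2 * s))"
  have "2 powr (2 * s) < (2::real) powr 1" using s by (intro powr_less_mono) auto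
  then have A: "0 \<le> A" using M0 K0 by (simp add: A_def)
  have "hoelder_seminorm parabolic_dist (2 * s) (cyl 1 0 0) u \<le> ennreal (A + K)"
  proof (rule hoelder_seminorm_le)
    show "0 \<le> A + K" using A K0 by simp
    fix p q :: "(real ^ 'n) \<times> real" assume "p \<in> cyl 1 0 0" "q \<in> cyl 1 0 0"
    moreover obtain x t y r where pq: "p = (x, t)" "q = (y, r)" by (metis surj_pair)
    ultimately have c: "norm x < 1" "\<bar>t\<bar> < 1" "norm y < 1" "\<bar>r\<bar> < 1" by (auto simp: cyl_iff)
    let ?d = "parabolic_dist p q"
    have x: "\<bar>u (x, t) - u (y, t)\<bar> \<le> A * norm (x - y) powr (2 * s)"
      unfolding A_def by (rule zygmund_hoelder[where v = "\<lambda>x. u (x, t)", OF s K0 M0]) (use c sd M in auto)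
    have t: "\<bar>u (y, t) - u (y, r)\<bar> \<le> K * \<bar>t - r\<bar> powr s" by (rule time) (use c in auto)
    have "norm (x - y) powr (2 * s) \<le> ?d powr (2 * s)"
      using s by (intro powr_mono2) (auto simp: parabolic_dist_def pq)
    then have 1: "A * norm (x - y) powr (2 * s) \<le> A * ?d powr (2 * s)" using A by (rule mult_left_mono)
    have "\<bar>t - r\<bar> powr s = (\<bar>t - r\<bar> powr (1 / 2)) powr (2 * s)" by (simp add: powr_powr)
    also have "\<dots> \<le> ?d powr (2 * s)"
      using s by (intro powr_mono2) (auto simp: parabolic_dist_def pq)
    finally have 2: "K * \<bar>t - r\<bar> powr s \<le> K * ?d powr (2 * s)" using K0 by (rule mult_left_mono)
    have "\<bar>u p - u q\<bar> \<le> \<bar>u (x, t) - u (y, t)\<bar> + \<bar>u (y, t) - u (y, r)\<bar>" unfolding pq by linarith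
    also have "\<dots> \<le> A * ?d powr (2 * s) + K * ?d powr (2 * s)"
      by (intro add_mono order_trans[OF x 1] order_trans[OF t 2])
    finally show "norm (u p - u q) \<le> (A + K) * ?d powr (2 * s)" by (simp add: distrib_right)
  qed
  moreover have "sup_norm (cyl 1 0 0) u \<le> ennreal M"
    by (rule sup_norm_le) (auto simp: cyl_def intro!: M)
  ultimately have "parabolic_hoelder_norm s (cyl 1 0 0) u \<le> ennreal M + ennreal (A + K)"
    using s unfolding parabolic_hoelder_norm_def by (simp add: add_mono)
  also have "\<dots> = ennreal (M + (A + K))" using M0 A K0 by simp
  also have "M + (A + K) = 65 * M + (1 / (2 - 2 powr (2 * s)) + 1) * K" by (simp add: A_def distrib_right)
  finally show ?thesis .
qed

text \<open>The norms of the gradient come from \<open>gradient_hoelder\<close>, fed with the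
  expansions of \<open>zygmund_taylor\<close>. The constants add up the five contributions: 1 + 32 +
  2048 + 1024 for M, 16 + 1033 + 514 for A, and 1 + 2 for K.\<close>

lemma parabolic_hoelder_norm_le_high:
  fixes u :: "(real ^ 'n) \<times> real \<Rightarrow> real"
  assumes s: "1 / 2 < s" "s < 1" and M0: "0 \<le> M" and K0: "0 \<le> K"
    and M: "\<And>x t. norm x \<le> 5 / 4 \<Longrightarrow> \<bar>t\<bar> < 1 \<Longrightarrow> \<bar>u (x, t)\<bar> \<le> M"
    and sd: "\<And>x t d. norm x \<le> 5 / 4 \<Longrightarrow> \<bar>t\<bar> < 1 \<Longrightarrow> norm d \<le> 1 / 32 \<Longrightarrow> \<bar>u (x + d, t) + u (x - d, t) - 2 * u (x, t)\<bar> \<le> K * norm d powr (2 * s)"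
    and time: "\<And>x t t'. norm x \<le> 5 / 4 \<Longrightarrow> \<bar>t\<bar> < 1 \<Longrightarrow> \<bar>t'\<bar> < 1 \<Longrightarrow> \<bar>u (x, t') - u (x, t)\<bar> \<le> K * \<bar>t' - t\<bar> powr s"
    and diff: "x_differentiable_on u (cyl 1 0 0)"
  shows "parabolic_hoelder_norm s (cyl 1 0 0) u \<le> ennreal (3105 * M + (1563 / (1 - 2 powr (1 - 2 * s)) + 3) * K)"
proof -
  let ?C = "cyl 1 0 0 :: ((real ^ 'n) \<times> real) set"
  define A where "A = K / (1 - 2 powr (1 - 2 * s))"
  have "2 powr (1 - 2 * s) < (2::real) powr 0" using s by (intro powr_less_mono) auto
  then have A: "0 \<le> A" using K0 by (simp add: A_def)
  have C: "(x, t) \<in> ?C \<longleftrightarrow> norm x < 1 \<and> \<bar>t\<bar> < 1" for x t by (simp add: cyl_iff)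
  have taylor: "\<bar>u (x + d, t) - u (x, t) - d \<bullet> grad_x u (x, t)\<bar> \<le> A * norm d powr (2 * s)"
    if "norm x < 1" "\<bar>t\<bar> < 1" "norm d \<le> 1 / 16" for x t d
  proof -
    have "(\<lambda>y. u (y, t)) differentiable (at x)" using diff that C unfolding x_differentiable_on_def by blast
    note g = grad_x_GDERIV[OF this]
    show ?thesis unfolding A_def
      by (rule zygmund_taylor[where v = "\<lambda>x. u (x, t)", OF s K0 _ g]) (use that sd in auto)
  qed
  note G = gradient_hoelder[where u = u and D = "grad_x u", OF s A M0 K0 taylor M time]
  have 1: "sup_norm ?C u \<le> ennreal M"
    by (rule sup_norm_le) (auto simp: cyl_def intro!: M)
  have 2: "sup_norm ?C (grad_x u) \<le> ennreal (32 * M + 16 * A)"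
    by (rule sup_norm_le) (auto simp: cyl_def intro!: G(1))
  have 3: "hoelder_t s ?C u \<le> ennreal K"
    by (rule hoelder_t_le[OF K0]) (auto simp: C intro!: time)
  have 4: "hoelder_x (2 * s - 1) ?C (grad_x u) \<le> ennreal (2048 * M + 1033 * A)"
    by (rule hoelder_x_le) (use M0 A in \<open>auto simp: C intro!: G(2)\<close>)
  have 5: "hoelder_t (s - 1 / 2) ?C (grad_x u) \<le> ennreal (2 * K + 1024 * M + 514 * A)"
    by (rule hoelder_t_le) (use M0 K0 A in \<open>auto simp: C intro!: G(3)\<close>)
  have "parabolic_hoelder_norm s ?C u = sup_norm ?C u + sup_norm ?C (grad_x u) + hoelder_t s ?C u
        + hoelder_x (2 * s - 1) ?C (grad_x u) + hoelder_t (s - 1 / 2) ?C (grad_x u)"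
    using s diff unfolding parabolic_hoelder_norm_def by simp
  also have "\<dots> \<le> ennreal M + ennreal (32 * M + 16 * A) + ennreal K + ennreal (2048 * M + 1033 * A) + ennreal (2 * K + 1024 * M + 514 * A)"
    by (intro add_mono 1 2 3 4 5)
  also have "\<dots> = ennreal (M + (32 * M + 16 * A) + K + (2048 * M + 1033 * A) + (2 * K + 1024 * M + 514 * A))"
    using M0 K0 A by (simp only: ennreal_plus add_nonneg_nonneg mult_nonneg_nonneg zero_le_numeral)
  also have "M + (32 * M + 16 * A) + K + (2048 * M + 1033 * A) + (2 * K + 1024 * M + 514 * A) = 3105 * M + (1563 / (1 - 2 powr (1 - 2 * s)) + 3) * K"
  proof -
    have "1563 * A = 1563 / (1 - 2 powr (1 - 2 * s)) * K" by (simp add: A_def)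
    then show ?thesis by (simp add: distrib_right)
  qed
  finally show ?thesis .
qed

text \<open>The slices in x are handled by \<open>zygmund_log_lipschitz\<close>; continuity of u
  supplies the measurability of the slices on which their essential supremum relies.\<close>

lemma parabolic_log_lipschitz_norm_le:
  fixes u :: "(real ^ 'n) \<times> real \<Rightarrow> real"
  assumes M0: "0 \<le> M" and K0: "0 \<le> K" and cont: "continuous_on UNIV u"
    and M: "\<And>x t. norm x \<le> 5 / 4 \<Longrightarrow> \<bar>t\<bar> < 1 \<Longrightarrow> \<bar>u (x, t)\<bar> \<le> M"
    and sd: "\<And>x t d. norm x \<le> 5 / 4 \<Longrightarrow> \<bar>t\<bar> < 1 \<Longrightarrow> norm d \<le> 1 / 32 \<Longrightarrow> \<bar>u (x + d, t) + u (x - d, t) - 2 * u (x, t)\<bar> \<le> K * norm d powr (2 * (1 / 2))"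
    and time: "\<And>x t t'. norm x \<le> 5 / 4 \<Longrightarrow> \<bar>t\<bar> < 1 \<Longrightarrow> \<bar>t'\<bar> < 1 \<Longrightarrow> \<bar>u (x, t') - u (x, t)\<bar> \<le> K * \<bar>t' - t\<bar> powr (1 / 2)"
  shows "parabolic_log_lipschitz_norm (1 / 2) (cyl 1 0 0) u \<le> ennreal ((1 + 64 / ln 2) * M + (1 / ln 2 + 1) * K)"
proof -
  let ?C = "cyl 1 0 0 :: ((real ^ 'n) \<times> real) set"
  define A where "A = (64 * M + K) / ln 2"
  have A: "0 \<le> A" using M0 K0 by (simp add: A_def)
  have C: "(x, t) \<in> ?C \<longleftrightarrow> norm x < 1 \<and> \<bar>t\<bar> < 1" for x t by (simp add: cyl_iff)
  have slice: "log_lipschitz_norm {x. (x, t) \<in> ?C} (\<lambda>x. u (x, t)) \<le> ennreal M + ennreal A" if t: "\<bar>t\<bar> < 1" for t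
    unfolding log_lipschitz_norm_def
  proof (intro add_mono SUP_least)
    have "continuous_on UNIV (\<lambda>x. u (x, t))"
      by (rule continuous_on_compose2[OF cont]) (auto intro!: continuous_intros)
    then have "(\<lambda>x. u (x, t)) \<in> borel_measurable lborel" by (simp add: borel_measurable_continuous_onI)
    then have "(\<lambda>x. ennreal \<bar>u (x, t)\<bar>) \<in> borel_measurable lborel" by measurable
    then have "(\<lambda>x. ennreal \<bar>u (x, t)\<bar>) \<in> borel_measurable lebesgue" by (rule measurable_completion)
    then have m: "(\<lambda>x. ennreal \<bar>u (x, t)\<bar>) \<in> borel_measurable (restrict_space lebesgue {x. (x, t) \<in> ?C})"
      by (rule measurable_restrict_space1)
    show "Linfty_norm {x. (x, t) \<in> ?C} (\<lambda>x. u (x, t)) \<le> ennreal M"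
      unfolding Linfty_norm_def
      by (rule esssup_I[OF m], rule AE_I2) (use t in \<open>auto simp: space_restrict_space C intro!: ennreal_leI M\<close>)
    fix p :: "(real ^ 'n) \<times> (real ^ 'n)"
    assume p: "p \<in> {(x, y). x \<in> {x. (x, t) \<in> ?C} \<and> y \<in> {x. (x, t) \<in> ?C} \<and> x \<noteq> y}"
    obtain x y where xy: "p = (x, y)" by (cases p)
    have c: "norm x < 1" "norm y < 1" "x \<noteq> y" using p by (auto simp: xy C)
    have b: "\<bar>u (x, t) - u (y, t)\<bar> \<le> A * (norm (x - y) * \<bar>ln (min (norm (x - y)) (1 / 2))\<bar>)"
      unfolding A_def by (rule zygmund_log_lipschitz[where v = "\<lambda>x. u (x, t)", OF K0 M0]) (use c t sd M in auto)
    have "min (norm (x - y)) (1 / 2) \<le> 1 / 2" "0 < min (norm (x - y)) (1 / 2)" using c by auto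
    then have "ln (min (norm (x - y)) (1 / 2)) < 0" by (intro ln_less_zero) auto
    then have "0 < norm (x - y) * \<bar>ln (min (norm (x - y)) (1 / 2))\<bar>" using c by (intro mult_pos_pos) auto
    then have "\<bar>u (x, t) - u (y, t)\<bar> / (norm (x - y) * \<bar>ln (min (norm (x - y)) (1 / 2))\<bar>) \<le> A"
      using b by (simp only: pos_divide_le_eq)
    then show "(case p of (x, y) \<Rightarrow> ennreal (\<bar>u (x, t) - u (y, t)\<bar> / (norm (x - y) * \<bar>ln (min (norm (x - y)) (1 / 2))\<bar>))) \<le> ennreal A"
      unfolding xy prod.case by (rule ennreal_leI)
  qed
  have "hoelder_t (1 / 2) ?C u \<le> ennreal K"
    by (rule hoelder_t_le[OF K0]) (auto simp: C intro!: time)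
  moreover have "(SUP t\<in>snd ` ?C. log_lipschitz_norm {x. (x, t) \<in> ?C} (\<lambda>x. u (x, t))) \<le> ennreal M + ennreal A"
  proof (rule SUP_least)
    fix t assume "t \<in> snd ` ?C"
    then have "\<bar>t\<bar> < 1" using C by force
    then show "log_lipschitz_norm {x. (x, t) \<in> ?C} (\<lambda>x. u (x, t)) \<le> ennreal M + ennreal A" by (rule slice)
  qed
  ultimately have "parabolic_log_lipschitz_norm (1 / 2) ?C u \<le> ennreal M + ennreal A + ennreal K"
    unfolding parabolic_log_lipschitz_norm_def by (intro add_mono)
  also have "\<dots> = ennreal (M + A + K)" using M0 A K0 by simp
  also have "M + A + K = (1 + 64 / ln 2) * M + (1 / ln 2 + 1) * K"
    by (simp add: A_def distrib_right add_divide_distrib)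
  finally show ?thesis .
qed

text \<open>The three regimes of s in a common form, with a and b fixed before u. The b obtained
  here grows without bound as s approaches 1/2 from either side, which reflects the logarithm in the
  critical case.\<close>

lemma parabolic_norms_le:
  assumes s: "0 < s" "s < 1"
  obtains a b :: real where "0 \<le> a" "0 \<le> b"
    "\<And>(u :: (real ^ 'n) \<times> real \<Rightarrow> real) M K. 0 \<le> M \<Longrightarrow> 0 \<le> K \<Longrightarrow> continuous_on UNIV u \<Longrightarrow>
     (\<And>x t. norm x \<le> 5 / 4 \<Longrightarrow> \<bar>t\<bar> < 1 \<Longrightarrow> \<bar>u (x, t)\<bar> \<le> M) \<Longrightarrow>
     (\<And>x t d. norm x \<le> 5 / 4 \<Longrightarrow> \<bar>t\<bar> < 1 \<Longrightarrow> norm d \<le> 1 / 32 \<Longrightarrow> \<bar>u (x + d, t) + u (x - d, t) - 2 * u (x, t)\<bar> \<le> K * norm d powr (2 * s)) \<Longrightarrow>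
     (\<And>x t t'. norm x \<le> 5 / 4 \<Longrightarrow> \<bar>t\<bar> < 1 \<Longrightarrow> \<bar>t'\<bar> < 1 \<Longrightarrow> \<bar>u (x, t') - u (x, t)\<bar> \<le> K * \<bar>t' - t\<bar> powr s) \<Longrightarrow>
     (1 / 2 < s \<Longrightarrow> x_differentiable_on u (cyl 1 0 0)) \<Longrightarrow>
     (s \<noteq> 1 / 2 \<longrightarrow> parabolic_hoelder_norm s (cyl 1 0 0) u \<le> ennreal (a * M + b * K)) \<and>
     (s = 1 / 2 \<longrightarrow> parabolic_log_lipschitz_norm s (cyl 1 0 0) u \<le> ennreal (a * M + b * K))"
proof -
  consider "s < 1 / 2" | "s = 1 / 2" | "1 / 2 < s" by linarith
  then show thesis
  proof cases
    case 1
    have "2 powr (2 * s) < (2::real) powr 1" using 1 by (intro powr_less_mono) auto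
    then have b: "0 \<le> 1 / (2 - 2 powr (2 * s)) + 1" by simp
    show thesis
      by (rule that[of 65 "1 / (2 - 2 powr (2 * s)) + 1", OF _ b])
        (use 1 in \<open>auto intro!: parabolic_hoelder_norm_le_low s\<close>)
  next
    case 2
    have ab: "0 \<le> 1 + 64 / ln (2::real)" "0 \<le> 1 / ln (2::real) + 1" by simp_all
    show thesis
    proof (rule that[OF ab], goal_cases)
      case (1 u M K)
      show ?case unfolding 2 using parabolic_log_lipschitz_norm_le[OF 1(1-6)[unfolded 2]] by blast
    qed
  next
    case 3
    have "2 powr (1 - 2 * s) < (2::real) powr 0" using 3 by (intro powr_less_mono) auto
    then have b: "0 \<le> 1563 / (1 - 2 powr (1 - 2 * s)) + 3" by simp
    show thesis
      by (rule that[of 3105 "1563 / (1 - 2 powr (1 - 2 * s)) + 3", OF _ b])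
        (use 3 in \<open>auto intro!: parabolic_hoelder_norm_le_high s\<close>)
  qed
qed

theorem theorem1:
  fixes s :: real
  assumes "0 < s" and "s < 1"
  shows "\<exists>C>0. \<forall>(u :: (real ^ 'n) \<times> real \<Rightarrow> real) f.
    (\<forall>p. f p \<ge> 0) \<longrightarrow> (\<forall>p. u p \<ge> 0) \<longrightarrow> classical_entire_solution s u f \<longrightarrow>
    bounded (f ` cyl 2 0 0) \<longrightarrow> bounded (u ` cyl 2 0 0) \<longrightarrow>
      (s \<noteq> 1 / 2 \<longrightarrow>
         parabolic_hoelder_norm s (cyl 1 0 0) u
           \<le> ennreal C * (Linfty_norm (cyl 2 0 0) f + Linfty_norm (cyl 2 0 0) u)) \<and>
      (s = 1 / 2 \<longrightarrow>
         parabolic_log_lipschitz_norm s (cyl 1 0 0) u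
           \<le> ennreal C * (Linfty_norm (cyl 2 0 0) f + Linfty_norm (cyl 2 0 0) u))"
proof -
  let ?C = "cyl 2 0 0 :: ((real ^ 'n) \<times> real) set"
  obtain C0 where C0: "0 < C0" and reg: "\<And>u f F M. heat_fraction s u (f :: (real ^ 'n) \<times> real \<Rightarrow> real) \<Longrightarrow> 0 \<le> F \<Longrightarrow> u (0, 3) \<le> M \<Longrightarrow>
     (AE p in lborel. norm (fst p) < 2 \<and> \<bar>snd p\<bar> < 4 \<longrightarrow> f p \<le> F) \<Longrightarrow>
     (\<forall>x t d. norm x \<le> 5 / 4 \<longrightarrow> \<bar>t\<bar> < 1 \<longrightarrow> norm d \<le> 1 / 32 \<longrightarrow> \<bar>u (x + d, t) + u (x - d, t) - 2 * u (x, t)\<bar> \<le> C0 * (F + M) * norm d powr (2 * s)) \<and>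
     (\<forall>x t t'. norm x \<le> 5 / 4 \<longrightarrow> - 1 < t \<longrightarrow> t < t' \<longrightarrow> t' < 1 \<longrightarrow> \<bar>u (x, t') - u (x, t)\<bar> \<le> C0 * (F + M) * (t' - t) powr s)"
    using regularity_bounds[OF assms, where 'a = "real ^ 'n"] by blast
  obtain a b :: real where ab: "0 \<le> a" "0 \<le> b" and norms: "\<And>(u :: (real ^ 'n) \<times> real \<Rightarrow> real) M K. 0 \<le> M \<Longrightarrow> 0 \<le> K \<Longrightarrow> continuous_on UNIV u \<Longrightarrow>
     (\<And>x t. norm x \<le> 5 / 4 \<Longrightarrow> \<bar>t\<bar> < 1 \<Longrightarrow> \<bar>u (x, t)\<bar> \<le> M) \<Longrightarrow>
     (\<And>x t d. norm x \<le> 5 / 4 \<Longrightarrow> \<bar>t\<bar> < 1 \<Longrightarrow> norm d \<le> 1 / 32 \<Longrightarrow> \<bar>u (x + d, t) + u (x - d, t) - 2 * u (x, t)\<bar> \<le> K * norm d powr (2 * s)) \<Longrightarrow>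
     (\<And>x t t'. norm x \<le> 5 / 4 \<Longrightarrow> \<bar>t\<bar> < 1 \<Longrightarrow> \<bar>t'\<bar> < 1 \<Longrightarrow> \<bar>u (x, t') - u (x, t)\<bar> \<le> K * \<bar>t' - t\<bar> powr s) \<Longrightarrow>
     (1 / 2 < s \<Longrightarrow> x_differentiable_on u (cyl 1 0 0)) \<Longrightarrow>
     (s \<noteq> 1 / 2 \<longrightarrow> parabolic_hoelder_norm s (cyl 1 0 0) u \<le> ennreal (a * M + b * K)) \<and>
     (s = 1 / 2 \<longrightarrow> parabolic_log_lipschitz_norm s (cyl 1 0 0) u \<le> ennreal (a * M + b * K))"
    by (rule parabolic_norms_le[OF assms, where 'n = 'n]) blast
  define g where "g = \<bar>Gamma (- s)\<bar>"
  have g: "0 \<le> g" by (simp add: g_def)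
  \<comment> \<open>The factor g + 1 accounts for passing from g F + M, where g F bounds the
    rescaled right-hand side, to F + M; the final 1 makes C positive.\<close>
  define C where "C = a + b * (C0 * (g + 1)) + 1"
  have C: "0 < C" using ab C0 g by (auto simp: C_def intro!: add_nonneg_pos add_nonneg_nonneg mult_nonneg_nonneg)
  have "(s \<noteq> 1 / 2 \<longrightarrow> parabolic_hoelder_norm s (cyl 1 0 0) u \<le> ennreal C * (Linfty_norm ?C f + Linfty_norm ?C u)) \<and>
      (s = 1 / 2 \<longrightarrow> parabolic_log_lipschitz_norm s (cyl 1 0 0) u \<le> ennreal C * (Linfty_norm ?C f + Linfty_norm ?C u))"
    if f0: "\<And>p. 0 \<le> f p" and u0: "\<And>p. 0 \<le> u p" and sol: "classical_entire_solution s u f" for u f :: "(real ^ 'n) \<times> real \<Rightarrow> real"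
  proof (cases "Linfty_norm ?C f = \<infinity> \<or> Linfty_norm ?C u = \<infinity>")
    case True
    then have "ennreal C * (Linfty_norm ?C f + Linfty_norm ?C u) = \<infinity>" using C by (auto simp: ennreal_mult_top)
    then show ?thesis by simp
  next
    case False
    define F where "F = enn2real (Linfty_norm ?C f)"
    define M where "M = enn2real (Linfty_norm ?C u)"
    have F: "Linfty_norm ?C f = ennreal F" "0 \<le> F" using False by (auto simp: F_def less_top)
    have M: "Linfty_norm ?C u = ennreal M" "0 \<le> M" using False by (auto simp: M_def less_top)
    have hf: "heat_fraction s u (\<lambda>p. g * f p)"
      unfolding g_def by (rule heat_fraction_if_classical[OF assms f0 u0 sol])
    then have cont: "continuous_on UNIV u" by (rule heat_fraction.u_cont)
    have cyl: "(x, t) \<in> ?C \<longleftrightarrow> norm x < 2 \<and> \<bar>t\<bar> < 4" for x t by (simp add: cyl_iff)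
    have "?C = ball 0 2 \<times> ball 0 4" by (auto simp: cyl dist_real_def)
    then have o: "open ?C" by (simp add: open_Times)
    have aeF: "AE p in lborel. norm (fst p) < 2 \<and> \<bar>snd p\<bar> < 4 \<longrightarrow> g * f p \<le> g * F"
      using AE_le_Linfty_norm[OF F o]
    proof eventually_elim
      case (elim p)
      then show ?case using f0[of p] g cyl[of "fst p" "snd p"] by (auto intro!: mult_left_mono)
    qed
    have "AE p in lborel. p \<in> ?C \<longrightarrow> u p \<le> M"
      using AE_le_Linfty_norm[OF M o] by eventually_elim auto
    note uM' = le_if_AE_le_continuous[OF cont o this]
    have uM: "\<bar>u (x, t)\<bar> \<le> M" if "norm x < 2" "\<bar>t\<bar> < 4" for x t
      using uM'[of "(x, t)"] u0[of "(x, t)"] that by (simp add: cyl)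
    define K where "K = C0 * (g * F + M)"
    have gF: "0 \<le> g * F" using g F by simp
    have K: "0 \<le> K" using C0 gF M by (simp add: K_def)
    have u3: "u (0, 3) \<le> M" by (rule uM') (simp add: cyl)
    note reg' = reg[OF hf gF u3 aeF, folded K_def]
    have time: "\<bar>u (x, t') - u (x, t)\<bar> \<le> K * \<bar>t' - t\<bar> powr s" if "norm x \<le> 5 / 4" "\<bar>t\<bar> < 1" "\<bar>t'\<bar> < 1" for x t t'
    proof -
      consider "t < t'" | "t' < t" | "t = t'" by linarith
      then show ?thesis
      proof cases
        case 1
        then have "- 1 < t" "t' < 1" using that by auto
        then show ?thesis using reg' that 1 by (simp add: abs_of_pos)
      next
        case 2
        then have "- 1 < t'" "t < 1" using that by auto
        then have "\<bar>u (x, t) - u (x, t')\<bar> \<le> K * (t - t') powr s" using reg' that 2 by blast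
        moreover have "\<bar>t' - t\<bar> = t - t'" using 2 by simp
        ultimately show ?thesis by (simp add: abs_minus_commute)
      qed simp
    qed
    obtain \<epsilon> where \<epsilon>: "0 < \<epsilon>" "u \<in> locally_hoelder (2 * s + \<epsilon>) (s + \<epsilon>)"
      using sol unfolding classical_entire_solution_def by blast
    \<comment> \<open>Differentiability itself is part of the regularity class because 2 s +
      \<epsilon> > 1; only the size of the gradient has to be estimated.\<close>
    have diff: "x_differentiable_on u (cyl 1 0 0)" if "1 / 2 < s"
    proof -
      have "\<not> 2 * s + \<epsilon> \<le> 1" using that \<epsilon>(1) by simp
      then show ?thesis using \<epsilon>(2) unfolding locally_hoelder_def by (auto dest!: spec[where x = 0] spec[where x = "1::real"])
    qed
    have bd: "a * M + b * K \<le> C * (F + M)"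
    proof -
      have "a * M \<le> a * (F + M)" using ab F M by (intro mult_left_mono) auto
      moreover have "g * F + M \<le> (g + 1) * (F + M)" using mult_nonneg_nonneg[OF g M(2)] F M by (simp add: algebra_simps)
      then have "b * K \<le> b * (C0 * ((g + 1) * (F + M)))" unfolding K_def using ab C0 by (intro mult_left_mono) auto
      ultimately have "a * M + b * K \<le> (a + b * (C0 * (g + 1))) * (F + M)" by (simp add: distrib_right mult.assoc)
      also have "\<dots> \<le> C * (F + M)" using F M by (intro mult_right_mono) (auto simp: C_def)
      finally show ?thesis .
    qed
    have rhs: "ennreal C * (Linfty_norm ?C f + Linfty_norm ?C u) = ennreal (C * (F + M))"
      unfolding F(1) M(1) using C F M by (simp add: ennreal_mult)
    have "(s \<noteq> 1 / 2 \<longrightarrow> parabolic_hoelder_norm s (cyl 1 0 0) u \<le> ennreal (a * M + b * K)) \<and>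
     (s = 1 / 2 \<longrightarrow> parabolic_log_lipschitz_norm s (cyl 1 0 0) u \<le> ennreal (a * M + b * K))"
      by (rule norms[OF M(2) K cont _ _ time diff]) (use uM reg' in auto)
    then show ?thesis unfolding rhs using ennreal_leI[OF bd] by (blast intro: order_trans)
  qed
  then show ?thesis using C by blast
qed

end
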